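(* Let $\mu(dy)=\int_0^\infty s\,N(ds,dy)$ be a completely random measure on a Polish space $\mathcal{Y}$ with law determined by the law of the Poisson random measure $N$ with mean $\nu(ds,dy)=\rho(ds|y)\,\eta(dy)$ on $\mathcal{J}\times\mathcal{Y}$, $\mathcal{J}=(0,\infty)$. Suppose that $\mathbf{X}|\mu$ has the multiplicative intensity likelihood $$L(\mathbf{X}|\mu)=e^{-\mu(g_m)}\prod_{i=1}^n\int_{\mathcal{Y}}k(X_i|Y_i)\,\mu(dY_i).$$ Then the posterior distribution of $\mu|\mathbf{X}$ is the posterior distribution of $\mu|\mathbf{Y},\mathbf{X}$ mixed over the posterior distribution of $\mathbf{Y}|\mathbf{X}$, described as follows. (i) The posterior distribution of $N|\mathbf{Y},\mathbf{X}$ is the conditional law of the random measure $$N_{n,m}^*(ds,dy)=N_{f_{k,m}}(ds,dy)+\sum_{j=1}^{n(\mathbf{p})}\delta_{J_{j,n},Y_j^*}(ds,dy),$$ where, conditional on $(\mathbf{J},\mathbf{Y},\mathbf{X})$, $N_{f_{k,m}}$ is a Poisson random measure with intensity $$E[N_{f_{k,m}}(ds,dy)]=e^{-f_{k,m}(s,y)}\,\nu(ds,dy)=e^{-g_m(y)s}\,\rho(ds|y)\,\eta(dy),$$ not depending on $(J_{j,n})$. Additionally, given $(\mathbf{Y},\mathbf{X})$, the $(J_{j,n})$ are conditionally independent of $N_{f_{k,m}}$ and are mutually independent, with each $J_{j,n}$ having the distribution, depending on $Y_j^*$, $$\mathbb{P}(J_{j,n}\in ds|Y_j^* )=\frac{s^{e_j}e^{-g_m(Y_j^*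 )s}\,\rho(ds|Y_j^* )}{\kappa_{e_j}(e^{-f_{k,m}}\rho|Y_j^* )}.$$ (ii) Consequently, $\mu|\mathbf{Y},\mathbf{X}$ is equivalent to the conditional distribution, given $(\mathbf{Y},\mathbf{X})$, of the random measure $$\mu_{n,m}^*(dy)=\int_0^\infty s\,N_{n,m}^*(ds,dy)=\mu_{g_m}(dy)+\sum_{j=1}^{n(\mathbf{p})}J_{j,n}\,\delta_{Y_j^*}(dy),$$ where, conditional on $\mathbf{Y}$ and $\mathbf{X}$, $\mu_{g_m}(dy):=\int_0^\infty s\,N_{f_{k,m}}(ds,dy)$ is a completely random measure with L\'evy measure $e^{-g_m(y)s}\rho(ds|y)\,\eta(dy)$. Additionally, the $(J_{j,n})$ are conditionally independent of $\mu_{g_m}$. (iii) If $\lambda$ is the random hazard rate or intensity $\lambda(x)=\lambda(x|\mu)=\int_{\mathcal{Y}}k(x|y)\,\mu(dy)$, then its posterior distribution, given $(\mathbf{Y},\mathbf{X})$, is the conditional distribution of $$\lambda_{n,m}^*(x)=\int_{\mathcal{Y}}k(x|y)\,\mu_{g_m}(dy)+\sum_{j=1}^{n(\mathbf{p})}J_{j,n}\,k(x|Y_j^* ).$$ (iv) The conditional distribution of $\mathbf{Y}|\mathbf{X}$ is expressed via the conditional distributions of $\mathbf{Y}|\mathbf{p},\mathbf{X}$ and $\mathbf{p}|\mathbf{X}$ as follows. The distribution of $\mathbf{Y}|\mathbf{p},\mathbf{X}$ is such that the unique values $Y_1^*,\ldots,Y_{n(\mathbf{p})}^*$ of $\mathbf{Y}$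 are conditionally independent with distributions $$\mathbb{P}(dY_j^*|\mathbf{p},\mathbf{X}):=\pi(dY_j^*|C_j)\propto\left[\prod_{i\in C_j}k(X_i|Y_j^* )\right]\kappa_{e_j}(e^{-f_{k,m}}\rho|Y_j^* )\,\eta(dY_j^* ),$$ and the posterior distribution of $\mathbf{p}|\mathbf{X}$ is $$\pi(\mathbf{p}|\mathbf{X})=[C(\mathbf{X})]^{-1}\prod_{j=1}^{n(\mathbf{p})}\int_{\mathcal{Y}}\left[\prod_{i\in C_j}k(X_i|y)\right]\kappa_{e_j}(e^{-f_{k,m}}\rho|y)\,\eta(dy).$$
   Context: $\mathcal{X},\mathcal{Y}$ are Polish spaces (with fixed complete separable metrics, which determine the bounded sets). $\eta$ is a sigma-finite nonatomic measure on $\mathcal{Y}$ and $\rho(ds|y)$ a (measurable in $y$) family of measures on $\mathcal{J}=(0,\infty)$ such that for each bounded Borel $B\subset\mathcal{Y}$, $\int_B\int_{\mathcal{J}}\min(s,1)\,\rho(ds|y)\,\eta(dy)<\infty$. $\mathcal{J}\times\mathcal{Y}$ carries a complete separable metric for which $\nu$ is finite on bounded sets, and $\mathcal{P}(dN|\nu)$ is the law of the Poisson random measure $N$ with mean intensity $\nu$. $k(x|y)$ is a known positive (i.e. nonnegative; indicator kernels are allowed) measurable kernel on $\mathcal{X}\times\mathcal{Y}$, $\eta$-integrable over $\mathcal{Y}$, such that for a sigma-finite measure $\tau$ on $\mathcal{X}$, $\int_Bk(x|y)\,\tau(dx)<\infty$ for each bounded $B\subset\mathcal{X}$ and each $y$.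 Integers $n\le m$; $\mathbf{X}=(X_1,\ldots,X_n)$ are the completely observed points. $U_1,\ldots,U_m$ are observed nonnegative (predictable) functions on $\mathcal{X}$, and $$g_m(y)=\sum_{i=1}^m\int_{\mathcal{X}}U_i(x)k(x|y)\,\tau(dx),\qquad \mu(g_m)=\int_{\mathcal{Y}}g_m(y)\,\mu(dy),\qquad f_{k,m}(s,y)=g_m(y)s,$$ where it is assumed that $g_m$ is a nonnegative Borel measurable function of bounded support on $\mathcal{Y}$. It is assumed that for all positive integers $l$ and each fixed $y$, $$\kappa_l(e^{-f_{k,m}}\rho|y)=\int_0^\infty s^le^{-g_m(y)s}\,\rho(ds|y)<\infty.$$ Define $$C(\mathbf{X})=\sum_{\mathbf{p}}\prod_{j=1}^{n(\mathbf{p})}\int_{\mathcal{Y}}\left[\prod_{i\in C_j}k(X_i|y)\right]\kappa_{e_j}(e^{-f_{k,m}}\rho|y)\,\eta(dy),$$ the sum being over all partitions $\mathbf{p}=\{C_1,\ldots,C_{n(\mathbf{p})}\}$ of $\{1,\ldots,n\}$, with $e_j=|C_j|$. The data ($\mathbf{X}$ and the $U_i$) are held fixed. The posterior distribution of $N$ (hence $\mu$) given $\mathbf{X}$ is the probability law proportional to $L(\mathbf{X}|\mu)\,\mathcal{P}(dN|\nu)$, where $0<\int L(\mathbf{X}|\mu)\,\mathcal{P}(dN|\nu)<\infty$ so that it is well defined. The missing data $\mathbf{Y}=(Y_1,\ldots,Y_n)\in\mathcal{Y}^n$ and latent jumps $\mathbf{J}=(J_1,\ldots,J_n)\in\mathcal{J}^n$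 are introduced by augmentation: the joint law of $(\mathbf{J},\mathbf{Y},N)$ given $\mathbf{X}$ is proportional to $$e^{-N(f_{k,m})}\left[\prod_{i=1}^nk(X_i|Y_i)J_i\right]\left[\prod_{i=1}^nN(dJ_i,dY_i)\right]\mathcal{P}(dN|\nu),$$ where $N(f_{k,m})=\int f_{k,m}\,dN=\mu(g_m)$. $Y_1^*,\ldots,Y^*_{n(\mathbf{p})}$ are the distinct values of $\mathbf{Y}$, $\mathbf{p}=\{C_1,\ldots,C_{n(\mathbf{p})}\}$ with $C_j=\{i:Y_i=Y_j^*\}$ is the induced partition, $e_j=|C_j|$, and $(J_{j,n},Y_j^* )$, $j=1,\ldots,n(\mathbf{p})$, are the distinct values of the pairs $(J_i,Y_i)$. *)

theory Defs
  imports "HOL-Probability.Probability"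
begin

section \<open>Generalities on measures\<close>

definition nonatomic :: "'a measure \<Rightarrow> bool" where
  "nonatomic M \<longleftrightarrow> \<not> (\<exists>A\<in>sets M. 0 < emeasure M A \<and>
     (\<forall>B\<in>sets M. B \<subseteq> A \<longrightarrow> emeasure M B = 0 \<or> emeasure M B = emeasure M A))"

text \<open>The probability measure proportional to \<open>M\<close>; meaningful only when the total mass of \<open>M\<close> is
  positive and finite, otherwise the result is not a probability measure.\<close>

definition normalized :: "'a measure \<Rightarrow> 'a measure" where
  "normalized M = scale_measure (inverse (emeasure M (space M))) M"

text \<open>\<open>exp (- a)\<close> for \<open>a\<close> in \<open>[0, \<infinity>]\<close>.\<close>

definition exp_neg :: "ennreal \<Rightarrow> ennreal" where
  "exp_neg a = (if a = \<infinity> then 0 else ennreal (exp (- enn2real a)))"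

text \<open>The measure \<open>N + (\<Sum>j\<in>I. w j \<cdot> \<delta>\<^bsub>z j\<^esub>)\<close>.\<close>

definition add_atoms :: "'a measure \<Rightarrow> 'j set \<Rightarrow> ('j \<Rightarrow> ennreal) \<Rightarrow> ('j \<Rightarrow> 'a) \<Rightarrow> 'a measure" where
  "add_atoms N I w z =
     measure_of (space N) (sets N) (\<lambda>A. emeasure N A + (\<Sum>j\<in>I. w j * indicator A (z j)))"

text \<open>\<open>K\<close> is a regular conditional distribution of \<open>V\<close> (with values in \<open>MV\<close>) given \<open>W\<close> (with values
  in \<open>MW\<close>) under \<open>M\<close>.  The kernel has to consist of probability measures only for almost every value
  of \<open>W\<close>.\<close>

definition has_cond_law ::
  "'a measure \<Rightarrow> ('a \<Rightarrow> 'v) \<Rightarrow> 'v measure \<Rightarrow> ('a \<Rightarrow> 'w) \<Rightarrow> 'w measure \<Rightarrow> ('w \<Rightarrow> 'v measure) \<Rightarrow> bool" where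
  "has_cond_law M V MV W MW K \<longleftrightarrow>
     V \<in> measurable M MV \<and> W \<in> measurable M MW \<and>
     (\<forall>w\<in>space MW. sets (K w) = sets MV) \<and>
     (\<forall>B\<in>sets MV. (\<lambda>w. emeasure (K w) B) \<in> borel_measurable MW) \<and>
     (AE w in distr M MW W. prob_space (K w)) \<and>
     (\<forall>A\<in>sets MW. \<forall>B\<in>sets MV.
        emeasure M {\<omega>\<in>space M. W \<omega> \<in> A \<and> V \<omega> \<in> B}
          = (\<integral>\<^sup>+w. emeasure (K w) B * indicator A w \<partial>(distr M MW W)))"


section \<open>Spaces of measures, Poisson and completely random measures\<close>

text \<open>A set \<open>S\<close> of measures on \<open>K\<close> with the sigma-algebra generated by the evaluations
  \<open>M \<mapsto> M(A)\<close>, as for \<^const>\<open>subprob_algebra\<close> in the library.\<close>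

definition evaluation_algebra :: "'a measure set \<Rightarrow> 'a measure \<Rightarrow> 'a measure measure" where
  "evaluation_algebra S K = (SUP A \<in> sets K. vimage_algebra S (\<lambda>M. emeasure M A) borel)"

definition measures_algebra :: "'a measure \<Rightarrow> 'a measure measure" where
  "measures_algebra K = evaluation_algebra {M. sets M = sets K} K"

definition jump_space :: "real measure" where
  "jump_space = restrict_space borel {0<..}"

abbreviation jump_loc_space :: "(real \<times> 'y::polish_space) measure" where
  "jump_loc_space \<equiv> jump_space \<Otimes>\<^sub>M borel"

text \<open>\<open>d\<close> is a complete metric for the topology of \<open>(0, \<infinity>) \<times> 'y\<close> (which is separable).\<close>

definition jump_loc_metric :: "(real \<times> 'y::polish_space \<Rightarrow> real \<times> 'y \<Rightarrow> real) \<Rightarrow> bool" where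
  "jump_loc_metric d \<longleftrightarrow>
     Metric_space ({0<..} \<times> UNIV) d \<and>
     Metric_space.mcomplete ({0<..} \<times> UNIV) d \<and>
     Metric_space.mtopology ({0<..} \<times> UNIV) d = top_of_set ({0<..} \<times> UNIV)"

abbreviation jump_loc_bounded ::
  "(real \<times> 'y::polish_space \<Rightarrow> real \<times> 'y \<Rightarrow> real) \<Rightarrow> (real \<times> 'y) set \<Rightarrow> bool" where
  "jump_loc_bounded d \<equiv> Metric_space.mbounded ({0<..} \<times> UNIV) d"

text \<open>The measurable space of point measures on \<open>(0, \<infinity>) \<times> 'y\<close>, i.e. measures with finite integer
  values on the Borel sets that are bounded for \<open>d\<close>.\<close>

definition point_measures_algebra ::
  "(real \<times> 'y::polish_space \<Rightarrow> real \<times> 'y \<Rightarrow> real) \<Rightarrow> (real \<times> 'y) measure measure" where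
  "point_measures_algebra d = evaluation_algebra
     {N. sets N = sets jump_loc_space \<and>
         (\<forall>B\<in>sets jump_loc_space. jump_loc_bounded d B \<longrightarrow> emeasure N B \<in> \<nat>)}
     jump_loc_space"

text \<open>\<open>P\<close> (a law on a space of measures) is the law of a Poisson random measure with mean \<open>\<Lambda>\<close>.\<close>

definition poisson_law :: "'a measure measure \<Rightarrow> 'a measure \<Rightarrow> bool" where
  "poisson_law P \<Lambda> \<longleftrightarrow>
     prob_space P \<and>
     (\<forall>A\<in>sets \<Lambda>. emeasure \<Lambda> A < \<infinity> \<longrightarrow>
        (\<forall>j. emeasure P {N\<in>space P. emeasure N A = of_nat j}
              = ennreal (measure \<Lambda> A ^ j / fact j * exp (- measure \<Lambda> A)))) \<and>
     (\<forall>A :: nat \<Rightarrow> 'a set. range A \<subseteq> sets \<Lambda> \<longrightarrow> disjoint_family A \<longrightarrow>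
        prob_space.indep_vars P (\<lambda>_. borel) (\<lambda>i N. emeasure N (A i)) UNIV)"

text \<open>\<open>M\<close> is the law of a completely random measure with Levy measure \<open>\<Lambda>(ds, dy)\<close>: a random measure,
  almost surely finite on bounded sets, with independent values on disjoint sets and
  \<open>E[exp (- t \<mu>(B))] = exp (- \<integral>\<^bsub>(0,\<infinity>) \<times> B\<^esub> (1 - exp (- t s)) \<Lambda>(ds, dy))\<close>.\<close>

definition completely_random_law ::
  "('y::polish_space) measure measure \<Rightarrow> (real \<times> 'y) measure \<Rightarrow> bool" where
  "completely_random_law M \<Lambda> \<longleftrightarrow>
     prob_space M \<and> sets M = sets (measures_algebra borel) \<and>
     (AE \<mu> in M. \<forall>B\<in>sets borel. bounded B \<longrightarrow> emeasure \<mu> B < \<infinity>) \<and>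
     (\<forall>A :: nat \<Rightarrow> 'y set. range A \<subseteq> sets borel \<longrightarrow> disjoint_family A \<longrightarrow>
        prob_space.indep_vars M (\<lambda>_. borel) (\<lambda>i \<mu>. emeasure \<mu> (A i)) UNIV) \<and>
     (\<forall>B\<in>sets borel. \<forall>t>0.
        (\<integral>\<^sup>+\<mu>. exp_neg (ennreal t * emeasure \<mu> B) \<partial>M)
          = exp_neg (\<integral>\<^sup>+(s, y). ennreal (1 - exp (- t * s)) * indicator B y \<partial>\<Lambda>))"

text \<open>The measure \<open>\<rho>(ds | y) \<eta>(dy)\<close>.\<close>

definition intensity ::
  "('y \<Rightarrow> real measure) \<Rightarrow> ('y::polish_space) measure \<Rightarrow> (real \<times> 'y) measure" where
  "intensity \<rho> \<eta> = measure_of (space jump_loc_space) (sets jump_loc_space)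
     (\<lambda>A. \<integral>\<^sup>+y. (\<integral>\<^sup>+s. indicator A (s, y) \<partial>\<rho> y) \<partial>\<eta>)"

text \<open>\<open>\<mu>(dy) = \<integral> s N(ds, dy)\<close>.\<close>

definition mu_of :: "(real \<times> 'y::polish_space) measure \<Rightarrow> 'y measure" where
  "mu_of N = distr (density N (\<lambda>(s, y). ennreal s)) borel snd"


section \<open>Multiplicative intensity model\<close>

text \<open>Throughout, \<open>k x y\<close> stands for \<open>k(x|y)\<close>, and \<open>g\<close> for \<open>g\<^sub>m\<close>.\<close>

definition hazard :: "('x \<Rightarrow> 'y \<Rightarrow> real) \<Rightarrow> 'y measure \<Rightarrow> 'x \<Rightarrow> ennreal" where
  "hazard k \<mu> x = (\<integral>\<^sup>+y. ennreal (k x y) \<partial>\<mu>)"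

definition likelihood ::
  "nat \<Rightarrow> ('x \<Rightarrow> 'y \<Rightarrow> real) \<Rightarrow> ('y \<Rightarrow> real) \<Rightarrow> (nat \<Rightarrow> 'x) \<Rightarrow> 'y measure \<Rightarrow> ennreal" where
  "likelihood n k g X \<mu> =
     exp_neg (\<integral>\<^sup>+y. ennreal (g y) \<partial>\<mu>) * (\<Prod>i=1..n. \<integral>\<^sup>+y. ennreal (k (X i) y) \<partial>\<mu>)"

text \<open>Law of \<open>N\<close> given \<open>X\<close>, for the prior law \<open>P\<close>.\<close>

definition posterior_N ::
  "nat \<Rightarrow> ('x \<Rightarrow> 'y \<Rightarrow> real) \<Rightarrow> ('y \<Rightarrow> real) \<Rightarrow> (nat \<Rightarrow> 'x)
    \<Rightarrow> (real \<times> 'y::polish_space) measure measure \<Rightarrow> (real \<times> 'y) measure measure" where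
  "posterior_N n k g X P = normalized (density P (\<lambda>N. likelihood n k g X (mu_of N)))"

abbreviation jumps_space :: "nat \<Rightarrow> (nat \<Rightarrow> real) measure" where
  "jumps_space n \<equiv> (\<Pi>\<^sub>M i\<in>{1..n}. jump_space)"

abbreviation locs_space :: "nat \<Rightarrow> (nat \<Rightarrow> 'y::polish_space) measure" where
  "locs_space n \<equiv> (\<Pi>\<^sub>M i\<in>{1..n}. borel)"

text \<open>Joint law of \<open>(J, Y, N)\<close> given \<open>X\<close>, proportional to
  \<open>exp (- N(f)) (\<Prod>i. k(X\<^sub>i|Y\<^sub>i) J\<^sub>i) (\<Prod>i. N(dJ\<^sub>i, dY\<^sub>i)) P(dN)\<close> with \<open>f(s,y) = g(y) s\<close>; the
  integration variable \<open>z\<close> is the family of pairs \<open>(J\<^sub>i, Y\<^sub>i)\<close>.\<close>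

definition joint_posterior ::
  "nat \<Rightarrow> ('x \<Rightarrow> 'y \<Rightarrow> real) \<Rightarrow> ('y \<Rightarrow> real) \<Rightarrow> (nat \<Rightarrow> 'x)
    \<Rightarrow> (real \<times> 'y::polish_space) measure measure
    \<Rightarrow> ((nat \<Rightarrow> real) \<times> (nat \<Rightarrow> 'y) \<times> (real \<times> 'y) measure) measure" where
  "joint_posterior n k g X P =
     (let S = jumps_space n \<Otimes>\<^sub>M locs_space n \<Otimes>\<^sub>M P in
      normalized (measure_of (space S) (sets S) (\<lambda>A.
        \<integral>\<^sup>+N. (\<integral>\<^sup>+z. exp_neg (\<integral>\<^sup>+(s, y). ennreal (g y * s) \<partial>N)
                 * (\<Prod>i=1..n. ennreal (k (X i) (snd (z i)) * fst (z i)))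
                 * indicator A (\<lambda>i\<in>{1..n}. fst (z i), \<lambda>i\<in>{1..n}. snd (z i), N)
               \<partial>(\<Pi>\<^sub>M i\<in>{1..n}. N)) \<partial>P)))"

text \<open>The block of \<open>i\<close> and the partition of \<open>{1..n}\<close> induced by the ties in \<open>Y\<close>.  Distinct values are
  indexed by the blocks \<open>C\<close> themselves instead of by \<open>1, \<dots>, n(p)\<close>: the distinct value of \<open>Y\<close> on the
  block \<open>C\<close> is \<open>Y (Min C)\<close>, and likewise for the jumps.\<close>

definition block :: "nat \<Rightarrow> (nat \<Rightarrow> 'y) \<Rightarrow> nat \<Rightarrow> nat set" where
  "block n Y i = {l\<in>{1..n}. Y l = Y i}"

definition ties :: "nat \<Rightarrow> (nat \<Rightarrow> 'y) \<Rightarrow> nat set set" where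
  "ties n Y = block n Y ` {1..n}"

text \<open>\<open>\<kappa>\<^sub>l(e\<^sup>-\<^sup>f \<rho> | y)\<close>.\<close>

definition kappa :: "('y \<Rightarrow> real) \<Rightarrow> ('y \<Rightarrow> real measure) \<Rightarrow> nat \<Rightarrow> 'y \<Rightarrow> ennreal" where
  "kappa g \<rho> l y = (\<integral>\<^sup>+s. ennreal (s ^ l * exp (- (g y * s))) \<partial>\<rho> y)"

text \<open>The law of \<open>J\<^bsub>j,n\<^esub>\<close>, for a block of size \<open>e\<close> with \<open>Y\<^sub>j\<^sup>* = y\<close>.\<close>

definition jump_law :: "('y \<Rightarrow> real) \<Rightarrow> ('y \<Rightarrow> real measure) \<Rightarrow> nat \<Rightarrow> 'y \<Rightarrow> real measure" where
  "jump_law g \<rho> e y =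
     density (\<rho> y) (\<lambda>s. ennreal (s ^ e * exp (- (g y * s))) / kappa g \<rho> e y)"

text \<open>For given \<open>Y\<close>, the law of the Poisson random measure with law \<open>Q\<close> together with the family
  of jumps indexed by the blocks, all of these being independent.\<close>

definition latent_law ::
  "nat \<Rightarrow> ('y \<Rightarrow> real) \<Rightarrow> ('y \<Rightarrow> real measure) \<Rightarrow> (real \<times> 'y) measure measure \<Rightarrow> (nat \<Rightarrow> 'y)
    \<Rightarrow> ((real \<times> 'y) measure \<times> (nat set \<Rightarrow> real)) measure" where
  "latent_law n g \<rho> Q Y = Q \<Otimes>\<^sub>M (\<Pi>\<^sub>M C\<in>ties n Y. jump_law g \<rho> (card C) (Y (Min C)))"

text \<open>\<open>N\<^sup>* = N\<^sub>f + \<Sum>\<^sub>j \<delta>\<^bsub>(J\<^sub>j, Y\<^sub>j\<^sup>*)\<^esub>\<close>, \<open>\<mu>\<^sup>* = \<mu>\<^sub>g + \<Sum>\<^sub>j J\<^sub>j \<delta>\<^bsub>Y\<^sub>j\<^sup>*\<^esub>\<close> and the hazard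
  \<open>\<lambda>\<^sup>*(x) = \<integral> k(x|y) \<mu>\<^sub>g(dy) + \<Sum>\<^sub>j J\<^sub>j k(x|Y\<^sub>j\<^sup>*)\<close>.\<close>

definition N_star ::
  "nat \<Rightarrow> (nat \<Rightarrow> 'y) \<Rightarrow> (real \<times> 'y) measure \<Rightarrow> (nat set \<Rightarrow> real) \<Rightarrow> (real \<times> 'y) measure" where
  "N_star n Y N J = add_atoms N (ties n Y) (\<lambda>_. 1) (\<lambda>C. (J C, Y (Min C)))"

definition mu_star ::
  "nat \<Rightarrow> (nat \<Rightarrow> 'y) \<Rightarrow> 'y measure \<Rightarrow> (nat set \<Rightarrow> real) \<Rightarrow> 'y measure" where
  "mu_star n Y \<mu> J = add_atoms \<mu> (ties n Y) (\<lambda>C. ennreal (J C)) (\<lambda>C. Y (Min C))"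

definition hazard_star ::
  "nat \<Rightarrow> ('x \<Rightarrow> 'y \<Rightarrow> real) \<Rightarrow> (nat \<Rightarrow> 'y) \<Rightarrow> 'y measure \<Rightarrow> (nat set \<Rightarrow> real) \<Rightarrow> 'x \<Rightarrow> ennreal" where
  "hazard_star n k Y \<mu> J x =
     (\<integral>\<^sup>+y. ennreal (k x y) \<partial>\<mu>) + (\<Sum>C\<in>ties n Y. ennreal (J C * k x (Y (Min C))))"

text \<open>The measure \<open>(\<Prod>i\<in>C. k(X\<^sub>i|y)) \<kappa>\<^sub>e(e\<^sup>-\<^sup>f \<rho> | y) \<eta>(dy)\<close>, where \<open>e\<close> is the size of \<open>C\<close>, and \<open>C(X)\<close>.\<close>

definition block_measure ::
  "('x \<Rightarrow> 'y \<Rightarrow> real) \<Rightarrow> ('y \<Rightarrow> real) \<Rightarrow> (nat \<Rightarrow> 'x) \<Rightarrow> ('y \<Rightarrow> real measure) \<Rightarrow> 'y measure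
    \<Rightarrow> nat set \<Rightarrow> 'y measure" where
  "block_measure k g X \<rho> \<eta> C =
     density \<eta> (\<lambda>y. (\<Prod>i\<in>C. ennreal (k (X i) y)) * kappa g \<rho> (card C) y)"

definition block_mass ::
  "('x \<Rightarrow> 'y \<Rightarrow> real) \<Rightarrow> ('y \<Rightarrow> real) \<Rightarrow> (nat \<Rightarrow> 'x) \<Rightarrow> ('y \<Rightarrow> real measure) \<Rightarrow> 'y measure
    \<Rightarrow> nat set \<Rightarrow> ennreal" where
  "block_mass k g X \<rho> \<eta> C =
     (\<integral>\<^sup>+y. (\<Prod>i\<in>C. ennreal (k (X i) y)) * kappa g \<rho> (card C) y \<partial>\<eta>)"

definition partition_constant ::
  "nat \<Rightarrow> ('x \<Rightarrow> 'y \<Rightarrow> real) \<Rightarrow> ('y \<Rightarrow> real) \<Rightarrow> (nat \<Rightarrow> 'x) \<Rightarrow> ('y \<Rightarrow> real measure) \<Rightarrow> 'y measure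
    \<Rightarrow> ennreal" where
  "partition_constant n k g X \<rho> \<eta> =
     (\<Sum>p | partition_on {1..n} p. \<Prod>C\<in>p. block_mass k g X \<rho> \<eta> C)"

end

theory Submission
  imports Defs
begin

text \<open>
  A law \<open>P\<close> of point configurations is Poisson with locally finite intensity \<open>\<Lambda>\<close> iff it satisfies
  Mecke's equation \<open>E \<integral> F(z, N) N(dz) = \<integral> E F(z, N + \<delta>\<^sub>z) \<Lambda>(dz)\<close>.  Weighting \<open>P\<close> by \<open>exp (- N(f))\<close>
  turns a solution for \<open>\<Lambda>\<close> into one for \<open>e\<^sup>-\<^sup>f \<Lambda>\<close>, because \<open>(N + \<delta>\<^sub>z)(f) = N(f) + f(z)\<close>; hence the
  tilted law \<open>Q\<close> is the law of the Poisson measure with intensity \<open>e\<^sup>-\<^sup>f \<nu>\<close>.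

  Iterating Mecke's equation under \<open>Q\<close> writes \<open>E \<integral> F(z\<^sub>1, \<dots>, z\<^sub>n, N) N(dz\<^sub>1) \<cdots> N(dz\<^sub>n)\<close> as a sum over
  the partitions of \<open>{1, \<dots>, n}\<close>: the points within a block coincide, and \<open>N\<close> acquires one atom for
  each block.  Integrating the weights \<open>\<Prod>i. k(X\<^sub>i|y\<^sub>i) s\<^sub>i\<close> over a block \<open>C\<close> and disintegrating
  \<open>s\<^sup>e e\<^bsup>-g(y)s\<^esup> \<rho>(ds|y) \<eta>(dy)\<close>, \<open>e = |C|\<close>, in \<open>y\<close> yields the law of the jump and the weight
  \<open>(\<Prod>i\<in>C. k(X\<^sub>i|y)) \<kappa>\<^sub>e(y) \<eta>(dy)\<close> of the location.  Since \<open>\<eta>\<close> has no atoms, locations of distinct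
  blocks are almost surely distinct, so the partition can be read off from \<open>Y\<close>, and all conditional
  laws follow from this single formula for the joint law of \<open>(J, Y, N)\<close>.
\<close>

section \<open>Integrals against kernels, mixtures and measures with atoms\<close>

text \<open>The law of the Poisson part is never constructed: it is the prior itself, reweighted and
  normalised, so it lives on the same space of point measures, and the converse of Mecke's equation
  only has to recognise it. That converse rests on the recursion
  \<open>(j + 1) * p (j + 1) = \<Lambda>(A) * p j\<close> for count probabilities, which yields the
  Poisson weights, independence over disjoint sets and the Laplace functional alike. One obstacle is
  that neither \<open>N\<close> nor the intensity is finite: both are cut along the same countably
  many bounded shells, which supplies sigma-finiteness, measurability of integrals against
  \<open>N\<close> and a generator of finite mass. Another is that the jumps are indexed by the
  blocks of a partition that depends on \<open>Y\<close>; measurability of such kernels is checked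
  separately on the finitely many events that fix the partition. Blocks are nonempty, so only
  \<open>kappa\<close> of positive order enters, which is finite even where \<open>\<rho> y\<close>
  has infinite mass.\<close>

lemma nn_integral_sum_measures:
  assumes R: "finite R"
    and sets: "\<And>r. r \<in> R \<Longrightarrow> sets (K r) = sets M"
    and eq: "\<And>A. A \<in> sets M \<Longrightarrow> emeasure M A = (\<Sum>r\<in>R. c r * emeasure (K r) A)"
    and f: "f \<in> borel_measurable M"
  shows "(\<integral>\<^sup>+x. f x \<partial>M) = (\<Sum>r\<in>R. c r * (\<integral>\<^sup>+x. f x \<partial>K r))"
  using f
proof induction
  case (cong f g)
  have "(\<integral>\<^sup>+x. f x \<partial>K r) = (\<integral>\<^sup>+x. g x \<partial>K r)" if "r \<in> R" for r
    using cong(3) sets_eq_imp_space_eq[OF sets[OF that]] by (auto intro: nn_integral_cong)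
  with cong(3,4) show ?case
    by (simp cong: nn_integral_cong)
next
  case (set A)
  then show ?case
    using eq sets by (simp cong: sum.cong)
next
  case (mult u d)
  have "(\<integral>\<^sup>+x. d * u x \<partial>K r) = d * (\<integral>\<^sup>+x. u x \<partial>K r)" if "r \<in> R" for r
    using mult(2) by (intro nn_integral_cmult) (simp add: measurable_cong_sets[OF sets[OF that] refl])
  then have "(\<Sum>r\<in>R. c r * (\<integral>\<^sup>+x. d * u x \<partial>K r)) = d * (\<Sum>r\<in>R. c r * (\<integral>\<^sup>+x. u x \<partial>K r))"
    by (simp add: sum_distrib_left ac_simps)
  with mult show ?case by (simp add: nn_integral_cmult)
next
  case (add u v)
  have "(\<integral>\<^sup>+x. v x + u x \<partial>K r) = (\<integral>\<^sup>+x. v x \<partial>K r) + (\<integral>\<^sup>+x. u x \<partial>K r)" if "r \<in> R" for r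
    using add by (intro nn_integral_add) (simp_all add: measurable_cong_sets[OF sets[OF that] refl])
  with add show ?case by (simp add: nn_integral_add sum.distrib distrib_left)
next
  case (seq U)
  have "(\<integral>\<^sup>+x. (SUP i. U i x) \<partial>K r) = (SUP i. \<integral>\<^sup>+x. U i x \<partial>K r)" if "r \<in> R" for r
    using seq by (intro nn_integral_monotone_convergence_SUP)
      (simp_all add: measurable_cong_sets[OF sets[OF that] refl])
  then have "(\<Sum>r\<in>R. c r * (\<integral>\<^sup>+x. (SUP i. U i x) \<partial>K r)) = (\<Sum>r\<in>R. SUP i. c r * (\<integral>\<^sup>+x. U i x \<partial>K r))"
    by (simp add: SUP_mult_left_ennreal)
  also have "\<dots> = (SUP i. \<Sum>r\<in>R. c r * (\<integral>\<^sup>+x. U i x \<partial>K r))"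
  proof (rule ennreal_SUP_sum[symmetric])
    fix r assume "r \<in> R"
    show "incseq (\<lambda>i. c r * (\<integral>\<^sup>+x. U i x \<partial>K r))"
      using seq(3) by (auto simp: incseq_def le_fun_def intro!: mult_left_mono nn_integral_mono)
  qed
  finally show ?case
    using seq nn_integral_monotone_convergence_SUP[OF seq(3,1)] by (simp add: image_comp)
qed

text \<open>One sequence \<open>B\<close> of sets of finite mass serves all \<open>w\<close> at
  once. Cut along \<open>B\<close> and divided by 1 plus its mass, each piece of the kernel is a
  subprobability kernel, whose integrals are measurable in \<open>w\<close>; multiplying back and
  summing recovers the integral.\<close>

lemma nn_integral_kernel_measurable:
  assumes sets: "\<And>w. w \<in> space M \<Longrightarrow> sets (\<kappa> w) = sets E"
    and meas: "\<And>A. A \<in> sets E \<Longrightarrow> (\<lambda>w. emeasure (\<kappa> w) A) \<in> borel_measurable M"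
    and B: "\<And>i::nat. B i \<in> sets E" "disjoint_family B" "(\<Union>i. B i) = space E"
    and fin: "\<And>w i. w \<in> space M \<Longrightarrow> emeasure (\<kappa> w) (B i) < \<infinity>"
    and F[measurable]: "(\<lambda>(w, z). F w z) \<in> borel_measurable (M \<Otimes>\<^sub>M E)"
  shows "(\<lambda>w. \<integral>\<^sup>+z. F w z \<partial>\<kappa> w) \<in> borel_measurable M"
\<comment> \<open>\<open>subprob_space\<close> demands a nonempty space, so the empty one is treated
  apart.\<close>
proof (cases "space E = {}")
  case True
  have "(\<integral>\<^sup>+z. F w z \<partial>\<kappa> w) = 0" if "w \<in> space M" for w
    using True sets_eq_imp_space_eq[OF sets[OF that]] by (simp add: nn_integral_empty)
  then show ?thesis by (simp cong: measurable_cong)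
next
  case False
  note B(1)[measurable]
  \<comment> \<open>The summand 1 in the denominator keeps the quotient meaningful for pieces of
    mass 0 and its mass at most 1.\<close>
  define L where "L i w = density (\<kappa> w) (\<lambda>z. indicator (B i) z / (1 + emeasure (\<kappa> w) (B i)))" for i w
  have emeasure_L: "emeasure (L i w) A = emeasure (\<kappa> w) (B i \<inter> A) / (1 + emeasure (\<kappa> w) (B i))"
    if w: "w \<in> space M" and A: "A \<in> sets E" for i w A
  proof -
    have [measurable_cong]: "sets (\<kappa> w) = sets E" using sets w by auto
    have "emeasure (L i w) A = (\<integral>\<^sup>+z. indicator (B i \<inter> A) z / (1 + emeasure (\<kappa> w) (B i)) \<partial>\<kappa> w)"
      unfolding L_def using A by (subst emeasure_density)
        (auto intro!: nn_integral_cong simp: indicator_def)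
    also have "\<dots> = (\<integral>\<^sup>+z. indicator (B i \<inter> A) z \<partial>\<kappa> w) / (1 + emeasure (\<kappa> w) (B i))"
      using A by (intro nn_integral_divide) auto
    finally show ?thesis using A B(1) sets w by simp
  qed
  have L: "L i \<in> measurable M (subprob_algebra E)" for i
  proof (rule measurable_subprob_algebra)
    fix w assume w: "w \<in> space M"
    show "sets (L i w) = sets E" using sets w by (simp add: L_def)
    then have sp: "space (L i w) = space E" by (rule sets_eq_imp_space_eq)
    show "subprob_space (L i w)"
    proof (rule subprob_spaceI)
      have "B i \<inter> space E = B i" using sets.sets_into_space[OF B(1)] by auto
      then show "emeasure (L i w) (space (L i w)) \<le> 1"
        using w by (auto simp: sp emeasure_L intro!: divide_le_posI_ennreal add_pos_nonneg)
    qed (use sp False in auto)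
  next
    fix A assume A[measurable]: "A \<in> sets E"
    have "(\<lambda>w. emeasure (\<kappa> w) (B i \<inter> A) / (1 + emeasure (\<kappa> w) (B i))) \<in> borel_measurable M"
      by (intro borel_measurable_divide_ennreal meas borel_measurable_add) auto
    then show "(\<lambda>w. emeasure (L i w) A) \<in> borel_measurable M"
      by (rule measurable_cong[THEN iffD1, rotated]) (simp add: emeasure_L A)
  qed
  have "(\<integral>\<^sup>+z. F w z \<partial>\<kappa> w) = (\<Sum>i. (1 + emeasure (\<kappa> w) (B i)) * (\<integral>\<^sup>+z. F w z \<partial>L i w))"
    if w: "w \<in> space M" for w
  proof -
    have [measurable_cong]: "sets (\<kappa> w) = sets E" using sets w by auto
    have [measurable]: "F w \<in> borel_measurable E" using w by measurable
    have "(1 + emeasure (\<kappa> w) (B i)) * (\<integral>\<^sup>+z. F w z \<partial>L i w) = (\<integral>\<^sup>+z. F w z * indicator (B i) z \<partial>\<kappa> w)" for i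
    proof -
      let ?c = "1 + emeasure (\<kappa> w) (B i)"
      have c: "?c / ?c = 1" using fin[OF w, of i] by (intro ennreal_divide_self) (auto simp: less_top)
      have "?c * (\<integral>\<^sup>+z. F w z \<partial>L i w) = (\<integral>\<^sup>+z. ?c * (indicator (B i) z / ?c * F w z) \<partial>\<kappa> w)"
        unfolding L_def by (subst nn_integral_density) (auto intro!: nn_integral_cmult[symmetric])
      also have "\<dots> = (\<integral>\<^sup>+z. F w z * indicator (B i) z \<partial>\<kappa> w)"
        using c by (intro nn_integral_cong) (auto simp: indicator_def ennreal_times_divide mult.assoc[symmetric] c)
      finally show ?thesis .
    qed
    then have "(\<Sum>i. (1 + emeasure (\<kappa> w) (B i)) * (\<integral>\<^sup>+z. F w z \<partial>L i w)) = (\<integral>\<^sup>+z. F w z * indicator (\<Union>i. B i) z \<partial>\<kappa> w)"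
      by (subst nn_integral_disjoint_family) (use B(2) in auto)
    also have "\<dots> = (\<integral>\<^sup>+z. F w z \<partial>\<kappa> w)"
      unfolding B(3) using sets_eq_imp_space_eq[OF sets[OF w]] by (intro nn_integral_cong) auto
    finally show ?thesis by simp
  qed
  moreover have "(\<lambda>w. \<Sum>i. (1 + emeasure (\<kappa> w) (B i)) * (\<integral>\<^sup>+z. F w z \<partial>L i w)) \<in> borel_measurable M"
    using nn_integral_measurable_subprob_algebra2[OF F L] meas[OF B(1)]
    by (intro borel_measurable_suminf_order borel_measurable_times borel_measurable_add) auto
  ultimately show ?thesis by (simp cong: measurable_cong)
qed

text \<open>Tonelli peels off one coordinate at a time. The inner integral depends on
  \<open>w\<close> and on the remaining coordinates, so the induction needs an arbitrary integrand
  \<open>F\<close>, and the kernel is lifted to pairs, where it ignores the second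
  component.\<close>

lemma nn_integral_PiM_kernel_measurable:
  assumes I: "finite I"
    and sets: "\<And>w. w \<in> space M \<Longrightarrow> sets (\<kappa> w) = sets E"
    and meas: "\<And>A. A \<in> sets E \<Longrightarrow> (\<lambda>w. emeasure (\<kappa> w) A) \<in> borel_measurable M"
    and B: "\<And>i::nat. B i \<in> sets E" "disjoint_family B" "(\<Union>i. B i) = space E"
    and fin: "\<And>w i. w \<in> space M \<Longrightarrow> emeasure (\<kappa> w) (B i) < \<infinity>"
    and F: "(\<lambda>(w, z). F w z) \<in> borel_measurable (M \<Otimes>\<^sub>M (\<Pi>\<^sub>M i\<in>I. E))"
  shows "(\<lambda>w. \<integral>\<^sup>+z. F w z \<partial>(\<Pi>\<^sub>M i\<in>I. \<kappa> w)) \<in> borel_measurable M"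
  using I F
proof (induction I arbitrary: F)
  case empty
  have [measurable]: "(\<lambda>(w, z). F w z) \<in> borel_measurable (M \<Otimes>\<^sub>M (\<Pi>\<^sub>M i\<in>{}. E))" by fact
  have "(\<lambda>w. F w (\<lambda>k. undefined)) \<in> borel_measurable M"
    using measurable_compose[of "\<lambda>w. (w, \<lambda>k. undefined)" M "M \<Otimes>\<^sub>M (\<Pi>\<^sub>M i\<in>{}. E)", OF _ empty]
    by (auto simp: space_PiM)
  then show ?case by (simp add: PiM_empty nn_integral_count_space_finite max_absorb2)
next
  case (insert i I)
  have [measurable]: "(\<lambda>(w, z). F w z) \<in> borel_measurable (M \<Otimes>\<^sub>M (\<Pi>\<^sub>M i\<in>insert i I. E))" by fact
  have "(\<lambda>(w, z). \<integral>\<^sup>+y. F w (z(i := y)) \<partial>\<kappa> w) \<in> borel_measurable (M \<Otimes>\<^sub>M (\<Pi>\<^sub>M i\<in>I. E))"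
    unfolding case_prod_beta
  proof (rule nn_integral_kernel_measurable[where E=E and B=B])
    show "(\<lambda>w. emeasure (\<kappa> (fst w)) A) \<in> borel_measurable (M \<Otimes>\<^sub>M Pi\<^sub>M I (\<lambda>i. E))" if "A \<in> sets E" for A
      by (rule measurable_compose[OF measurable_fst meas[OF that]])
    show "(\<lambda>(w, z). F (fst w) ((snd w)(i := z))) \<in> borel_measurable ((M \<Otimes>\<^sub>M Pi\<^sub>M I (\<lambda>i. E)) \<Otimes>\<^sub>M E)"
      by measurable
  qed (use sets B fin in \<open>auto simp: space_pair_measure\<close>)
  from insert.IH[OF this]
  have "(\<lambda>w. \<integral>\<^sup>+z. \<integral>\<^sup>+y. F w (z(i := y)) \<partial>\<kappa> w \<partial>(\<Pi>\<^sub>M i\<in>I. \<kappa> w)) \<in> borel_measurable M" .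
  moreover have "(\<integral>\<^sup>+z. F w z \<partial>(\<Pi>\<^sub>M i\<in>insert i I. \<kappa> w)) = (\<integral>\<^sup>+z. \<integral>\<^sup>+y. F w (z(i := y)) \<partial>\<kappa> w \<partial>(\<Pi>\<^sub>M i\<in>I. \<kappa> w))"
    if w: "w \<in> space M" for w
  proof -
    have [measurable_cong]: "sets (\<kappa> w) = sets E" using sets w by auto
    have "sigma_finite_measure (\<kappa> w)"
      using B fin[OF w] sets[OF w] sets_eq_imp_space_eq[OF sets[OF w]]
      by (intro sigma_finite_measure.intro exI[of _ "range B"]) (auto simp: less_top)
    then interpret product_sigma_finite "\<lambda>_. \<kappa> w"
      by (simp add: product_sigma_finite_def)
    show ?thesis
      using w insert.hyps by (intro product_nn_integral_insert) auto
  qed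
  ultimately show ?case by (simp cong: measurable_cong)
qed

section \<open>Evaluation sigma-algebras, added atoms and mixtures\<close>

lemma space_evaluation_algebra: "space (evaluation_algebra S K) = S"
  by (auto simp add: evaluation_algebra_def space_Sup_eq_UN)

lemma measurable_emeasure_evaluation_algebra:
  "A \<in> sets K \<Longrightarrow> (\<lambda>M. emeasure M A) \<in> borel_measurable (evaluation_algebra S K)"
  by (auto intro!: measurable_Sup1 measurable_vimage_algebra1 simp: evaluation_algebra_def)

lemma measurable_evaluation_algebra:
  "(\<And>a. a \<in> space M \<Longrightarrow> K a \<in> S) \<Longrightarrow>
  (\<And>A. A \<in> sets N \<Longrightarrow> (\<lambda>a. emeasure (K a) A) \<in> borel_measurable M) \<Longrightarrow>
  K \<in> measurable M (evaluation_algebra S N)"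
  by (auto intro!: measurable_Sup2 measurable_vimage_algebra2 simp: evaluation_algebra_def)

lemma sets_add_atoms[simp, measurable_cong]: "sets (add_atoms N I w z) = sets N"
  by (simp add: add_atoms_def)

lemma emeasure_add_atoms:
  assumes A: "A \<in> sets N"
  shows "emeasure (add_atoms N I w z) A = emeasure N A + (\<Sum>j\<in>I. w j * indicator A (z j))"
  unfolding add_atoms_def
proof (rule emeasure_measure_of_sigma[OF sets.sigma_algebra_axioms _ _ A])
  show "positive (sets N) (\<lambda>A. emeasure N A + (\<Sum>j\<in>I. w j * indicator A (z j)))"
    by (simp add: positive_def)
  show "countably_additive (sets N) (\<lambda>A. emeasure N A + (\<Sum>j\<in>I. w j * indicator A (z j)))"
  proof (rule countably_additiveI)
    fix A :: "nat \<Rightarrow> 'a set" assume A: "range A \<subseteq> sets N" "disjoint_family A"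
    have "(\<Sum>i. \<Sum>j\<in>I. w j * indicator (A i) (z j)) = (\<Sum>j\<in>I. w j * indicator (\<Union>i. A i) (z j))"
      by (subst suminf_sum) (simp_all add: suminf_indicator[OF A(2)])
    then show "(\<Sum>i. emeasure N (A i) + (\<Sum>j\<in>I. w j * indicator (A i) (z j))) =
        emeasure N (\<Union>i. A i) + (\<Sum>j\<in>I. w j * indicator (\<Union>i. A i) (z j))"
      by (subst suminf_add[symmetric]) (simp_all add: suminf_emeasure A)
  qed
qed

lemma nn_integral_add_atoms:
  assumes I: "finite I" and z: "\<And>j. j \<in> I \<Longrightarrow> z j \<in> space N" and f: "f \<in> borel_measurable N"
  shows "(\<integral>\<^sup>+x. f x \<partial>add_atoms N I w z) = (\<integral>\<^sup>+x. f x \<partial>N) + (\<Sum>j\<in>I. w j * f (z j))"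
proof -
  \<comment> \<open>\<open>None\<close> indexes \<open>N\<close> itself and \<open>Some j\<close>
    the Dirac measure at \<open>z j\<close>, so that the formula for finite sums of measures
    applies.\<close>
  let ?K = "\<lambda>r. case r of None \<Rightarrow> N | Some j \<Rightarrow> return N (z j)"
  let ?c = "\<lambda>r. case r of None \<Rightarrow> 1 | Some j \<Rightarrow> w j"
  have "(\<integral>\<^sup>+x. f x \<partial>add_atoms N I w z) = (\<Sum>r\<in>insert None (Some ` I). ?c r * (\<integral>\<^sup>+x. f x \<partial>?K r))"
    by (rule nn_integral_sum_measures)
      (use I f in \<open>auto simp: emeasure_add_atoms sum.reindex sum.insert split: option.split intro!: sum.cong\<close>)
  also have "\<dots> = (\<integral>\<^sup>+x. f x \<partial>N) + (\<Sum>j\<in>I. w j * f (z j))"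
    using I z f by (simp add: sum.insert image_iff sum.reindex nn_integral_return cong: sum.cong)
  finally show ?thesis .
qed

context
  fixes c :: "'w \<Rightarrow> 'z \<Rightarrow> ennreal" and K :: "'k measure" and h :: "'w \<Rightarrow> 'z \<Rightarrow> 'k"
    and \<kappa> :: "'w \<Rightarrow> 'z measure" and M :: "'w measure" and L :: "'k measure"
  assumes m1: "\<And>f. f \<in> borel_measurable K \<Longrightarrow> (\<lambda>w. \<integral>\<^sup>+z. c w z * f (h w z) \<partial>\<kappa> w) \<in> borel_measurable M"
    and m2: "\<And>w. w \<in> space M \<Longrightarrow> c w \<in> borel_measurable (\<kappa> w)"
    and m3: "\<And>w. w \<in> space M \<Longrightarrow> h w \<in> measurable (\<kappa> w) K"
    and L: "L = measure_of (space K) (sets K) (\<lambda>A. \<integral>\<^sup>+w. \<integral>\<^sup>+z. c w z * indicator A (h w z) \<partial>\<kappa> w \<partial>M)"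
begin

text \<open>\<open>L\<close> is the image of the weighted kernel under \<open>h\<close>, averaged
  over \<open>M\<close>. \<open>measure_of\<close> returns the intended values only for a countably
  additive set function, hence this check comes first. The construction occurs three times: for
  \<open>intensity\<close>, for the left side of Mecke's equation as a measure on pairs, and for the
  posterior before normalisation.\<close>

lemma emeasure_mixture:
  assumes A: "A \<in> sets K"
  shows "emeasure L A = (\<integral>\<^sup>+w. \<integral>\<^sup>+z. c w z * indicator A (h w z) \<partial>\<kappa> w \<partial>M)"
  unfolding L
proof (rule emeasure_measure_of_sigma[OF sets.sigma_algebra_axioms _ _ A])
  show "positive (sets K) (\<lambda>A. \<integral>\<^sup>+w. \<integral>\<^sup>+z. c w z * indicator A (h w z) \<partial>\<kappa> w \<partial>M)"
    by (simp add: positive_def)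
  show "countably_additive (sets K) (\<lambda>A. \<integral>\<^sup>+w. \<integral>\<^sup>+z. c w z * indicator A (h w z) \<partial>\<kappa> w \<partial>M)"
  proof (rule countably_additiveI)
    fix A :: "nat \<Rightarrow> 'k set" assume A: "range A \<subseteq> sets K" "disjoint_family A"
    have "(\<integral>\<^sup>+z. c w z * indicator (\<Union>i. A i) (h w z) \<partial>\<kappa> w) = (\<Sum>i. \<integral>\<^sup>+z. c w z * indicator (A i) (h w z) \<partial>\<kappa> w)"
      if w: "w \<in> space M" for w
    proof -
      have "(\<lambda>z. c w z * indicator (A i) (h w z)) \<in> borel_measurable (\<kappa> w)" for i
        using A by (intro borel_measurable_times_ennreal m2[OF w] measurable_compose[OF m3[OF w]]) auto
      then show ?thesis
        by (subst nn_integral_suminf[symmetric]) (simp_all add: suminf_indicator[OF A(2)])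
    qed
    then have "(\<integral>\<^sup>+w. \<integral>\<^sup>+z. c w z * indicator (\<Union>i. A i) (h w z) \<partial>\<kappa> w \<partial>M)
        = (\<integral>\<^sup>+w. (\<Sum>i. \<integral>\<^sup>+z. c w z * indicator (A i) (h w z) \<partial>\<kappa> w) \<partial>M)"
      by (rule nn_integral_cong)
    also have "\<dots> = (\<Sum>i. \<integral>\<^sup>+w. \<integral>\<^sup>+z. c w z * indicator (A i) (h w z) \<partial>\<kappa> w \<partial>M)"
      using A by (intro nn_integral_suminf m1) auto
    finally show "(\<Sum>i. \<integral>\<^sup>+w. \<integral>\<^sup>+z. c w z * indicator (A i) (h w z) \<partial>\<kappa> w \<partial>M)
        = (\<integral>\<^sup>+w. \<integral>\<^sup>+z. c w z * indicator (\<Union>i. A i) (h w z) \<partial>\<kappa> w \<partial>M)" by simp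
  qed
qed

lemma nn_integral_mixture:
  assumes f: "f \<in> borel_measurable K"
  shows "(\<integral>\<^sup>+x. f x \<partial>L) = (\<integral>\<^sup>+w. \<integral>\<^sup>+z. c w z * f (h w z) \<partial>\<kappa> w \<partial>M)"
proof -
  have sp: "space L = space K" and [measurable_cong]: "sets L = sets K" by (simp_all add: L)
  have m4: "(\<lambda>z. c w z * f (h w z)) \<in> borel_measurable (\<kappa> w)"
    if "w \<in> space M" "f \<in> borel_measurable K" for w and f :: "'k \<Rightarrow> ennreal"
    by (intro borel_measurable_times_ennreal m2 measurable_compose[OF m3] that)
  show ?thesis using f
  proof induction
    case (cong f g)
    have "(\<integral>\<^sup>+x. f x \<partial>L) = (\<integral>\<^sup>+x. g x \<partial>L)"
      using cong(3) sp by (intro nn_integral_cong) auto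
    moreover have "(\<integral>\<^sup>+w. \<integral>\<^sup>+z. c w z * f (h w z) \<partial>\<kappa> w \<partial>M) = (\<integral>\<^sup>+w. \<integral>\<^sup>+z. c w z * g (h w z) \<partial>\<kappa> w \<partial>M)"
      using cong(3) measurable_space[OF m3] by (auto intro!: nn_integral_cong)
    ultimately show ?case using cong(4) by simp
  next
    case (set A)
    then show ?case by (simp add: emeasure_mixture)
  next
    case (mult u d)
    have "(\<integral>\<^sup>+z. c w z * (d * u (h w z)) \<partial>\<kappa> w) = d * (\<integral>\<^sup>+z. c w z * u (h w z) \<partial>\<kappa> w)"
      if "w \<in> space M" for w
      using nn_integral_cmult[OF m4[OF that mult(2)], of d] by (simp add: ac_simps)
    with mult show ?case by (simp add: nn_integral_cmult m1 cong: nn_integral_cong)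
  next
    case (add u v)
    have "(\<integral>\<^sup>+z. c w z * (v (h w z) + u (h w z)) \<partial>\<kappa> w) =
        (\<integral>\<^sup>+z. c w z * v (h w z) \<partial>\<kappa> w) + (\<integral>\<^sup>+z. c w z * u (h w z) \<partial>\<kappa> w)"
      if "w \<in> space M" for w
      unfolding distrib_left using add that by (intro nn_integral_add m4)
    with add show ?case by (simp add: nn_integral_add m1 cong: nn_integral_cong)
  next
    case (seq U)
    have inc: "incseq (\<lambda>i z. c w z * U i (h w z))" for w
      using seq(3) by (auto simp: incseq_def le_fun_def intro!: mult_left_mono)
    have "(\<integral>\<^sup>+z. c w z * (SUP i. U i (h w z)) \<partial>\<kappa> w) = (SUP i. \<integral>\<^sup>+z. c w z * U i (h w z) \<partial>\<kappa> w)"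
      if "w \<in> space M" for w
      unfolding SUP_mult_left_ennreal using seq that inc
      by (intro nn_integral_monotone_convergence_SUP m4) auto
    then have "(\<integral>\<^sup>+w. \<integral>\<^sup>+z. c w z * (SUP i. U i (h w z)) \<partial>\<kappa> w \<partial>M) =
        (\<integral>\<^sup>+w. (SUP i. \<integral>\<^sup>+z. c w z * U i (h w z) \<partial>\<kappa> w) \<partial>M)"
      by (rule nn_integral_cong)
    also have "\<dots> = (SUP i. \<integral>\<^sup>+w. \<integral>\<^sup>+z. c w z * U i (h w z) \<partial>\<kappa> w \<partial>M)"
      using seq inc by (intro nn_integral_monotone_convergence_SUP m1)
        (auto simp: incseq_def le_fun_def intro!: nn_integral_mono)
    finally show ?case
      using seq nn_integral_monotone_convergence_SUP[OF seq(3), of L] by (simp add: image_comp)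
  qed
qed

end

section \<open>Poisson weights, size bias and disjoint refinements\<close>

lemma suminf_ennreal_shift:
  fixes f :: "nat \<Rightarrow> ennreal"
  assumes "f 0 = 0"
  shows "(\<Sum>j. f j) = (\<Sum>j. f (Suc j))"
  using suminf_offset[of f 1] assms by simp

context
  fixes D :: "ennreal measure" and a :: real
  assumes D: "prob_space D" "sets D = sets borel" and a: "0 \<le> a"
    and p: "\<And>j. emeasure D {of_nat j} = ennreal (a ^ j / fact j * exp (- a))"
begin

text \<open>The prescribed masses of the naturals already sum to 1, so \<open>D\<close>, a measure
  on all of \<open>ennreal\<close>, charges nothing else.\<close>

lemma nn_integral_poisson:
  assumes f: "f \<in> borel_measurable borel"
  shows "(\<integral>\<^sup>+x. f x \<partial>D) = (\<Sum>j. ennreal (a ^ j / fact j * exp (- a)) * f (of_nat j))"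
proof -
  note D(2)[measurable_cong] f[measurable]
  interpret prob_space D by fact
  let ?R = "\<Union>j::nat. {of_nat j :: ennreal}"
  have disj: "disjoint_family (\<lambda>j::nat. {of_nat j :: ennreal})"
    by (auto simp: disjoint_family_on_def)
  have "(\<lambda>j. a ^ j / fact j * exp (- a)) sums (exp a * exp (- a))"
    using exp_converges[of a] by (intro sums_mult2) (simp add: divide_inverse mult.commute)
  then have "(\<Sum>j. ennreal (a ^ j / fact j * exp (- a))) = ennreal 1"
    using a by (intro suminf_ennreal_eq) (simp_all add: exp_minus)
  then have "emeasure D ?R = 1"
    using suminf_emeasure[of "\<lambda>j::nat. {of_nat j :: ennreal}" D] disj D(2)
    by (simp only: p) (simp add: image_subset_iff)
  then have "AE x in D. x \<in> ?R"
    using sets_eq_imp_space_eq[OF D(2)] by (intro AE_I_eq_1) (simp_all only: UNIV_I Collect_mem_eq space_borel simp_thms D(2), measurable)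
  then have "(\<integral>\<^sup>+x. f x \<partial>D) = (\<integral>\<^sup>+x. f x * indicator ?R x \<partial>D)"
    by (intro nn_integral_cong_AE) auto
  also have "\<dots> = (\<Sum>j. \<integral>\<^sup>+x. f x * indicator {of_nat j} x \<partial>D)"
    using disj by (intro nn_integral_disjoint_family) auto
  finally show ?thesis
    by (simp add: nn_integral_indicator_singleton D(2) p mult.commute)
qed

text \<open>Mecke's equation for a single count: \<open>j\<close> times the Poisson weight of
  \<open>j\<close> is \<open>a\<close> times the weight of \<open>j - 1\<close>, and a shift of the
  summation index turns one side into the other.\<close>

lemma nn_integral_poisson_size_bias:
  assumes f: "f \<in> borel_measurable borel"
  shows "(\<integral>\<^sup>+x. x * f x \<partial>D) = ennreal a * (\<integral>\<^sup>+x. f (x + 1) \<partial>D)"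
proof -
  note f[measurable]
  have "(\<integral>\<^sup>+x. x * f x \<partial>D) = (\<Sum>j. ennreal (a ^ j / fact j * exp (- a)) * (of_nat j * f (of_nat j)))"
    by (rule nn_integral_poisson) measurable
  also have "\<dots> = (\<Sum>j. ennreal (a ^ Suc j / fact (Suc j) * exp (- a)) * (of_nat (Suc j) * f (of_nat (Suc j))))"
    by (rule suminf_ennreal_shift) simp
  also have "\<dots> = (\<Sum>j. ennreal a * (ennreal (a ^ j / fact j * exp (- a)) * f (of_nat j + 1)))"
  proof (rule suminf_cong)
    fix j
    have "ennreal (a ^ Suc j / fact (Suc j) * exp (- a)) * of_nat (Suc j) = ennreal a * ennreal (a ^ j / fact j * exp (- a))"
      using a by (simp add: ennreal_of_nat_eq_real_of_nat ennreal_mult[symmetric] del: of_nat_Suc fact_Suc)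
        (simp add: fact_Suc divide_simps)
    then show "ennreal (a ^ Suc j / fact (Suc j) * exp (- a)) * (of_nat (Suc j) * f (of_nat (Suc j)))
        = ennreal a * (ennreal (a ^ j / fact j * exp (- a)) * f (of_nat j + 1))"
      by (simp add: mult.assoc[symmetric] add.commute)
  qed
  also have "\<dots> = ennreal a * (\<integral>\<^sup>+x. f (x + 1) \<partial>D)"
    by (subst nn_integral_poisson) simp_all
  finally show ?thesis .
qed

end

text \<open>The sets \<open>a i\<close> are the atoms of the finite algebra generated by
  \<open>DD\<close>, one for each subset of \<open>DD\<close>. They are enumerated by naturals and
  continued by empty sets, because \<open>poisson_law\<close> speaks of independence for sequences
  of disjoint sets.\<close>

lemma disjoint_refinement:
  assumes DD: "finite DD" "DD \<subseteq> sets E"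
  obtains a :: "nat \<Rightarrow> 'a set" and I :: "'a set \<Rightarrow> nat set" and m :: nat
  where "disjoint_family a" "\<And>i. a i \<in> sets E" "\<And>D. D \<in> DD \<Longrightarrow> I D \<subseteq> {..<m}"
    "\<And>D. D \<in> DD \<Longrightarrow> D = (\<Union>i\<in>I D. a i)"
proof -
  define atom where "atom T = {x\<in>space E. \<forall>D\<in>DD. x \<in> D \<longleftrightarrow> D \<in> T}" for T
  have atom: "atom T \<in> sets E" for T
    unfolding atom_def
  proof (rule sets.sets_Collect_finite_All[OF _ DD(1)])
    fix D assume "D \<in> DD"
    then have D: "D \<in> sets E" using DD by auto
    show "{x \<in> space E. (x \<in> D) = (D \<in> T)} \<in> sets E"
      using D by measurable
  qed
  define m where "m = card (Pow DD)"
  obtain e where e: "bij_betw e {0..<m} (Pow DD)"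
    using ex_bij_betw_nat_finite[of "Pow DD"] DD by (auto simp: m_def)
  let ?a = "\<lambda>i. if i < m then atom (e i) else {}"
  let ?I = "\<lambda>D. {i. i < m \<and> D \<in> e i}"
  show thesis
  proof (rule that[of ?a ?I m])
    show "disjoint_family ?a"
    proof (unfold disjoint_family_on_def, intro ballI impI)
      fix i j :: nat assume ij: "i \<noteq> j"
      show "?a i \<inter> ?a j = {}"
      proof (cases "i < m \<and> j < m")
        case True
        then have "e i \<noteq> e j" "e i \<subseteq> DD" "e j \<subseteq> DD"
          using e ij by (auto simp: bij_betw_def dest: inj_onD)
        then show ?thesis using True by (auto simp: atom_def)
      qed auto
    qed
    show "?a i \<in> sets E" for i using atom by auto
    show "D = (\<Union>i\<in>?I D. ?a i)" if D: "D \<in> DD" for D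
    proof (intro set_eqI iffI)
      fix x assume x: "x \<in> D"
      then have "x \<in> space E" using D DD sets.sets_into_space by blast
      moreover obtain i where "i < m" "e i = {D'\<in>DD. x \<in> D'}"
        using e by (auto simp: bij_betw_def image_iff set_eq_iff dest!: spec[of _ "{D'\<in>DD. x \<in> D'}"])
      ultimately show "x \<in> (\<Union>i\<in>?I D. ?a i)"
        using x D by (auto simp: atom_def intro!: exI[of _ i])
    next
      fix x assume "x \<in> (\<Union>i\<in>?I D. ?a i)"
      then show "x \<in> D" using D by (auto simp: atom_def split: if_splits)
    qed
  qed auto
qed

section \<open>Mecke's equation for Poisson point processes\<close>

text \<open>\<open>B\<close> is a countable partition of the space into sets that play the role of the bounded sets.\<close>

locale point_config =
  fixes E :: "'a measure" and S :: "'a measure set" and B :: "nat \<Rightarrow> 'a set"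
  assumes cover: "\<And>i. B i \<in> sets E" "disjoint_family B" "(\<Union>i. B i) = space E"
    and sets_S: "\<And>N. N \<in> S \<Longrightarrow> sets N = sets E"
    and fin_S: "\<And>N i. N \<in> S \<Longrightarrow> emeasure N (B i) < \<infinity>"
    and int_S: "\<And>N A i. N \<in> S \<Longrightarrow> A \<in> sets E \<Longrightarrow> A \<subseteq> B i \<Longrightarrow> emeasure N A \<in> \<nat>"
    and add_S: "\<And>N z. N \<in> S \<Longrightarrow> z \<in> space E \<Longrightarrow> add_atoms N {()} (\<lambda>_. 1) (\<lambda>_. z) \<in> S"
begin

abbreviation PM :: "'a measure measure" where
  "PM \<equiv> evaluation_algebra S E"

definition add_point :: "'a measure \<Rightarrow> 'a \<Rightarrow> 'a measure" where
  "add_point N z = add_atoms N {()} (\<lambda>_. 1) (\<lambda>_. z)"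

lemma space_S: "N \<in> S \<Longrightarrow> space N = space E"
  using sets_eq_imp_space_eq[OF sets_S] .

lemma space_PM[simp]: "space PM = S"
  by (rule space_evaluation_algebra)

lemma add_point_S: "N \<in> S \<Longrightarrow> z \<in> space E \<Longrightarrow> add_point N z \<in> S"
  unfolding add_point_def by (rule add_S)

lemma sets_add_point[simp]: "sets (add_point N z) = sets N"
  by (simp add: add_point_def)

lemma emeasure_add_point: "A \<in> sets N \<Longrightarrow> emeasure (add_point N z) A = emeasure N A + indicator A z"
  by (simp add: add_point_def emeasure_add_atoms)

lemma nn_integral_add_point:
  "z \<in> space N \<Longrightarrow> f \<in> borel_measurable N \<Longrightarrow> (\<integral>\<^sup>+x. f x \<partial>add_point N z) = (\<integral>\<^sup>+x. f x \<partial>N) + f z"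
  by (simp add: add_point_def nn_integral_add_atoms)

lemma add_atoms_insert_point:
  "finite I \<Longrightarrow> j \<notin> I \<Longrightarrow> add_atoms N (insert j I) (\<lambda>_. 1) z = add_point (add_atoms N I (\<lambda>_. 1) z) (z j)"
  by (rule measure_eqI) (simp_all add: emeasure_add_point emeasure_add_atoms ac_simps)

lemma add_atoms_S: "finite I \<Longrightarrow> N \<in> S \<Longrightarrow> (\<And>j. j \<in> I \<Longrightarrow> z j \<in> space E) \<Longrightarrow> add_atoms N I (\<lambda>_. 1) z \<in> S"
proof (induction I rule: finite_induct)
  case empty
  have "add_atoms N {} (\<lambda>_. 1) z = N"
    by (rule measure_eqI) (simp_all add: emeasure_add_atoms)
  then show ?case using empty by simp
qed (simp add: add_atoms_insert_point add_point_S)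

lemma measurable_emeasure_PM[measurable]: "A \<in> sets E \<Longrightarrow> (\<lambda>N. emeasure N A) \<in> borel_measurable PM"
  by (rule measurable_emeasure_evaluation_algebra)

lemma measurable_nn_integral_PM:
  assumes F: "(\<lambda>(w, z). F w z) \<in> borel_measurable (M \<Otimes>\<^sub>M E)" and N: "N \<in> measurable M PM"
  shows "(\<lambda>w. \<integral>\<^sup>+z. F w z \<partial>N w) \<in> borel_measurable M"
proof (rule nn_integral_kernel_measurable[OF _ _ cover _ F])
  show "(\<lambda>w. emeasure (N w) A) \<in> borel_measurable M" if "A \<in> sets E" for A
    by (rule measurable_compose[OF N measurable_emeasure_PM[OF that]])
qed (use measurable_space[OF N] sets_S fin_S in auto)

lemma measurable_nn_integral_PiM_PM:
  assumes I: "finite I" and F: "(\<lambda>(w, z). F w z) \<in> borel_measurable (M \<Otimes>\<^sub>M (\<Pi>\<^sub>M i\<in>I. E))"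
    and N: "N \<in> measurable M PM"
  shows "(\<lambda>w. \<integral>\<^sup>+z. F w z \<partial>(\<Pi>\<^sub>M i\<in>I. N w)) \<in> borel_measurable M"
proof (rule nn_integral_PiM_kernel_measurable[OF I _ _ cover _ F])
  show "(\<lambda>w. emeasure (N w) A) \<in> borel_measurable M" if "A \<in> sets E" for A
    by (rule measurable_compose[OF N measurable_emeasure_PM[OF that]])
qed (use measurable_space[OF N] sets_S fin_S in auto)

lemma measurable_add_atoms[measurable (raw)]:
  assumes I: "finite I" and N: "N \<in> measurable M PM" and z: "\<And>j. j \<in> I \<Longrightarrow> (\<lambda>w. z w j) \<in> measurable M E"
  shows "(\<lambda>w. add_atoms (N w) I (\<lambda>_. 1) (z w)) \<in> measurable M PM"
proof (rule measurable_evaluation_algebra)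
  show "add_atoms (N w) I (\<lambda>_. 1) (z w) \<in> S" if "w \<in> space M" for w
    using measurable_space[OF N that] measurable_space[OF z that] by (auto intro!: add_atoms_S I)
  fix A assume A[measurable]: "A \<in> sets E"
  have "(\<lambda>w. emeasure (N w) A + (\<Sum>j\<in>I. indicator A (z w j))) \<in> borel_measurable M"
    using N z by measurable
  moreover have "emeasure (add_atoms (N w) I (\<lambda>_. 1) (z w)) A = emeasure (N w) A + (\<Sum>j\<in>I. indicator A (z w j))"
    if "w \<in> space M" for w
    using measurable_space[OF N that] A by (simp add: emeasure_add_atoms sets_S)
  ultimately show "(\<lambda>w. emeasure (add_atoms (N w) I (\<lambda>_. 1) (z w)) A) \<in> borel_measurable M"
    by (simp cong: measurable_cong)
qed

lemma measurable_add_point[measurable (raw)]: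
  "N \<in> measurable M PM \<Longrightarrow> z \<in> measurable M E \<Longrightarrow> (\<lambda>w. add_point (N w) (z w)) \<in> measurable M PM"
  unfolding add_point_def by (rule measurable_add_atoms) auto

definition locally_finite :: "'a measure \<Rightarrow> bool" where
  "locally_finite \<Lambda> \<longleftrightarrow> sets \<Lambda> = sets E \<and> (\<forall>i. emeasure \<Lambda> (B i) < \<infinity>)"

lemma locally_finite_S: "N \<in> S \<Longrightarrow> locally_finite N"
  unfolding locally_finite_def using sets_S fin_S by blast

lemma locally_finite_sigma_finite:
  assumes "locally_finite \<Lambda>" shows "sigma_finite_measure \<Lambda>"
proof -
  have "space \<Lambda> = space E" using assms by (auto simp: locally_finite_def dest: sets_eq_imp_space_eq)
  with assms cover show ?thesis
    by (intro sigma_finite_measure.intro exI[of _ "range B"]) (auto simp: locally_finite_def less_top)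
qed

definition mecke :: "'a measure measure \<Rightarrow> 'a measure \<Rightarrow> bool" where
  "mecke P \<Lambda> \<longleftrightarrow> prob_space P \<and> sets P = sets PM \<and> locally_finite \<Lambda> \<and>
     (\<forall>F\<in>borel_measurable (E \<Otimes>\<^sub>M PM).
        (\<integral>\<^sup>+N. \<integral>\<^sup>+z. F (z, N) \<partial>N \<partial>P) = (\<integral>\<^sup>+z. \<integral>\<^sup>+N. F (z, add_point N z) \<partial>P \<partial>\<Lambda>))"

text \<open>The cylinder events: an intersection-stable generator of \<open>PM\<close> on which
  Mecke's equation can be verified through finitely many counts.\<close>

definition count_events :: "'a measure set set" where
  "count_events = {{N\<in>S. \<forall>D\<in>DD. emeasure N D \<in> c D} |DD c. finite DD \<and> DD \<subseteq> sets E \<and> (\<forall>D\<in>DD. c D \<in> sets borel)}"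

lemma count_eventsI:
  "finite DD \<Longrightarrow> DD \<subseteq> sets E \<Longrightarrow> (\<And>D. D \<in> DD \<Longrightarrow> c D \<in> sets borel) \<Longrightarrow>
    {N\<in>S. \<forall>D\<in>DD. emeasure N D \<in> c D} \<in> count_events"
  unfolding count_events_def by blast

lemma Int_stable_count_events: "Int_stable count_events"
proof (rule Int_stableI)
  fix G H assume "G \<in> count_events" "H \<in> count_events"
  then obtain DD c DD' c' where
    G: "G = {N\<in>S. \<forall>D\<in>DD. emeasure N D \<in> c D}" "finite DD" "DD \<subseteq> sets E" "\<And>D. D\<in>DD \<Longrightarrow> c D \<in> sets borel" and
    H: "H = {N\<in>S. \<forall>D\<in>DD'. emeasure N D \<in> c' D}" "finite DD'" "DD' \<subseteq> sets E" "\<And>D. D\<in>DD' \<Longrightarrow> c' D \<in> sets borel"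
    unfolding count_events_def by blast
  \<comment> \<open>A set constrained by only one of the two events receives the trivial constraint
    \<open>UNIV\<close> from the other.\<close>
  let ?c = "\<lambda>D. (if D \<in> DD then c D else UNIV) \<inter> (if D \<in> DD' then c' D else UNIV)"
  have "G \<inter> H = {N\<in>S. \<forall>D\<in>DD \<union> DD'. emeasure N D \<in> ?c D}"
    unfolding G H by (auto split: if_splits)
  also have "\<dots> \<in> count_events"
    using G H by (intro count_eventsI) auto
  finally show "G \<inter> H \<in> count_events" .
qed

lemma sets_PM_count_events: "sets PM = sigma_sets S count_events"
proof (rule antisym)
  have sub: "count_events \<subseteq> Pow S" by (auto simp: count_events_def)
  have "(\<lambda>N. N) \<in> measurable (sigma S count_events) PM"
  proof (rule measurable_evaluation_algebra)
    fix A assume A: "A \<in> sets E"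
    show "(\<lambda>N. emeasure N A) \<in> borel_measurable (sigma S count_events)"
    proof (rule measurableI)
      fix C :: "ennreal set" assume "C \<in> sets borel"
      then have "{N\<in>S. \<forall>D\<in>{A}. emeasure N D \<in> C} \<in> count_events"
        using A by (intro count_eventsI) auto
      then have "{N\<in>S. emeasure N A \<in> C} \<in> sigma_sets S count_events" by auto
      then show "(\<lambda>N. emeasure N A) -` C \<inter> space (sigma S count_events) \<in> sets (sigma S count_events)"
        using sub by (simp add: vimage_def Int_def conj_commute)
    qed simp
  qed (use sub in \<open>simp add: space_measure_of\<close>)
  from measurable_sets[OF this] show "sets PM \<subseteq> sigma_sets S count_events"
    using sub sets.sets_into_space[of _ PM] by (auto simp: Int_absorb2)
  show "sigma_sets S count_events \<subseteq> sets PM"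
  proof (rule sets.sigma_sets_subset'[of _ PM, simplified])
    show "count_events \<subseteq> sets PM"
    proof
      fix G assume "G \<in> count_events"
      then obtain DD c where
        G: "G = {N\<in>S. \<forall>D\<in>DD. emeasure N D \<in> c D}" "finite DD" "DD \<subseteq> sets E" "\<And>D. D\<in>DD \<Longrightarrow> c D \<in> sets borel"
        unfolding count_events_def by blast
      have "{N\<in>space PM. \<forall>D\<in>DD. emeasure N D \<in> c D} \<in> sets PM"
        using G by (intro sets.sets_Collect_finite_All measurable_sets_Collect[OF measurable_emeasure_PM]) auto
      then show "G \<in> sets PM" using G by simp
    qed
    show "S \<in> sets PM" using sets.top[of PM] by simp
  qed
qed

text \<open>Counts of disjoint sets are independent, so the law of the count vector is a product.
  Integrating coordinate \<open>i\<close> last leaves a function of that Poisson count alone, to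
  which the size-bias identity applies.\<close>

lemma poisson_component:
  fixes a :: "nat \<Rightarrow> 'a set"
  assumes P: "poisson_law P \<Lambda>" "sets P = sets PM" "sets \<Lambda> = sets E"
    and a: "disjoint_family a" "\<And>i. a i \<in> sets E" and i: "i < m" and fin: "emeasure \<Lambda> (a i) < \<infinity>"
    and phi: "\<phi> \<in> borel_measurable (\<Pi>\<^sub>M j\<in>{..<m}. borel)"
  shows "(\<integral>\<^sup>+N. emeasure N (a i) * \<phi> (\<lambda>j\<in>{..<m}. emeasure N (a j)) \<partial>P) =
    emeasure \<Lambda> (a i) * (\<integral>\<^sup>+N. \<phi> ((\<lambda>j\<in>{..<m}. emeasure N (a j))(i := emeasure N (a i) + 1)) \<partial>P)"
proof -
  note P(2)[measurable_cong] a(2)[measurable] phi[measurable]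
  have [simp]: "space P = S" using sets_eq_imp_space_eq[OF P(2)] by simp
  interpret prob_space P using P(1) by (simp add: poisson_law_def)
  define V where "V N = (\<lambda>j\<in>{..<m}. emeasure N (a j))" for N
  define D where "D j = distr P borel (\<lambda>N. emeasure N (a j))" for j
  have V[measurable]: "V \<in> measurable P (\<Pi>\<^sub>M j\<in>{..<m}. borel)"
    unfolding V_def by measurable
  have [measurable_cong]: "sets (D j) = sets borel" for j by (simp add: D_def)
  interpret D: prob_space "D j" for j unfolding D_def by (rule prob_space_distr) measurable
  interpret D: product_sigma_finite D by unfold_locales
  have "indep_vars (\<lambda>_. borel) (\<lambda>i N. emeasure N (a i)) UNIV"
    using P(1)[unfolded poisson_law_def, THEN conjunct2, THEN conjunct2, rule_format, of a] a P(3)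
    by (simp add: image_subset_iff)
  then have "indep_vars (\<lambda>_. borel) (\<lambda>i N. emeasure N (a i)) {..<m}"
    by (rule indep_vars_subset) auto
  then have dV: "distr P (\<Pi>\<^sub>M j\<in>{..<m}. borel) V = (\<Pi>\<^sub>M j\<in>{..<m}. D j)"
    unfolding V_def D_def using i by (subst (asm) indep_vars_iff_distr_eq_PiM') auto
  \<comment> \<open>The coordinates other than \<open>i\<close>, to be integrated inside.\<close>
  define J where "J = {..<m} - {i}"
  have J: "finite J" "i \<notin> J" "{..<m} = insert i J" using i by (auto simp: J_def)
  note phi' = phi[unfolded J(3), measurable]
  interpret DJ: sigma_finite_measure "PiM J D" using J(1) by (rule D.sigma_finite)
  have "(\<integral>\<^sup>+N. emeasure N (a i) * \<phi> (V N) \<partial>P) = (\<integral>\<^sup>+N. V N i * \<phi> (V N) \<partial>P)"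
    using i by (simp add: V_def)
  also have "\<dots> = (\<integral>\<^sup>+x. x i * \<phi> x \<partial>distr P (\<Pi>\<^sub>M j\<in>{..<m}. borel) V)"
    using i by (subst nn_integral_distr) auto
  also have "\<dots> = (\<integral>\<^sup>+x. x i * \<phi> x \<partial>(\<Pi>\<^sub>M j\<in>insert i J. D j))"
    by (simp only: dV J(3)[symmetric])
  also have "\<dots> = (\<integral>\<^sup>+y. y * (\<integral>\<^sup>+x. \<phi> (x(i := y)) \<partial>PiM J D) \<partial>D i)"
    using J by (subst D.product_nn_integral_insert_rev) (auto simp: nn_integral_cmult)
  also have "\<dots> = ennreal (measure \<Lambda> (a i)) * (\<integral>\<^sup>+y. (\<integral>\<^sup>+x. \<phi> (x(i := y + 1)) \<partial>PiM J D) \<partial>D i)"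
  proof (rule nn_integral_poisson_size_bias[OF D.prob_space_axioms])
    show "(\<lambda>y. \<integral>\<^sup>+x. \<phi> (x(i := y)) \<partial>PiM J D) \<in> borel_measurable borel"
      using J by measurable
    fix j :: nat
    have "{of_nat j} \<in> sets (borel :: ennreal measure)" by simp
    then show "emeasure (D i) {of_nat j} = ennreal (measure \<Lambda> (a i) ^ j / fact j * exp (- measure \<Lambda> (a i)))"
      using P fin a by (auto simp: D_def emeasure_distr poisson_law_def vimage_def Int_def conj_commute)
  qed (simp_all add: D_def)
  also have "(\<integral>\<^sup>+y. (\<integral>\<^sup>+x. \<phi> (x(i := y + 1)) \<partial>PiM J D) \<partial>D i) = (\<integral>\<^sup>+x. \<phi> (x(i := x i + 1)) \<partial>(\<Pi>\<^sub>M j\<in>insert i J. D j))"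
  proof (subst D.product_nn_integral_insert_rev[OF J(1,2)])
    have "(\<lambda>x. x(i := x i + 1)) \<in> measurable (\<Pi>\<^sub>M j\<in>insert i J. borel :: ennreal measure) (\<Pi>\<^sub>M j\<in>insert i J. borel)"
      by (rule measurable_fun_upd[where J="insert i J"]) auto
    from measurable_compose[OF this phi'(1)]
    show "(\<lambda>x. \<phi> (x(i := x i + 1))) \<in> borel_measurable (Pi\<^sub>M (insert i J) D)"
      by (simp cong: measurable_cong_sets sets_PiM_cong)
  qed simp
  also have "\<dots> = (\<integral>\<^sup>+x. \<phi> (x(i := x i + 1)) \<partial>distr P (\<Pi>\<^sub>M j\<in>{..<m}. borel) V)"
    by (simp only: dV J(3)[symmetric])
  also have "\<dots> = (\<integral>\<^sup>+N. \<phi> ((V N)(i := V N i + 1)) \<partial>P)"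
  proof (rule nn_integral_distr[OF V])
    have "(\<lambda>x. x(i := x i + 1)) \<in> measurable (\<Pi>\<^sub>M j\<in>{..<m}. borel :: ennreal measure) (\<Pi>\<^sub>M j\<in>{..<m}. borel)"
      using i by (intro measurable_fun_upd[where J="{..<m}"]) auto
    from measurable_compose[OF this phi]
    show "(\<lambda>x. \<phi> (x(i := x i + 1))) \<in> borel_measurable (distr P (\<Pi>\<^sub>M j\<in>{..<m}. borel) V)"
      by simp
  qed
  finally have *: "(\<integral>\<^sup>+N. emeasure N (a i) * \<phi> (V N) \<partial>P) =
      ennreal (measure \<Lambda> (a i)) * (\<integral>\<^sup>+N. \<phi> ((V N)(i := V N i + 1)) \<partial>P)" .
  have Vi: "V N i = emeasure N (a i)" for N using i by (simp add: V_def)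
  have "ennreal (measure \<Lambda> (a i)) = emeasure \<Lambda> (a i)"
    using fin by (simp add: emeasure_eq_ennreal_measure less_top)
  with * show ?thesis unfolding Vi unfolding V_def by (simp only:)
qed

text \<open>The case \<open>F(z, N) = indicator B0 z * indicator G N\<close>. After refinement into
  disjoint atoms, the count of \<open>B0\<close> is a sum of atom counts and \<open>G\<close> is a
  condition on the count vector; a new point in the atom \<open>a i\<close> raises the
  \<open>i\<close>-th count by one and no other, which is what \<open>poisson_component\<close>
  produces. \<open>B0\<close> lies in \<open>DD\<close> so that it, too, is a union of
  atoms.\<close>

lemma mecke_event:
  assumes P: "poisson_law P \<Lambda>" "sets P = sets PM" "sets \<Lambda> = sets E"
    and DD: "finite DD" "DD \<subseteq> sets E" "B0 \<in> DD" "\<And>D. D \<in> DD \<Longrightarrow> c D \<in> sets borel"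
    and fin: "emeasure \<Lambda> B0 < \<infinity>"
    and G: "G = {N\<in>S. \<forall>D\<in>DD. emeasure N D \<in> c D}"
  shows "(\<integral>\<^sup>+N. emeasure N B0 * indicator G N \<partial>P) =
    (\<integral>\<^sup>+z. indicator B0 z * (\<integral>\<^sup>+N. indicator G (add_point N z) \<partial>P) \<partial>\<Lambda>)"
proof -
  obtain a :: "nat \<Rightarrow> 'a set" and I m where
    a: "disjoint_family a" "\<And>i. a i \<in> sets E" and I: "\<And>D. D \<in> DD \<Longrightarrow> I D \<subseteq> {..<m}"
    and D: "\<And>D. D \<in> DD \<Longrightarrow> D = (\<Union>i\<in>I D. a i)"
    using disjoint_refinement[OF DD(1,2)] by metis
  note P(2)[measurable_cong] a(2)[measurable] P(3)[measurable_cong]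
  have [simp]: "space P = S" using sets_eq_imp_space_eq[OF P(2)] by simp
  have fin_I: "finite (I D)" if "D \<in> DD" for D using I[OF that] finite_subset by blast
  have disj: "disjoint_family_on a J" for J using a(1) by (auto simp: disjoint_family_on_def)
  define V where "V N = (\<lambda>j\<in>{..<m}. emeasure N (a j))" for N
  define \<phi> where "\<phi> x = (indicator {x\<in>space (\<Pi>\<^sub>M j\<in>{..<m}. borel). \<forall>D\<in>DD. (\<Sum>i\<in>I D. x i) \<in> c D} x :: ennreal)"
    for x :: "nat \<Rightarrow> ennreal"
  have phi[measurable]: "\<phi> \<in> borel_measurable (\<Pi>\<^sub>M j\<in>{..<m}. borel)"
    unfolding \<phi>_def
  proof (intro borel_measurable_indicator sets.sets_Collect_finite_All DD(1))
    fix D assume D: "D \<in> DD"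
    have "(\<lambda>x. \<Sum>i\<in>I D. x i) \<in> borel_measurable (\<Pi>\<^sub>M j\<in>{..<m}. borel :: ennreal measure)"
      using I[OF D] by (intro borel_measurable_sum measurable_component_singleton) auto
    then show "{x \<in> space (\<Pi>\<^sub>M j\<in>{..<m}. borel). (\<Sum>i\<in>I D. x i) \<in> c D} \<in> sets (\<Pi>\<^sub>M j\<in>{..<m}. borel :: ennreal measure)"
      by (rule measurable_sets_Collect) (use DD(4)[OF D] in simp)
  qed
  have sum_I: "emeasure N D = (\<Sum>i\<in>I D. V N i)" if "N \<in> S" "D \<in> DD" for N D
  proof -
    have "emeasure N (\<Union>i\<in>I D. a i) = (\<Sum>i\<in>I D. emeasure N (a i))"
      using a sets_S[OF that(1)] fin_I[OF that(2)] disj by (intro sum_emeasure[symmetric]) auto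
    also have "\<dots> = (\<Sum>i\<in>I D. V N i)"
      using I[OF that(2)] by (intro sum.cong) (auto simp: V_def)
    finally show ?thesis using D[OF that(2)] by simp
  qed
  have ind: "indicator G N = \<phi> (V N)" if "N \<in> S" for N
    using that sum_I by (auto simp: G \<phi>_def indicator_def V_def space_PiM)
  have B0: "indicator B0 z = (\<Sum>i\<in>I B0. indicator (a i) z :: ennreal)" for z
    using indicator_UN_disjoint[OF fin_I[OF DD(3)] disj, of z] D[OF DD(3), symmetric] by simp
  have V_add: "V (add_point N z) = (V N)(i := V N i + 1)" if "N \<in> S" "i < m" "z \<in> a i" for N i z
  proof
    fix j
    have "indicator (a j) z = (if i = j then 1 else 0 :: ennreal)"
      using that a(1) by (auto simp: disjoint_family_on_def indicator_def)
    then show "V (add_point N z) j = ((V N)(i := V N i + 1)) j"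
      using that a sets_S by (auto simp: V_def emeasure_add_point)
  qed
  have "(\<integral>\<^sup>+N. emeasure N B0 * indicator G N \<partial>P) = (\<integral>\<^sup>+N. (\<Sum>i\<in>I B0. emeasure N (a i) * \<phi> (V N)) \<partial>P)"
  proof (rule nn_integral_cong)
    fix N assume "N \<in> space P"
    then show "emeasure N B0 * indicator G N = (\<Sum>i\<in>I B0. emeasure N (a i) * \<phi> (V N))"
      using I[OF DD(3)] sum_I[OF _ DD(3)] ind
      by (auto simp: sum_distrib_right V_def intro!: sum.cong)
  qed
  also have "\<dots> = (\<Sum>i\<in>I B0. \<integral>\<^sup>+N. emeasure N (a i) * \<phi> (V N) \<partial>P)"
    unfolding V_def by (rule nn_integral_sum) measurable
  also have "\<dots> = (\<Sum>i\<in>I B0. emeasure \<Lambda> (a i) * (\<integral>\<^sup>+N. \<phi> ((V N)(i := V N i + 1)) \<partial>P))"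
  proof (rule sum.cong[OF refl])
    fix i assume i: "i \<in> I B0"
    then have "i < m" using I[OF DD(3)] by auto
    have "emeasure \<Lambda> (a i) \<le> emeasure \<Lambda> B0"
      using D[OF DD(3)] i DD P by (intro emeasure_mono) auto
    then have "emeasure \<Lambda> (a i) < \<infinity>" using fin by (rule le_less_trans)
    from poisson_component[OF P a \<open>i < m\<close> this phi] \<open>i < m\<close>
    show "(\<integral>\<^sup>+N. emeasure N (a i) * \<phi> (V N) \<partial>P) = emeasure \<Lambda> (a i) * (\<integral>\<^sup>+N. \<phi> ((V N)(i := V N i + 1)) \<partial>P)"
      by (simp add: V_def)
  qed
  also have "\<dots> = (\<Sum>i\<in>I B0. \<integral>\<^sup>+z. indicator (a i) z * (\<integral>\<^sup>+N. \<phi> ((V N)(i := V N i + 1)) \<partial>P) \<partial>\<Lambda>)"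
    using a P by (simp add: nn_integral_multc)
  also have "\<dots> = (\<integral>\<^sup>+z. (\<Sum>i\<in>I B0. indicator (a i) z * (\<integral>\<^sup>+N. \<phi> ((V N)(i := V N i + 1)) \<partial>P)) \<partial>\<Lambda>)"
    by (rule nn_integral_sum[symmetric]) measurable
  also have "\<dots> = (\<integral>\<^sup>+z. indicator B0 z * (\<integral>\<^sup>+N. indicator G (add_point N z) \<partial>P) \<partial>\<Lambda>)"
  proof (rule nn_integral_cong)
    fix z assume "z \<in> space \<Lambda>"
    then have z: "z \<in> space E" using sets_eq_imp_space_eq[OF P(3)] by simp
    have "indicator (a i) z * (\<integral>\<^sup>+N. \<phi> ((V N)(i := V N i + 1)) \<partial>P) = indicator (a i) z * (\<integral>\<^sup>+N. indicator G (add_point N z) \<partial>P)"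
      if i: "i \<in> I B0" for i
    proof (cases "z \<in> a i")
      case True
      have "i < m" using I[OF DD(3)] i by auto
      then have "(\<integral>\<^sup>+N. \<phi> ((V N)(i := V N i + 1)) \<partial>P) = (\<integral>\<^sup>+N. indicator G (add_point N z) \<partial>P)"
        using V_add[OF _ _ True] z by (intro nn_integral_cong) (simp add: ind add_point_S)
      then show ?thesis by simp
    qed simp
    then show "(\<Sum>i\<in>I B0. indicator (a i) z * (\<integral>\<^sup>+N. \<phi> ((V N)(i := V N i + 1)) \<partial>P)) =
        indicator B0 z * (\<integral>\<^sup>+N. indicator G (add_point N z) \<partial>P)"
      by (simp add: B0 sum_distrib_right cong: sum.cong)
  qed
  finally show ?thesis .
qed

text \<open>Generators confined to a single \<open>B i\<close> have finite intensity, as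
  \<open>mecke_event\<close> demands.\<close>

lemma sigma_sets_local: "sets E = sigma_sets (space E) {A\<in>sets E. \<exists>i. A \<subseteq> B i}"
proof (rule antisym)
  show "sets E \<subseteq> sigma_sets (space E) {A\<in>sets E. \<exists>i. A \<subseteq> B i}"
  proof
    fix A assume A: "A \<in> sets E"
    have "(\<Union>i. A \<inter> B i) \<in> sigma_sets (space E) {A\<in>sets E. \<exists>i. A \<subseteq> B i}"
      using A cover by (intro sigma_sets.Union sigma_sets.Basic) blast
    moreover have "(\<Union>i. A \<inter> B i) = A"
      using sets.sets_into_space[OF A] cover(3) by auto
    ultimately show "A \<in> sigma_sets (space E) {A\<in>sets E. \<exists>i. A \<subseteq> B i}" by simp
  qed
  show "sigma_sets (space E) {A\<in>sets E. \<exists>i. A \<subseteq> B i} \<subseteq> sets E"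
    by (rule sets.sigma_sets_subset) auto
qed

text \<open>Both sides of Mecke's equation are integrals of \<open>F\<close> against a measure on
  pairs \<open>(z, N)\<close>. Two measures that agree on an intersection-stable generator, with an
  exhausting sequence of finite mass, coincide; boxes made of a subset of one \<open>B i\<close> and
  a count event form such a generator.\<close>

theorem poisson_law_imp_mecke:
  assumes P: "poisson_law P \<Lambda>" "sets P = sets PM" and \<Lambda>: "locally_finite \<Lambda>"
  shows "mecke P \<Lambda>"
proof -
  have L: "sets \<Lambda> = sets E" "\<And>i. emeasure \<Lambda> (B i) < \<infinity>"
    using \<Lambda> unfolding locally_finite_def by blast+
  note P(2)[measurable_cong] L(1)[measurable_cong]
  have [simp]: "space P = S" "space \<Lambda> = space E"
    using sets_eq_imp_space_eq[OF P(2)] sets_eq_imp_space_eq[OF L(1)] by simp_all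
  interpret prob_space P using P(1) by (simp add: poisson_law_def)
  interpret L: sigma_finite_measure \<Lambda> by (rule locally_finite_sigma_finite) fact
  \<comment> \<open>\<open>M1\<close> is the Campbell measure, under which \<open>z\<close> is a
    point of \<open>N\<close>; \<open>M2\<close> arises by adding to \<open>N\<close> a point
    \<open>z\<close> taken from the intensity independently of \<open>N\<close>.\<close>
  define M1 where "M1 = measure_of (space (E \<Otimes>\<^sub>M PM)) (sets (E \<Otimes>\<^sub>M PM))
    (\<lambda>A. \<integral>\<^sup>+N. \<integral>\<^sup>+z. 1 * indicator A (z, N) \<partial>N \<partial>P)"
  define M2 where "M2 = distr (\<Lambda> \<Otimes>\<^sub>M P) (E \<Otimes>\<^sub>M PM) (\<lambda>(z, N). (z, add_point N z))"
  have meas: "(\<lambda>N. \<integral>\<^sup>+z. 1 * f (z, N) \<partial>N) \<in> borel_measurable P" if [measurable]: "f \<in> borel_measurable (E \<Otimes>\<^sub>M PM)" for f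
    by (rule measurable_nn_integral_PM) measurable
  have meas_pair: "(\<lambda>z. (z, N)) \<in> measurable N (E \<Otimes>\<^sub>M PM)" if "N \<in> space P" for N
    using that sets_S[of N] by (simp add: measurable_cong_sets[OF sets_S refl])
  note mix = meas borel_measurable_const meas_pair M1_def
  have M1: "emeasure M1 A = (\<integral>\<^sup>+N. \<integral>\<^sup>+z. 1 * indicator A (z, N) \<partial>N \<partial>P)" if "A \<in> sets (E \<Otimes>\<^sub>M PM)" for A
    by (rule emeasure_mixture[OF mix that])
  have [measurable]: "(\<lambda>(z, N). (z, add_point N z)) \<in> measurable (\<Lambda> \<Otimes>\<^sub>M P) (E \<Otimes>\<^sub>M PM)"
    by measurable
  have M2: "(\<integral>\<^sup>+x. F x \<partial>M2) = (\<integral>\<^sup>+z. \<integral>\<^sup>+N. F (z, add_point N z) \<partial>P \<partial>\<Lambda>)"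
    if [measurable]: "F \<in> borel_measurable (E \<Otimes>\<^sub>M PM)" for F
    unfolding M2_def by (subst nn_integral_distr) (auto simp: nn_integral_fst[symmetric])
  let ?EE = "{A\<in>sets E. \<exists>i. A \<subseteq> B i}"
  let ?G = "{a \<times> b |a b. a \<in> ?EE \<and> b \<in> count_events}"
  have S_event: "S \<in> count_events"
    using count_eventsI[of "{}"] by simp
  have event_sets: "G \<in> sets PM" if "G \<in> count_events" for G
    using that unfolding sets_PM_count_events by auto
  have sets_pair: "sets (E \<Otimes>\<^sub>M PM) = sigma_sets (space E \<times> S) ?G"
  proof -
    have "sets (E \<Otimes>\<^sub>M PM) = sets (sigma (space E \<times> space PM) ?G)"
    proof (rule sets_pair_eq)
      show "?EE \<subseteq> Pow (space E)" by (auto dest: sets.sets_into_space)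
      show "count_events \<subseteq> Pow (space PM)" by (auto simp: count_events_def)
      show "sets E = sigma_sets (space E) ?EE" by (rule sigma_sets_local)
      show "range B \<subseteq> ?EE" "\<Union> (range B) = space E" using cover by auto
      show "{S} \<subseteq> count_events" using S_event by simp
    qed (simp_all add: sets_PM_count_events)
    also have "\<dots> = sigma_sets (space E \<times> S) ?G"
      by (simp, rule sets_measure_of) (auto simp: count_events_def dest: sets.sets_into_space)
    finally show ?thesis .
  qed
  have "M1 = M2"
  proof (rule measure_eqI_generator_eq[where \<Omega>="space E \<times> S" and E="?G" and A="\<lambda>i. B i \<times> S"])
    have "Int_stable ?EE" by (auto simp: Int_stable_def)
    then show "Int_stable ?G"
    proof (intro Int_stableI, safe)
      fix a b i a' b' i' assume *: "b \<in> count_events" "b' \<in> count_events" "a \<in> sets E" "a' \<in> sets E" "a \<subseteq> B i"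
      have "b \<inter> b' \<in> count_events" using Int_stable_count_events * by (auto simp: Int_stable_def)
      with * show "\<exists>c d. a \<times> b \<inter> a' \<times> b' = c \<times> d \<and> c \<in> ?EE \<and> d \<in> count_events"
        by (intro exI[of _ "a \<inter> a'"] exI[of _ "b \<inter> b'"]) auto
    qed
    show "?G \<subseteq> Pow (space E \<times> S)" by (auto simp: count_events_def dest: sets.sets_into_space)
    show "sets M1 = sigma_sets (space E \<times> S) ?G" "sets M2 = sigma_sets (space E \<times> S) ?G"
      unfolding sets_pair[symmetric] by (simp_all add: M1_def M2_def)
    show "range (\<lambda>i. B i \<times> S) \<subseteq> ?G" using cover S_event by blast
    show "(\<Union>i. B i \<times> S) = space E \<times> S" using cover by auto
    have box: "emeasure M1 (a \<times> b) = emeasure M2 (a \<times> b) \<and> (b = S \<longrightarrow> emeasure M1 (a \<times> b) < \<infinity>)"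
      if a: "a \<in> sets E" "a \<subseteq> B i" and b: "b \<in> count_events" for a b i
    proof -
      note a(1)[measurable] event_sets[OF b, measurable]
      obtain DD c where G: "b = {N\<in>S. \<forall>D\<in>DD. emeasure N D \<in> c D}" "finite DD" "DD \<subseteq> sets E"
          "\<And>D. D\<in>DD \<Longrightarrow> c D \<in> sets borel"
        using b unfolding count_events_def by blast
      \<comment> \<open>The set \<open>a\<close> joins those whose counts are observed, with the
        constraint \<open>UNIV\<close> unless it was constrained already.\<close>
      define c' where "c' D = (if D \<in> DD then c D else UNIV)" for D
      have G': "b = {N\<in>S. \<forall>D\<in>insert a DD. emeasure N D \<in> c' D}"
        unfolding G(1) c'_def by auto
      have fin: "emeasure \<Lambda> a < \<infinity>"
        using emeasure_mono[OF a(2), of \<Lambda>] L cover le_less_trans by blast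
      have "emeasure M1 (a \<times> b) = (\<integral>\<^sup>+N. \<integral>\<^sup>+z. indicator a z * indicator b N \<partial>N \<partial>P)"
        by (subst M1) (auto simp: indicator_times)
      also have "\<dots> = (\<integral>\<^sup>+N. emeasure N a * indicator b N \<partial>P)"
      proof (rule nn_integral_cong)
        fix N assume "N \<in> space P"
        then have "a \<in> sets N" using a sets_S[of N] by simp
        then show "(\<integral>\<^sup>+z. indicator a z * indicator b N \<partial>N) = emeasure N a * indicator b N"
          by (subst nn_integral_multc) auto
      qed
      also have "\<dots> = (\<integral>\<^sup>+z. indicator a z * (\<integral>\<^sup>+N. indicator b (add_point N z) \<partial>P) \<partial>\<Lambda>)"
        by (rule mecke_event[OF P L(1) _ _ _ _ fin G']) (use G a in \<open>auto simp: c'_def\<close>)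
      finally have *: "emeasure M1 (a \<times> b) = (\<integral>\<^sup>+z. indicator a z * (\<integral>\<^sup>+N. indicator b (add_point N z) \<partial>P) \<partial>\<Lambda>)" .
      have "emeasure M2 (a \<times> b) = (\<integral>\<^sup>+x. indicator (a \<times> b) x \<partial>M2)"
        by (simp add: M2_def)
      also have "\<dots> = (\<integral>\<^sup>+z. \<integral>\<^sup>+N. indicator a z * indicator b (add_point N z) \<partial>P \<partial>\<Lambda>)"
        by (subst M2) (auto simp: indicator_times)
      also have "\<dots> = (\<integral>\<^sup>+z. indicator a z * (\<integral>\<^sup>+N. indicator b (add_point N z) \<partial>P) \<partial>\<Lambda>)"
        by (intro nn_integral_cong nn_integral_cmult) measurable
      finally have "emeasure M1 (a \<times> b) = emeasure M2 (a \<times> b)" using * by simp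
      \<comment> \<open>Finiteness concerns the exhausting boxes, where the intensity of
        \<open>a\<close> is an upper bound.\<close>
      moreover have "emeasure M1 (a \<times> b) < \<infinity>" if "b = S"
      proof -
        have "emeasure M1 (a \<times> b) \<le> (\<integral>\<^sup>+z. indicator a z \<partial>\<Lambda>)"
          unfolding *
        proof (rule nn_integral_mono)
          fix z
          have "(\<integral>\<^sup>+N. indicator b (add_point N z) \<partial>P) \<le> (\<integral>\<^sup>+N. 1 \<partial>P)"
            by (intro nn_integral_mono) (simp add: indicator_def)
          also have "\<dots> = 1" using emeasure_space_1 by simp
          finally show "indicator a z * (\<integral>\<^sup>+N. indicator b (add_point N z) \<partial>P) \<le> indicator a z"
            by (simp add: indicator_def)
        qed
        also have "\<dots> < \<infinity>" using fin by simp
        finally show ?thesis .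
      qed
      ultimately show ?thesis by blast
    qed
    show "emeasure M1 X = emeasure M2 X" if "X \<in> ?G" for X
      using that box by blast
    show "emeasure M1 (B i \<times> S) \<noteq> \<infinity>" for i
      using box[OF cover(1) order_refl S_event, of i] by (auto simp: less_top)
  qed
  then have "(\<integral>\<^sup>+N. \<integral>\<^sup>+z. F (z, N) \<partial>N \<partial>P) = (\<integral>\<^sup>+z. \<integral>\<^sup>+N. F (z, add_point N z) \<partial>P \<partial>\<Lambda>)"
    if "F \<in> borel_measurable (E \<Otimes>\<^sub>M PM)" for F
    using nn_integral_mixture[OF mix that] M2[OF that] by simp
  then show ?thesis
    using P(2) \<Lambda> prob_space_axioms unfolding mecke_def by (intro conjI ballI) assumption+
qed

end

section \<open>Exponential tilting of Mecke's equation\<close>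

lemma exp_neg_ennreal: "0 \<le> x \<Longrightarrow> exp_neg (ennreal x) = ennreal (exp (- x))"
  by (simp add: exp_neg_def)

lemma exp_neg_0[simp]: "exp_neg 0 = 1"
  using exp_neg_ennreal[of 0] by simp

lemma exp_neg_top[simp]: "exp_neg \<top> = 0"
  by (simp add: exp_neg_def)

lemma exp_neg_le_1: "exp_neg a \<le> 1"
  by (simp add: exp_neg_def)

lemma exp_neg_add: "exp_neg (a + b) = exp_neg a * exp_neg b"
proof (cases "a = \<infinity> \<or> b = \<infinity>")
  case False
  then show ?thesis
    by (cases a; cases b) (auto simp: exp_neg_ennreal simp flip: ennreal_plus ennreal_mult exp_add)
qed (auto simp: exp_neg_def)

lemma exp_neg_antimono: "a \<le> b \<Longrightarrow> exp_neg b \<le> exp_neg a"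
  by (cases a; cases b) (auto simp: exp_neg_ennreal top_unique)

lemma measurable_exp_neg[measurable (raw)]:
  assumes "f \<in> borel_measurable M" shows "(\<lambda>x. exp_neg (f x)) \<in> borel_measurable M"
proof -
  have "exp_neg \<in> borel_measurable borel"
    unfolding exp_neg_def[abs_def] by (intro measurable_If) auto
  from measurable_compose[OF assms this] show ?thesis .
qed

text \<open>For a finite limit this is continuity of \<open>exp\<close>; if the values increase to
  infinity, \<open>exp_neg\<close> falls below every positive level.\<close>

lemma LIMSEQ_exp_neg:
  assumes x: "incseq x"
  shows "(\<lambda>k. exp_neg (x k)) \<longlonglongrightarrow> exp_neg (SUP k. x k)"
proof (cases "SUP k. x k")
  case (real s)
  have le: "x k \<le> ennreal s" for k
    using SUP_upper[of k UNIV x] real by simp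
  have x_fin: "x k \<noteq> \<infinity>" for k using le[of k] by (auto simp: top_unique)
  have "x \<longlonglongrightarrow> ennreal s" using LIMSEQ_SUP[OF x] real by simp
  then have "(\<lambda>k. enn2real (x k)) \<longlonglongrightarrow> s" by (rule tendsto_enn2real) (use real in auto)
  then have "(\<lambda>k. ennreal (exp (- enn2real (x k)))) \<longlonglongrightarrow> ennreal (exp (- s))"
    by (rule tendsto_ennrealI[OF tendsto_exp[OF tendsto_minus]])
  then show ?thesis using x_fin real by (simp add: exp_neg_def)
next
  case top
  have dec: "decseq (\<lambda>k. exp_neg (x k))"
    using x by (auto simp: decseq_def incseq_def intro: exp_neg_antimono)
  have "(INF k. exp_neg (x k)) \<le> 0"
  proof (rule ennreal_le_epsilon)
    fix e :: real assume e: "0 < e"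
    \<comment> \<open>\<open>exp_neg\<close> is at most \<open>e\<close> beyond the level
      \<open>- ln e\<close>; the maximum with 0 keeps the level in the range of
      \<open>exp_neg_ennreal\<close>.\<close>
    have "ennreal (max 0 (- ln e)) < (SUP k. x k)" unfolding top by simp
    then obtain k where "ennreal (max 0 (- ln e)) < x k" by (auto simp: less_SUP_iff)
    then have "exp_neg (x k) \<le> exp_neg (ennreal (max 0 (- ln e)))"
      by (intro exp_neg_antimono) simp
    also have "\<dots> = ennreal (exp (- max 0 (- ln e)))" by (rule exp_neg_ennreal) simp
    also have "\<dots> \<le> ennreal (exp (ln e))" by (intro ennreal_leI) auto
    finally have "exp_neg (x k) \<le> ennreal e" using e by simp
    then show "(INF k. exp_neg (x k)) \<le> 0 + ennreal e"
      by (intro INF_lower2[of k]) auto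
  qed
  then have "(INF k. exp_neg (x k)) = exp_neg (SUP k. x k)" unfolding top by simp
  with LIMSEQ_INF[OF dec] show ?thesis by simp
qed

lemma emeasure_normalized: "emeasure (normalized M) A = inverse (emeasure M (space M)) * emeasure M A"
  by (simp add: normalized_def)

lemma sets_normalized[simp, measurable_cong]: "sets (normalized M) = sets M"
  by (simp add: normalized_def)

lemma space_normalized[simp]: "space (normalized M) = space M"
  by (simp add: normalized_def space_scale_measure)

lemma nn_integral_normalized:
  "f \<in> borel_measurable M \<Longrightarrow> (\<integral>\<^sup>+x. f x \<partial>normalized M) = inverse (emeasure M (space M)) * (\<integral>\<^sup>+x. f x \<partial>M)"
  unfolding normalized_def by (rule nn_integral_scale_measure)

lemma prob_space_normalized:
  assumes "0 < emeasure M (space M)" "emeasure M (space M) < \<infinity>"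
  shows "prob_space (normalized M)"
proof
  show "emeasure (normalized M) (space (normalized M)) = 1"
    unfolding emeasure_normalized space_normalized using assms
    by (subst mult.commute) (simp add: divide_ennreal_def[symmetric])
qed

text \<open>A convergent series of naturals has only finitely many nonzero terms. This carries
  integrality of \<open>N\<close> from subsets of single sets \<open>B i\<close> to sets that meet
  infinitely many of them.\<close>

lemma suminf_Nats_ennreal:
  fixes f :: "nat \<Rightarrow> ennreal"
  assumes f: "\<And>i. f i \<in> \<nat>" and fin: "(\<Sum>i. f i) < \<infinity>"
  shows "(\<Sum>i. f i) \<in> \<nat>"
proof -
  have "\<exists>n. f i = of_nat n" for i using f[of i] by (auto elim: Nats_cases)
  then obtain n :: "nat \<Rightarrow> nat" where n: "\<And>i. f i = of_nat (n i)" by metis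
  then have f': "f i = ennreal (real (n i))" for i by (simp add: ennreal_of_nat_eq_real_of_nat)
  have "summable (\<lambda>i. real (n i))"
    using fin unfolding f' by (intro summable_suminf_not_top) auto
  then have "(\<lambda>i. real (n i)) \<longlonglongrightarrow> 0" by (rule summable_LIMSEQ_zero)
  then have "eventually (\<lambda>i. real (n i) < 1) sequentially" by (rule order_tendstoD) simp
  then obtain K where "\<And>i. K \<le> i \<Longrightarrow> n i = 0" by (auto simp: eventually_sequentially)
  then have "(\<Sum>i. f i) = (\<Sum>i<K. f i)"
    by (intro suminf_finite) (auto simp: n)
  also have "\<dots> = of_nat (\<Sum>i<K. n i)" by (simp add: n)
  finally show ?thesis by (simp del: of_nat_sum)
qed

context
  fixes p :: "nat \<Rightarrow> ennreal" and c :: real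
  assumes c: "0 \<le> c" and p: "\<And>j. of_nat (Suc j) * p (Suc j) = ennreal c * p j"
begin

text \<open>The recursion determines all weights up to the factor \<open>p 0\<close>, which the
  applications find from the total mass or from the configurations without points.\<close>

lemma poisson_recursion: "p j = ennreal (c ^ j / fact j) * p 0"
proof (induction j)
  case (Suc j)
  have "p (Suc j) = ennreal (1 / real (Suc j)) * of_nat (Suc j) * p (Suc j)"
    by (simp add: ennreal_of_nat_eq_real_of_nat ennreal_mult[symmetric] del: of_nat_Suc)
  also have "\<dots> = ennreal (1 / real (Suc j)) * (ennreal c * p j)"
    by (simp only: p mult.assoc)
  also have "\<dots> = (ennreal (1 / real (Suc j)) * (ennreal c * ennreal (c ^ j / fact j))) * p 0"
    unfolding Suc.IH by (simp only: mult.assoc)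
  also have "ennreal (1 / real (Suc j)) * (ennreal c * ennreal (c ^ j / fact j)) = ennreal (c ^ Suc j / fact (Suc j))"
    using c by (simp add: ennreal_mult[symmetric] fact_Suc del: of_nat_Suc)
  finally show ?case .
qed simp

lemma poisson_recursion_suminf: "(\<Sum>j. p j) = ennreal (exp c) * p 0"
proof -
  have "(\<lambda>j. c ^ j / fact j) sums exp c"
    using exp_converges[of c] by (simp add: divide_inverse mult.commute)
  then have "(\<Sum>j. ennreal (c ^ j / fact j)) = ennreal (exp c)"
    using c by (intro suminf_ennreal_eq) auto
  moreover have "(\<Sum>j. p j) = (\<Sum>j. ennreal (c ^ j / fact j) * p 0)"
    by (intro suminf_cong poisson_recursion)
  ultimately show ?thesis by simp
qed

end

context point_config begin

text \<open>The normalising constant passes unchanged through both sides of Mecke's equation. Its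
  finiteness follows from the weight being at most 1, so positivity alone has to be
  supposed.\<close>

lemma mecke_tilt:
  assumes P: "mecke P \<Lambda>" and f[measurable]: "f \<in> borel_measurable E"
    and pos: "0 < (\<integral>\<^sup>+N. exp_neg (\<integral>\<^sup>+z. f z \<partial>N) \<partial>P)"
  shows "mecke (normalized (density P (\<lambda>N. exp_neg (\<integral>\<^sup>+z. f z \<partial>N)))) (density \<Lambda> (\<lambda>z. exp_neg (f z)))"
proof -
  have sP[measurable_cong]: "sets P = sets PM" and L: "locally_finite \<Lambda>" and "prob_space P"
    and mecke: "\<And>F. F\<in>borel_measurable (E \<Otimes>\<^sub>M PM) \<Longrightarrow>
        (\<integral>\<^sup>+N. \<integral>\<^sup>+z. F (z, N) \<partial>N \<partial>P) = (\<integral>\<^sup>+z. \<integral>\<^sup>+N. F (z, add_point N z) \<partial>P \<partial>\<Lambda>)"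
    using P unfolding mecke_def by blast+
  have sL[measurable_cong]: "sets \<Lambda> = sets E" using L by (simp add: locally_finite_def)
  interpret prob_space P by fact
  have [simp]: "space P = S" "space \<Lambda> = space E"
    using sets_eq_imp_space_eq[OF sP] sets_eq_imp_space_eq[OF sL] by simp_all
  let ?e = "\<lambda>N. exp_neg (\<integral>\<^sup>+z. f z \<partial>N)"
  have [measurable]: "?e \<in> borel_measurable PM"
    by (intro measurable_exp_neg measurable_nn_integral_PM) measurable
  let ?c = "\<integral>\<^sup>+N. ?e N \<partial>P"
  let ?D = "density P ?e"
  have c: "emeasure ?D (space ?D) = ?c"
  proof -
    have "emeasure ?D (space P) = (\<integral>\<^sup>+N. ?e N * indicator (space P) N \<partial>P)"
      using sets.top[of P] by (intro emeasure_density) (simp_all add: measurable_cong_sets[OF sP refl])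
    also have "\<dots> = ?c" by (rule nn_integral_cong) simp
    finally show ?thesis by simp
  qed
  have "?c \<le> (\<integral>\<^sup>+N. 1 \<partial>P)" by (intro nn_integral_mono exp_neg_le_1)
  also have "\<dots> = 1" using emeasure_space_1 by simp
  finally have c1: "?c < \<infinity>" by (rule le_less_trans) simp
  show ?thesis
    unfolding mecke_def
  proof (intro conjI ballI)
    show "prob_space (normalized ?D)"
      using c c1 pos by (intro prob_space_normalized) simp_all
    show "sets (normalized ?D) = sets PM" by (simp add: sP)
    have "emeasure (density \<Lambda> (\<lambda>z. exp_neg (f z))) (B i) \<le> emeasure \<Lambda> (B i)" for i
    proof -
      have "emeasure (density \<Lambda> (\<lambda>z. exp_neg (f z))) (B i) = (\<integral>\<^sup>+z. exp_neg (f z) * indicator (B i) z \<partial>\<Lambda>)"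
        using cover(1) by (intro emeasure_density) (simp_all add: sL)
      also have "\<dots> \<le> (\<integral>\<^sup>+z. 1 * indicator (B i) z \<partial>\<Lambda>)"
        by (intro nn_integral_mono mult_right_mono exp_neg_le_1) simp
      finally have "emeasure (density \<Lambda> (\<lambda>z. exp_neg (f z))) (B i) \<le> (\<integral>\<^sup>+z. indicator (B i) z \<partial>\<Lambda>)" by simp
      then show ?thesis using cover(1) by simp
    qed
    then show "locally_finite (density \<Lambda> (\<lambda>z. exp_neg (f z)))"
      using L le_less_trans unfolding locally_finite_def by (metis sets_density)
  next
    fix F :: "'a \<times> 'a measure \<Rightarrow> ennreal"
    assume F[measurable]: "F \<in> borel_measurable (E \<Otimes>\<^sub>M PM)"
    have m1: "(\<lambda>N. \<integral>\<^sup>+z. F (z, N) \<partial>N) \<in> borel_measurable PM"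
      by (rule measurable_nn_integral_PM) measurable
    have "(\<integral>\<^sup>+N. \<integral>\<^sup>+z. F (z, N) \<partial>N \<partial>normalized ?D) = inverse ?c * (\<integral>\<^sup>+N. ?e N * (\<integral>\<^sup>+z. F (z, N) \<partial>N) \<partial>P)"
      using m1 by (subst nn_integral_normalized) (simp_all only: c, simp_all add: nn_integral_density)
    also have "(\<integral>\<^sup>+N. ?e N * (\<integral>\<^sup>+z. F (z, N) \<partial>N) \<partial>P) = (\<integral>\<^sup>+N. \<integral>\<^sup>+z. ?e N * F (z, N) \<partial>N \<partial>P)"
      by (intro nn_integral_cong nn_integral_cmult[symmetric]) (simp add: measurable_cong_sets[OF sets_S refl])
    also have "\<dots> = (\<integral>\<^sup>+z. \<integral>\<^sup>+N. ?e (add_point N z) * F (z, add_point N z) \<partial>P \<partial>\<Lambda>)"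
      using mecke[of "\<lambda>(z, N). ?e N * F (z, N)"] by simp
    also have "\<dots> = (\<integral>\<^sup>+z. exp_neg (f z) * (\<integral>\<^sup>+N. ?e N * F (z, add_point N z) \<partial>P) \<partial>\<Lambda>)"
    proof (rule nn_integral_cong)
      fix z assume "z \<in> space \<Lambda>"
      then have z[measurable]: "z \<in> space E" by simp
      \<comment> \<open>Valid also where one of the exponents is infinite, both sides then being
        0.\<close>
      have "?e (add_point N z) = exp_neg (f z) * ?e N" if "N \<in> S" for N
      proof -
        have "f \<in> borel_measurable N" by (simp add: f measurable_cong_sets[OF sets_S[OF that] refl])
        then show ?thesis using z space_S[OF that]
          by (subst nn_integral_add_point) (simp_all add: exp_neg_add mult.commute)
      qed
      then show "(\<integral>\<^sup>+N. ?e (add_point N z) * F (z, add_point N z) \<partial>P) = exp_neg (f z) * (\<integral>\<^sup>+N. ?e N * F (z, add_point N z) \<partial>P)"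
        by (subst nn_integral_cmult[symmetric]) (auto intro!: nn_integral_cong simp: mult.assoc)
    qed
    also have "inverse ?c * \<dots> = (\<integral>\<^sup>+z. exp_neg (f z) * (inverse ?c * (\<integral>\<^sup>+N. ?e N * F (z, add_point N z) \<partial>P)) \<partial>\<Lambda>)"
      by (subst nn_integral_cmult[symmetric]) (auto simp: ac_simps)
    also have "\<dots> = (\<integral>\<^sup>+z. \<integral>\<^sup>+N. F (z, add_point N z) \<partial>normalized ?D \<partial>density \<Lambda> (\<lambda>z. exp_neg (f z)))"
    proof -
      have "(\<integral>\<^sup>+N. F (z, add_point N z) \<partial>normalized ?D) = inverse ?c * (\<integral>\<^sup>+N. ?e N * F (z, add_point N z) \<partial>P)"
        if [measurable]: "z \<in> space E" for z
        by (subst nn_integral_normalized) (simp_all only: c, simp_all add: nn_integral_density)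
      then have "(\<integral>\<^sup>+z. \<integral>\<^sup>+N. F (z, add_point N z) \<partial>normalized ?D \<partial>density \<Lambda> (\<lambda>z. exp_neg (f z))) =
          (\<integral>\<^sup>+z. inverse ?c * (\<integral>\<^sup>+N. ?e N * F (z, add_point N z) \<partial>P) \<partial>density \<Lambda> (\<lambda>z. exp_neg (f z)))"
        by (intro nn_integral_cong) simp
      also have "\<dots> = (\<integral>\<^sup>+z. exp_neg (f z) * (inverse ?c * (\<integral>\<^sup>+N. ?e N * F (z, add_point N z) \<partial>P)) \<partial>\<Lambda>)"
        by (rule nn_integral_density) measurable
      finally show ?thesis by simp
    qed
    finally show "(\<integral>\<^sup>+N. \<integral>\<^sup>+z. F (z, N) \<partial>N \<partial>normalized ?D) =
        (\<integral>\<^sup>+z. \<integral>\<^sup>+N. F (z, add_point N z) \<partial>normalized ?D \<partial>density \<Lambda> (\<lambda>z. exp_neg (f z)))" .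
  qed
qed

end

locale mecke_law = point_config E S B for E :: "'a measure" and S B +
  fixes Q :: "'a measure measure" and \<Lambda> :: "'a measure"
  assumes mecke: "mecke Q \<Lambda>"
begin

lemma sets_Q[measurable_cong]: "sets Q = sets PM"
  and locally_finite_\<Lambda>: "locally_finite \<Lambda>"
  and mecke_eq: "F \<in> borel_measurable (E \<Otimes>\<^sub>M PM) \<Longrightarrow>
    (\<integral>\<^sup>+N. \<integral>\<^sup>+z. F (z, N) \<partial>N \<partial>Q) = (\<integral>\<^sup>+z. \<integral>\<^sup>+N. F (z, add_point N z) \<partial>Q \<partial>\<Lambda>)"
  using mecke unfolding mecke_def by blast+

sublocale prob_space Q
  using mecke by (simp add: mecke_def)

lemma sets_\<Lambda>[measurable_cong]: "sets \<Lambda> = sets E"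
  using locally_finite_\<Lambda> by (simp add: locally_finite_def)

lemma emeasure_\<Lambda>_B: "emeasure \<Lambda> (B i) < \<infinity>"
  using locally_finite_\<Lambda> unfolding locally_finite_def by blast

lemma space_Q[simp]: "space Q = S" and space_\<Lambda>[simp]: "space \<Lambda> = space E"
  using sets_eq_imp_space_eq[OF sets_Q] sets_eq_imp_space_eq[OF sets_\<Lambda>] by simp_all

sublocale \<Lambda>: sigma_finite_measure \<Lambda>
  by (rule locally_finite_sigma_finite[OF locally_finite_\<Lambda>])

text \<open>Campbell's formula, that is, Mecke's equation for an integrand that ignores
  \<open>N\<close>.\<close>

lemma nn_integral_intensity_measure:
  assumes [measurable]: "h \<in> borel_measurable E"
  shows "(\<integral>\<^sup>+N. \<integral>\<^sup>+z. h z \<partial>N \<partial>Q) = (\<integral>\<^sup>+z. h z \<partial>\<Lambda>)"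
  using mecke_eq[of "\<lambda>(z, N). h z"] emeasure_space_1 by simp

text \<open>\<open>A\<close> may meet infinitely many of the sets \<open>B i\<close>, so membership
  in \<open>S\<close> does not bound its count. By Campbell's formula the count has a finite mean,
  hence is almost surely finite, and then it is a convergent series of naturals.\<close>

lemma AE_count:
  assumes A: "A \<in> sets E" and fin: "emeasure \<Lambda> A < \<infinity>"
  shows "AE N in Q. emeasure N A \<in> \<nat>"
proof -
  have "(\<integral>\<^sup>+N. emeasure N A \<partial>Q) = (\<integral>\<^sup>+N. \<integral>\<^sup>+z. indicator A z \<partial>N \<partial>Q)"
    using A sets_S by (intro nn_integral_cong) simp
  also have "\<dots> = emeasure \<Lambda> A"
    using A by (subst nn_integral_intensity_measure) auto
  finally have "(\<integral>\<^sup>+N. emeasure N A \<partial>Q) \<noteq> \<infinity>" using fin by simp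
  then have "AE N in Q. emeasure N A \<noteq> \<infinity>"
    using A by (intro nn_integral_PInf_AE) auto
  then show ?thesis
  proof (rule AE_mp, intro AE_I2 impI)
    fix N assume N: "N \<in> space Q" and *: "emeasure N A \<noteq> \<infinity>"
    then have "N \<in> S" by simp
    have "(\<Union>i. A \<inter> B i) = A" using sets.sets_into_space[OF A] cover(3) by auto
    then have sum: "(\<Sum>i. emeasure N (A \<inter> B i)) = emeasure N A"
      using suminf_emeasure[of "\<lambda>i. A \<inter> B i" N] cover A sets_S[OF \<open>N \<in> S\<close>]
      by (auto simp: disjoint_family_on_def)
    have "emeasure N (A \<inter> B i) \<in> \<nat>" for i
      by (rule int_S[OF \<open>N \<in> S\<close>, of _ i]) (use A cover in auto)
    then have "(\<Sum>i. emeasure N (A \<inter> B i)) \<in> \<nat>"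
      using * by (intro suminf_Nats_ennreal) (simp_all add: sum less_top)
    then show "emeasure N A \<in> \<nat>" by (simp add: sum)
  qed
qed

end

section \<open>Mecke's equation characterises the Poisson process\<close>

context mecke_law begin

abbreviation count_ind :: "'a set \<Rightarrow> nat \<Rightarrow> 'a measure \<Rightarrow> ennreal" where
  "count_ind A j \<equiv> indicator {N\<in>S. emeasure N A = of_nat j}"

lemma measurable_count_ind[measurable]:
  assumes A: "A \<in> sets E" shows "count_ind A j \<in> borel_measurable PM"
proof -
  have "{N\<in>space PM. emeasure N A = of_nat j} \<in> sets PM"
    using A by measurable
  then show ?thesis by simp
qed

text \<open>Mecke's equation for \<open>F(z, N) = 1\<^sub>A(z) H(N) 1{N(A) = j + 1}\<close>; with \<open>H = 1\<close> this is the recursion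
  \<open>(j + 1) p\<^sub>j\<^sub>+\<^sub>1 = \<Lambda>(A) p\<^sub>j\<close> of the Poisson weights.\<close>

lemma count_recursion:
  assumes A[measurable]: "A \<in> sets E" and H[measurable]: "H \<in> borel_measurable PM"
  shows "of_nat (Suc j) * (\<integral>\<^sup>+N. H N * count_ind A (Suc j) N \<partial>Q) =
    (\<integral>\<^sup>+z. indicator A z * (\<integral>\<^sup>+N. H (add_point N z) * count_ind A j N \<partial>Q) \<partial>\<Lambda>)"
proof -
  have "of_nat (Suc j) * (\<integral>\<^sup>+N. H N * count_ind A (Suc j) N \<partial>Q) =
      (\<integral>\<^sup>+N. of_nat (Suc j) * (H N * count_ind A (Suc j) N) \<partial>Q)"
    by (rule nn_integral_cmult[symmetric]) measurable
  also have "\<dots> = (\<integral>\<^sup>+N. \<integral>\<^sup>+z. indicator A z * (H N * count_ind A (Suc j) N) \<partial>N \<partial>Q)"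
  proof (rule nn_integral_cong)
    fix N assume "N \<in> space Q"
    then have "A \<in> sets N" using sets_S by simp
    then have "(\<integral>\<^sup>+z. indicator A z * (H N * count_ind A (Suc j) N) \<partial>N) = emeasure N A * (H N * count_ind A (Suc j) N)"
      by (subst nn_integral_multc) auto
    then show "of_nat (Suc j) * (H N * count_ind A (Suc j) N) = (\<integral>\<^sup>+z. indicator A z * (H N * count_ind A (Suc j) N) \<partial>N)"
      by (auto simp: indicator_def)
  qed
  also have "\<dots> = (\<integral>\<^sup>+z. \<integral>\<^sup>+N. indicator A z * (H (add_point N z) * count_ind A (Suc j) (add_point N z)) \<partial>Q \<partial>\<Lambda>)"
  proof -
    have "(\<lambda>(z, N). indicator A z * (H N * count_ind A (Suc j) N)) \<in> borel_measurable (E \<Otimes>\<^sub>M PM)"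
      by measurable
    from mecke_eq[OF this] show ?thesis by (simp only: split_conv)
  qed
  also have "\<dots> = (\<integral>\<^sup>+z. indicator A z * (\<integral>\<^sup>+N. H (add_point N z) * count_ind A j N \<partial>Q) \<partial>\<Lambda>)"
  proof (rule nn_integral_cong)
    fix z assume "z \<in> space \<Lambda>"
    then have z[measurable]: "z \<in> space E" by simp
    \<comment> \<open>An added point of \<open>A\<close> turns the event of \<open>j + 1\<close>
      points into the event of \<open>j\<close> points.\<close>
    have eq: "x + 1 = of_nat (Suc j) \<longleftrightarrow> x = of_nat j" for x :: ennreal
      using ennreal_add_left_cancel[of 1 x "of_nat j"] by (simp add: add.commute)
    have "indicator A z * (H (add_point N z) * count_ind A (Suc j) (add_point N z)) =
        indicator A z * (H (add_point N z) * count_ind A j N)" if "N \<in> space Q" for N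
      using that z A eq[of "emeasure N A"] sets_S[of N] add_point_S[of N z]
      by (cases "z \<in> A") (auto simp: indicator_def emeasure_add_point)
    then have "(\<integral>\<^sup>+N. indicator A z * (H (add_point N z) * count_ind A (Suc j) (add_point N z)) \<partial>Q) =
        (\<integral>\<^sup>+N. indicator A z * (H (add_point N z) * count_ind A j N) \<partial>Q)"
      by (rule nn_integral_cong)
    also have "\<dots> = indicator A z * (\<integral>\<^sup>+N. H (add_point N z) * count_ind A j N \<partial>Q)"
      by (rule nn_integral_cmult) measurable
    finally show "(\<integral>\<^sup>+N. indicator A z * (H (add_point N z) * count_ind A (Suc j) (add_point N z)) \<partial>Q) =
        indicator A z * (\<integral>\<^sup>+N. H (add_point N z) * count_ind A j N \<partial>Q)" .
  qed
  finally show ?thesis .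
qed

text \<open>Almost surely exactly one of the count indicators equals 1.\<close>

lemma nn_integral_count:
  assumes A[measurable]: "A \<in> sets E" and fin: "emeasure \<Lambda> A < \<infinity>" and H[measurable]: "H \<in> borel_measurable PM"
  shows "(\<integral>\<^sup>+N. H N \<partial>Q) = (\<Sum>j. \<integral>\<^sup>+N. H N * count_ind A j N \<partial>Q)"
proof -
  have "(\<Sum>j. \<integral>\<^sup>+N. H N * count_ind A j N \<partial>Q) = (\<integral>\<^sup>+N. (\<Sum>j. H N * count_ind A j N) \<partial>Q)"
    by (rule nn_integral_suminf[symmetric]) measurable
  also have "\<dots> = (\<integral>\<^sup>+N. H N \<partial>Q)"
    using AE_count[OF A fin]
  proof (intro nn_integral_cong_AE, rule AE_mp, intro AE_I2 impI)
    fix N assume N: "N \<in> space Q" "emeasure N A \<in> \<nat>"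
    then obtain i where i: "emeasure N A = of_nat i" by (auto elim: Nats_cases)
    have "(\<Sum>j. H N * count_ind A j N) = (\<Sum>j\<in>{i}. H N * count_ind A j N)"
      by (rule suminf_finite) (auto simp: i)
    also have "\<dots> = H N" using N(1) by (simp add: i)
    finally show "(\<Sum>j. H N * count_ind A j N) = H N" .
  qed
  finally show ?thesis by simp
qed

context
  fixes A assumes A[measurable]: "A \<in> sets E" and fin: "emeasure \<Lambda> A < \<infinity>"
begin

lemma emeasure_A: "emeasure \<Lambda> A = ennreal (measure \<Lambda> A)"
  using fin by (simp add: emeasure_eq_ennreal_measure less_top)

text \<open>If \<open>\<Psi>\<close> does not see points of \<open>A\<close>, the recursion for its
  weighted count probabilities has the constant coefficient \<open>\<Lambda>(A)\<close>. So the
  count in \<open>A\<close> is Poisson and independent of \<open>\<Psi>\<close> at once;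
  \<open>\<Psi> = 1\<close> gives the bare Poisson law.\<close>

lemma count_law:
  assumes [measurable]: "\<Psi> \<in> borel_measurable PM"
    and inv: "\<And>N z. N \<in> S \<Longrightarrow> z \<in> A \<Longrightarrow> \<Psi> (add_point N z) = \<Psi> N"
  shows "(\<integral>\<^sup>+N. \<Psi> N * count_ind A j N \<partial>Q) =
    ennreal (measure \<Lambda> A ^ j / fact j * exp (- measure \<Lambda> A)) * (\<integral>\<^sup>+N. \<Psi> N \<partial>Q)"
proof -
  define p where "p j = (\<integral>\<^sup>+N. \<Psi> N * count_ind A j N \<partial>Q)" for j
  have rec: "of_nat (Suc j) * p (Suc j) = ennreal (measure \<Lambda> A) * p j" for j
  proof -
    have "of_nat (Suc j) * p (Suc j) = (\<integral>\<^sup>+z. indicator A z * (\<integral>\<^sup>+N. \<Psi> (add_point N z) * count_ind A j N \<partial>Q) \<partial>\<Lambda>)"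
      unfolding p_def by (rule count_recursion) measurable
    also have "\<dots> = (\<integral>\<^sup>+z. indicator A z * p j \<partial>\<Lambda>)"
    proof (rule nn_integral_cong)
      fix z
      have "(\<integral>\<^sup>+N. \<Psi> (add_point N z) * count_ind A j N \<partial>Q) = p j" if "z \<in> A"
        unfolding p_def using inv[OF _ that] by (intro nn_integral_cong) simp
      then show "indicator A z * (\<integral>\<^sup>+N. \<Psi> (add_point N z) * count_ind A j N \<partial>Q) = indicator A z * p j"
        by (simp add: indicator_def)
    qed
    also have "\<dots> = ennreal (measure \<Lambda> A) * p j"
      by (subst nn_integral_multc) (simp_all add: emeasure_A)
    finally show ?thesis .
  qed
  have "(\<integral>\<^sup>+N. \<Psi> N \<partial>Q) = (\<Sum>j. p j)"
    unfolding p_def by (rule nn_integral_count[OF A fin]) measurable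
  also have "\<dots> = ennreal (exp (measure \<Lambda> A)) * p 0"
    by (rule poisson_recursion_suminf[OF _ rec]) simp
  finally have "ennreal (exp (- measure \<Lambda> A)) * (\<integral>\<^sup>+N. \<Psi> N \<partial>Q) =
      (ennreal (exp (- measure \<Lambda> A)) * ennreal (exp (measure \<Lambda> A))) * p 0" by (simp only: mult.assoc)
  also have "ennreal (exp (- measure \<Lambda> A)) * ennreal (exp (measure \<Lambda> A)) = 1"
    by (simp flip: ennreal_mult exp_add)
  finally have p0: "p 0 = ennreal (exp (- measure \<Lambda> A)) * (\<integral>\<^sup>+N. \<Psi> N \<partial>Q)" by simp
  have "p j = ennreal (measure \<Lambda> A ^ j / fact j) * p 0"
    by (rule poisson_recursion[OF _ rec]) simp
  then show ?thesis
    unfolding p0 p_def[symmetric] by (simp add: mult.assoc[symmetric] flip: ennreal_mult)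
qed

text \<open>Induction on the number of points in \<open>A\<close>: \<open>count_recursion\<close> removes a point of \<open>A\<close>, which
  \<open>\<Psi>\<close> does not see.\<close>

lemma indep_inside_outside:
  assumes Phi: "\<Phi> \<in> borel_measurable PM"
    and det: "\<And>N N'. N \<in> S \<Longrightarrow> N' \<in> S \<Longrightarrow>
      (\<And>D. D \<in> sets E \<Longrightarrow> D \<subseteq> A \<Longrightarrow> emeasure N D = emeasure N' D) \<Longrightarrow> \<Phi> N = \<Phi> N'"
    and Psi[measurable]: "\<Psi> \<in> borel_measurable PM"
    and inv: "\<And>N z. N \<in> S \<Longrightarrow> z \<in> A \<Longrightarrow> \<Psi> (add_point N z) = \<Psi> N"
  shows "(\<integral>\<^sup>+N. \<Phi> N * \<Psi> N \<partial>Q) = (\<integral>\<^sup>+N. \<Phi> N \<partial>Q) * (\<integral>\<^sup>+N. \<Psi> N \<partial>Q)"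
proof -
  have one: "(\<integral>\<^sup>+N. \<Phi> N * \<Psi> N * count_ind A j N \<partial>Q) = (\<integral>\<^sup>+N. \<Phi> N * count_ind A j N \<partial>Q) * (\<integral>\<^sup>+N. \<Psi> N \<partial>Q)" for j
    using Phi det
  proof (induction j arbitrary: \<Phi>)
    case (0 \<Phi>)
    note [measurable] = 0(1)
    show ?case
    proof (cases "\<exists>N0\<in>S. emeasure N0 A = 0")
      case True
      then obtain N0 where N0: "N0 \<in> S" "emeasure N0 A = 0" by blast
      \<comment> \<open>Two configurations without points in \<open>A\<close> agree on all subsets
        of \<open>A\<close>, so \<open>\<Phi>\<close> takes a single value on this event.\<close>
      have const: "\<Phi> N = \<Phi> N0" if N: "N \<in> S" "emeasure N A = 0" for N
      proof (rule 0(2)[OF N(1) N0(1)])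
        fix D assume D: "D \<in> sets E" "D \<subseteq> A"
        have "emeasure N D \<le> emeasure N A" "emeasure N0 D \<le> emeasure N0 A"
          using D A sets_S[OF N(1)] sets_S[OF N0(1)] by (auto intro!: emeasure_mono)
        with N N0 show "emeasure N D = emeasure N0 D" by simp
      qed
      have "(\<integral>\<^sup>+N. \<Phi> N * \<Psi> N * count_ind A 0 N \<partial>Q) = (\<integral>\<^sup>+N. \<Phi> N0 * (\<Psi> N * count_ind A 0 N) \<partial>Q)"
        using const by (intro nn_integral_cong) (auto simp: indicator_def)
      also have "\<dots> = \<Phi> N0 * (\<integral>\<^sup>+N. \<Psi> N * count_ind A 0 N \<partial>Q)"
        by (rule nn_integral_cmult) measurable
      also have "\<dots> = \<Phi> N0 * (ennreal (exp (- measure \<Lambda> A)) * (\<integral>\<^sup>+N. \<Psi> N \<partial>Q))"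
        using count_law[of \<Psi> 0] inv by simp
      finally have 1: "(\<integral>\<^sup>+N. \<Phi> N * \<Psi> N * count_ind A 0 N \<partial>Q) = \<dots>" .
      have "(\<integral>\<^sup>+N. \<Phi> N * count_ind A 0 N \<partial>Q) = (\<integral>\<^sup>+N. \<Phi> N0 * (1 * count_ind A 0 N) \<partial>Q)"
        using const by (intro nn_integral_cong) (auto simp: indicator_def)
      also have "\<dots> = \<Phi> N0 * (\<integral>\<^sup>+N. 1 * count_ind A 0 N \<partial>Q)"
        by (rule nn_integral_cmult) measurable
      also have "\<dots> = \<Phi> N0 * ennreal (exp (- measure \<Lambda> A))"
        using count_law[of "\<lambda>_. 1" 0] emeasure_space_1 by simp
      finally show ?thesis using 1 by (simp add: mult.assoc)
    next
      case False
      then have "count_ind A 0 N = 0" for N by auto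
      then show ?thesis by simp
    qed
  next
    case (Suc j \<Phi>)
    note [measurable] = Suc(2)
    \<comment> \<open>Adding a fixed point preserves the property that the value depends on the
      configuration inside \<open>A\<close> only; for this the induction ranges over all such
      \<open>\<Phi>\<close>.\<close>
    have IH: "(\<integral>\<^sup>+N. \<Phi> (add_point N z) * \<Psi> N * count_ind A j N \<partial>Q) =
        (\<integral>\<^sup>+N. \<Phi> (add_point N z) * count_ind A j N \<partial>Q) * (\<integral>\<^sup>+N. \<Psi> N \<partial>Q)" if z[measurable]: "z \<in> space E" for z
    proof (rule Suc(1))
      show "(\<lambda>N. \<Phi> (add_point N z)) \<in> borel_measurable PM" by measurable
      fix N N' assume N: "N \<in> S" "N' \<in> S" "\<And>D. D \<in> sets E \<Longrightarrow> D \<subseteq> A \<Longrightarrow> emeasure N D = emeasure N' D"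
      then show "\<Phi> (add_point N z) = \<Phi> (add_point N' z)"
        using z by (intro Suc(3)) (auto simp: add_point_S emeasure_add_point sets_S)
    qed
    have "of_nat (Suc j) * (\<integral>\<^sup>+N. \<Phi> N * \<Psi> N * count_ind A (Suc j) N \<partial>Q) =
        (\<integral>\<^sup>+z. indicator A z * (\<integral>\<^sup>+N. \<Phi> (add_point N z) * \<Psi> (add_point N z) * count_ind A j N \<partial>Q) \<partial>\<Lambda>)"
      by (rule count_recursion) measurable
    also have "\<dots> = (\<integral>\<^sup>+z. indicator A z * (\<integral>\<^sup>+N. \<Phi> (add_point N z) * count_ind A j N \<partial>Q) * (\<integral>\<^sup>+N. \<Psi> N \<partial>Q) \<partial>\<Lambda>)"
    proof (rule nn_integral_cong)
      fix z assume "z \<in> space \<Lambda>"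
      then have z: "z \<in> space E" by simp
      have "(\<integral>\<^sup>+N. \<Phi> (add_point N z) * \<Psi> (add_point N z) * count_ind A j N \<partial>Q) =
          (\<integral>\<^sup>+N. \<Phi> (add_point N z) * \<Psi> N * count_ind A j N \<partial>Q)" if "z \<in> A"
        using inv[OF _ that] by (intro nn_integral_cong) simp
      with IH[OF z] show "indicator A z * (\<integral>\<^sup>+N. \<Phi> (add_point N z) * \<Psi> (add_point N z) * count_ind A j N \<partial>Q) =
          indicator A z * (\<integral>\<^sup>+N. \<Phi> (add_point N z) * count_ind A j N \<partial>Q) * (\<integral>\<^sup>+N. \<Psi> N \<partial>Q)"
        by (simp add: indicator_def)
    qed
    also have "\<dots> = (\<integral>\<^sup>+z. indicator A z * (\<integral>\<^sup>+N. \<Phi> (add_point N z) * count_ind A j N \<partial>Q) \<partial>\<Lambda>) * (\<integral>\<^sup>+N. \<Psi> N \<partial>Q)"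
      by (rule nn_integral_multc) measurable
    also have "(\<integral>\<^sup>+z. indicator A z * (\<integral>\<^sup>+N. \<Phi> (add_point N z) * count_ind A j N \<partial>Q) \<partial>\<Lambda>) =
        of_nat (Suc j) * (\<integral>\<^sup>+N. \<Phi> N * count_ind A (Suc j) N \<partial>Q)"
      by (rule count_recursion[symmetric]) measurable
    finally show ?case
      by (simp add: mult.assoc ennreal_mult_cancel_left del: of_nat_Suc)
  qed
  have [measurable]: "\<Phi> \<in> borel_measurable PM" by fact
  have "(\<integral>\<^sup>+N. \<Phi> N * \<Psi> N \<partial>Q) = (\<Sum>j. \<integral>\<^sup>+N. \<Phi> N * \<Psi> N * count_ind A j N \<partial>Q)"
    by (rule nn_integral_count[OF A fin]) measurable
  also have "\<dots> = (\<Sum>j. \<integral>\<^sup>+N. \<Phi> N * count_ind A j N \<partial>Q) * (\<integral>\<^sup>+N. \<Psi> N \<partial>Q)"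
    by (simp add: one)
  also have "(\<Sum>j. \<integral>\<^sup>+N. \<Phi> N * count_ind A j N \<partial>Q) = (\<integral>\<^sup>+N. \<Phi> N \<partial>Q)"
    by (rule nn_integral_count[OF A fin, symmetric]) measurable
  finally show ?thesis .
qed

text \<open>\<open>H N\<close> picks up the factor \<open>exp_neg (h z)\<close> when
  \<open>z\<close> is added, so its weighted count probabilities obey the Poisson recursion with
  coefficient \<open>c\<close>, the integral of \<open>exp_neg (h z)\<close> over \<open>A\<close>.
  Configurations without points in \<open>A\<close> contribute \<open>exp (- \<Lambda>(A))\<close>,
  and summation gives \<open>exp (c - \<Lambda>(A))\<close>.\<close>

lemma laplace_functional_finite:
  assumes h[measurable]: "h \<in> borel_measurable E" and supp: "\<And>z. z \<in> space E - A \<Longrightarrow> h z = 0"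
  shows "(\<integral>\<^sup>+N. exp_neg (\<integral>\<^sup>+z. h z \<partial>N) \<partial>Q) = exp_neg (\<integral>\<^sup>+z. 1 - exp_neg (h z) \<partial>\<Lambda>)"
proof -
  define H where "H N = exp_neg (\<integral>\<^sup>+z. h z \<partial>N)" for N
  have [measurable]: "H \<in> borel_measurable PM"
    unfolding H_def by (intro measurable_exp_neg measurable_nn_integral_PM) measurable
  define c where "c = (\<integral>\<^sup>+z. indicator A z * exp_neg (h z) \<partial>\<Lambda>)"
  have "c \<le> (\<integral>\<^sup>+z. indicator A z \<partial>\<Lambda>)"
    unfolding c_def by (intro nn_integral_mono) (auto simp: indicator_def exp_neg_le_1)
  then have c_le: "c \<le> ennreal (measure \<Lambda> A)" by (simp add: emeasure_A)
  then have c: "c = ennreal (enn2real c)"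
    by (cases c) (auto simp: top_unique)
  define p where "p j = (\<integral>\<^sup>+N. H N * count_ind A j N \<partial>Q)" for j
  have rec: "of_nat (Suc j) * p (Suc j) = ennreal (enn2real c) * p j" for j
  proof -
    have "of_nat (Suc j) * p (Suc j) = (\<integral>\<^sup>+z. indicator A z * (\<integral>\<^sup>+N. H (add_point N z) * count_ind A j N \<partial>Q) \<partial>\<Lambda>)"
      unfolding p_def by (rule count_recursion) measurable
    also have "\<dots> = (\<integral>\<^sup>+z. (indicator A z * exp_neg (h z)) * p j \<partial>\<Lambda>)"
    proof (rule nn_integral_cong)
      fix z assume "z \<in> space \<Lambda>"
      then have z: "z \<in> space E" by simp
      have "H (add_point N z) = exp_neg (h z) * H N" if "N \<in> S" for N
      proof -
        have "h \<in> borel_measurable N" by (simp add: h measurable_cong_sets[OF sets_S[OF that] refl])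
        then show ?thesis using z space_S[OF that]
          unfolding H_def by (subst nn_integral_add_point) (simp_all add: exp_neg_add mult.commute)
      qed
      then have "(\<integral>\<^sup>+N. H (add_point N z) * count_ind A j N \<partial>Q) = (\<integral>\<^sup>+N. exp_neg (h z) * (H N * count_ind A j N) \<partial>Q)"
        by (intro nn_integral_cong) (simp add: mult.assoc)
      also have "\<dots> = exp_neg (h z) * p j"
        unfolding p_def by (rule nn_integral_cmult) measurable
      finally show "indicator A z * (\<integral>\<^sup>+N. H (add_point N z) * count_ind A j N \<partial>Q) = (indicator A z * exp_neg (h z)) * p j"
        by (simp add: mult.assoc)
    qed
    also have "\<dots> = c * p j"
      unfolding c_def by (rule nn_integral_multc) measurable
    finally show ?thesis using c by simp
  qed
  have "p 0 = (\<integral>\<^sup>+N. 1 * count_ind A 0 N \<partial>Q)"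
    unfolding p_def
  proof (rule nn_integral_cong)
    fix N assume "N \<in> space Q"
    then have N: "N \<in> S" by simp
    have "(\<integral>\<^sup>+z. h z \<partial>N) = 0" if "emeasure N A = 0"
    proof -
      have "AE z in N. z \<notin> A"
        using that A sets_S[OF N] by (intro AE_I[of _ _ A]) auto
      then have "AE z in N. h z = 0" using supp space_S[OF N] by (auto intro: AE_mp)
      then show ?thesis
        by (subst nn_integral_cong_AE) auto
    qed
    then show "H N * count_ind A 0 N = 1 * count_ind A 0 N"
      by (auto simp: H_def indicator_def)
  qed
  also have "\<dots> = ennreal (exp (- measure \<Lambda> A))"
    using count_law[of "\<lambda>_. 1" 0] emeasure_space_1 by simp
  finally have p0: "p 0 = ennreal (exp (- measure \<Lambda> A))" .
  have "(\<integral>\<^sup>+N. H N \<partial>Q) = (\<Sum>j. p j)"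
    unfolding p_def by (rule nn_integral_count[OF A fin]) measurable
  also have "\<dots> = ennreal (exp (enn2real c)) * p 0"
    by (rule poisson_recursion_suminf[OF _ rec]) simp
  also have "\<dots> = ennreal (exp (- (measure \<Lambda> A - enn2real c)))"
    unfolding p0 by (simp flip: ennreal_mult exp_add)
  also have "\<dots> = exp_neg (ennreal (measure \<Lambda> A - enn2real c))"
    using c_le c by (subst exp_neg_ennreal) (auto, metis ennreal_le_iff measure_nonneg)
  also have "ennreal (measure \<Lambda> A - enn2real c) = ennreal (measure \<Lambda> A) - c"
    by (subst (2) c) (simp add: ennreal_minus)
  also have "\<dots> = (\<integral>\<^sup>+z. 1 - exp_neg (h z) \<partial>\<Lambda>)"
  proof -
    have "(\<integral>\<^sup>+z. 1 - exp_neg (h z) \<partial>\<Lambda>) = (\<integral>\<^sup>+z. indicator A z - indicator A z * exp_neg (h z) \<partial>\<Lambda>)"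
      using supp by (intro nn_integral_cong) (auto simp: indicator_def)
    also have "\<dots> = (\<integral>\<^sup>+z. indicator A z \<partial>\<Lambda>) - c"
      unfolding c_def
    proof (rule nn_integral_diff)
      show "(\<integral>\<^sup>+z. indicator A z * exp_neg (h z) \<partial>\<Lambda>) \<noteq> \<infinity>"
        using c_le by (auto simp: c_def[symmetric] top_unique)
    qed (auto simp: indicator_def exp_neg_le_1)
    finally show ?thesis by (simp add: emeasure_A)
  qed
  finally show ?thesis by (simp add: H_def)
qed

end

end

lemma (in prob_space) indep_vars_cong_space:
  assumes "\<And>i x. i \<in> I \<Longrightarrow> x \<in> space M \<Longrightarrow> X i x = Y i x"
  shows "indep_vars M' X I \<longleftrightarrow> indep_vars M' Y I"
proof -
  have "(\<forall>i\<in>I. random_variable (M' i) (X i)) \<longleftrightarrow> (\<forall>i\<in>I. random_variable (M' i) (Y i))"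
    using assms by (intro ball_cong refl measurable_cong) auto
  moreover have "X i -` A \<inter> space M = Y i -` A \<inter> space M" if "i \<in> I" for i A
    using assms[OF that] by auto
  then have "indep_sets (\<lambda>i. {X i -` A \<inter> space M |A. A \<in> sets (M' i)}) I \<longleftrightarrow>
      indep_sets (\<lambda>i. {Y i -` A \<inter> space M |A. A \<in> sets (M' i)}) I"
    by (intro indep_sets_cong) auto
  ultimately show ?thesis unfolding indep_vars_def2 by simp
qed

context mecke_law begin

text \<open>One index at a time is split off by \<open>indep_inside_outside\<close>: the integral
  over \<open>A i\<close> is determined by the configuration inside \<open>A i\<close>, and the
  other integrals do not notice a point added there.\<close>

lemma indep_integrals_finite:
  fixes A :: "'i \<Rightarrow> 'a set"
  assumes h[measurable]: "h \<in> borel_measurable E" and A[measurable]: "\<And>i. A i \<in> sets E"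
    and disj: "\<And>i j. i \<noteq> j \<Longrightarrow> A i \<inter> A j = {}" and fin: "\<And>i. emeasure \<Lambda> (A i) < \<infinity>"
  shows "indep_vars (\<lambda>_. borel) (\<lambda>i N. \<integral>\<^sup>+z. h z * indicator (A i) z \<partial>N) UNIV"
proof -
  define X where "X i N = (\<integral>\<^sup>+z. h z * indicator (A i) z \<partial>N)" for i N
  have X[measurable]: "X i \<in> borel_measurable PM" for i
    unfolding X_def by (intro measurable_nn_integral_PM) measurable
  have hN: "(\<lambda>z. h z * indicator (A i) z) \<in> borel_measurable N" if "N \<in> S" for N i
    unfolding measurable_cong_sets[OF sets_S[OF that] refl] by measurable
  have inv: "X j (add_point N z) = X j N" if "N \<in> S" "z \<in> A i" "j \<noteq> i" for i j N z
  proof -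
    have "z \<in> space N" "z \<notin> A j"
      using that disj[of i j] sets.sets_into_space[OF A[of i]] space_S[OF that(1)] by auto
    then show ?thesis unfolding X_def
      by (subst nn_integral_add_point[OF _ hN[OF that(1)]]) auto
  qed
  have det: "X i N = X i N'" if N: "N \<in> S" "N' \<in> S" and
    eq: "\<And>D. D \<in> sets E \<Longrightarrow> D \<subseteq> A i \<Longrightarrow> emeasure N D = emeasure N' D" for i N N'
  proof -
    \<comment> \<open>The restriction of \<open>N\<close> to \<open>A i\<close>, written as a
      density, is determined by the values of \<open>N\<close> on subsets of \<open>A i\<close>, and
      it carries the integral.\<close>
    have restr: "emeasure (density N (indicator (A i))) D = emeasure N (A i \<inter> D)" if "N \<in> S" "D \<in> sets E" for N D
      using that A[of i] sets_S[OF that(1)]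
      by (subst emeasure_density) (auto simp: indicator_inter_arith[symmetric] intro!: borel_measurable_indicator)
    have "density N (indicator (A i)) = density N' (indicator (A i))"
    proof (rule measure_eqI)
      fix D assume "D \<in> sets (density N (indicator (A i)))"
      then have D: "D \<in> sets E" using sets_S[OF N(1)] by simp
      show "emeasure (density N (indicator (A i))) D = emeasure (density N' (indicator (A i))) D"
        using restr[OF N(1) D] restr[OF N(2) D] eq[of "A i \<inter> D"] D A[of i] by auto
    qed (simp add: sets_S[OF N(1)] sets_S[OF N(2)])
    moreover have "X i N = (\<integral>\<^sup>+z. h z \<partial>density N (indicator (A i)))" if "N \<in> S" for N
    proof -
      have "h \<in> borel_measurable N" "indicator (A i) \<in> borel_measurable N"
        by (simp_all add: h A measurable_cong_sets[OF sets_S[OF that] refl])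
      then show ?thesis unfolding X_def by (subst nn_integral_density) (simp_all add: mult.commute)
    qed
    ultimately show ?thesis using N by simp
  qed
  have prod: "emeasure Q {N\<in>S. \<forall>i\<in>J. X i N \<in> C i} = (\<Prod>i\<in>J. emeasure Q {N\<in>S. X i N \<in> C i})"
    if "finite J" "\<And>i. i \<in> J \<Longrightarrow> C i \<in> sets borel" for J C
    using that
  proof (induction J)
    case empty
    then show ?case using emeasure_space_1 by simp
  next
    case (insert i J)
    let ?P = "{N\<in>S. X i N \<in> C i}" and ?R = "{N\<in>S. \<forall>i\<in>J. X i N \<in> C i}"
    have [measurable]: "C j \<in> sets borel" if "j \<in> insert i J" for j using insert.prems that by auto
    have "{N\<in>space PM. X i N \<in> C i} \<in> sets PM"
      by (rule measurable_sets_Collect[OF X]) (use insert.prems in simp)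
    then have P[measurable]: "?P \<in> sets PM" by simp
    have "{N\<in>space PM. \<forall>i\<in>J. X i N \<in> C i} \<in> sets PM"
      using insert.hyps insert.prems
      by (intro sets.sets_Collect_finite_All measurable_sets_Collect[OF X]) auto
    then have R[measurable]: "?R \<in> sets PM" by simp
    have "emeasure Q {N\<in>S. \<forall>i\<in>insert i J. X i N \<in> C i} = (\<integral>\<^sup>+N. indicator (?P \<inter> ?R) N \<partial>Q)"
    proof -
      have "?P \<inter> ?R \<in> sets Q" using P R sets_Q by auto
      moreover have "{N\<in>S. \<forall>i\<in>insert i J. X i N \<in> C i} = ?P \<inter> ?R" by auto
      ultimately show ?thesis by simp
    qed
    also have "\<dots> = (\<integral>\<^sup>+N. indicator ?P N * indicator ?R N \<partial>Q)"
      by (simp add: indicator_inter_arith)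
    also have "\<dots> = (\<integral>\<^sup>+N. indicator ?P N \<partial>Q) * (\<integral>\<^sup>+N. indicator ?R N \<partial>Q)"
    proof (rule indep_inside_outside[OF A fin])
      fix N N' assume "N \<in> S" "N' \<in> S" "\<And>D. D \<in> sets E \<Longrightarrow> D \<subseteq> A i \<Longrightarrow> emeasure N D = emeasure N' D"
      then show "indicator ?P N = (indicator ?P N' :: ennreal)"
        using det[of N N' i] by (auto simp: indicator_def)
    next
      fix N z assume N: "N \<in> S" "z \<in> A i"
      then have "add_point N z \<in> S"
        using sets.sets_into_space[OF A[of i]] by (auto intro: add_point_S)
      moreover have "X j (add_point N z) = X j N" if "j \<in> J" for j
        by (rule inv[OF N]) (use that insert.hyps in auto)
      ultimately show "indicator ?R (add_point N z) = (indicator ?R N :: ennreal)"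
        using N by (auto simp: indicator_def)
    qed measurable
    also have "\<dots> = emeasure Q ?P * emeasure Q ?R"
      using P R sets_Q by simp
    finally show ?case using insert by simp
  qed
  have "indep_vars (\<lambda>_. borel) X UNIV"
    unfolding indep_vars_def2
  proof (intro conjI ballI indep_setsI)
    show "X i \<in> borel_measurable Q" for i by measurable
    then show "{X i -` A \<inter> space Q |A. A \<in> sets borel} \<subseteq> events" for i
      by (blast intro: measurable_sets)
    fix a and J :: "'i set"
    assume J: "J \<noteq> {}" "finite J" "\<forall>j\<in>J. a j \<in> {X j -` A \<inter> space Q |A. A \<in> sets borel}"
    then have "\<forall>j\<in>J. \<exists>C. C \<in> sets borel \<and> a j = X j -` C \<inter> space Q" by blast
    then obtain C where C: "\<And>j. j \<in> J \<Longrightarrow> C j \<in> sets borel" "\<And>j. j \<in> J \<Longrightarrow> a j = X j -` C j \<inter> space Q"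
      by metis
    have "(\<Inter>j\<in>J. a j) = {N\<in>S. \<forall>i\<in>J. X i N \<in> C i}"
      using C(2) J(1) by auto
    moreover have "a j = {N\<in>S. X j N \<in> C j}" if "j \<in> J" for j using C(2)[OF that] by auto
    ultimately have "ennreal (prob (\<Inter>j\<in>J. a j)) = ennreal (\<Prod>j\<in>J. prob (a j))"
      using prod[OF J(2) C(1)] by (simp add: emeasure_eq_measure prod_ennreal)
    then show "prob (\<Inter>j\<in>J. a j) = (\<Prod>j\<in>J. prob (a j))"
      by (simp add: prod_nonneg)
  qed
  then show ?thesis by (simp add: X_def[abs_def])
qed

text \<open>The sets may have infinite intensity, but the pieces \<open>A i \<inter> B k\<close>
  have not. Independence of the doubly indexed family is inherited by the sums over
  \<open>k\<close>, which recover the integrals over \<open>A i\<close>.\<close>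

lemma indep_integrals:
  fixes A :: "nat \<Rightarrow> 'a set"
  assumes h[measurable]: "h \<in> borel_measurable E" and A[measurable]: "\<And>i. A i \<in> sets E" and disj: "disjoint_family A"
  shows "indep_vars (\<lambda>_. borel) (\<lambda>i N. \<integral>\<^sup>+z. h z * indicator (A i) z \<partial>N) UNIV"
proof -
  note cover(1)[measurable]
  define X where "X p N = (\<integral>\<^sup>+z. h z * indicator (case p of (i, k) \<Rightarrow> A i \<inter> B k) z \<partial>N)" for p :: "nat \<times> nat" and N
  have "indep_vars (\<lambda>_. borel) X UNIV"
    unfolding X_def
  proof (rule indep_integrals_finite)
    show "(case p of (i, k) \<Rightarrow> A i \<inter> B k) \<in> sets E" for p by (cases p) auto
    show "(case p of (i, k) \<Rightarrow> A i \<inter> B k) \<inter> (case q of (i, k) \<Rightarrow> A i \<inter> B k) = {}" if "p \<noteq> q" for p q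
    proof -
      obtain i k i' k' where pq: "p = (i, k)" "q = (i', k')" by (cases p; cases q)
      then have "i \<noteq> i' \<or> k \<noteq> k'" using that by auto
      then have "A i \<inter> A i' = {} \<or> B k \<inter> B k' = {}"
        using disj cover(2) unfolding disjoint_family_on_def by blast
      then show ?thesis unfolding pq by auto
    qed
    show "emeasure \<Lambda> (case p of (i, k) \<Rightarrow> A i \<inter> B k) < \<infinity>" for p
    proof (cases p)
      case (Pair i k)
      have "emeasure \<Lambda> (A i \<inter> B k) \<le> emeasure \<Lambda> (B k)"
        by (intro emeasure_mono) (auto simp: sets_\<Lambda>)
      with Pair emeasure_\<Lambda>_B[of k] show ?thesis by (auto intro: le_less_trans)
    qed
  qed measurable
  then have "indep_vars (\<lambda>i. PiM ({i} \<times> UNIV) (\<lambda>_. borel)) (\<lambda>i N. restrict (\<lambda>p. X p N) ({i} \<times> UNIV)) UNIV"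
    by (rule indep_vars_restrict) (auto simp: disjoint_family_on_def)
  then have "indep_vars (\<lambda>_. borel) (\<lambda>i N. (\<Sum>k. restrict (\<lambda>p. X p N) ({i} \<times> UNIV) (i, k))) UNIV"
    by (rule indep_vars_compose2[where Y="\<lambda>i v. \<Sum>k. v (i, k)"]) measurable
  moreover have "(\<Sum>k. restrict (\<lambda>p. X p N) ({i} \<times> UNIV) (i, k)) = (\<integral>\<^sup>+z. h z * indicator (A i) z \<partial>N)"
    if "N \<in> space Q" for i N
  proof -
    have N: "N \<in> S" using that by simp
    note sets_S[OF N, measurable_cong]
    have "(\<Sum>k. restrict (\<lambda>p. X p N) ({i} \<times> UNIV) (i, k)) = (\<Sum>k. \<integral>\<^sup>+z. h z * indicator (A i \<inter> B k) z \<partial>N)"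
      by (simp add: X_def)
    also have "\<dots> = (\<integral>\<^sup>+z. h z * indicator (\<Union>k. A i \<inter> B k) z \<partial>N)"
      using cover(2) by (intro nn_integral_disjoint_family[symmetric])
        (measurable, auto simp: disjoint_family_on_def)
    also have "(\<Union>k. A i \<inter> B k) = A i"
      using sets.sets_into_space[OF A[of i]] cover(3) by auto
    finally show ?thesis .
  qed
  ultimately show ?thesis
    by (subst (asm) indep_vars_cong_space[where Y="\<lambda>i N. \<integral>\<^sup>+z. h z * indicator (A i) z \<partial>N"]) simp_all
qed

lemma poisson_law: "poisson_law Q \<Lambda>"
  unfolding poisson_law_def
proof (intro conjI ballI allI impI)
  fix A j assume A: "A \<in> sets \<Lambda>" "emeasure \<Lambda> A < \<infinity>"
  then have A': "A \<in> sets E" by (simp add: sets_\<Lambda>)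
  have "{N\<in>space PM. emeasure N A = of_nat j} \<in> sets PM" using A' by measurable
  then have "emeasure Q {N\<in>space Q. emeasure N A = of_nat j} = (\<integral>\<^sup>+N. 1 * count_ind A j N \<partial>Q)"
    by (simp add: sets_Q)
  also have "\<dots> = ennreal (measure \<Lambda> A ^ j / fact j * exp (- measure \<Lambda> A))"
    using count_law[OF A' A(2), of "\<lambda>_. 1" j] emeasure_space_1 by simp
  finally show "emeasure Q {N\<in>space Q. emeasure N A = of_nat j} = ennreal (measure \<Lambda> A ^ j / fact j * exp (- measure \<Lambda> A))" .
next
  fix A :: "nat \<Rightarrow> 'a set" assume A: "range A \<subseteq> sets \<Lambda>" "disjoint_family A"
  then have A': "A i \<in> sets E" for i using sets_\<Lambda> by auto
  have "indep_vars (\<lambda>_. borel) (\<lambda>i N. \<integral>\<^sup>+z. 1 * indicator (A i) z \<partial>N) UNIV"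
    by (rule indep_integrals[OF _ A' A(2)]) simp
  then show "indep_vars (\<lambda>_. borel) (\<lambda>i N. emeasure N (A i)) UNIV"
    by (subst (asm) indep_vars_cong_space[where Y="\<lambda>i N. emeasure N (A i)"])
      (simp_all add: A' sets_S)
qed (rule prob_space_axioms)

text \<open>Exhaustion by the sets \<open>C k\<close> of finite intensity. The left side converges
  because its integrands are dominated by 1, the right side by monotone convergence and continuity
  of \<open>exp_neg\<close> along increasing sequences.\<close>

lemma laplace_functional:
  assumes h[measurable]: "h \<in> borel_measurable E"
  shows "(\<integral>\<^sup>+N. exp_neg (\<integral>\<^sup>+z. h z \<partial>N) \<partial>Q) = exp_neg (\<integral>\<^sup>+z. 1 - exp_neg (h z) \<partial>\<Lambda>)"
proof -
  note cover(1)[measurable]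
  define C where "C k = (\<Union>i<k. B i)" for k
  have C[measurable]: "C k \<in> sets E" for k unfolding C_def by measurable
  have C_mono: "incseq C" unfolding C_def incseq_def by (intro allI impI UN_mono) auto
  have C_fin: "emeasure \<Lambda> (C k) < \<infinity>" for k
  proof -
    have "emeasure \<Lambda> (C k) \<le> (\<Sum>i<k. emeasure \<Lambda> (B i))"
      unfolding C_def by (rule emeasure_subadditive_finite) (auto simp: sets_\<Lambda>)
    also have "\<dots> < \<infinity>" using emeasure_\<Lambda>_B by simp
    finally show ?thesis .
  qed
  have SUP: "(SUP k. c * indicator (C k) z) = (c :: ennreal)" if "z \<in> space E" for c z
  proof (rule antisym)
    show "(SUP k. c * indicator (C k) z) \<le> c" by (auto simp: indicator_def intro!: SUP_least)
    have "z \<in> (\<Union>i. B i)" using that cover(3) by simp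
    then obtain i where "z \<in> B i" by blast
    then have "z \<in> C (Suc i)" by (auto simp: C_def)
    then show "c \<le> (SUP k. c * indicator (C k) z)" by (intro SUP_upper2[of "Suc i"]) auto
  qed
  have inc: "incseq (\<lambda>k z. f z * indicator (C k) z)" for f :: "'a \<Rightarrow> ennreal"
    using C_mono by (auto simp: incseq_def le_fun_def indicator_def)
  have MC: "(SUP k. \<integral>\<^sup>+z. f z * indicator (C k) z \<partial>M) = (\<integral>\<^sup>+z. f z \<partial>M)"
    if M: "sets M = sets E" and f: "f \<in> borel_measurable E" for f M
  proof -
    have "(\<lambda>z. f z * indicator (C k) z) \<in> borel_measurable M" for k
      unfolding measurable_cong_sets[OF M refl] using f by measurable
    then have "(SUP k. \<integral>\<^sup>+z. f z * indicator (C k) z \<partial>M) = (\<integral>\<^sup>+z. (SUP k. f z * indicator (C k) z) \<partial>M)"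
      by (intro nn_integral_monotone_convergence_SUP[symmetric] inc)
    also have "\<dots> = (\<integral>\<^sup>+z. f z \<partial>M)"
      by (intro nn_integral_cong SUP) (simp add: sets_eq_imp_space_eq[OF M])
    finally show ?thesis .
  qed
  have inc': "incseq (\<lambda>k. \<integral>\<^sup>+z. f z * indicator (C k) z \<partial>M)" for f and M :: "'a measure"
    using inc[of f] by (auto simp: incseq_def le_fun_def intro!: nn_integral_mono)
  have "(\<lambda>k. \<integral>\<^sup>+N. exp_neg (\<integral>\<^sup>+z. h z * indicator (C k) z \<partial>N) \<partial>Q) \<longlonglongrightarrow> (\<integral>\<^sup>+N. exp_neg (\<integral>\<^sup>+z. h z \<partial>N) \<partial>Q)"
  proof (rule nn_integral_dominated_convergence[where w="\<lambda>_. 1"])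
    show "(\<lambda>N. exp_neg (\<integral>\<^sup>+z. h z * indicator (C k) z \<partial>N)) \<in> borel_measurable Q" for k
      unfolding measurable_cong_sets[OF sets_Q refl]
      by (intro measurable_exp_neg measurable_nn_integral_PM) measurable
    show "(\<lambda>N. exp_neg (\<integral>\<^sup>+z. h z \<partial>N)) \<in> borel_measurable Q"
      unfolding measurable_cong_sets[OF sets_Q refl]
      by (intro measurable_exp_neg measurable_nn_integral_PM) measurable
    show "AE N in Q. (\<lambda>k. exp_neg (\<integral>\<^sup>+z. h z * indicator (C k) z \<partial>N)) \<longlonglongrightarrow> exp_neg (\<integral>\<^sup>+z. h z \<partial>N)"
    proof (rule AE_I2)
      fix N assume "N \<in> space Q"
      then have "sets N = sets E" using sets_S by simp
      from MC[OF this h] LIMSEQ_exp_neg[OF inc'[of N h]]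
      show "(\<lambda>k. exp_neg (\<integral>\<^sup>+z. h z * indicator (C k) z \<partial>N)) \<longlonglongrightarrow> exp_neg (\<integral>\<^sup>+z. h z \<partial>N)" by simp
    qed
  qed (use emeasure_space_1 in \<open>auto simp: exp_neg_le_1\<close>)
  moreover have "(\<integral>\<^sup>+N. exp_neg (\<integral>\<^sup>+z. h z * indicator (C k) z \<partial>N) \<partial>Q) =
      exp_neg (\<integral>\<^sup>+z. (1 - exp_neg (h z)) * indicator (C k) z \<partial>\<Lambda>)" for k
  proof -
    have "(\<integral>\<^sup>+N. exp_neg (\<integral>\<^sup>+z. h z * indicator (C k) z \<partial>N) \<partial>Q) =
        exp_neg (\<integral>\<^sup>+z. 1 - exp_neg (h z * indicator (C k) z) \<partial>\<Lambda>)"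
      by (rule laplace_functional_finite[where A="C k", OF C C_fin]) auto
    also have "(\<integral>\<^sup>+z. 1 - exp_neg (h z * indicator (C k) z) \<partial>\<Lambda>) =
        (\<integral>\<^sup>+z. (1 - exp_neg (h z)) * indicator (C k) z \<partial>\<Lambda>)"
      by (intro nn_integral_cong) (simp add: indicator_def)
    finally show ?thesis .
  qed
  moreover have "(\<lambda>k. exp_neg (\<integral>\<^sup>+z. (1 - exp_neg (h z)) * indicator (C k) z \<partial>\<Lambda>)) \<longlonglongrightarrow>
      exp_neg (\<integral>\<^sup>+z. 1 - exp_neg (h z) \<partial>\<Lambda>)"
    using LIMSEQ_exp_neg[OF inc'[of \<Lambda> "\<lambda>z. 1 - exp_neg (h z)"]] MC[OF sets_\<Lambda>, of "\<lambda>z. 1 - exp_neg (h z)"] by simp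
  ultimately show ?thesis
    using LIMSEQ_unique by fastforce
qed

text \<open>Where \<open>h < 1\<close>, the integral has a finite mean by Campbell's formula. The
  complement \<open>D 0\<close> has finite intensity, hence almost surely finitely many points, but
  \<open>h\<close> may be unbounded on it. The counts of the decreasing sets \<open>D r\<close> are
  integers tending to 0, so some \<open>D r\<close> contains no point, and \<open>Suc r\<close>
  bounds \<open>h\<close> on the points present.\<close>

lemma AE_finite_integral:
  assumes h[measurable]: "h \<in> borel_measurable E" and h_fin: "\<And>z. z \<in> space E \<Longrightarrow> h z < \<infinity>"
    and fin: "(\<integral>\<^sup>+z. min (h z) 1 \<partial>\<Lambda>) < \<infinity>"
  shows "AE N in Q. (\<integral>\<^sup>+z. h z \<partial>N) < \<infinity>"
proof -
  define D where "D r = {z\<in>space E. of_nat (Suc r) \<le> h z}" for r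
  have D[measurable]: "D r \<in> sets E" for r unfolding D_def by measurable
  have D_dec: "decseq D"
    unfolding D_def decseq_def by (auto intro: order_trans[rotated])
  have D0_fin: "emeasure \<Lambda> (D 0) < \<infinity>"
  proof -
    have "emeasure \<Lambda> (D 0) = (\<integral>\<^sup>+z. indicator (D 0) z \<partial>\<Lambda>)" by simp
    also have "\<dots> \<le> (\<integral>\<^sup>+z. min (h z) 1 \<partial>\<Lambda>)"
      by (intro nn_integral_mono) (auto simp: D_def indicator_def)
    finally show ?thesis using fin by (rule le_less_trans)
  qed
  have D_fin: "emeasure \<Lambda> (D r) < \<infinity>" for r
    using emeasure_mono[of "D r" "D 0" \<Lambda>] D_dec D0_fin by (auto simp: decseq_def sets_\<Lambda> intro: le_less_trans)
  have "(\<integral>\<^sup>+N. \<integral>\<^sup>+z. h z * indicator (space E - D 0) z \<partial>N \<partial>Q) = (\<integral>\<^sup>+z. h z * indicator (space E - D 0) z \<partial>\<Lambda>)"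
    by (rule nn_integral_intensity_measure) measurable
  also have "\<dots> \<le> (\<integral>\<^sup>+z. min (h z) 1 \<partial>\<Lambda>)"
    by (intro nn_integral_mono) (auto simp: D_def indicator_def)
  finally have "(\<integral>\<^sup>+N. \<integral>\<^sup>+z. h z * indicator (space E - D 0) z \<partial>N \<partial>Q) \<noteq> \<infinity>" using fin by auto
  then have AE1: "AE N in Q. (\<integral>\<^sup>+z. h z * indicator (space E - D 0) z \<partial>N) \<noteq> \<infinity>"
    by (rule nn_integral_PInf_AE[rotated])
      (unfold measurable_cong_sets[OF sets_Q refl], intro measurable_nn_integral_PM, measurable)
  have AE2: "AE N in Q. \<forall>r. emeasure N (D r) \<in> \<nat>"
    using AE_count[OF D D_fin] by (simp add: AE_all_countable)
  show ?thesis
    using AE1 AE2 AE_space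
  proof eventually_elim
    case (elim N)
    then have N: "N \<in> S" by simp
    note sets_S[OF N, measurable_cong]
    have DN: "D r \<in> sets N" for r using D sets_S[OF N] by simp
    have nat_fin: "emeasure N (D r) \<noteq> \<infinity>" for r
      using elim(2)[rule_format, of r] by (auto elim!: Nats_cases)
    have "(\<Inter>r. D r) = {}"
    proof (rule equals0I)
      fix z assume z: "z \<in> (\<Inter>r. D r)"
      then have "z \<in> D 0" by blast
      then have "h z < \<infinity>" using h_fin by (simp add: D_def)
      then obtain r where "h z < of_nat r" using ennreal_Ex_less_of_nat[of "h z"] by auto
      also have "of_nat r \<le> (of_nat (Suc r) :: ennreal)" by (rule of_nat_mono) simp
      also have "\<dots> \<le> h z" using z by (auto simp: D_def simp del: of_nat_Suc)
      finally show False by simp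
    qed
    then have "(\<lambda>r. emeasure N (D r)) \<longlonglongrightarrow> 0"
      using Lim_emeasure_decseq[of D N] D_dec DN nat_fin by (simp add: image_subset_iff)
    then have "eventually (\<lambda>r. emeasure N (D r) < 1) sequentially"
      by (rule order_tendstoD) simp
    then obtain r where r: "emeasure N (D r) < 1" by (auto simp: eventually_sequentially)
    then have r0: "emeasure N (D r) = 0"
    proof -
      obtain i where "emeasure N (D r) = of_nat i"
        using elim(2)[rule_format, of r] by (auto elim: Nats_cases)
      with r show ?thesis by (cases i) (auto simp: not_less[symmetric])
    qed
    have "AE z in N. z \<notin> D r" using r0 DN by (intro AE_I[of _ _ "D r"]) auto
    then have "(\<integral>\<^sup>+z. h z \<partial>N) \<le> (\<integral>\<^sup>+z. h z * indicator (space E - D 0) z + of_nat (Suc r) * indicator (D 0) z \<partial>N)"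
    proof (intro nn_integral_mono_AE, rule AE_mp, intro AE_I2 impI)
      fix z assume "z \<in> space N" "z \<notin> D r"
      then have "z \<in> space E" "h z \<le> of_nat (Suc r)" using space_S[OF N] by (auto simp: D_def)
      then show "h z \<le> h z * indicator (space E - D 0) z + of_nat (Suc r) * indicator (D 0) z"
        by (cases "z \<in> D 0") auto
    qed
    also have "\<dots> = (\<integral>\<^sup>+z. h z * indicator (space E - D 0) z \<partial>N) + of_nat (Suc r) * emeasure N (D 0)"
      using DN by (subst nn_integral_add) (auto simp: nn_integral_cmult simp del: of_nat_Suc)
    also have "\<dots> < \<infinity>"
      using elim(1) nat_fin[of 0] by (auto simp: less_top[symmetric] ennreal_mult_eq_top_iff simp del: of_nat_Suc)
    finally show ?case .
  qed
qed

end

section \<open>The iterated Mecke equation\<close>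

text \<open>A partition of \<open>{1, \<dots>, n}\<close> is encoded by the map sending each index to the least element of its
  block.\<close>

definition reps :: "nat \<Rightarrow> (nat \<Rightarrow> nat) set" where
  "reps n = {r \<in> {1..n} \<rightarrow>\<^sub>E {1..n}. \<forall>i\<in>{1..n}. r i \<le> i \<and> r (r i) = r i}"

lemma reps_D:
  assumes "r \<in> reps n"
  shows "i \<in> {1..n} \<Longrightarrow> r i \<in> {1..n}" "i \<in> {1..n} \<Longrightarrow> r i \<le> i" "i \<in> {1..n} \<Longrightarrow> r (r i) = r i"
    "i \<notin> {1..n} \<Longrightarrow> r i = undefined"
  using assms unfolding reps_def PiE_def extensional_def by blast+

lemma reps_0: "reps 0 = {\<lambda>_. undefined}"
  by (auto simp: reps_def)

lemma finite_reps: "finite (reps n)"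
  unfolding reps_def by (rule finite_subset[of _ "{1..n} \<rightarrow>\<^sub>E {1..n}"]) (auto intro: finite_PiE)

text \<open>The new index joins the block with representative \<open>c\<close>, or opens its own
  block when \<open>c\<close> is \<open>Suc n\<close>.\<close>

lemma reps_extend:
  assumes r: "r \<in> reps n" and c: "c \<in> insert (Suc n) (r ` {1..n})"
  shows "r(Suc n := c) \<in> reps (Suc n)" "(r(Suc n := c)) ` {1..Suc n} = insert c (r ` {1..n})"
proof -
  note D = reps_D[OF r]
  have c': "c \<in> {1..Suc n}" using c D(1) by fastforce
  have rc: "c \<noteq> Suc n \<Longrightarrow> r c = c" using c D(3) by auto
  let ?r = "r(Suc n := c)"
  have "?r i \<in> {1..Suc n} \<and> ?r i \<le> i \<and> ?r (?r i) = ?r i" if "i \<in> {1..Suc n}" for i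
  proof (cases "i = Suc n")
    case True
    then show ?thesis using c' rc by auto
  next
    case False
    then have "i \<in> {1..n}" using that by auto
    with D(1-3)[OF this] False show ?thesis by auto
  qed
  moreover have "?r i = undefined" if "i \<notin> {1..Suc n}" for i
    using that D(4)[of i] by auto
  ultimately show "?r \<in> reps (Suc n)"
    unfolding reps_def by (auto simp: PiE_def extensional_def)
  have "{1..Suc n} = insert (Suc n) {1..n}" by auto
  then show "?r ` {1..Suc n} = insert c (r ` {1..n})" by auto
qed

text \<open>Every partition of the larger set arises exactly once from a partition of the smaller
  one and a choice for the last index; the inverse map erases the last value and remembers
  it.\<close>

lemma sum_reps_Suc:
  "(\<Sum>r\<in>reps (Suc n). \<phi> r) = (\<Sum>r\<in>reps n. \<Sum>c\<in>insert (Suc n) (r ` {1..n}). \<phi> (r(Suc n := c)))"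
proof -
  have "(\<Sum>r\<in>reps n. \<Sum>c\<in>insert (Suc n) (r ` {1..n}). \<phi> (r(Suc n := c))) =
      (\<Sum>(r, c)\<in>(SIGMA r:reps n. insert (Suc n) (r ` {1..n})). \<phi> (r(Suc n := c)))"
    using finite_reps by (intro sum.Sigma) auto
  also have "\<dots> = (\<Sum>r\<in>reps (Suc n). \<phi> r)"
  proof (rule sum.reindex_bij_witness[where i="\<lambda>r. (r(Suc n := undefined), r (Suc n))" and j="\<lambda>(r, c). r(Suc n := c)"])
    fix x assume x: "x \<in> (SIGMA r:reps n. insert (Suc n) (r ` {1..n}))"
    obtain r c where rc: "x = (r, c)" "r \<in> reps n" "c \<in> insert (Suc n) (r ` {1..n})" using x by auto
    then show "((case x of (r, c) \<Rightarrow> r(Suc n := c))(Suc n := undefined), (case x of (r, c) \<Rightarrow> r(Suc n := c)) (Suc n)) = x"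
      using reps_D(4)[OF rc(2), of "Suc n"] by auto
    show "(case x of (r, c) \<Rightarrow> r(Suc n := c)) \<in> reps (Suc n)"
      using rc reps_extend(1) by auto
    show "\<phi> (case x of (r, c) \<Rightarrow> r(Suc n := c)) = (case x of (r, c) \<Rightarrow> \<phi> (r(Suc n := c)))"
      using rc by simp
  next
    fix r assume r: "r \<in> reps (Suc n)"
    note D = reps_D[OF r]
    let ?r = "r(Suc n := undefined)"
    have "?r i \<in> {1..n} \<and> ?r i \<le> i \<and> ?r (?r i) = ?r i" if "i \<in> {1..n}" for i
    proof -
      have "i \<in> {1..Suc n}" using that by auto
      from D(1-3)[OF this] that show ?thesis by auto
    qed
    moreover have "?r i = undefined" if "i \<notin> {1..n}" for i
      using that D(4)[of i] by (cases "i = Suc n") auto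
    ultimately have "?r \<in> reps n"
      unfolding reps_def by (auto simp: PiE_def extensional_def)
    moreover have "r (Suc n) \<in> insert (Suc n) (?r ` {1..n})"
    proof (cases "r (Suc n) = Suc n")
      case False
      then have "r (Suc n) \<in> {1..n}" "?r (r (Suc n)) = r (Suc n)"
        using D(1-3)[of "Suc n"] by auto
      then show ?thesis by (metis imageI insertI2)
    qed simp
    ultimately show "(?r, r (Suc n)) \<in> (SIGMA r:reps n. insert (Suc n) (r ` {1..n}))" by simp
    show "(case (?r, r (Suc n)) of (r, c) \<Rightarrow> r(Suc n := c)) = r" by simp
  qed
  finally show ?thesis by simp
qed

context point_config begin

lemma measurable_reps:
  assumes r: "r \<in> reps n"
  shows "(\<lambda>(z, N). (\<lambda>i\<in>{1..n}. z (r i), add_atoms N (r ` {1..n}) (\<lambda>_. 1) z))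
    \<in> measurable ((\<Pi>\<^sub>M c\<in>r ` {1..n}. E) \<Otimes>\<^sub>M PM) ((\<Pi>\<^sub>M i\<in>{1..n}. E) \<Otimes>\<^sub>M PM)"
  unfolding case_prod_beta
  by (intro measurable_Pair measurable_restrict measurable_add_atoms measurable_snd
      measurable_compose[OF measurable_fst measurable_component_singleton]) auto

lemma add_atoms_add_point:
  assumes "finite I" "j \<notin> I"
  shows "add_atoms N (insert j I) (\<lambda>_. 1) (z(j := w)) = add_atoms (add_point N w) I (\<lambda>_. 1) z"
proof (rule measure_eqI)
  fix A assume "A \<in> sets (add_atoms N (insert j I) (\<lambda>_. 1) (z(j := w)))"
  then have A: "A \<in> sets N" by simp
  have "(\<Sum>i\<in>I. indicator A ((z(j := w)) i)) = (\<Sum>i\<in>I. indicator A (z i) :: ennreal)"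
    using assms by (intro sum.cong) auto
  with A assms show "emeasure (add_atoms N (insert j I) (\<lambda>_. 1) (z(j := w))) A = emeasure (add_atoms (add_point N w) I (\<lambda>_. 1) z) A"
    by (simp add: emeasure_add_atoms emeasure_add_point ac_simps)
qed simp

lemma add_atoms_empty: "add_atoms N {} w z = N"
  by (rule measure_eqI) (simp_all add: emeasure_add_atoms)

end

context mecke_law begin

lemma sets_PiM_\<Lambda>[measurable_cong]: "sets (PiM I (\<lambda>_. \<Lambda>)) = sets (PiM I (\<lambda>_. E))"
  by (intro sets_PiM_cong refl sets_\<Lambda>)

text \<open>Induction with the last variable integrated first. Once the first \<open>n\<close>
  variables have been handled, \<open>N\<close> carries one atom per block, so the integral over the
  last variable splits: an atom puts the new index into an old block, while the part from
  \<open>N\<close> itself is treated by Mecke's equation and opens a new block.\<close>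

theorem multivariate_mecke:
  assumes "F \<in> borel_measurable ((\<Pi>\<^sub>M i\<in>{1..n}. E) \<Otimes>\<^sub>M PM)"
  shows "(\<integral>\<^sup>+N. \<integral>\<^sup>+z. F (z, N) \<partial>(\<Pi>\<^sub>M i\<in>{1..n}. N) \<partial>Q) =
    (\<Sum>r\<in>reps n. \<integral>\<^sup>+z. \<integral>\<^sup>+N. F (\<lambda>i\<in>{1..n}. z (r i), add_atoms N (r ` {1..n}) (\<lambda>_. 1) z) \<partial>Q \<partial>(\<Pi>\<^sub>M c\<in>r ` {1..n}. \<Lambda>))"
  using assms
proof (induction n arbitrary: F)
  case 0
  have "(\<integral>\<^sup>+z. F (z, N) \<partial>(\<Pi>\<^sub>M i\<in>{}. N)) = F (\<lambda>_. undefined, N)" for N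
    by (simp add: PiM_empty nn_integral_count_space_finite)
  then show ?case
    by (simp add: reps_0 PiM_empty nn_integral_count_space_finite add_atoms_empty restrict_def)
next
  case (Suc n F)
  have Sn: "{1..Suc n} = insert (Suc n) {1..n}" "Suc n \<notin> {1..n}" by auto
  have F[measurable]: "F \<in> borel_measurable ((\<Pi>\<^sub>M i\<in>insert (Suc n) {1..n}. E) \<Otimes>\<^sub>M PM)"
    using Suc.prems by (simp only: Sn)
  interpret L: product_sigma_finite "\<lambda>_. \<Lambda>" by unfold_locales
  define H where "H x = (\<integral>\<^sup>+w. F ((fst x)(Suc n := w), snd x) \<partial>snd x)" for x
  have H: "H \<in> borel_measurable ((\<Pi>\<^sub>M i\<in>{1..n}. E) \<Otimes>\<^sub>M PM)"
    unfolding H_def by (rule measurable_nn_integral_PM) measurable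
  have "(\<integral>\<^sup>+N. \<integral>\<^sup>+z. F (z, N) \<partial>(\<Pi>\<^sub>M i\<in>{1..Suc n}. N) \<partial>Q) = (\<integral>\<^sup>+N. \<integral>\<^sup>+z. H (z, N) \<partial>(\<Pi>\<^sub>M i\<in>{1..n}. N) \<partial>Q)"
  proof (rule nn_integral_cong)
    fix N assume "N \<in> space Q"
    then have N: "N \<in> S" by simp
    then have [measurable]: "N \<in> space PM" by simp
    interpret sigma_finite_measure N
      by (rule locally_finite_sigma_finite[OF locally_finite_S[OF N]])
    interpret product_sigma_finite "\<lambda>_. N" by unfold_locales
    have sN: "sets (PiM I (\<lambda>_. N)) = sets (PiM I (\<lambda>_. E))" for I :: "nat set"
      by (intro sets_PiM_cong refl sets_S[OF N])
    show "(\<integral>\<^sup>+z. F (z, N) \<partial>(\<Pi>\<^sub>M i\<in>{1..Suc n}. N)) = (\<integral>\<^sup>+z. H (z, N) \<partial>(\<Pi>\<^sub>M i\<in>{1..n}. N))"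
      unfolding Sn H_def fst_conv snd_conv
    proof (rule product_nn_integral_insert)
      show "(\<lambda>z. F (z, N)) \<in> borel_measurable (\<Pi>\<^sub>M i\<in>insert (Suc n) {1..n}. N)"
        unfolding measurable_cong_sets[OF sN refl] by measurable
    qed auto
  qed
  also have "\<dots> = (\<Sum>r\<in>reps n. \<integral>\<^sup>+z. \<integral>\<^sup>+N. H (\<lambda>i\<in>{1..n}. z (r i), add_atoms N (r ` {1..n}) (\<lambda>_. 1) z) \<partial>Q \<partial>(\<Pi>\<^sub>M c\<in>r ` {1..n}. \<Lambda>))"
    by (rule Suc.IH[OF H])
  also have "\<dots> = (\<Sum>r\<in>reps n. \<Sum>c\<in>insert (Suc n) (r ` {1..n}).
      \<integral>\<^sup>+z. \<integral>\<^sup>+N. F (\<lambda>i\<in>{1..Suc n}. z ((r(Suc n := c)) i), add_atoms N ((r(Suc n := c)) ` {1..Suc n}) (\<lambda>_. 1) z) \<partial>Q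
        \<partial>(\<Pi>\<^sub>M c\<in>(r(Suc n := c)) ` {1..Suc n}. \<Lambda>))"
  proof (rule sum.cong[OF refl])
    fix r assume r: "r \<in> reps n"
    note D = reps_D[OF r]
    let ?I = "r ` {1..n}"
    have I: "finite ?I" "Suc n \<notin> ?I" using D(1) by fastforce+
    have I_le: "r i \<noteq> Suc n" if "i \<in> {1..n}" for i using D(1)[OF that] by auto
    let ?G = "\<lambda>c z. \<integral>\<^sup>+N. F (\<lambda>i\<in>{1..Suc n}. z ((r(Suc n := c)) i), add_atoms N ((r(Suc n := c)) ` {1..Suc n}) (\<lambda>_. 1) z) \<partial>Q"
    have FG: "(\<lambda>(z, N). F (\<lambda>i\<in>{1..Suc n}. z ((r(Suc n := c)) i), add_atoms N ((r(Suc n := c)) ` {1..Suc n}) (\<lambda>_. 1) z))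
        \<in> borel_measurable ((\<Pi>\<^sub>M c\<in>insert c ?I. E) \<Otimes>\<^sub>M PM)" if c: "c \<in> insert (Suc n) ?I" for c
      using measurable_compose[OF measurable_reps[OF reps_extend(1)[OF r c]] Suc.prems]
      unfolding reps_extend(2)[OF r c] by (simp add: case_prod_beta)
    then have G: "?G c \<in> borel_measurable (\<Pi>\<^sub>M c\<in>insert c ?I. E)" if c: "c \<in> insert (Suc n) ?I" for c
      using c by measurable
    have upd: "(\<lambda>i\<in>{1..Suc n}. x ((r(Suc n := c)) i)) = (\<lambda>i\<in>{1..n}. x (r i))(Suc n := x c)" for x :: "nat \<Rightarrow> 'a" and c
      by (auto simp: restrict_def fun_eq_iff)
    \<comment> \<open>The integrand with the old blocks at \<open>z\<close> and the last variable at
      \<open>w\<close>; its argument \<open>N\<close> is the point measure before the atoms of the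
      old blocks are added.\<close>
    define T where "T z w N = F ((\<lambda>i\<in>{1..n}. z (r i))(Suc n := w), add_atoms N ?I (\<lambda>_. 1) z)" for z w N
    have T: "(\<lambda>((z, w), N). T z w N) \<in> borel_measurable (((\<Pi>\<^sub>M c\<in>?I. E) \<Otimes>\<^sub>M E) \<Otimes>\<^sub>M PM)"
      unfolding T_def case_prod_beta
      by (intro measurable_compose[OF _ F] measurable_Pair measurable_fun_upd[where J="{1..n}"] measurable_restrict
          measurable_add_atoms measurable_snd measurable_compose[OF measurable_fst measurable_snd]
          measurable_compose[OF measurable_compose[OF measurable_fst measurable_fst] measurable_component_singleton]) auto
    have T'[measurable (raw)]: "(\<lambda>x. T (a x) (b x) (c x)) \<in> borel_measurable M"
      if "a \<in> measurable M (\<Pi>\<^sub>M c\<in>?I. E)" "b \<in> measurable M E" "c \<in> measurable M PM" for a b c M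
      using measurable_compose[OF measurable_Pair[OF measurable_Pair[OF that(1,2)] that(3)] T] by simp
    have T_z: "(\<lambda>(w, N). T z w N) \<in> borel_measurable (E \<Otimes>\<^sub>M PM)" if "z \<in> space (\<Pi>\<^sub>M c\<in>?I. E)" for z
      using that by measurable
    have T_c: "(\<lambda>(z, N). T z (z c) N) \<in> borel_measurable ((\<Pi>\<^sub>M c\<in>?I. E) \<Otimes>\<^sub>M PM)" if "c \<in> ?I" for c
      using that by measurable
    have inner: "(\<integral>\<^sup>+N. H (\<lambda>i\<in>{1..n}. z (r i), add_atoms N ?I (\<lambda>_. 1) z) \<partial>Q) =
        (\<integral>\<^sup>+w. \<integral>\<^sup>+N. T z w (add_point N w) \<partial>Q \<partial>\<Lambda>) + (\<Sum>c\<in>?I. \<integral>\<^sup>+N. T z (z c) N \<partial>Q)"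
      if z: "z \<in> space (\<Pi>\<^sub>M c\<in>?I. E)" for z
    proof -
      have zE: "z c \<in> space E" if "c \<in> ?I" for c using z that by (auto simp: space_PiM)
      note [measurable] = T_z[OF z]
      have TN: "T z w \<in> borel_measurable PM" if "w \<in> space E" for w
        using that by measurable
      have m1: "(\<lambda>N. \<integral>\<^sup>+w. T z w N \<partial>N) \<in> borel_measurable PM"
        by (rule measurable_nn_integral_PM) measurable
      have "H (\<lambda>i\<in>{1..n}. z (r i), add_atoms N ?I (\<lambda>_. 1) z) = (\<integral>\<^sup>+w. T z w N \<partial>N) + (\<Sum>c\<in>?I. T z (z c) N)"
        if N: "N \<in> space Q" for N
      proof -
        have "N \<in> S" using N by simp
        then have "(\<lambda>w. T z w N) \<in> borel_measurable N"
          unfolding measurable_cong_sets[OF sets_S[OF \<open>N \<in> S\<close>] refl]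
          by (intro T') (use z \<open>N \<in> S\<close> in simp_all)
        then show ?thesis
          using zE space_S[OF \<open>N \<in> S\<close>] I(1)
          unfolding H_def fst_conv snd_conv T_def by (subst nn_integral_add_atoms) simp_all
      qed
      then have "(\<integral>\<^sup>+N. H (\<lambda>i\<in>{1..n}. z (r i), add_atoms N ?I (\<lambda>_. 1) z) \<partial>Q) =
          (\<integral>\<^sup>+N. (\<integral>\<^sup>+w. T z w N \<partial>N) + (\<Sum>c\<in>?I. T z (z c) N) \<partial>Q)"
        by (rule nn_integral_cong)
      also have "\<dots> = (\<integral>\<^sup>+N. \<integral>\<^sup>+w. T z w N \<partial>N \<partial>Q) + (\<Sum>c\<in>?I. \<integral>\<^sup>+N. T z (z c) N \<partial>Q)"
        using m1 TN[OF zE] by (subst nn_integral_add) (simp_all add: nn_integral_sum measurable_cong_sets[OF sets_Q refl])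
      also have "(\<integral>\<^sup>+N. \<integral>\<^sup>+w. T z w N \<partial>N \<partial>Q) = (\<integral>\<^sup>+w. \<integral>\<^sup>+N. T z w (add_point N w) \<partial>Q \<partial>\<Lambda>)"
        using mecke_eq[OF T_z[OF z]] by simp
      finally show ?thesis .
    qed
    have T_add: "(\<lambda>(z, w). \<integral>\<^sup>+N. T z w (add_point N w) \<partial>Q) \<in> borel_measurable ((\<Pi>\<^sub>M c\<in>?I. E) \<Otimes>\<^sub>M E)"
      by measurable
    have "(\<integral>\<^sup>+z. \<integral>\<^sup>+N. H (\<lambda>i\<in>{1..n}. z (r i), add_atoms N ?I (\<lambda>_. 1) z) \<partial>Q \<partial>(\<Pi>\<^sub>M c\<in>?I. \<Lambda>)) =
        (\<integral>\<^sup>+z. (\<integral>\<^sup>+w. \<integral>\<^sup>+N. T z w (add_point N w) \<partial>Q \<partial>\<Lambda>) + (\<Sum>c\<in>?I. \<integral>\<^sup>+N. T z (z c) N \<partial>Q) \<partial>(\<Pi>\<^sub>M c\<in>?I. \<Lambda>))"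
      by (intro nn_integral_cong inner) (simp add: sets_eq_imp_space_eq[OF sets_PiM_\<Lambda>])
    also have "\<dots> = (\<integral>\<^sup>+z. \<integral>\<^sup>+w. \<integral>\<^sup>+N. T z w (add_point N w) \<partial>Q \<partial>\<Lambda> \<partial>(\<Pi>\<^sub>M c\<in>?I. \<Lambda>)) +
        (\<Sum>c\<in>?I. \<integral>\<^sup>+z. \<integral>\<^sup>+N. T z (z c) N \<partial>Q \<partial>(\<Pi>\<^sub>M c\<in>?I. \<Lambda>))"
    proof (subst nn_integral_add)
      have m: "(\<lambda>z. \<integral>\<^sup>+N. T z (z c) N \<partial>Q) \<in> borel_measurable (\<Pi>\<^sub>M c\<in>?I. \<Lambda>)" if "c \<in> ?I" for c
        using T_c[OF that] by measurable
      then show "(\<lambda>z. \<Sum>c\<in>?I. \<integral>\<^sup>+N. T z (z c) N \<partial>Q) \<in> borel_measurable (\<Pi>\<^sub>M c\<in>?I. \<Lambda>)"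
        by (rule borel_measurable_sum)
      show "(\<lambda>z. \<integral>\<^sup>+w. \<integral>\<^sup>+N. T z w (add_point N w) \<partial>Q \<partial>\<Lambda>) \<in> borel_measurable (\<Pi>\<^sub>M c\<in>?I. \<Lambda>)"
        using T_add by measurable
      show "(\<integral>\<^sup>+z. \<integral>\<^sup>+w. \<integral>\<^sup>+N. T z w (add_point N w) \<partial>Q \<partial>\<Lambda> \<partial>(\<Pi>\<^sub>M c\<in>?I. \<Lambda>)) +
          (\<integral>\<^sup>+z. (\<Sum>c\<in>?I. \<integral>\<^sup>+N. T z (z c) N \<partial>Q) \<partial>(\<Pi>\<^sub>M c\<in>?I. \<Lambda>)) =
        (\<integral>\<^sup>+z. \<integral>\<^sup>+w. \<integral>\<^sup>+N. T z w (add_point N w) \<partial>Q \<partial>\<Lambda> \<partial>(\<Pi>\<^sub>M c\<in>?I. \<Lambda>)) +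
          (\<Sum>c\<in>?I. \<integral>\<^sup>+z. \<integral>\<^sup>+N. T z (z c) N \<partial>Q \<partial>(\<Pi>\<^sub>M c\<in>?I. \<Lambda>))"
        using m by (simp add: nn_integral_sum)
    qed
    also have "(\<integral>\<^sup>+z. \<integral>\<^sup>+w. \<integral>\<^sup>+N. T z w (add_point N w) \<partial>Q \<partial>\<Lambda> \<partial>(\<Pi>\<^sub>M c\<in>?I. \<Lambda>)) =
        (\<integral>\<^sup>+z. ?G (Suc n) z \<partial>(\<Pi>\<^sub>M c\<in>insert (Suc n) ?I. \<Lambda>))"
    proof (subst L.product_nn_integral_insert[OF I])
      show "?G (Suc n) \<in> borel_measurable (\<Pi>\<^sub>M c\<in>insert (Suc n) ?I. \<Lambda>)"
        using G[of "Suc n"] by measurable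
      have "T z w (add_point N w) = F (\<lambda>i\<in>{1..Suc n}. (z(Suc n := w)) ((r(Suc n := Suc n)) i),
          add_atoms N ((r(Suc n := Suc n)) ` {1..Suc n}) (\<lambda>_. 1) (z(Suc n := w)))" for z w N
      proof -
        have "(\<lambda>i\<in>{1..n}. (z(Suc n := w)) (r i)) = (\<lambda>i\<in>{1..n}. z (r i))"
          using I_le by (intro restrict_ext) auto
        then show ?thesis
          unfolding T_def upd reps_extend(2)[OF r insertI1] add_atoms_add_point[OF I] by simp
      qed
      then show "(\<integral>\<^sup>+z. \<integral>\<^sup>+w. \<integral>\<^sup>+N. T z w (add_point N w) \<partial>Q \<partial>\<Lambda> \<partial>(\<Pi>\<^sub>M c\<in>?I. \<Lambda>)) =
          (\<integral>\<^sup>+z. \<integral>\<^sup>+w. ?G (Suc n) (z(Suc n := w)) \<partial>\<Lambda> \<partial>(\<Pi>\<^sub>M c\<in>?I. \<Lambda>))" by simp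
    qed
    also have "(\<Sum>c\<in>?I. \<integral>\<^sup>+z. \<integral>\<^sup>+N. T z (z c) N \<partial>Q \<partial>(\<Pi>\<^sub>M c\<in>?I. \<Lambda>)) =
        (\<Sum>c\<in>?I. \<integral>\<^sup>+z. ?G c z \<partial>(\<Pi>\<^sub>M c\<in>insert c ?I. \<Lambda>))"
    proof (rule sum.cong[OF refl])
      fix c assume c: "c \<in> ?I"
      \<comment> \<open>The index joins an old block, so the set of integrated points stays the
        same.\<close>
      then have "insert c ?I = ?I" "c \<in> insert (Suc n) ?I" by auto
      then show "(\<integral>\<^sup>+z. \<integral>\<^sup>+N. T z (z c) N \<partial>Q \<partial>(\<Pi>\<^sub>M c\<in>?I. \<Lambda>)) = (\<integral>\<^sup>+z. ?G c z \<partial>(\<Pi>\<^sub>M c\<in>insert c ?I. \<Lambda>))"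
        unfolding upd T_def by (simp only: reps_extend(2)[OF r])
    qed
    also have "(\<integral>\<^sup>+z. ?G (Suc n) z \<partial>(\<Pi>\<^sub>M c\<in>insert (Suc n) ?I. \<Lambda>)) + (\<Sum>c\<in>?I. \<integral>\<^sup>+z. ?G c z \<partial>(\<Pi>\<^sub>M c\<in>insert c ?I. \<Lambda>)) =
        (\<Sum>c\<in>insert (Suc n) ?I. \<integral>\<^sup>+z. ?G c z \<partial>(\<Pi>\<^sub>M c\<in>insert c ?I. \<Lambda>))"
      by (rule sum.insert[OF I, symmetric])
    also have "\<dots> = (\<Sum>c\<in>insert (Suc n) ?I. \<integral>\<^sup>+z. ?G c z \<partial>(\<Pi>\<^sub>M c\<in>(r(Suc n := c)) ` {1..Suc n}. \<Lambda>))"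
      by (intro sum.cong refl) (simp only: reps_extend(2)[OF r])
    finally show "(\<integral>\<^sup>+z. \<integral>\<^sup>+N. H (\<lambda>i\<in>{1..n}. z (r i), add_atoms N ?I (\<lambda>_. 1) z) \<partial>Q \<partial>(\<Pi>\<^sub>M c\<in>?I. \<Lambda>)) = \<dots>" .
  qed
  also have "\<dots> = (\<Sum>r\<in>reps (Suc n). \<integral>\<^sup>+z. \<integral>\<^sup>+N. F (\<lambda>i\<in>{1..Suc n}. z (r i), add_atoms N (r ` {1..Suc n}) (\<lambda>_. 1) z) \<partial>Q
      \<partial>(\<Pi>\<^sub>M c\<in>r ` {1..Suc n}. \<Lambda>))"
    by (rule sum_reps_Suc[symmetric])
  finally show ?case .
qed

end

section \<open>Ties and partitions\<close>

lemma block_mem: "i \<in> {1..n} \<Longrightarrow> i \<in> block n Y i"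
  by (simp add: block_def)

lemma block_subset: "block n Y i \<subseteq> {1..n}"
  by (auto simp: block_def)

lemma finite_block: "finite (block n Y i)"
  by (simp add: block_def)

lemma Min_block: "i \<in> {1..n} \<Longrightarrow> Min (block n Y i) \<in> block n Y i"
  using block_mem[of i n Y] by (intro Min_in finite_block) auto

lemma block_cong: "Y i = Y j \<Longrightarrow> block n Y i = block n Y j"
  by (simp add: block_def)

lemma block_eq: "l \<in> block n Y i \<Longrightarrow> block n Y l = block n Y i"
  by (auto simp: block_def)

lemma ties_eq_block: "C \<in> ties n Y \<Longrightarrow> l \<in> C \<Longrightarrow> C = block n Y l"
  unfolding ties_def using block_eq by fastforce

lemma finite_ties: "finite (ties n Y)"
  by (simp add: ties_def)

lemma ties_nonempty: "C \<in> ties n Y \<Longrightarrow> C \<noteq> {} \<and> C \<subseteq> {1..n} \<and> finite C \<and> Min C \<in> C \<and> Min C \<in> {1..n}"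
proof -
  assume "C \<in> ties n Y"
  then obtain i where i: "i \<in> {1..n}" "C = block n Y i" by (auto simp: ties_def)
  then show ?thesis
    using Min_block[OF i(1)] block_subset[of n Y i] finite_block block_mem[OF i(1)] by blast
qed

lemma partition_on_ties: "partition_on {1..n} (ties n Y)"
proof (rule partition_onI)
  show "\<Union> (ties n Y) = {1..n}"
    using block_mem block_subset by (fastforce simp: ties_def)
  show "disjnt C D" if "C \<in> ties n Y" "D \<in> ties n Y" "C \<noteq> D" for C D
    using that ties_eq_block[of C n Y] ties_eq_block[of D n Y] by (fastforce simp: disjnt_def)
  show "{} \<notin> ties n Y" using ties_nonempty by blast
qed

lemma block_cong_ties: "ties n Y = ties n Z \<Longrightarrow> i \<in> {1..n} \<Longrightarrow> block n Y i = block n Z i"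
proof -
  assume eq: "ties n Y = ties n Z" and i: "i \<in> {1..n}"
  have "block n Y i \<in> ties n Y" using i unfolding ties_def by (rule imageI)
  with eq have "block n Y i \<in> ties n Z" by simp
  from ties_eq_block[OF this block_mem[OF i]] show ?thesis .
qed

lemma ties_eq_iff:
  "ties n Y = ties n Z \<longleftrightarrow> (\<forall>i\<in>{1..n}. \<forall>l\<in>{1..n}. Y i = Y l \<longleftrightarrow> Z i = Z l)"
proof
  assume eq: "ties n Y = ties n Z"
  show "\<forall>i\<in>{1..n}. \<forall>l\<in>{1..n}. Y i = Y l \<longleftrightarrow> Z i = Z l"
  proof (intro ballI)
    fix i l assume i: "i \<in> {1..n}" and l: "l \<in> {1..n}"
    have "i \<in> block n Y l \<longleftrightarrow> i \<in> block n Z l" using block_cong_ties[OF eq l] by simp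
    then show "Y i = Y l \<longleftrightarrow> Z i = Z l" using i by (auto simp: block_def)
  qed
next
  assume *: "\<forall>i\<in>{1..n}. \<forall>l\<in>{1..n}. Y i = Y l \<longleftrightarrow> Z i = Z l"
  then have "block n Y i = block n Z i" if "i \<in> {1..n}" for i
    using that by (auto simp: block_def)
  then show "ties n Y = ties n Z" by (simp add: ties_def)
qed

text \<open>A member of \<open>reps\<close> is itself a labelling of the indices, so
  \<open>block\<close> and \<open>ties\<close> apply to it and yield its partition. Idempotence puts
  \<open>r i\<close> into the block of \<open>i\<close>, and \<open>r l \<le> l\<close> makes it
  minimal there.\<close>

lemma Min_block_reps: "r \<in> reps n \<Longrightarrow> i \<in> {1..n} \<Longrightarrow> Min (block n r i) = r i"
proof (rule Min_eqI[OF finite_block])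
  assume r: "r \<in> reps n" and i: "i \<in> {1..n}"
  note D = reps_D[OF r]
  show "r i \<in> block n r i" using D(1)[OF i] D(3)[OF i] by (simp add: block_def)
  show "r i \<le> l" if "l \<in> block n r i" for l
    using that D(2)[of l] by (auto simp: block_def)
qed

lemma bij_betw_block_reps:
  assumes r: "r \<in> reps n"
  shows "bij_betw (block n r) (r ` {1..n}) (ties n r)"
  unfolding bij_betw_def
proof
  note D = reps_D[OF r]
  have *: "block n r (r i) = block n r i" if "i \<in> {1..n}" for i
    using D(3)[OF that] by (rule block_cong)
  have "Min (block n r c) = c" if "c \<in> r ` {1..n}" for c
    using that Min_block_reps[OF r] * by auto
  then show "inj_on (block n r) (r ` {1..n})" by (rule inj_on_inverseI)
  have "block n r ` r ` {1..n} = (\<lambda>i. block n r (r i)) ` {1..n}" by (rule image_image)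
  also have "\<dots> = ties n r" unfolding ties_def by (intro image_cong refl *)
  finally show "block n r ` r ` {1..n} = ties n r" .
qed

lemma ties_Min_reps:
  assumes r: "r \<in> reps n" and C: "C \<in> ties n r"
  shows "Min C \<in> r ` {1..n}" "block n r (Min C) = C" "r (Min C) = Min C"
proof -
  obtain i where i: "i \<in> {1..n}" "C = block n r i" using C by (auto simp: ties_def)
  then have M: "Min C = r i" using Min_block_reps[OF r] by simp
  then show "Min C \<in> r ` {1..n}" using i by auto
  have "r (r i) = r i" using reps_D(3)[OF r i(1)] .
  then show "r (Min C) = Min C" unfolding M .
  have "block n r (r i) = block n r i" by (rule block_cong) fact
  then show "block n r (Min C) = C" by (simp only: M i(2)[symmetric])
qed

lemma Min_block_range:
  assumes r: "r \<in> reps n" and c: "c \<in> r ` {1..n}"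
  shows "Min (block n r c) = c" "c \<in> {1..n}" "r c = c"
proof -
  obtain i where "i \<in> {1..n}" "c = r i" using c by auto
  then show "c \<in> {1..n}" "r c = c" using reps_D[OF r] by auto
  then show "Min (block n r c) = c" using Min_block_reps[OF r] by auto
qed

text \<open>Normal form of a labelling: it lies in \<open>reps\<close> and has the same ties as
  \<open>Y\<close>, so every \<open>Y\<close> belongs to exactly one of the finitely many cases
  indexed by \<open>reps\<close>.\<close>

definition rep :: "nat \<Rightarrow> (nat \<Rightarrow> 'y) \<Rightarrow> nat \<Rightarrow> nat" where
  "rep n Y = (\<lambda>i\<in>{1..n}. Min (block n Y i))"

lemma rep_eq_iff: "i \<in> {1..n} \<Longrightarrow> l \<in> {1..n} \<Longrightarrow> rep n Y i = rep n Y l \<longleftrightarrow> Y i = Y l"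
proof -
  assume i: "i \<in> {1..n}" and l: "l \<in> {1..n}"
  have "Min (block n Y i) = Min (block n Y l) \<Longrightarrow> Y i = Y l"
    using Min_block[OF i, of Y] Min_block[OF l, of Y] by (auto simp: block_def)
  then show ?thesis using i l block_cong[of Y i l n] by (auto simp: rep_def)
qed

lemma ties_rep: "ties n (rep n Y) = ties n Y"
  using rep_eq_iff[of _ n _ Y] by (simp add: ties_eq_iff)

lemma rep_reps: "rep n Y \<in> reps n"
proof -
  have M: "Min (block n Y i) \<in> block n Y i" if "i \<in> {1..n}" for i using Min_block[OF that] .
  have le: "Min (block n Y i) \<le> i" if "i \<in> {1..n}" for i
    using block_mem[OF that, of Y] finite_block by (auto intro: Min_le)
  have idem: "Min (block n Y (Min (block n Y i))) = Min (block n Y i)" if "i \<in> {1..n}" for i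
    using block_eq[OF M[OF that]] by simp
  show ?thesis
    unfolding reps_def
  proof (intro CollectI conjI ballI)
    show "rep n Y \<in> {1..n} \<rightarrow>\<^sub>E {1..n}"
      unfolding rep_def restrict_PiE_iff using M block_subset by blast
    fix i assume i: "i \<in> {1..n}"
    then have "Min (block n Y i) \<in> {1..n}" using M block_subset by blast
    then show "rep n Y i \<le> i" "rep n Y (rep n Y i) = rep n Y i"
      using i le[OF i] idem[OF i] by (simp_all add: rep_def)
  qed
qed

text \<open>Block minima determine the representative map, whence injectivity. For surjectivity,
  every index is labelled by the block that contains it, and \<open>rep\<close> of this labelling is
  the preimage.\<close>

lemma bij_betw_ties: "bij_betw (ties n) (reps n) {p. partition_on {1..n} p}"
  unfolding bij_betw_def
proof
  show "inj_on (ties n) (reps n)"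
  proof (rule inj_onI)
    fix r r' assume r: "r \<in> reps n" "r' \<in> reps n" "ties n r = ties n r'"
    show "r = r'"
    proof
      fix i show "r i = r' i"
        using block_cong_ties[OF r(3), of i] Min_block_reps[OF r(1), of i] Min_block_reps[OF r(2), of i]
          reps_D(4)[OF r(1), of i] reps_D(4)[OF r(2), of i] by (cases "i \<in> {1..n}") simp_all
    qed
  qed
  show "ties n ` reps n = {p. partition_on {1..n} p}"
  proof (intro subset_antisym subsetI)
    show "p \<in> {p. partition_on {1..n} p}" if "p \<in> ties n ` reps n" for p
      using that partition_on_ties by auto
    fix p assume "p \<in> {p. partition_on {1..n} p}"
    then have p: "partition_on {1..n} p" by simp
    define Y where "Y i = (THE C. C \<in> p \<and> i \<in> C)" for i
    have uniq: "C = D" if "C \<in> p" "D \<in> p" "i \<in> C" "i \<in> D" for C D i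
      using p that unfolding partition_on_def disjoint_def by blast
    have Y: "Y i = C" if "C \<in> p" "i \<in> C" for C i
      unfolding Y_def using that uniq by (intro the_equality) auto
    have Un: "\<Union>p = {1..n}" using p by (simp add: partition_on_def)
    have blk: "block n Y i = C" if "C \<in> p" "i \<in> C" for C i
    proof (intro subset_antisym subsetI)
      fix l assume "l \<in> block n Y i"
      then have l: "l \<in> {1..n}" "Y l = C" using Y[OF that] by (auto simp: block_def)
      then obtain D where "D \<in> p" "l \<in> D" using Un by blast
      with Y l show "l \<in> C" by auto
    next
      fix l assume l: "l \<in> C"
      then have "l \<in> {1..n}" using Un that by blast
      then show "l \<in> block n Y i" using Y[OF that] Y[OF that(1) l] by (simp add: block_def)
    qed
    have "ties n Y = p"
    proof (intro subset_antisym subsetI)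
      fix C assume "C \<in> ties n Y"
      then obtain i where "i \<in> {1..n}" "C = block n Y i" by (auto simp: ties_def)
      moreover obtain D where "D \<in> p" "i \<in> D" using Un \<open>i \<in> {1..n}\<close> by blast
      ultimately show "C \<in> p" using blk by simp
    next
      fix C assume C: "C \<in> p"
      then obtain i where "i \<in> C" using p by (fastforce simp: partition_on_def)
      moreover then have "i \<in> {1..n}" using C Un by blast
      ultimately show "C \<in> ties n Y" using blk[OF C, of i] unfolding ties_def by blast
    qed
    then show "p \<in> ties n ` reps n"
      using rep_reps[of n Y] ties_rep[of n Y] by (metis image_eqI)
  qed
qed

lemma prod_ties_reps:
  assumes r: "r \<in> reps n"
  shows "(\<Prod>C\<in>ties n r. \<phi> C) = (\<Prod>c\<in>r ` {1..n}. \<phi> (block n r c))"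
  by (rule prod.reindex_bij_betw[OF bij_betw_block_reps[OF r], symmetric])

lemma prod_reps_group:
  fixes w :: "nat \<Rightarrow> 'a \<Rightarrow> 'b::comm_monoid_mult"
  assumes r: "r \<in> reps n"
  shows "(\<Prod>i=1..n. w i (z (r i))) = (\<Prod>c\<in>r ` {1..n}. \<Prod>i\<in>block n r c. w i (z c))"
proof -
  have "(\<Prod>i=1..n. w i (z (r i))) = (\<Prod>c\<in>r ` {1..n}. \<Prod>i | i \<in> {1..n} \<and> r i = c. w i (z (r i)))"
    by (rule prod.group[symmetric]) auto
  also have "\<dots> = (\<Prod>c\<in>r ` {1..n}. \<Prod>i\<in>block n r c. w i (z c))"
  proof (rule prod.cong[OF refl])
    fix c assume "c \<in> r ` {1..n}"
    then have "r c = c" by (rule Min_block_range(3)[OF r])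
    then show "(\<Prod>i | i \<in> {1..n} \<and> r i = c. w i (z (r i))) = (\<Prod>i\<in>block n r c. w i (z c))"
      by (intro prod.cong) (auto simp: block_def)
  qed
  finally show ?thesis .
qed

section \<open>Product measures with densities, product kernels and images of conditional
  laws\<close>

lemma sigma_finite_density:
  assumes M: "sigma_finite_measure M" and W: "W \<in> borel_measurable M"
    and fin: "\<And>x. x \<in> space M \<Longrightarrow> W x < \<infinity>"
  shows "sigma_finite_measure (density M W)"
proof -
  have "AE x in M. W x \<noteq> \<infinity>" using fin by (intro AE_I2) (auto simp: less_top)
  then show ?thesis
    using sigma_finite_measure.sigma_finite_iff_density_finite[OF M W] by simp
qed

text \<open>Both sides agree on boxes. Finiteness of the densities keeps the weighted factors
  sigma-finite, so that boxes determine the product.\<close>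

lemma PiM_density:
  assumes M: "\<And>i. sigma_finite_measure (M i)" and I: "finite I"
    and W[measurable]: "\<And>i. W i \<in> borel_measurable (M i)" and fin: "\<And>i x. x \<in> space (M i) \<Longrightarrow> W i x < \<infinity>"
  shows "(\<Pi>\<^sub>M i\<in>I. density (M i) (W i)) = density (PiM I M) (\<lambda>x. \<Prod>i\<in>I. W i (x i))"
proof -
  interpret M: product_sigma_finite M using M by (simp add: product_sigma_finite_def)
  interpret D: product_sigma_finite "\<lambda>i. density (M i) (W i)"
    unfolding product_sigma_finite_def using sigma_finite_density[OF M W fin] by simp
  have [measurable]: "(\<lambda>x. \<Prod>i\<in>I. W i (x i)) \<in> borel_measurable (PiM I M)" by measurable
  show ?thesis
  proof (rule D.PiM_eqI[OF I, symmetric])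
    show "sets (density (PiM I M) (\<lambda>x. \<Prod>i\<in>I. W i (x i))) = sets (\<Pi>\<^sub>M i\<in>I. density (M i) (W i))"
      by (simp cong: sets_PiM_cong)
    fix A assume "\<And>i. i \<in> I \<Longrightarrow> A i \<in> sets (density (M i) (W i))"
    then have A[measurable]: "\<And>i. i \<in> I \<Longrightarrow> A i \<in> sets (M i)" by simp
    then have box: "Pi\<^sub>E I A \<in> sets (PiM I M)" using I by (intro sets_PiM_I_finite) auto
    have "emeasure (density (PiM I M) (\<lambda>x. \<Prod>i\<in>I. W i (x i))) (Pi\<^sub>E I A) =
        (\<integral>\<^sup>+x. (\<Prod>i\<in>I. W i (x i)) * indicator (Pi\<^sub>E I A) x \<partial>PiM I M)"
      by (intro emeasure_density box) measurable
    also have "\<dots> = (\<integral>\<^sup>+x. (\<Prod>i\<in>I. W i (x i) * indicator (A i) (x i)) \<partial>PiM I M)"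
    proof (rule nn_integral_cong)
      fix x assume "x \<in> space (PiM I M)"
      then have "indicator (Pi\<^sub>E I A) x = (\<Prod>i\<in>I. indicator (A i) (x i) :: ennreal)"
        using I by (auto simp: indicator_def space_PiM PiE_def Pi_iff)
      then show "(\<Prod>i\<in>I. W i (x i)) * indicator (Pi\<^sub>E I A) x = (\<Prod>i\<in>I. W i (x i) * indicator (A i) (x i))"
        by (simp add: prod.distrib)
    qed
    also have "\<dots> = (\<Prod>i\<in>I. \<integral>\<^sup>+x. W i x * indicator (A i) x \<partial>M i)"
      using I by (intro M.product_nn_integral_prod) measurable
    also have "\<dots> = (\<Prod>i\<in>I. emeasure (density (M i) (W i)) (A i))"
      using A by (intro prod.cong refl emeasure_density[symmetric]) auto
    finally show "emeasure (density (PiM I M) (\<lambda>x. \<Prod>i\<in>I. W i (x i))) (Pi\<^sub>E I A) =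
        (\<Prod>i\<in>I. emeasure (density (M i) (W i)) (A i))" .
  qed
qed

lemma emeasure_PiM_le_1:
  assumes "\<And>i. i \<in> I \<Longrightarrow> a i \<le> (1::ennreal)"
  shows "(\<Prod>i\<in>I. a i) \<le> 1"
  using assms by (induction I rule: infinite_finite_induct) (auto intro: mult_le_one)

text \<open>On boxes the product measure is a finite product of measurable functions, and boxes
  generate. The subprobability property is asked for every index, inside \<open>I\<close> or not,
  because \<open>product_sigma_finite\<close> quantifies over all of them.\<close>

lemma measurable_PiM_subprob:
  assumes I: "finite I" and K: "\<And>i. i \<in> I \<Longrightarrow> K i \<in> measurable M (subprob_algebra (N i))"
    and sub: "\<And>i w. w \<in> space M \<Longrightarrow> subprob_space (K i w)"
  shows "(\<lambda>w. \<Pi>\<^sub>M i\<in>I. K i w) \<in> measurable M (subprob_algebra (PiM I N))"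
proof (rule measurable_subprob_algebra_generated[OF sets_PiM Int_stable_prod_algebra prod_algebra_sets_into_space])
  fix w assume w: "w \<in> space M"
  interpret subprob_space "K i w" for i by (rule sub[OF w])
  interpret product_sigma_finite "\<lambda>i. K i w" by unfold_locales
  show sets: "sets (\<Pi>\<^sub>M i\<in>I. K i w) = sets (PiM I N)"
    using K w by (intro sets_PiM_cong refl sets_kernel) auto
  show "subprob_space (\<Pi>\<^sub>M i\<in>I. K i w)"
  proof (rule subprob_spaceI)
    show "space (\<Pi>\<^sub>M i\<in>I. K i w) \<noteq> {}"
      by (simp add: space_PiM PiE_eq_empty_iff subprob_not_empty)
    have "emeasure (\<Pi>\<^sub>M i\<in>I. K i w) (\<Pi>\<^sub>E i\<in>I. space (K i w)) = (\<Prod>i\<in>I. emeasure (K i w) (space (K i w)))"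
      using I by (intro emeasure_PiM) auto
    then show "emeasure (\<Pi>\<^sub>M i\<in>I. K i w) (space (\<Pi>\<^sub>M i\<in>I. K i w)) \<le> 1"
      by (simp add: space_PiM emeasure_PiM_le_1 emeasure_space_le_1)
  qed
next
  have box: "(\<lambda>w. emeasure (\<Pi>\<^sub>M i\<in>I. K i w) (Pi\<^sub>E I A)) \<in> borel_measurable M"
    if A: "\<And>i. i \<in> I \<Longrightarrow> A i \<in> sets (N i)" for A
  proof -
    have "emeasure (\<Pi>\<^sub>M i\<in>I. K i w) (Pi\<^sub>E I A) = (\<Prod>i\<in>I. emeasure (K i w) (A i))" if w: "w \<in> space M" for w
    proof -
      interpret subprob_space "K i w" for i by (rule sub[OF w])
      interpret product_sigma_finite "\<lambda>i. K i w" by unfold_locales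
      show ?thesis using A sets_kernel[OF K w] by (intro emeasure_PiM I) auto
    qed
    moreover have "(\<lambda>w. \<Prod>i\<in>I. emeasure (K i w) (A i)) \<in> borel_measurable M"
      using K A by (intro borel_measurable_prod_ennreal measurable_emeasure_kernel) auto
    ultimately show ?thesis by (simp cong: measurable_cong)
  qed
  show "(\<lambda>w. emeasure (\<Pi>\<^sub>M i\<in>I. K i w) X) \<in> borel_measurable M" if "X \<in> prod_algebra I N" for X
    using that box I by (auto simp: prod_algebra_eq_finite)
  show "(\<lambda>w. emeasure (\<Pi>\<^sub>M i\<in>I. K i w) (\<Pi>\<^sub>E i\<in>I. space (N i))) \<in> borel_measurable M"
    by (rule box) auto
qed

lemma has_cond_law_map:
  assumes law: "has_cond_law M V MV W MW K" and f[measurable]: "f \<in> measurable MV MV'"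
  shows "has_cond_law M (\<lambda>x. f (V x)) MV' W MW (\<lambda>w. distr (K w) MV' f)"
proof -
  have V: "V \<in> measurable M MV" "W \<in> measurable M MW" and sK: "\<And>w. w \<in> space MW \<Longrightarrow> sets (K w) = sets MV"
    and mK: "\<And>B. B \<in> sets MV \<Longrightarrow> (\<lambda>w. emeasure (K w) B) \<in> borel_measurable MW"
    and AE_K: "AE w in distr M MW W. prob_space (K w)"
    and eq: "\<And>A B. A \<in> sets MW \<Longrightarrow> B \<in> sets MV \<Longrightarrow> emeasure M {\<omega>\<in>space M. W \<omega> \<in> A \<and> V \<omega> \<in> B}
          = (\<integral>\<^sup>+w. emeasure (K w) B * indicator A w \<partial>(distr M MW W))"
    using law unfolding has_cond_law_def by blast+
  have fK: "f \<in> measurable (K w) MV'" if "w \<in> space MW" for w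
    using f by (simp add: measurable_cong_sets[OF sK[OF that] refl])
  have em: "emeasure (distr (K w) MV' f) B = emeasure (K w) (f -` B \<inter> space MV)"
    if "w \<in> space MW" "B \<in> sets MV'" for w B
    using that fK sets_eq_imp_space_eq[OF sK] by (simp add: emeasure_distr)
  have vB: "f -` B \<inter> space MV \<in> sets MV" if "B \<in> sets MV'" for B
    using that by measurable
  show ?thesis
    unfolding has_cond_law_def
  proof (intro conjI ballI)
    show "(\<lambda>x. f (V x)) \<in> measurable M MV'" "W \<in> measurable M MW" using V by measurable
    show "(\<lambda>w. emeasure (distr (K w) MV' f) B) \<in> borel_measurable MW" if "B \<in> sets MV'" for B
      using mK[OF vB[OF that]] by (rule measurable_cong[THEN iffD1, rotated]) (simp add: em that)
    show "AE w in distr M MW W. prob_space (distr (K w) MV' f)"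
      using AE_K AE_space
    proof eventually_elim
      case (elim w)
      then show ?case using fK by (intro prob_space.prob_space_distr) auto
    qed
    fix A B assume A: "A \<in> sets MW" and B: "B \<in> sets MV'"
    have "{\<omega>\<in>space M. W \<omega> \<in> A \<and> f (V \<omega>) \<in> B} = {\<omega>\<in>space M. W \<omega> \<in> A \<and> V \<omega> \<in> f -` B \<inter> space MV}"
      using measurable_space[OF V(1)] by auto
    then show "emeasure M {\<omega>\<in>space M. W \<omega> \<in> A \<and> f (V \<omega>) \<in> B}
        = (\<integral>\<^sup>+w. emeasure (distr (K w) MV' f) B * indicator A w \<partial>(distr M MW W))"
      using eq[OF A vB[OF B]] by (auto simp: em B intro!: nn_integral_cong)
  qed simp
qed

lemma has_cond_law_cong:
  assumes law: "has_cond_law M V MV W MW K"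
    and V: "\<And>x. x \<in> space M \<Longrightarrow> V x = V' x" and K: "\<And>w. w \<in> space MW \<Longrightarrow> K w = K' w"
  shows "has_cond_law M V' MV W MW K'"
proof -
  have "V' \<in> measurable M MV" using law V measurable_cong[of M V V' MV] by (simp add: has_cond_law_def)
  moreover have "(\<lambda>w. emeasure (K' w) B) \<in> borel_measurable MW" if "B \<in> sets MV" for B
    using law that K measurable_cong[of MW "\<lambda>w. emeasure (K w) B" "\<lambda>w. emeasure (K' w) B" borel]
    by (simp add: has_cond_law_def)
  moreover have "AE w in distr M MW W. prob_space (K' w)"
  proof -
    have "AE w in distr M MW W. prob_space (K w)" using law by (simp add: has_cond_law_def)
    then show ?thesis using AE_space by eventually_elim (simp add: K)
  qed
  moreover have "{\<omega>\<in>space M. W \<omega> \<in> A \<and> V' \<omega> \<in> B} = {\<omega>\<in>space M. W \<omega> \<in> A \<and> V \<omega> \<in> B}" for A B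
    using V by auto
  moreover have "(\<integral>\<^sup>+w. emeasure (K' w) B * indicator A w \<partial>(distr M MW W)) =
      (\<integral>\<^sup>+w. emeasure (K w) B * indicator A w \<partial>(distr M MW W))" for A B
    by (intro nn_integral_cong) (simp add: K)
  ultimately show ?thesis
    using law K unfolding has_cond_law_def by simp
qed

section \<open>Jump kernels and their disintegration\<close>

lemma space_jump_space[simp]: "space jump_space = {0<..}"
  by (simp add: jump_space_def space_restrict_space)

lemma measurable_jump_space_real[measurable]: "(\<lambda>s. s) \<in> borel_measurable jump_space"
  unfolding jump_space_def by (intro measurable_restrict_space1) simp

lemma measurable_jump_ident[measurable (raw)]: "f \<in> measurable M jump_space \<Longrightarrow> f \<in> borel_measurable M"
  using measurable_compose[OF _ measurable_jump_space_real] by simp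

text \<open>By finiteness of \<open>\<kappa>\<^sub>1\<close>, each \<open>\<rho>(\<cdot>|y)\<close> is finite on sets of jumps that are bounded and bounded away
  from 0.\<close>

definition jump_level :: "nat \<Rightarrow> real set" where
  "jump_level i = {s. 0 < s \<and> real i \<le> max s (1 / s) \<and> max s (1 / s) < real (Suc i)}"

lemma sets_jump_level: "jump_level i \<in> sets jump_space"
proof -
  have "{s\<in>space jump_space. real i \<le> max s (1 / s) \<and> max s (1 / s) < real (Suc i)} \<in> sets jump_space"
    by measurable
  also have "{s\<in>space jump_space. real i \<le> max s (1 / s) \<and> max s (1 / s) < real (Suc i)} = jump_level i"
    by (auto simp: jump_level_def)
  finally show ?thesis .
qed

lemma disjoint_jump_level: "disjoint_family jump_level"
  unfolding disjoint_family_on_def jump_level_def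
proof (intro ballI impI equals0I)
  fix i j :: nat and s :: real assume "i \<noteq> j" and
    s: "s \<in> {s. 0 < s \<and> real i \<le> max s (1 / s) \<and> max s (1 / s) < real (Suc i)} \<inter>
      {s. 0 < s \<and> real j \<le> max s (1 / s) \<and> max s (1 / s) < real (Suc j)}"
  then have "real i < real (Suc j)" "real j < real (Suc i)" by auto
  then show False using \<open>i \<noteq> j\<close> by simp
qed

lemma Union_jump_level: "(\<Union>i. jump_level i) = space jump_space"
proof (intro subset_antisym subsetI)
  fix s assume "s \<in> space jump_space"
  then have "0 < s" "0 \<le> max s (1 / s)" by (auto simp: max_def)
  then have "s \<in> jump_level (nat \<lfloor>max s (1 / s)\<rfloor>)"
    unfolding jump_level_def using of_nat_floor[of "max s (1 / s)"]
    by (auto simp del: max_less_iff_conj) linarith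
  then show "s \<in> (\<Union>i. jump_level i)" by blast
qed (auto simp: jump_level_def)

text \<open>The levels do not depend on \<open>y\<close>, so one countable partition makes every
  \<open>\<rho> y\<close> finite on its parts; measurability of kernel integrals rests on this
  uniform sigma-finiteness.\<close>

definition jump_kernel :: "('y::polish_space \<Rightarrow> real measure) \<Rightarrow> bool" where
  "jump_kernel \<rho> \<longleftrightarrow> (\<forall>y. sets (\<rho> y) = sets jump_space) \<and>
     (\<forall>A\<in>sets jump_space. (\<lambda>y. emeasure (\<rho> y) A) \<in> borel_measurable borel) \<and>
     (\<forall>y i. emeasure (\<rho> y) (jump_level i) < \<infinity>)"

lemma jump_kernelD:
  assumes "jump_kernel \<rho>"
  shows "sets (\<rho> y) = sets jump_space" "space (\<rho> y) = {0<..}"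
    "A \<in> sets jump_space \<Longrightarrow> (\<lambda>y. emeasure (\<rho> y) A) \<in> borel_measurable borel"
    "emeasure (\<rho> y) (jump_level i) < \<infinity>"
proof -
  show s: "sets (\<rho> y) = sets jump_space" using assms unfolding jump_kernel_def by blast
  show "space (\<rho> y) = {0<..}" using sets_eq_imp_space_eq[OF s] by simp
  show "A \<in> sets jump_space \<Longrightarrow> (\<lambda>y. emeasure (\<rho> y) A) \<in> borel_measurable borel"
    "emeasure (\<rho> y) (jump_level i) < \<infinity>" using assms unfolding jump_kernel_def by blast+
qed

lemma measurable_jump_kernel:
  assumes rho: "jump_kernel \<rho>" and F: "(\<lambda>(w, s). F w s) \<in> borel_measurable (M \<Otimes>\<^sub>M jump_space)"
    and Y: "Y \<in> borel_measurable M"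
  shows "(\<lambda>w. \<integral>\<^sup>+s. F w s \<partial>\<rho> (Y w)) \<in> borel_measurable M"
proof (rule nn_integral_kernel_measurable[OF _ _ sets_jump_level disjoint_jump_level Union_jump_level _ F])
  show "(\<lambda>w. emeasure (\<rho> (Y w)) A) \<in> borel_measurable M" if "A \<in> sets jump_space" for A
    by (rule measurable_compose[OF Y jump_kernelD(3)[OF rho that]])
qed (use jump_kernelD[OF rho] in auto)

context
  fixes \<rho> :: "'y::polish_space \<Rightarrow> real measure" and \<eta> :: "'y measure"
  assumes rho: "jump_kernel \<rho>" and eta: "sets \<eta> = sets borel"
begin

lemma sets_intensity: "sets (intensity \<rho> \<eta>) = sets (jump_loc_space :: (real \<times> 'y) measure)"
  by (simp add: intensity_def)

text \<open>The weight 1 casts \<open>intensity\<close> as a mixture in the sense of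
  \<open>nn_integral_mixture\<close>.\<close>

lemma intensity_mixture:
  "(\<lambda>y. \<integral>\<^sup>+s. 1 * f (s, y) \<partial>\<rho> y) \<in> borel_measurable \<eta>" if "f \<in> borel_measurable jump_loc_space"
  unfolding measurable_cong_sets[OF eta refl]
proof (rule measurable_jump_kernel[OF rho])
  show "(\<lambda>(y, s). 1 * f (s, y)) \<in> borel_measurable (borel \<Otimes>\<^sub>M jump_space)"
    using measurable_compose[OF measurable_pair_swap' that] by (simp add: case_prod_beta)
qed simp

lemma intensity_pair: "(\<lambda>s. (s, y)) \<in> measurable (\<rho> y) (jump_loc_space :: (real \<times> 'y) measure)"
  unfolding measurable_cong_sets[OF jump_kernelD(1)[OF rho] refl] by measurable

lemma intensity_eq: "intensity \<rho> \<eta> = measure_of (space jump_loc_space) (sets jump_loc_space)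
     (\<lambda>A. \<integral>\<^sup>+y. (\<integral>\<^sup>+s. 1 * indicator A (s, y) \<partial>\<rho> y) \<partial>\<eta>)"
  by (simp add: intensity_def)

lemma nn_integral_intensity:
  assumes "f \<in> borel_measurable jump_loc_space"
  shows "(\<integral>\<^sup>+z. f z \<partial>intensity \<rho> \<eta>) = (\<integral>\<^sup>+y. \<integral>\<^sup>+s. f (s, y) \<partial>\<rho> y \<partial>\<eta>)"
  using nn_integral_mixture[OF intensity_mixture borel_measurable_const intensity_pair intensity_eq assms]
  by simp

end

locale jump_model =
  fixes \<eta> :: "'y::polish_space measure" and \<rho> :: "'y \<Rightarrow> real measure" and g :: "'y \<Rightarrow> real"
  assumes eta: "sets \<eta> = sets borel" "sigma_finite_measure \<eta>"
    and rho: "\<And>y. sets (\<rho> y) = sets jump_space"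
      "\<And>A. A \<in> sets jump_space \<Longrightarrow> (\<lambda>y. emeasure (\<rho> y) A) \<in> borel_measurable borel"
    and g: "g \<in> borel_measurable borel" "\<And>y. 0 \<le> g y"
    and kappa_finite: "\<And>l y. 1 \<le> l \<Longrightarrow> kappa g \<rho> l y < \<infinity>"
begin

text \<open>Markov's inequality: the integrand of \<open>kappa\<close> of order 1 is bounded away
  from 0 on each level, and its integral is finite.\<close>

lemma jump_kernel: "jump_kernel \<rho>"
  unfolding jump_kernel_def
proof (intro conjI allI ballI)
  fix y i
  \<comment> \<open>On level \<open>i\<close> every jump lies between \<open>1 / Suc i\<close> and
    \<open>Suc i\<close>, so \<open>?c\<close> bounds \<open>s * exp (- (g y * s))\<close> from
    below.\<close>
  let ?c = "1 / real (Suc i) * exp (- (g y * real (Suc i)))"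
  have "ennreal ?c * emeasure (\<rho> y) (jump_level i) = (\<integral>\<^sup>+s. ennreal ?c * indicator (jump_level i) s \<partial>\<rho> y)"
    using sets_jump_level[of i] rho(1) by (subst nn_integral_cmult_indicator) auto
  also have "\<dots> \<le> (\<integral>\<^sup>+s. ennreal (s ^ 1 * exp (- (g y * s))) \<partial>\<rho> y)"
  proof (rule nn_integral_mono)
    fix s
    show "ennreal ?c * indicator (jump_level i) s \<le> ennreal (s ^ 1 * exp (- (g y * s)))"
    proof (cases "s \<in> jump_level i")
      case True
      then have s: "0 < s" "s < real (Suc i)" "1 / s < real (Suc i)" by (auto simp: jump_level_def)
      then have "1 / real (Suc i) \<le> s" by (simp add: field_simps del: of_nat_Suc)
      moreover have "exp (- (g y * real (Suc i))) \<le> exp (- (g y * s))"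
        using s g(2)[of y] by (simp add: mult_left_mono del: of_nat_Suc)
      ultimately have "?c \<le> s ^ 1 * exp (- (g y * s))"
        using s by (intro mult_mono) auto
      then show ?thesis using True by (simp add: ennreal_leI)
    qed simp
  qed
  also have "\<dots> < \<infinity>" using kappa_finite[of 1 y] by (simp add: kappa_def)
  finally have "ennreal ?c * emeasure (\<rho> y) (jump_level i) < \<infinity>" .
  moreover have "0 < ?c" by simp
  ultimately show "emeasure (\<rho> y) (jump_level i) < \<infinity>"
    by (auto simp: ennreal_mult_less_top simp del: of_nat_Suc)
qed (use rho in auto)

lemmas space_rho = jump_kernelD(2)[OF jump_kernel]

lemma measurable_weight_y:
  "(\<lambda>s. ennreal (s ^ e * exp (- (g y * s)))) \<in> borel_measurable (\<rho> y)"
  unfolding measurable_cong_sets[OF rho(1) refl] by measurable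

lemma measurable_kappa[measurable]: "kappa g \<rho> e \<in> borel_measurable borel"
  unfolding kappa_def by (rule measurable_jump_kernel[OF jump_kernel]) (use g(1) in measurable)

lemma jump_kernel_tilt: "jump_kernel (\<lambda>y. density (\<rho> y) (\<lambda>s. ennreal (exp (- (g y * s)))))"
  unfolding jump_kernel_def
proof (intro conjI allI ballI)
  have m: "(\<lambda>s. ennreal (exp (- (g y * s)))) \<in> borel_measurable (\<rho> y)" for y
    using measurable_weight_y[of 0 y] by simp
  have em: "emeasure (density (\<rho> y) (\<lambda>s. ennreal (exp (- (g y * s))))) A =
      (\<integral>\<^sup>+s. ennreal (exp (- (g y * s))) * indicator A s \<partial>\<rho> y)" if "A \<in> sets jump_space" for y A
    using m that by (intro emeasure_density) (simp_all add: rho)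
  show "(\<lambda>y. emeasure (density (\<rho> y) (\<lambda>s. ennreal (exp (- (g y * s))))) A) \<in> borel_measurable borel"
    if A[measurable]: "A \<in> sets jump_space" for A
    unfolding em[OF A] by (rule measurable_jump_kernel[OF jump_kernel]) (use g(1) in measurable)
  fix y i
  have "(\<integral>\<^sup>+s. ennreal (exp (- (g y * s))) * indicator (jump_level i) s \<partial>\<rho> y) \<le> (\<integral>\<^sup>+s. indicator (jump_level i) s \<partial>\<rho> y)"
    using g(2) by (intro nn_integral_mono) (auto simp: indicator_def jump_level_def)
  also have "\<dots> < \<infinity>"
    using sets_jump_level[of i] jump_kernelD(4)[OF jump_kernel] by (simp add: rho)
  finally show "emeasure (density (\<rho> y) (\<lambda>s. ennreal (exp (- (g y * s))))) (jump_level i) < \<infinity>"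
    by (simp add: em sets_jump_level)
qed (simp add: rho)

abbreviation \<nu>\<^sub>f :: "(real \<times> 'y) measure" where
  "\<nu>\<^sub>f \<equiv> density (intensity \<rho> \<eta>) (\<lambda>(s, y). ennreal (exp (- (g y * s))))"

lemma measurable_tilt[measurable]: "(\<lambda>(s, y). ennreal (exp (- (g y * s)))) \<in> borel_measurable jump_loc_space"
  using g(1) by measurable

lemma sets_\<nu>: "sets (intensity \<rho> \<eta>) = sets jump_loc_space"
  by (rule sets_intensity[OF jump_kernel eta(1)])

lemma nn_integral_\<nu>f:
  assumes f[measurable]: "f \<in> borel_measurable jump_loc_space"
  shows "(\<integral>\<^sup>+z. f z \<partial>\<nu>\<^sub>f) = (\<integral>\<^sup>+y. \<integral>\<^sup>+s. ennreal (exp (- (g y * s))) * f (s, y) \<partial>\<rho> y \<partial>\<eta>)"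
proof -
  have "(\<integral>\<^sup>+z. f z \<partial>\<nu>\<^sub>f) = (\<integral>\<^sup>+z. (case z of (s, y) \<Rightarrow> ennreal (exp (- (g y * s)))) * f z \<partial>intensity \<rho> \<eta>)"
    by (rule nn_integral_density) (simp_all add: measurable_cong_sets[OF sets_\<nu> refl])
  also have "\<dots> = (\<integral>\<^sup>+y. \<integral>\<^sup>+s. ennreal (exp (- (g y * s))) * f (s, y) \<partial>\<rho> y \<partial>\<eta>)"
    by (subst nn_integral_intensity[OF jump_kernel eta(1)]) simp_all
  finally show ?thesis .
qed

lemma \<nu>f_eq_intensity: "\<nu>\<^sub>f = intensity (\<lambda>y. density (\<rho> y) (\<lambda>s. ennreal (exp (- (g y * s))))) \<eta>"
proof (rule measure_eqI)
  let ?\<rho> = "\<lambda>y. density (\<rho> y) (\<lambda>s. ennreal (exp (- (g y * s))))"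
  show "sets \<nu>\<^sub>f = sets (intensity ?\<rho> \<eta>)"
    by (simp add: sets_\<nu> sets_intensity[OF jump_kernel_tilt eta(1)])
  fix A assume "A \<in> sets \<nu>\<^sub>f"
  then have A[measurable]: "A \<in> sets jump_loc_space" by (simp add: sets_\<nu>)
  have "emeasure \<nu>\<^sub>f A = (\<integral>\<^sup>+z. indicator A z \<partial>\<nu>\<^sub>f)" using A by (simp add: sets_\<nu>)
  also have "\<dots> = (\<integral>\<^sup>+y. \<integral>\<^sup>+s. ennreal (exp (- (g y * s))) * indicator A (s, y) \<partial>\<rho> y \<partial>\<eta>)"
    by (rule nn_integral_\<nu>f) measurable
  also have "\<dots> = (\<integral>\<^sup>+y. \<integral>\<^sup>+s. indicator A (s, y) \<partial>?\<rho> y \<partial>\<eta>)"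
  proof (intro nn_integral_cong nn_integral_density[symmetric])
    fix y
    show "(\<lambda>s. ennreal (exp (- (g y * s)))) \<in> borel_measurable (\<rho> y)"
      using measurable_weight_y[of 0 y] by simp
    show "(\<lambda>s. indicator A (s, y)) \<in> borel_measurable (\<rho> y)"
      unfolding measurable_cong_sets[OF rho(1) refl] by measurable
  qed
  also have "\<dots> = (\<integral>\<^sup>+z. indicator A z \<partial>intensity ?\<rho> \<eta>)"
    by (rule nn_integral_intensity[OF jump_kernel_tilt eta(1), symmetric]) measurable
  also have "\<dots> = emeasure (intensity ?\<rho> \<eta>) A"
    using A by (simp add: sets_intensity[OF jump_kernel_tilt eta(1)])
  finally show "emeasure \<nu>\<^sub>f A = emeasure (intensity ?\<rho> \<eta>) A" .
qed

lemma sets_jump_law: "sets (jump_law g \<rho> e y) = sets jump_space"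
  by (simp add: jump_law_def rho)

lemma space_jump_law[simp]: "space (jump_law g \<rho> e y) = {0<..}"
  using sets_eq_imp_space_eq[OF sets_jump_law] by simp

lemma nn_integral_jump_law:
  assumes F: "F \<in> borel_measurable jump_space"
  shows "(\<integral>\<^sup>+s. F s \<partial>jump_law g \<rho> e y) = (\<integral>\<^sup>+s. ennreal (s ^ e * exp (- (g y * s))) * F s \<partial>\<rho> y) / kappa g \<rho> e y"
proof -
  have F': "F \<in> borel_measurable (\<rho> y)" using F by (simp add: measurable_cong_sets[OF rho(1) refl])
  have "(\<integral>\<^sup>+s. F s \<partial>jump_law g \<rho> e y) = (\<integral>\<^sup>+s. ennreal (s ^ e * exp (- (g y * s))) / kappa g \<rho> e y * F s \<partial>\<rho> y)"
    unfolding jump_law_def using F' measurable_weight_y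
    by (intro nn_integral_density borel_measurable_divide_ennreal) auto
  also have "\<dots> = (\<integral>\<^sup>+s. ennreal (s ^ e * exp (- (g y * s))) * F s / kappa g \<rho> e y \<partial>\<rho> y)"
    by (simp add: divide_ennreal_def ac_simps)
  also have "\<dots> = (\<integral>\<^sup>+s. ennreal (s ^ e * exp (- (g y * s))) * F s \<partial>\<rho> y) / kappa g \<rho> e y"
    using F' measurable_weight_y by (intro nn_integral_divide borel_measurable_times_ennreal)
  finally show ?thesis .
qed

lemma emeasure_jump_law_space: "emeasure (jump_law g \<rho> e y) {0<..} = kappa g \<rho> e y / kappa g \<rho> e y"
proof -
  have "emeasure (jump_law g \<rho> e y) (space (jump_law g \<rho> e y)) = (\<integral>\<^sup>+s. 1 \<partial>jump_law g \<rho> e y)" by simp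
  also have "\<dots> = kappa g \<rho> e y / kappa g \<rho> e y"
    by (subst nn_integral_jump_law) (simp_all add: kappa_def)
  finally show ?thesis by simp
qed

text \<open>The total mass is \<open>kappa / kappa\<close>, which in \<open>ennreal\<close> is 0 if
  \<open>kappa\<close> is 0 or infinite and 1 otherwise. So the jump law is a subprobability for
  every \<open>y\<close>, and a kernel without exceptional set.\<close>

lemma subprob_space_jump_law: "subprob_space (jump_law g \<rho> e y)"
proof (rule subprob_spaceI)
  have "(a::ennreal) / a \<le> 1" for a
    by (cases "a = 0 \<or> a = \<infinity>") (auto simp: less_top)
  then show "emeasure (jump_law g \<rho> e y) (space (jump_law g \<rho> e y)) \<le> 1"
    by (simp add: emeasure_jump_law_space)
qed auto

lemma prob_space_jump_law: "1 \<le> e \<Longrightarrow> kappa g \<rho> e y \<noteq> 0 \<Longrightarrow> prob_space (jump_law g \<rho> e y)"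
  using kappa_finite[of e y] by (intro prob_spaceI) (simp add: emeasure_jump_law_space)

lemma measurable_jump_law[measurable]: "jump_law g \<rho> e \<in> measurable borel (subprob_algebra jump_space)"
proof (rule measurable_subprob_algebra)
  fix A assume A[measurable]: "A \<in> sets jump_space"
  have "emeasure (jump_law g \<rho> e y) A = (\<integral>\<^sup>+s. ennreal (s ^ e * exp (- (g y * s))) * indicator A s \<partial>\<rho> y) / kappa g \<rho> e y" for y
    by (subst nn_integral_jump_law[symmetric]) (simp_all add: sets_jump_law)
  moreover have "(\<lambda>y. \<integral>\<^sup>+s. ennreal (s ^ e * exp (- (g y * s))) * indicator A s \<partial>\<rho> y) \<in> borel_measurable borel"
    by (rule measurable_jump_kernel[OF jump_kernel]) (use g(1) in measurable)
  ultimately show "(\<lambda>y. emeasure (jump_law g \<rho> e y) A) \<in> borel_measurable borel" by simp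
qed (rule subprob_space_jump_law, rule sets_jump_law)

text \<open>Bayes' rule for one point: the measure with density
  \<open>s ^ e * exp (- (g y * s))\<close> over \<open>\<rho> y\<close> is \<open>kappa\<close>
  times the jump law, so \<open>kappa\<close> can be handed over to the measure of the
  location.\<close>

lemma nn_integral_disintegrate:
  assumes e: "1 \<le> e" and u[measurable]: "u \<in> borel_measurable borel" and F[measurable]: "F \<in> borel_measurable jump_loc_space"
  shows "(\<integral>\<^sup>+z. F z \<partial>density \<nu>\<^sub>f (\<lambda>(s, y). u y * ennreal (s ^ e))) =
    (\<integral>\<^sup>+y. \<integral>\<^sup>+s. F (s, y) \<partial>jump_law g \<rho> e y \<partial>density \<eta> (\<lambda>y. u y * kappa g \<rho> e y))"
proof -
  note eta(1)[measurable_cong]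
  have Fy: "(\<lambda>s. F (s, y)) \<in> borel_measurable jump_space" for y by measurable
  have w: "(\<lambda>(s, y). u y * ennreal (s ^ e)) \<in> borel_measurable jump_loc_space" by measurable
  have "(\<integral>\<^sup>+z. F z \<partial>density \<nu>\<^sub>f (\<lambda>(s, y). u y * ennreal (s ^ e))) =
      (\<integral>\<^sup>+z. (case z of (s, y) \<Rightarrow> u y * ennreal (s ^ e)) * F z \<partial>\<nu>\<^sub>f)"
    by (rule nn_integral_density) (simp_all add: measurable_cong_sets[OF sets_\<nu> refl] w)
  also have "\<dots> = (\<integral>\<^sup>+y. \<integral>\<^sup>+s. ennreal (exp (- (g y * s))) * (u y * ennreal (s ^ e) * F (s, y)) \<partial>\<rho> y \<partial>\<eta>)"
    using w by (subst nn_integral_\<nu>f) simp_all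
  also have "\<dots> = (\<integral>\<^sup>+y. u y * kappa g \<rho> e y * (\<integral>\<^sup>+s. F (s, y) \<partial>jump_law g \<rho> e y) \<partial>\<eta>)"
  proof (rule nn_integral_cong)
    fix y
    let ?I = "\<integral>\<^sup>+s. ennreal (s ^ e * exp (- (g y * s))) * F (s, y) \<partial>\<rho> y"
    have Fy': "(\<lambda>s. F (s, y)) \<in> borel_measurable (\<rho> y)"
      using Fy by (simp add: measurable_cong_sets[OF rho(1) refl])
    have m: "(\<lambda>s. ennreal (s ^ e * exp (- (g y * s))) * F (s, y)) \<in> borel_measurable (\<rho> y)"
      by (intro borel_measurable_times_ennreal measurable_weight_y Fy')
    have "(\<integral>\<^sup>+s. ennreal (exp (- (g y * s))) * (u y * ennreal (s ^ e) * F (s, y)) \<partial>\<rho> y) =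
        (\<integral>\<^sup>+s. u y * (ennreal (s ^ e * exp (- (g y * s))) * F (s, y)) \<partial>\<rho> y)"
      by (intro nn_integral_cong) (simp add: space_rho ennreal_mult ac_simps)
    also have "\<dots> = u y * ?I"
      by (rule nn_integral_cmult[OF m])
    also have "?I = kappa g \<rho> e y * (?I / kappa g \<rho> e y)"
    \<comment> \<open>Dividing by \<open>kappa\<close> loses nothing where it vanishes: the
      integrand is then 0 almost everywhere.\<close>
    proof (cases "kappa g \<rho> e y = 0")
      case True
      then have "AE s in \<rho> y. ennreal (s ^ e * exp (- (g y * s))) = 0"
        unfolding kappa_def by (subst (asm) nn_integral_0_iff_AE[OF measurable_weight_y])
      then have "AE s in \<rho> y. ennreal (s ^ e * exp (- (g y * s))) * F (s, y) = 0" by eventually_elim simp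
      then have "?I = 0" by (subst nn_integral_0_iff_AE[OF m])
      then show ?thesis using True by simp
    next
      case False
      then show ?thesis using kappa_finite[OF e, of y]
        by (simp add: ennreal_times_divide mult.commute[of _ ?I] ennreal_mult_divide_eq less_top)
    qed
    also have "?I / kappa g \<rho> e y = (\<integral>\<^sup>+s. F (s, y) \<partial>jump_law g \<rho> e y)"
      by (rule nn_integral_jump_law[OF Fy, symmetric])
    finally show "(\<integral>\<^sup>+s. ennreal (exp (- (g y * s))) * (u y * ennreal (s ^ e) * F (s, y)) \<partial>\<rho> y) =
        u y * kappa g \<rho> e y * (\<integral>\<^sup>+s. F (s, y) \<partial>jump_law g \<rho> e y)" by (simp add: mult.assoc)
  qed
  also have "\<dots> = (\<integral>\<^sup>+y. \<integral>\<^sup>+s. F (s, y) \<partial>jump_law g \<rho> e y \<partial>density \<eta> (\<lambda>y. u y * kappa g \<rho> e y))"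
  proof (rule nn_integral_density[symmetric])
    show "(\<lambda>y. \<integral>\<^sup>+s. F (s, y) \<partial>jump_law g \<rho> e y) \<in> borel_measurable \<eta>"
      unfolding measurable_cong_sets[OF eta(1) refl]
      by (rule nn_integral_measurable_subprob_algebra2[OF _ measurable_jump_law])
        (use measurable_compose[OF measurable_pair_swap' F] in \<open>simp add: case_prod_beta\<close>)
  qed measurable
  finally show ?thesis .
qed

end

context jump_model begin

text \<open>The partition is a separate parameter, so that it can be held fixed while the locations
  vary; in \<open>latent_law\<close> it is \<open>ties n Y\<close>.\<close>

definition latent_jumps :: "nat set set \<Rightarrow> (nat \<Rightarrow> 'y) \<Rightarrow> (nat set \<Rightarrow> real) measure" where
  "latent_jumps p Y = (\<Pi>\<^sub>M C\<in>p. jump_law g \<rho> (card C) (Y (Min C)))"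

lemma sets_latent_jumps[measurable_cong]: "sets (latent_jumps p Y) = sets (\<Pi>\<^sub>M C\<in>p. jump_space)"
  unfolding latent_jumps_def by (intro sets_PiM_cong refl sets_jump_law)

lemma space_latent_jumps: "space (latent_jumps p Y) = (\<Pi>\<^sub>E C\<in>p. {0<..})"
  using sets_eq_imp_space_eq[OF sets_latent_jumps] by (simp add: space_PiM)

lemma measurable_latent_jumps:
  assumes p: "finite p" and Y: "\<And>C. C \<in> p \<Longrightarrow> (\<lambda>w. Y w (Min C)) \<in> borel_measurable M"
  shows "(\<lambda>w. latent_jumps p (Y w)) \<in> measurable M (subprob_algebra (\<Pi>\<^sub>M C\<in>p. jump_space))"
  unfolding latent_jumps_def
  by (intro measurable_PiM_subprob p subprob_space_jump_law measurable_compose[OF Y measurable_jump_law])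

lemma sigma_finite_\<nu>f: "sigma_finite_measure \<nu>\<^sub>f" if "sigma_finite_measure (intensity \<rho> \<eta>)"
proof (rule sigma_finite_density[OF that])
  show "(\<lambda>(s, y). ennreal (exp (- (g y * s)))) \<in> borel_measurable (intensity \<rho> \<eta>)"
    by (simp add: measurable_cong_sets[OF sets_\<nu> refl])
qed auto

text \<open>The product of the one-point disintegrations. Locations are indexed by representatives
  and jumps by blocks, hence the bijection \<open>\<beta>\<close>. Both sides are integrals against
  measures on the same product space, and on boxes each of them factors over the indices.\<close>

lemma PiM_disintegrate:
  fixes I :: "nat set" and p :: "nat set set" and e :: "nat \<Rightarrow> nat" and u :: "nat \<Rightarrow> 'y \<Rightarrow> ennreal"
  assumes \<nu>: "sigma_finite_measure (intensity \<rho> \<eta>)"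
    and I: "finite I" and p: "bij_betw \<beta> I p" "\<And>c. c \<in> I \<Longrightarrow> Min (\<beta> c) = c" "\<And>c. c \<in> I \<Longrightarrow> card (\<beta> c) = e c"
    and e: "\<And>c. 1 \<le> e c" and u[measurable]: "\<And>c. u c \<in> borel_measurable borel" and u_fin: "\<And>c y. u c y < \<infinity>"
    and F[measurable]: "F \<in> borel_measurable (\<Pi>\<^sub>M c\<in>I. jump_loc_space)"
  shows "(\<integral>\<^sup>+z. F z \<partial>(\<Pi>\<^sub>M c\<in>I. density \<nu>\<^sub>f (\<lambda>(s, y). u c y * ennreal (s ^ e c)))) =
    (\<integral>\<^sup>+y. \<integral>\<^sup>+s. F (\<lambda>c\<in>I. (s (\<beta> c), y c)) \<partial>latent_jumps p y \<partial>(\<Pi>\<^sub>M c\<in>I. density \<eta> (\<lambda>y. u c y * kappa g \<rho> (e c) y)))"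
proof -
  let ?B = "\<lambda>c. density \<nu>\<^sub>f (\<lambda>(s, y). u c y * ennreal (s ^ e c))"
  let ?b = "\<lambda>c. density \<eta> (\<lambda>y. u c y * kappa g \<rho> (e c) y)"
  note eta(1)[measurable_cong]
  have sB: "sets (?B c) = sets (jump_loc_space :: (real \<times> 'y) measure)" for c by (simp add: sets_\<nu>)
  have sb: "sets (?b c) = sets borel" for c by (simp add: eta)
  have sPb[measurable_cong]: "sets (PiM I ?b) = sets (\<Pi>\<^sub>M c\<in>I. borel)" by (intro sets_PiM_cong refl sb)
  have fin_p: "finite p" using I p(1) bij_betw_finite by blast
  have Min_p: "Min C \<in> I" "\<beta> (Min C) = C" if "C \<in> p" for C
    using that p(1,2) by (auto simp: bij_betw_def)
  interpret B: product_sigma_finite ?B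
    unfolding product_sigma_finite_def
  proof
    fix c
    have "(\<lambda>(s, y). u c y * ennreal (s ^ e c)) \<in> borel_measurable jump_loc_space" by measurable
    then have m: "(\<lambda>(s, y). u c y * ennreal (s ^ e c)) \<in> borel_measurable \<nu>\<^sub>f"
      by (simp add: measurable_cong_sets[OF sets_\<nu> refl])
    show "sigma_finite_measure (?B c)"
      by (rule sigma_finite_density[OF sigma_finite_\<nu>f[OF \<nu>] m]) (use u_fin in \<open>auto simp: ennreal_mult_less_top\<close>)
  qed
  interpret b: product_sigma_finite ?b
    unfolding product_sigma_finite_def
  proof
    fix c
    have m: "(\<lambda>y. u c y * kappa g \<rho> (e c) y) \<in> borel_measurable \<eta>" by measurable
    show "sigma_finite_measure (?b c)"
      by (rule sigma_finite_density[OF eta(2) m])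
        (use u_fin kappa_finite[OF e] in \<open>simp add: ennreal_mult_less_top\<close>)
  qed
  interpret jl: subprob_space "jump_law g \<rho> (card C) (y (Min C))" for C and y :: "nat \<Rightarrow> 'y"
    by (rule subprob_space_jump_law)
  interpret jl: product_sigma_finite "\<lambda>C. jump_law g \<rho> (card C) (y (Min C))" for y :: "nat \<Rightarrow> 'y"
    by unfold_locales
  let ?T = "\<lambda>y s. \<lambda>c\<in>I. (s (\<beta> c), y c)"
  have \<beta>: "\<beta> c \<in> p" if "c \<in> I" for c using p(1) that by (auto simp: bij_betw_def)
  have T: "(\<lambda>(y, s). ?T y s) \<in> measurable ((\<Pi>\<^sub>M c\<in>I. borel) \<Otimes>\<^sub>M (\<Pi>\<^sub>M C\<in>p. jump_space)) (\<Pi>\<^sub>M c\<in>I. jump_loc_space :: (real \<times> 'y) measure)"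
    unfolding case_prod_beta
    by (intro measurable_restrict measurable_Pair measurable_compose[OF measurable_snd measurable_component_singleton]
        measurable_compose[OF measurable_fst measurable_component_singleton] \<beta>)
  have K: "(\<lambda>y. latent_jumps p y) \<in> measurable (PiM I ?b) (subprob_algebra (\<Pi>\<^sub>M C\<in>p. jump_space))"
    by (rule measurable_latent_jumps[OF fin_p]) (use Min_p in measurable)
  \<comment> \<open>\<open>D\<close> is the measure on families of points in which the locations are
    chosen first and the jumps given the locations.\<close>
  define D where "D = PiM I ?b \<bind> (\<lambda>y. distr (latent_jumps p y) (\<Pi>\<^sub>M c\<in>I. jump_loc_space :: (real \<times> 'y) measure) (?T y))"
  have KT: "(\<lambda>y. distr (latent_jumps p y) (\<Pi>\<^sub>M c\<in>I. jump_loc_space :: (real \<times> 'y) measure) (?T y))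
      \<in> measurable (PiM I ?b) (subprob_algebra (\<Pi>\<^sub>M c\<in>I. jump_loc_space))"
  proof (rule measurable_distr2[OF _ K])
    show "(\<lambda>(y, s). ?T y s) \<in> measurable (PiM I ?b \<Otimes>\<^sub>M (\<Pi>\<^sub>M C\<in>p. jump_space)) (\<Pi>\<^sub>M c\<in>I. jump_loc_space)"
      using T by (simp add: measurable_cong_sets[OF sets_pair_measure_cong[OF sPb refl] refl])
  qed
  have sp: "space (PiM I ?b) \<noteq> {}"
    using sets_eq_imp_space_eq[OF sPb] by (simp add: space_PiM PiE_eq_empty_iff)
  have nn_D: "(\<integral>\<^sup>+z. F z \<partial>D) = (\<integral>\<^sup>+y. \<integral>\<^sup>+s. F (?T y s) \<partial>latent_jumps p y \<partial>PiM I ?b)"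
    if F: "F \<in> borel_measurable (\<Pi>\<^sub>M c\<in>I. jump_loc_space)" for F
    unfolding D_def nn_integral_bind[OF F KT]
  proof (rule nn_integral_cong)
    fix y assume "y \<in> space (PiM I ?b)"
    then have y: "y \<in> space (\<Pi>\<^sub>M c\<in>I. borel)" using sets_eq_imp_space_eq[OF sPb] by simp
    have "?T y \<in> measurable (\<Pi>\<^sub>M C\<in>p. jump_space) (\<Pi>\<^sub>M c\<in>I. jump_loc_space)"
      using measurable_Pair2[OF T y] by simp
    then show "(\<integral>\<^sup>+z. F z \<partial>distr (latent_jumps p y) (\<Pi>\<^sub>M c\<in>I. jump_loc_space) (?T y)) = (\<integral>\<^sup>+s. F (?T y s) \<partial>latent_jumps p y)"
      using F by (intro nn_integral_distr) (simp_all add: measurable_cong_sets[OF sets_latent_jumps refl])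
  qed
  have "D = PiM I ?B"
  proof (rule B.PiM_eqI[OF I])
    have sD: "sets D = sets (\<Pi>\<^sub>M c\<in>I. jump_loc_space :: (real \<times> 'y) measure)"
      unfolding D_def using sp by (subst sets_bind) auto
    also have "\<dots> = sets (PiM I ?B)" by (intro sets_PiM_cong refl sB[symmetric])
    finally show "sets D = sets (PiM I ?B)" .
    fix A assume "\<And>c. c \<in> I \<Longrightarrow> A c \<in> sets (?B c)"
    then have A[measurable]: "\<And>c. c \<in> I \<Longrightarrow> A c \<in> sets jump_loc_space" using sB by simp
    have box[measurable]: "Pi\<^sub>E I A \<in> sets (\<Pi>\<^sub>M c\<in>I. jump_loc_space)" using I A by (intro sets_PiM_I_finite) auto
    have mA: "(\<lambda>s. indicator (A c) (s, y)) \<in> borel_measurable (jump_law g \<rho> e' y')" if "c \<in> I" for c y y' e'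
      unfolding measurable_cong_sets[OF sets_jump_law refl] using A[OF that] by measurable
    have "emeasure D (Pi\<^sub>E I A) = (\<integral>\<^sup>+z. indicator (Pi\<^sub>E I A) z \<partial>D)"
      by (rule nn_integral_indicator[symmetric]) (simp only: sD box)
    also have "\<dots> = (\<integral>\<^sup>+y. \<integral>\<^sup>+s. indicator (Pi\<^sub>E I A) (?T y s) \<partial>latent_jumps p y \<partial>PiM I ?b)"
      by (rule nn_D) measurable
    also have "\<dots> = (\<integral>\<^sup>+y. (\<Prod>c\<in>I. \<integral>\<^sup>+s. indicator (A c) (s, y c) \<partial>jump_law g \<rho> (e c) (y c)) \<partial>PiM I ?b)"
    proof (rule nn_integral_cong)
      fix y
      have "(\<integral>\<^sup>+s. indicator (Pi\<^sub>E I A) (?T y s) \<partial>latent_jumps p y) =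
          (\<integral>\<^sup>+s. (\<Prod>C\<in>p. indicator (A (Min C)) (s C, y (Min C))) \<partial>latent_jumps p y)"
      proof (rule nn_integral_cong)
        fix s
        have "indicator (Pi\<^sub>E I A) (?T y s) = (\<Prod>c\<in>I. indicator (A c) (s (\<beta> c), y c) :: ennreal)"
          using I by (auto simp: indicator_def PiE_def Pi_iff)
        also have "\<dots> = (\<Prod>c\<in>I. indicator (A (Min (\<beta> c))) (s (\<beta> c), y (Min (\<beta> c))))"
          by (simp add: p(2))
        also have "\<dots> = (\<Prod>C\<in>p. indicator (A (Min C)) (s C, y (Min C)))"
          by (rule prod.reindex_bij_betw[OF p(1)])
        finally show "indicator (Pi\<^sub>E I A) (?T y s) = (\<Prod>C\<in>p. indicator (A (Min C)) (s C, y (Min C)) :: ennreal)" .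
      qed
      also have "\<dots> = (\<Prod>C\<in>p. \<integral>\<^sup>+s. indicator (A (Min C)) (s, y (Min C)) \<partial>jump_law g \<rho> (card C) (y (Min C)))"
        unfolding latent_jumps_def
        by (rule jl.product_nn_integral_prod[OF fin_p]) (rule mA[OF Min_p(1)])
      also have "\<dots> = (\<Prod>c\<in>I. \<integral>\<^sup>+s. indicator (A (Min (\<beta> c))) (s, y (Min (\<beta> c))) \<partial>jump_law g \<rho> (card (\<beta> c)) (y (Min (\<beta> c))))"
        by (rule prod.reindex_bij_betw[OF p(1), symmetric])
      also have "\<dots> = (\<Prod>c\<in>I. \<integral>\<^sup>+s. indicator (A c) (s, y c) \<partial>jump_law g \<rho> (e c) (y c))"
        by (simp add: p(2,3))
      finally show "(\<integral>\<^sup>+s. indicator (Pi\<^sub>E I A) (?T y s) \<partial>latent_jumps p y) =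
          (\<Prod>c\<in>I. \<integral>\<^sup>+s. indicator (A c) (s, y c) \<partial>jump_law g \<rho> (e c) (y c))" .
    qed
    also have "\<dots> = (\<Prod>c\<in>I. \<integral>\<^sup>+y. \<integral>\<^sup>+s. indicator (A c) (s, y) \<partial>jump_law g \<rho> (e c) y \<partial>?b c)"
    proof (rule b.product_nn_integral_prod[OF I])
      fix c assume c: "c \<in> I"
      have [measurable]: "A c \<in> sets jump_loc_space" using A[OF c] .
      show "(\<lambda>y. \<integral>\<^sup>+s. indicator (A c) (s, y) \<partial>jump_law g \<rho> (e c) y) \<in> borel_measurable (?b c)"
        unfolding measurable_cong_sets[OF sb refl]
        by (rule nn_integral_measurable_subprob_algebra2[OF _ measurable_jump_law]) measurable
    qed
    also have "\<dots> = (\<Prod>c\<in>I. \<integral>\<^sup>+z. indicator (A c) z \<partial>?B c)"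
      by (intro prod.cong refl nn_integral_disintegrate[symmetric] e u) measurable
    also have "\<dots> = (\<Prod>c\<in>I. emeasure (?B c) (A c))"
      using A by (intro prod.cong refl nn_integral_indicator) (simp add: sets_\<nu>)
    finally show "emeasure D (Pi\<^sub>E I A) = (\<Prod>c\<in>I. emeasure (?B c) (A c))" .
  qed
  with nn_D[OF F] show ?thesis by simp
qed

end

section \<open>The posterior model\<close>

lemma add_atoms_cong:
  assumes "\<And>j. j \<in> I \<Longrightarrow> z j = z' j"
  shows "add_atoms N I w z = add_atoms N I w z'"
proof -
  have "(\<Sum>j\<in>I. w j * indicator A (z j)) = (\<Sum>j\<in>I. w j * indicator A (z' j))" for A
    by (intro sum.cong) (simp_all add: assms)
  then show ?thesis by (simp add: add_atoms_def)
qed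

lemma nonatomic_singleton:
  assumes "nonatomic M" "{y} \<in> sets M"
  shows "emeasure M {y} = 0"
proof (rule ccontr)
  assume "emeasure M {y} \<noteq> 0"
  then have "0 < emeasure M {y}" by (simp add: zero_less_iff_neq_zero)
  moreover have "emeasure M B = 0 \<or> emeasure M B = emeasure M {y}" if "B \<subseteq> {y}" for B
    using that by (auto simp: subset_singleton_iff)
  ultimately show False using assms unfolding nonatomic_def by blast
qed

text \<open>A cylinder over a null set has one vanishing factor; with finitely many factors the
  product is 0 even if other factors are infinite.\<close>

lemma (in product_sigma_finite) AE_PiM_component_finite:
  assumes I: "finite I" and i: "i \<in> I" and P: "AE x in M i. P x"
  shows "AE x in PiM I M. P (x i)"
proof -
  obtain N where N: "N \<in> sets (M i)" "emeasure (M i) N = 0" "{x\<in>space (M i). \<not> P x} \<subseteq> N"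
    using P by (auto elim!: AE_E)
  let ?A = "\<lambda>j. if j = i then N else space (M j)"
  have "emeasure (PiM I M) (Pi\<^sub>E I ?A) = (\<Prod>j\<in>I. emeasure (M j) (?A j))"
    using N(1) by (intro emeasure_PiM I) auto
  also have "\<dots> = 0" using N(2) i I by (intro prod_zero) auto
  finally have "emeasure (PiM I M) (Pi\<^sub>E I ?A) = 0" .
  moreover have "Pi\<^sub>E I ?A \<in> sets (PiM I M)" using N(1) by (intro sets_PiM_I_finite I) auto
  moreover have "{x\<in>space (PiM I M). \<not> P (x i)} \<subseteq> Pi\<^sub>E I ?A"
    using N(3) i by (auto simp: space_PiM PiE_def Pi_iff split: if_splits)
  ultimately show ?thesis by (intro AE_I)
qed

definition point_measures :: "(real \<times> 'y::polish_space \<Rightarrow> real \<times> 'y \<Rightarrow> real) \<Rightarrow> (real \<times> 'y) measure set" where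
  "point_measures d = {N. sets N = sets jump_loc_space \<and>
         (\<forall>B\<in>sets jump_loc_space. jump_loc_bounded d B \<longrightarrow> emeasure N B \<in> \<nat>)}"

lemma point_measures_algebra_eq: "point_measures_algebra d = evaluation_algebra (point_measures d) jump_loc_space"
  by (simp add: point_measures_algebra_def point_measures_def)

text \<open>The point \<open>(1, undefined)\<close> is an arbitrary centre.\<close>

definition metric_shell :: "(real \<times> 'y::polish_space \<Rightarrow> real \<times> 'y \<Rightarrow> real) \<Rightarrow> nat \<Rightarrow> (real \<times> 'y) set" where
  "metric_shell d = disjointed (\<lambda>i. Metric_space.mball ({0<..} \<times> UNIV) d (1, undefined) (real (Suc i)))"

lemma space_jump_loc_space: "space (jump_loc_space :: (real \<times> 'y::polish_space) measure) = {0<..} \<times> UNIV"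
  by (simp add: space_pair_measure)

context
  fixes d :: "real \<times> 'y::polish_space \<Rightarrow> real \<times> 'y \<Rightarrow> real"
  assumes metric: "jump_loc_metric d"
begin

interpretation Metric_space "{0<..} \<times> UNIV :: (real \<times> 'y) set" d
  using metric by (simp add: jump_loc_metric_def)

text \<open>Balls of \<open>d\<close> are relatively open because \<open>d\<close> induces the usual
  topology, and open sets of the product are product measurable since both factors are second
  countable.\<close>

lemma sets_metric_shell: "metric_shell d i \<in> sets jump_loc_space"
proof -
  have ball: "mball c r \<in> sets jump_loc_space" for c r
  proof -
    have "openin (top_of_set ({0<..} \<times> UNIV)) (mball c r)"
      using openin_mball[of c r] unfolding metric[unfolded jump_loc_metric_def, THEN conjunct2, THEN conjunct2] .
    then obtain T where T: "open T" "mball c r = ({0<..} \<times> UNIV) \<inter> T"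
      by (auto simp: openin_open)
    have "(\<lambda>z. (fst z, snd z)) \<in> measurable jump_loc_space (borel \<Otimes>\<^sub>M borel :: (real \<times> 'y) measure)"
      by measurable
    moreover have "T \<in> sets (borel \<Otimes>\<^sub>M borel)" unfolding borel_prod using T(1) by (rule borel_open)
    ultimately have "(\<lambda>z. (fst z, snd z)) -` T \<inter> space jump_loc_space \<in> sets jump_loc_space"
      by (rule measurable_sets)
    also have "(\<lambda>z. (fst z, snd z)) -` T \<inter> space jump_loc_space = mball c r"
      unfolding T(2) space_jump_loc_space by auto
    finally show ?thesis .
  qed
  have "range (metric_shell d) \<subseteq> sets jump_loc_space"
    unfolding metric_shell_def using ball by (intro sets.range_disjointed_sets) auto
  then show ?thesis by auto
qed

lemma metric_shell_bounded: "A \<subseteq> metric_shell d i \<Longrightarrow> jump_loc_bounded d A"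
  using disjointed_subset[of "\<lambda>i. mball (1, undefined) (real (Suc i))" i]
  by (auto simp: metric_shell_def intro: mbounded_subset[OF mbounded_mball])

lemma Union_metric_shell: "(\<Union>i. metric_shell d i) = space jump_loc_space"
proof -
  have "(\<Union>i. mball (1, undefined) (real (Suc i))) = {0<..} \<times> UNIV"
  proof (intro subset_antisym subsetI)
    fix z :: "real \<times> 'y" assume z: "z \<in> {0<..} \<times> UNIV"
    obtain i where "d (1, undefined) z < real i" using reals_Archimedean2 by blast
    then have "d (1, undefined) z < real (Suc i)" by simp
    then have "z \<in> mball (1, undefined) (real (Suc i))" using z by auto
    then show "z \<in> (\<Union>i. mball (1, undefined) (real (Suc i)))" by blast
  qed auto
  then show ?thesis by (simp add: metric_shell_def UN_disjointed_eq space_jump_loc_space)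
qed

lemma point_config_point_measures:
  "point_config (jump_loc_space :: (real \<times> 'y) measure) (point_measures d) (metric_shell d)"
proof
  show "metric_shell d i \<in> sets jump_loc_space" for i by (rule sets_metric_shell)
  show "disjoint_family (metric_shell d)" unfolding metric_shell_def by (rule disjoint_family_disjointed)
  show "(\<Union>i. metric_shell d i) = space jump_loc_space" by (rule Union_metric_shell)
  show "sets N = sets jump_loc_space" if "N \<in> point_measures d" for N
    using that by (simp add: point_measures_def)
  show *: "emeasure N A \<in> \<nat>" if "N \<in> point_measures d" "A \<in> sets jump_loc_space" "A \<subseteq> metric_shell d i" for N A i
    using that metric_shell_bounded[of A i] by (simp add: point_measures_def)
  show "emeasure N (metric_shell d i) < \<infinity>" if "N \<in> point_measures d" for N i
    using *[OF that sets_metric_shell order_refl, of i] by (auto elim!: Nats_cases simp: less_top[symmetric])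
  show "add_atoms N {()} (\<lambda>_. 1) (\<lambda>_. z) \<in> point_measures d" if N: "N \<in> point_measures d" for N z
    unfolding point_measures_def
  proof (intro CollectI conjI ballI impI)
    have sN: "sets N = sets jump_loc_space" using N by (simp add: point_measures_def)
    then show "sets (add_atoms N {()} (\<lambda>_. 1) (\<lambda>_. z)) = sets jump_loc_space" by simp
    fix B assume B: "B \<in> sets jump_loc_space" "jump_loc_bounded d B"
    then have "emeasure N B \<in> \<nat>" using N by (simp add: point_measures_def)
    moreover have "indicator B z \<in> (\<nat> :: ennreal set)" by (simp add: indicator_def)
    ultimately show "emeasure (add_atoms N {()} (\<lambda>_. 1) (\<lambda>_. z)) B \<in> \<nat>"
      using B sN by (simp add: emeasure_add_atoms Nats_add)
  qed
qed

end

lemma nn_integral_mu_of: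
  assumes N: "sets N = sets (jump_loc_space :: (real \<times> 'y::polish_space) measure)"
    and h[measurable]: "h \<in> borel_measurable borel"
  shows "(\<integral>\<^sup>+y. h y \<partial>mu_of N) = (\<integral>\<^sup>+z. ennreal (fst z) * h (snd z) \<partial>N)"
proof -
  note N[measurable_cong]
  have "(\<integral>\<^sup>+y. h y \<partial>mu_of N) = (\<integral>\<^sup>+z. h (snd z) \<partial>density N (\<lambda>(s, y). ennreal s))"
    unfolding mu_of_def by (rule nn_integral_distr) measurable
  also have "\<dots> = (\<integral>\<^sup>+z. (case z of (s, y) \<Rightarrow> ennreal s) * h (snd z) \<partial>N)"
    by (rule nn_integral_density) measurable
  finally show ?thesis by (simp add: case_prod_beta)
qed

lemma sets_mu_of[simp]: "sets (mu_of N) = sets borel"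
  by (simp add: mu_of_def)

lemma emeasure_mu_of:
  assumes N: "sets N = sets (jump_loc_space :: (real \<times> 'y::polish_space) measure)" and A: "A \<in> sets borel"
  shows "emeasure (mu_of N) A = (\<integral>\<^sup>+z. ennreal (fst z) * indicator A (snd z) \<partial>N)"
  using nn_integral_mu_of[OF N, of "indicator A"] A by simp

locale posterior_model = jump_model \<eta> \<rho> g
  for \<eta> :: "'y::polish_space measure" and \<rho> :: "'y \<Rightarrow> real measure" and g :: "'y \<Rightarrow> real" +
  fixes d :: "real \<times> 'y \<Rightarrow> real \<times> 'y \<Rightarrow> real" and P :: "(real \<times> 'y) measure measure"
    and k :: "'x \<Rightarrow> 'y \<Rightarrow> real" and n :: nat and X :: "nat \<Rightarrow> 'x"
  assumes nonatomic: "nonatomic \<eta>"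
    and metric: "jump_loc_metric d"
    and nu_bounded: "\<And>B. B \<in> sets jump_loc_space \<Longrightarrow> jump_loc_bounded d B \<Longrightarrow> emeasure (intensity \<rho> \<eta>) B < \<infinity>"
    and prior: "sets P = sets (point_measures_algebra d)" "poisson_law P (intensity \<rho> \<eta>)"
    and k: "\<And>x y. 0 \<le> k x y" "\<And>x. (\<lambda>y. k x y) \<in> borel_measurable borel"
    and well_defined: "0 < (\<integral>\<^sup>+N. likelihood n k g X (mu_of N) \<partial>P)"
      "(\<integral>\<^sup>+N. likelihood n k g X (mu_of N) \<partial>P) < \<infinity>"
begin

sublocale point_config "jump_loc_space :: (real \<times> 'y) measure" "point_measures d" "metric_shell d"
  by (rule point_config_point_measures[OF metric])

lemma sets_P[measurable_cong]: "sets P = sets PM"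
  using prior(1) by (simp add: point_measures_algebra_eq)

lemma space_P[simp]: "space P = point_measures d"
  using sets_eq_imp_space_eq[OF sets_P] by simp

lemma locally_finite_\<nu>: "locally_finite (intensity \<rho> \<eta>)"
  unfolding locally_finite_def
proof (intro conjI allI)
  show "emeasure (intensity \<rho> \<eta>) (metric_shell d i) < \<infinity>" for i
    by (rule nu_bounded[OF sets_metric_shell[OF metric] metric_shell_bounded[OF metric order_refl]])
qed (rule sets_\<nu>)

lemma mecke_P: "mecke P (intensity \<rho> \<eta>)"
  using prior(2) sets_P locally_finite_\<nu> by (rule poisson_law_imp_mecke)

definition f :: "real \<times> 'y \<Rightarrow> ennreal" where
  "f z = ennreal (g (snd z) * fst z)"

definition tilt :: "(real \<times> 'y) measure \<Rightarrow> ennreal" where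
  "tilt N = exp_neg (\<integral>\<^sup>+z. f z \<partial>N)"

definition tilt_mass :: ennreal where
  "tilt_mass = (\<integral>\<^sup>+N. tilt N \<partial>P)"

definition Q :: "(real \<times> 'y) measure measure" where
  "Q = normalized (density P tilt)"

definition w :: "nat \<Rightarrow> real \<times> 'y \<Rightarrow> ennreal" where
  "w i z = ennreal (k (X i) (snd z) * fst z)"

lemma measurable_f[measurable]: "f \<in> borel_measurable jump_loc_space"
  unfolding f_def using g(1) by measurable

lemma measurable_w[measurable]: "w i \<in> borel_measurable jump_loc_space"
  unfolding w_def using k(2) by measurable

lemma measurable_tilt_PM[measurable]: "tilt \<in> borel_measurable PM"
  unfolding tilt_def by (intro measurable_exp_neg measurable_nn_integral_PM) measurable

text \<open>By Tonelli the product of \<open>n\<close> integrals against \<open>N\<close> is one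
  integral over \<open>n\<close> points of \<open>N\<close>, the form in which the iterated Mecke
  equation applies. The factor \<open>s\<close> from \<open>mu_of\<close> moves into the weights
  \<open>w i\<close>.\<close>

lemma likelihood_eq:
  assumes N: "N \<in> point_measures d"
  shows "likelihood n k g X (mu_of N) = tilt N * (\<integral>\<^sup>+z. (\<Prod>i=1..n. w i (z i)) \<partial>(\<Pi>\<^sub>M i\<in>{1..n}. N))"
proof -
  note sN = sets_S[OF N]
  have sp: "\<And>z. z \<in> space N \<Longrightarrow> 0 < fst z" using space_S[OF N] by (auto simp: space_jump_loc_space)
  interpret sigma_finite_measure N by (rule locally_finite_sigma_finite[OF locally_finite_S[OF N]])
  interpret product_sigma_finite "\<lambda>_. N" by unfold_locales
  have gm: "(\<lambda>y. ennreal (g y)) \<in> borel_measurable borel" and km: "(\<lambda>y. ennreal (k (X i) y)) \<in> borel_measurable borel" for i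
    using g(1) k(2) by measurable
  have "(\<integral>\<^sup>+y. ennreal (g y) \<partial>mu_of N) = (\<integral>\<^sup>+z. f z \<partial>N)"
    unfolding nn_integral_mu_of[OF sN gm] f_def
    using sp g(2) by (intro nn_integral_cong) (simp add: ennreal_mult mult.commute less_imp_le)
  moreover have "(\<integral>\<^sup>+y. ennreal (k (X i) y) \<partial>mu_of N) = (\<integral>\<^sup>+z. w i z \<partial>N)" for i
    unfolding nn_integral_mu_of[OF sN km] w_def
    using sp k(1) by (intro nn_integral_cong) (simp add: ennreal_mult mult.commute less_imp_le)
  moreover have "(\<integral>\<^sup>+z. (\<Prod>i=1..n. w i (z i)) \<partial>(\<Pi>\<^sub>M i\<in>{1..n}. N)) = (\<Prod>i=1..n. \<integral>\<^sup>+z. w i z \<partial>N)"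
    by (intro product_nn_integral_prod) (simp_all add: measurable_cong_sets[OF sN refl])
  ultimately show ?thesis by (simp add: likelihood_def tilt_def)
qed

text \<open>\<open>tilt\<close> is a factor of the likelihood: if it vanished almost surely, the
  likelihood would have mean 0.\<close>

lemma tilt_mass: "0 < tilt_mass" "tilt_mass < \<infinity>"
proof -
  interpret P: prob_space P using prior(2) by (simp add: poisson_law_def)
  have m: "tilt \<in> borel_measurable P" by measurable
  show "0 < tilt_mass"
  proof (rule ccontr)
    assume "\<not> 0 < tilt_mass"
    then have "AE N in P. tilt N = 0"
      unfolding tilt_mass_def by (subst nn_integral_0_iff_AE[OF m, symmetric]) (simp add: not_less)
    then have "AE N in P. likelihood n k g X (mu_of N) = 0"
      using AE_space by eventually_elim (simp add: likelihood_eq)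
    then have "(\<integral>\<^sup>+N. likelihood n k g X (mu_of N) \<partial>P) = (\<integral>\<^sup>+N. 0 \<partial>P)" by (rule nn_integral_cong_AE)
    then show False using well_defined(1) by simp
  qed
  have "tilt_mass \<le> (\<integral>\<^sup>+N. 1 \<partial>P)"
    unfolding tilt_mass_def tilt_def by (intro nn_integral_mono exp_neg_le_1)
  also have "\<dots> = 1" using P.emeasure_space_1 by simp
  finally show "tilt_mass < \<infinity>" by (rule le_less_trans) simp
qed

lemma \<nu>f_eq: "\<nu>\<^sub>f = density (intensity \<rho> \<eta>) (\<lambda>z. exp_neg (f z))"
proof (rule density_cong)
  show "AE z in intensity \<rho> \<eta>. (case z of (s, y) \<Rightarrow> ennreal (exp (- (g y * s)))) = exp_neg (f z)"
  proof (rule AE_I2)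
    fix z assume "z \<in> space (intensity \<rho> \<eta>)"
    then have "0 < fst z" using sets_eq_imp_space_eq[OF sets_\<nu>] by (auto simp: space_jump_loc_space)
    then show "(case z of (s, y) \<Rightarrow> ennreal (exp (- (g y * s)))) = exp_neg (f z)"
      using g(2) by (simp add: f_def exp_neg_ennreal case_prod_beta)
  qed
qed (simp_all add: measurable_cong_sets[OF sets_\<nu> refl])

sublocale Q: mecke_law "jump_loc_space :: (real \<times> 'y) measure" "point_measures d" "metric_shell d" Q "\<nu>\<^sub>f"
proof
  show "mecke Q \<nu>\<^sub>f"
    unfolding \<nu>f_eq Q_def tilt_def[abs_def]
    using tilt_mass(1) by (intro mecke_tilt mecke_P measurable_f) (simp add: tilt_mass_def tilt_def)
qed

lemma nn_integral_tilt:
  assumes G: "G \<in> borel_measurable PM"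
  shows "(\<integral>\<^sup>+N. tilt N * G N \<partial>P) = tilt_mass * (\<integral>\<^sup>+N. G N \<partial>Q)"
proof -
  have mt: "tilt \<in> borel_measurable P" and mG: "G \<in> borel_measurable P"
    using G by (simp_all add: measurable_cong_sets[OF sets_P refl])
  have "emeasure (density P tilt) (space P) = (\<integral>\<^sup>+N. tilt N * indicator (space P) N \<partial>P)"
    by (rule emeasure_density[OF mt sets.top])
  also have "\<dots> = tilt_mass" unfolding tilt_mass_def by (rule nn_integral_cong) simp
  finally have "(\<integral>\<^sup>+N. G N \<partial>Q) = inverse tilt_mass * (\<integral>\<^sup>+N. tilt N * G N \<partial>P)"
    unfolding Q_def using mt mG by (subst nn_integral_normalized) (simp_all add: nn_integral_density)
  moreover have "tilt_mass * inverse tilt_mass = 1"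
    using tilt_mass by (simp add: divide_ennreal_def[symmetric])
  ultimately show ?thesis by (simp add: mult.assoc[symmetric])
qed

abbreviation data_space :: "((nat \<Rightarrow> real) \<times> (nat \<Rightarrow> 'y) \<times> (real \<times> 'y) measure) measure" where
  "data_space \<equiv> jumps_space n \<Otimes>\<^sub>M locs_space n \<Otimes>\<^sub>M PM"

text \<open>The sigma-algebra of \<open>P\<close> is replaced by the equal one of \<open>PM\<close>,
  so that measurability can be argued on a space that does not mention a law.\<close>

definition unnormalized :: "((nat \<Rightarrow> real) \<times> (nat \<Rightarrow> 'y) \<times> (real \<times> 'y) measure) measure" where
  "unnormalized = measure_of (space data_space) (sets data_space) (\<lambda>A.
        \<integral>\<^sup>+N. (\<integral>\<^sup>+z. (tilt N * (\<Prod>i=1..n. w i (z i)))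
                 * indicator A (\<lambda>i\<in>{1..n}. fst (z i), \<lambda>i\<in>{1..n}. snd (z i), N)
               \<partial>(\<Pi>\<^sub>M i\<in>{1..n}. N)) \<partial>P)"

abbreviation joint where "joint \<equiv> joint_posterior n k g X P"

lemma joint_eq: "joint = normalized unnormalized"
proof -
  have s: "sets (jumps_space n \<Otimes>\<^sub>M locs_space n \<Otimes>\<^sub>M P) = sets data_space"
    by (intro sets_pair_measure_cong refl sets_P)
  show ?thesis
    unfolding joint_posterior_def Let_def unnormalized_def s sets_eq_imp_space_eq[OF s]
    by (simp add: tilt_def f_def[abs_def] w_def case_prod_unfold)
qed

lemma sets_joint[measurable_cong]: "sets joint = sets data_space"
  by (simp add: joint_eq unnormalized_def)

lemma measurable_data:
  "(\<lambda>(N, z). (\<lambda>i\<in>{1..n}. fst (z i), \<lambda>i\<in>{1..n}. snd (z i), N)) \<in>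
     measurable (PM \<Otimes>\<^sub>M (\<Pi>\<^sub>M i\<in>{1..n}. jump_loc_space)) data_space"
proof -
  have c: "(\<lambda>x. snd x i) \<in> measurable (PM \<Otimes>\<^sub>M (\<Pi>\<^sub>M i\<in>{1..n}. jump_loc_space)) jump_loc_space"
    if "i \<in> {1..n}" for i
    by (rule measurable_compose[OF measurable_snd measurable_component_singleton[OF that]])
  show ?thesis
    unfolding case_prod_beta
    by (intro measurable_Pair measurable_restrict measurable_fst
        measurable_compose[OF c measurable_fst] measurable_compose[OF c measurable_snd])
qed

lemma nn_integral_unnormalized:
  assumes F: "F \<in> borel_measurable data_space"
  shows "(\<integral>\<^sup>+x. F x \<partial>unnormalized) = (\<integral>\<^sup>+N. tilt N * (\<integral>\<^sup>+z. (\<Prod>i=1..n. w i (z i)) *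
      F (\<lambda>i\<in>{1..n}. fst (z i), \<lambda>i\<in>{1..n}. snd (z i), N) \<partial>(\<Pi>\<^sub>M i\<in>{1..n}. N)) \<partial>P)"
proof -
  have sPi: "sets (\<Pi>\<^sub>M i\<in>{1..n}. N) = sets (\<Pi>\<^sub>M i\<in>{1..n}. jump_loc_space)" if "N \<in> space P" for N
    using sets_S[of N] that by (intro sets_PiM_cong refl) simp
  have mw: "(\<lambda>z. \<Prod>i=1..n. w i (z i)) \<in> borel_measurable (\<Pi>\<^sub>M i\<in>{1..n}. jump_loc_space)"
    by measurable
  have mj: "(\<lambda>(N, z). \<Prod>i=1..n. w i (z i)) \<in> borel_measurable (PM \<Otimes>\<^sub>M (\<Pi>\<^sub>M i\<in>{1..n}. jump_loc_space))"
    using measurable_compose[OF measurable_snd mw] by (simp add: case_prod_beta)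
  have mF: "(\<lambda>(N, z). F (\<lambda>i\<in>{1..n}. fst (z i), \<lambda>i\<in>{1..n}. snd (z i), N)) \<in>
      borel_measurable (PM \<Otimes>\<^sub>M (\<Pi>\<^sub>M i\<in>{1..n}. jump_loc_space))" if "F \<in> borel_measurable data_space" for F :: "_ \<Rightarrow> ennreal"
    using measurable_compose[OF measurable_data that] by (simp add: case_prod_beta)
  have h: "(\<lambda>z. (\<lambda>i\<in>{1..n}. fst (z i), \<lambda>i\<in>{1..n}. snd (z i), N)) \<in> measurable (\<Pi>\<^sub>M i\<in>{1..n}. N) data_space"
    if "N \<in> space P" for N
    unfolding measurable_cong_sets[OF sPi[OF that] refl]
    using measurable_Pair2[OF measurable_data, of N] that by simp
  have "(\<integral>\<^sup>+x. F x \<partial>unnormalized) = (\<integral>\<^sup>+N. \<integral>\<^sup>+z. (tilt N * (\<Prod>i=1..n. w i (z i))) *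
      F (\<lambda>i\<in>{1..n}. fst (z i), \<lambda>i\<in>{1..n}. snd (z i), N) \<partial>(\<Pi>\<^sub>M i\<in>{1..n}. N) \<partial>P)"
  proof (rule nn_integral_mixture[OF _ _ h unnormalized_def F])
    fix F :: "_ \<Rightarrow> ennreal" assume F: "F \<in> borel_measurable data_space"
    show "(\<lambda>N. \<integral>\<^sup>+z. (tilt N * (\<Prod>i=1..n. w i (z i))) *
      F (\<lambda>i\<in>{1..n}. fst (z i), \<lambda>i\<in>{1..n}. snd (z i), N) \<partial>(\<Pi>\<^sub>M i\<in>{1..n}. N)) \<in> borel_measurable P"
      unfolding measurable_cong_sets[OF sets_P refl]
    proof (rule measurable_nn_integral_PiM_PM)
      have "(\<lambda>x. (tilt (fst x) * (case x of (N, z) \<Rightarrow> \<Prod>i=1..n. w i (z i))) *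
          (case x of (N, z) \<Rightarrow> F (\<lambda>i\<in>{1..n}. fst (z i), \<lambda>i\<in>{1..n}. snd (z i), N))) \<in>
          borel_measurable (PM \<Otimes>\<^sub>M (\<Pi>\<^sub>M i\<in>{1..n}. jump_loc_space))"
        by (intro borel_measurable_times_ennreal mj mF F measurable_compose[OF measurable_fst measurable_tilt_PM])
      then show "(\<lambda>(N, z). (tilt N * (\<Prod>i=1..n. w i (z i))) * F (\<lambda>i\<in>{1..n}. fst (z i), \<lambda>i\<in>{1..n}. snd (z i), N)) \<in>
          borel_measurable (PM \<Otimes>\<^sub>M (\<Pi>\<^sub>M i\<in>{1..n}. jump_loc_space))"
        by (simp add: case_prod_beta)
    qed simp_all
  next
    fix N assume N: "N \<in> space P"
    show "(\<lambda>z. tilt N * (\<Prod>i=1..n. w i (z i))) \<in> borel_measurable (\<Pi>\<^sub>M i\<in>{1..n}. N)"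
      unfolding measurable_cong_sets[OF sPi[OF N] refl] using mw by measurable
  qed
  also have "\<dots> = (\<integral>\<^sup>+N. tilt N * (\<integral>\<^sup>+z. (\<Prod>i=1..n. w i (z i)) *
      F (\<lambda>i\<in>{1..n}. fst (z i), \<lambda>i\<in>{1..n}. snd (z i), N) \<partial>(\<Pi>\<^sub>M i\<in>{1..n}. N)) \<partial>P)"
  proof (rule nn_integral_cong)
    fix N assume N: "N \<in> space P"
    have "(\<lambda>z. (\<Prod>i=1..n. w i (z i)) * F (\<lambda>i\<in>{1..n}. fst (z i), \<lambda>i\<in>{1..n}. snd (z i), N)) \<in> borel_measurable (\<Pi>\<^sub>M i\<in>{1..n}. N)"
      by (intro borel_measurable_times_ennreal measurable_compose[OF h[OF N] F])
        (unfold measurable_cong_sets[OF sPi[OF N] refl], rule mw)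
    from nn_integral_cmult[OF this, of "tilt N"]
    show "(\<integral>\<^sup>+z. (tilt N * (\<Prod>i=1..n. w i (z i))) * F (\<lambda>i\<in>{1..n}. fst (z i), \<lambda>i\<in>{1..n}. snd (z i), N) \<partial>(\<Pi>\<^sub>M i\<in>{1..n}. N)) =
      tilt N * (\<integral>\<^sup>+z. (\<Prod>i=1..n. w i (z i)) * F (\<lambda>i\<in>{1..n}. fst (z i), \<lambda>i\<in>{1..n}. snd (z i), N) \<partial>(\<Pi>\<^sub>M i\<in>{1..n}. N))"
      by (simp add: mult.assoc)
  qed
  finally show ?thesis .
qed

text \<open>The value \<open>\<eta>\<close> off \<open>r ` {1..n}\<close> is never used; it only makes \<open>block_factor r\<close> a family of
  sigma-finite measures, as \<open>product_sigma_finite\<close> demands for all indices.\<close>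

definition block_factor :: "(nat \<Rightarrow> nat) \<Rightarrow> nat \<Rightarrow> 'y measure" where
  "block_factor r c = (if c \<in> r ` {1..n} then block_measure k g X \<rho> \<eta> (block n r c) else \<eta>)"

definition blocks :: "(nat \<Rightarrow> nat) \<Rightarrow> (nat \<Rightarrow> 'y) measure" where
  "blocks r = PiM (r ` {1..n}) (block_factor r)"

text \<open>The sample point \<open>(J, Y, N)\<close> with partition \<open>r\<close>, location \<open>y c\<close> and jump \<open>s\<close> on each block, and
  Poisson part \<open>N\<close>.\<close>

definition conf :: "(nat \<Rightarrow> nat) \<Rightarrow> (nat \<Rightarrow> 'y) \<Rightarrow> (nat set \<Rightarrow> real) \<Rightarrow> (real \<times> 'y) measure \<Rightarrow>
    (nat \<Rightarrow> real) \<times> (nat \<Rightarrow> 'y) \<times> (real \<times> 'y) measure" where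
  "conf r y s N = (\<lambda>i\<in>{1..n}. s (block n r i), \<lambda>i\<in>{1..n}. y (r i),
     add_atoms N (r ` {1..n}) (\<lambda>_. 1) (\<lambda>c. (s (block n r c), y c)))"

lemma sets_block_measure[simp]: "sets (block_measure k g X \<rho> \<eta> C) = sets borel"
  by (simp add: block_measure_def eta)

lemma measurable_block_density:
  "(\<lambda>y. (\<Prod>i\<in>C. ennreal (k (X i) y)) * kappa g \<rho> (card C) y) \<in> borel_measurable \<eta>"
  unfolding measurable_cong_sets[OF eta(1) refl] using k(2) by measurable

lemma emeasure_block_measure_space: "emeasure (block_measure k g X \<rho> \<eta> C) UNIV = block_mass k g X \<rho> \<eta> C"
proof -
  have "UNIV \<in> sets \<eta>" by (simp add: eta)
  then show ?thesis
    unfolding block_measure_def block_mass_def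
    by (subst emeasure_density[OF measurable_block_density]) auto
qed

lemma card_block_range:
  assumes "r \<in> reps n" "c \<in> r ` {1..n}" shows "1 \<le> card (block n r c)"
proof -
  have "c \<in> block n r c" using Min_block_range(2)[OF assms] by (rule block_mem)
  then have "0 < card (block n r c)" by (subst card_gt_0_iff) (auto simp: finite_block)
  then show ?thesis by simp
qed

lemma sigma_finite_block_factor:
  assumes r: "r \<in> reps n" shows "sigma_finite_measure (block_factor r c)"
proof (cases "c \<in> r ` {1..n}")
  case True
  have "(\<Prod>i\<in>block n r c. ennreal (k (X i) y)) * kappa g \<rho> (card (block n r c)) y < \<infinity>" for y
    using kappa_finite[OF card_block_range[OF r True], of y] by (auto simp: ennreal_mult_less_top prod_ennreal k)
  then show ?thesis
    unfolding block_factor_def block_measure_def using True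
    by (simp add: sigma_finite_density[OF eta(2) measurable_block_density])
qed (simp add: block_factor_def eta)

lemma sets_block_factor: "sets (block_factor r c) = sets borel"
  by (simp add: block_factor_def eta)

lemma sets_blocks[measurable_cong]: "sets (blocks r) = sets (\<Pi>\<^sub>M c\<in>r ` {1..n}. borel)"
  unfolding blocks_def by (intro sets_PiM_cong refl sets_block_factor)

lemma space_blocks: "space (blocks r) = (\<Pi>\<^sub>E c\<in>r ` {1..n}. UNIV)"
  using sets_eq_imp_space_eq[OF sets_blocks] by (simp add: space_PiM)

lemma measurable_conf:
  assumes r: "r \<in> reps n"
  shows "(\<lambda>((y, s), N). conf r y s N) \<in> measurable
    (((\<Pi>\<^sub>M c\<in>r ` {1..n}. borel) \<Otimes>\<^sub>M (\<Pi>\<^sub>M C\<in>ties n r. jump_space)) \<Otimes>\<^sub>M PM) data_space"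
proof -
  have b: "block n r i \<in> ties n r" if "i \<in> {1..n}" for i using that unfolding ties_def by (rule imageI)
  have b': "block n r c \<in> ties n r" if "c \<in> r ` {1..n}" for c
    using bij_betw_block_reps[OF r] that by (auto simp: bij_betw_def)
  let ?M = "((\<Pi>\<^sub>M c\<in>r ` {1..n}. borel :: 'y measure) \<Otimes>\<^sub>M (\<Pi>\<^sub>M C\<in>ties n r. jump_space)) \<Otimes>\<^sub>M PM"
  have s: "(\<lambda>x. snd (fst x) C) \<in> measurable ?M jump_space" if "C \<in> ties n r" for C
    by (rule measurable_compose[OF measurable_compose[OF measurable_fst measurable_snd] measurable_component_singleton[OF that]])
  have y: "(\<lambda>x. fst (fst x) c) \<in> measurable ?M borel" if "c \<in> r ` {1..n}" for c
    by (rule measurable_compose[OF measurable_compose[OF measurable_fst measurable_fst] measurable_component_singleton[OF that]])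
  show ?thesis
    unfolding conf_def case_prod_unfold
    by (intro measurable_Pair measurable_restrict measurable_add_atoms s y b b' measurable_snd finite_imageI imageI) auto
qed

lemma measurable_conf_N:
  assumes r: "r \<in> reps n" and y: "y \<in> space (blocks r)" and s: "s \<in> space (latent_jumps (ties n r) y')"
  shows "(\<lambda>N. conf r y s N) \<in> measurable PM data_space"
proof -
  have "(y, s) \<in> space ((\<Pi>\<^sub>M c\<in>r ` {1..n}. borel) \<Otimes>\<^sub>M (\<Pi>\<^sub>M C\<in>ties n r. jump_space))"
    using y s by (simp add: space_pair_measure space_blocks space_latent_jumps space_PiM)
  from measurable_Pair2[OF measurable_conf[OF r] this] show ?thesis by simp
qed

text \<open>All results on the posterior come from this formula. The factor \<open>tilt\<close>
  changes \<open>P\<close> into \<open>Q\<close> at the price of a constant. In the iterated Mecke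
  equation the weights of all indices of a block meet at one point and combine to
  \<open>s ^ e\<close> times a product of kernels, which the disintegration turns into a measure of
  the location and a law of the jump.\<close>

lemma nn_integral_unnormalized_reps:
  assumes F: "F \<in> borel_measurable data_space"
  shows "(\<integral>\<^sup>+x. F x \<partial>unnormalized) = tilt_mass * (\<Sum>r\<in>reps n.
    \<integral>\<^sup>+y. \<integral>\<^sup>+s. \<integral>\<^sup>+N. F (conf r y s N) \<partial>Q \<partial>latent_jumps (ties n r) y \<partial>blocks r)"
proof -
  define D where "D x = (\<lambda>i\<in>{1..n}. fst (fst x i), \<lambda>i\<in>{1..n}. snd (fst x i), snd x)"
    for x :: "(nat \<Rightarrow> real \<times> 'y) \<times> (real \<times> 'y) measure"
  have D: "D \<in> measurable ((\<Pi>\<^sub>M i\<in>{1..n}. jump_loc_space) \<Otimes>\<^sub>M PM) data_space"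
    using measurable_compose[OF measurable_pair_swap' measurable_data] by (simp add: D_def[abs_def] case_prod_beta)
  have mw: "(\<lambda>z. \<Prod>i=1..n. w i (z i)) \<in> borel_measurable (\<Pi>\<^sub>M i\<in>{1..n}. jump_loc_space)"
    by measurable
  define F' where "F' x = (\<Prod>i=1..n. w i (fst x i)) * F (D x)" for x
  have F': "F' \<in> borel_measurable ((\<Pi>\<^sub>M i\<in>{1..n}. jump_loc_space) \<Otimes>\<^sub>M PM)"
    unfolding F'_def
    by (intro borel_measurable_times_ennreal measurable_compose[OF measurable_fst mw] measurable_compose[OF D F])
  have "(\<integral>\<^sup>+x. F x \<partial>unnormalized) = (\<integral>\<^sup>+N. tilt N * (\<integral>\<^sup>+z. F' (z, N) \<partial>(\<Pi>\<^sub>M i\<in>{1..n}. N)) \<partial>P)"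
    unfolding nn_integral_unnormalized[OF F] F'_def D_def fst_conv snd_conv ..
  also have "\<dots> = tilt_mass * (\<integral>\<^sup>+N. \<integral>\<^sup>+z. F' (z, N) \<partial>(\<Pi>\<^sub>M i\<in>{1..n}. N) \<partial>Q)"
  proof (rule nn_integral_tilt, rule measurable_nn_integral_PiM_PM)
    show "(\<lambda>(N, z). F' (z, N)) \<in> borel_measurable (PM \<Otimes>\<^sub>M (\<Pi>\<^sub>M i\<in>{1..n}. jump_loc_space))"
      using measurable_compose[OF measurable_pair_swap' F'] by (simp add: case_prod_beta)
  qed simp_all
  also have "(\<integral>\<^sup>+N. \<integral>\<^sup>+z. F' (z, N) \<partial>(\<Pi>\<^sub>M i\<in>{1..n}. N) \<partial>Q) = (\<Sum>r\<in>reps n. \<integral>\<^sup>+z. \<integral>\<^sup>+N.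
      F' (\<lambda>i\<in>{1..n}. z (r i), add_atoms N (r ` {1..n}) (\<lambda>_. 1) z) \<partial>Q \<partial>(\<Pi>\<^sub>M c\<in>r ` {1..n}. \<nu>\<^sub>f))"
    by (rule Q.multivariate_mecke[OF F'])
  also have "\<dots> = (\<Sum>r\<in>reps n. \<integral>\<^sup>+y. \<integral>\<^sup>+s. \<integral>\<^sup>+N. F (conf r y s N) \<partial>Q \<partial>latent_jumps (ties n r) y \<partial>blocks r)"
  proof (rule sum.cong[OF refl])
    fix r assume r: "r \<in> reps n"
    let ?I = "r ` {1..n}"
    \<comment> \<open>Total weight of the block with representative \<open>c\<close>, all of whose
      indices share one point.\<close>
    define Wc where "Wc c x = (\<Prod>i\<in>block n r c. w i x)" for c x
    have Wc: "Wc c \<in> borel_measurable jump_loc_space" for c unfolding Wc_def by measurable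
    have Wc_fin: "Wc c x < \<infinity>" for c x
      unfolding Wc_def w_def by (auto simp: less_top[symmetric] ennreal_prod_eq_top)
    define H where "H z N = (\<lambda>i\<in>{1..n}. fst (z (r i)), \<lambda>i\<in>{1..n}. snd (z (r i)), add_atoms N ?I (\<lambda>_. 1) z)"
      for z :: "nat \<Rightarrow> real \<times> 'y" and N
    have DH: "D (\<lambda>i\<in>{1..n}. z (r i), add_atoms N ?I (\<lambda>_. 1) z) = H z N" for z N
      by (auto simp: D_def H_def intro!: restrict_ext)
    have H: "(\<lambda>(z, N). H z N) \<in> measurable ((\<Pi>\<^sub>M c\<in>?I. jump_loc_space) \<Otimes>\<^sub>M PM) data_space"
      using measurable_compose[OF measurable_reps[OF r] D] by (simp only: case_prod_unfold DH)
    have FH: "(\<lambda>(z, N). F (H z N)) \<in> borel_measurable ((\<Pi>\<^sub>M c\<in>?I. jump_loc_space) \<Otimes>\<^sub>M PM)"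
      using measurable_compose[OF H F] by (simp add: case_prod_unfold)
    define G where "G z = (\<integral>\<^sup>+N. F (H z N) \<partial>Q)" for z
    have G: "G \<in> borel_measurable (\<Pi>\<^sub>M c\<in>?I. jump_loc_space)"
      unfolding G_def
    proof (rule Q.borel_measurable_nn_integral)
      show "(\<lambda>(z, N). F (H z N)) \<in> borel_measurable ((\<Pi>\<^sub>M c\<in>?I. jump_loc_space) \<Otimes>\<^sub>M Q)"
        using FH by (simp add: measurable_cong_sets[OF sets_pair_measure_cong[OF refl Q.sets_Q] refl])
    qed
    have "F' (\<lambda>i\<in>{1..n}. z (r i), add_atoms N ?I (\<lambda>_. 1) z) = (\<Prod>c\<in>?I. Wc c (z c)) * F (H z N)" for z N
    proof -
      have "(\<Prod>i=1..n. w i ((\<lambda>i\<in>{1..n}. z (r i)) i)) = (\<Prod>i=1..n. w i (z (r i)))"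
        by (intro prod.cong) auto
      also have "\<dots> = (\<Prod>c\<in>?I. Wc c (z c))"
        unfolding Wc_def by (rule prod_reps_group[OF r])
      finally show ?thesis unfolding F'_def DH fst_conv by simp
    qed
    then have "(\<integral>\<^sup>+z. \<integral>\<^sup>+N. F' (\<lambda>i\<in>{1..n}. z (r i), add_atoms N ?I (\<lambda>_. 1) z) \<partial>Q \<partial>(\<Pi>\<^sub>M c\<in>?I. \<nu>\<^sub>f)) =
        (\<integral>\<^sup>+z. \<integral>\<^sup>+N. (\<Prod>c\<in>?I. Wc c (z c)) * F (H z N) \<partial>Q \<partial>(\<Pi>\<^sub>M c\<in>?I. \<nu>\<^sub>f))" by simp
    also have "\<dots> = (\<integral>\<^sup>+z. (\<Prod>c\<in>?I. Wc c (z c)) * G z \<partial>(\<Pi>\<^sub>M c\<in>?I. \<nu>\<^sub>f))"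
    proof (rule nn_integral_cong)
      fix z assume "z \<in> space (\<Pi>\<^sub>M c\<in>?I. \<nu>\<^sub>f)"
      then have "z \<in> space (\<Pi>\<^sub>M c\<in>?I. jump_loc_space)"
        using sets_eq_imp_space_eq[OF Q.sets_PiM_\<Lambda>] by auto
      from measurable_Pair2[OF FH this]
      have "(\<lambda>N. F (H z N)) \<in> borel_measurable Q" by (simp add: measurable_cong_sets[OF Q.sets_Q refl])
      then show "(\<integral>\<^sup>+N. (\<Prod>c\<in>?I. Wc c (z c)) * F (H z N) \<partial>Q) = (\<Prod>c\<in>?I. Wc c (z c)) * G z"
        unfolding G_def by (rule nn_integral_cmult)
    qed
    also have "\<dots> = (\<integral>\<^sup>+z. G z \<partial>density (\<Pi>\<^sub>M c\<in>?I. \<nu>\<^sub>f) (\<lambda>z. \<Prod>c\<in>?I. Wc c (z c)))"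
    proof (rule nn_integral_density[symmetric])
      show "(\<lambda>z. \<Prod>c\<in>?I. Wc c (z c)) \<in> borel_measurable (\<Pi>\<^sub>M c\<in>?I. \<nu>\<^sub>f)"
        unfolding measurable_cong_sets[OF Q.sets_PiM_\<Lambda> refl]
        by (intro borel_measurable_prod_ennreal measurable_compose[OF measurable_component_singleton[where M="\<lambda>_. jump_loc_space"] Wc])
      show "G \<in> borel_measurable (\<Pi>\<^sub>M c\<in>?I. \<nu>\<^sub>f)"
        unfolding measurable_cong_sets[OF Q.sets_PiM_\<Lambda> refl] by (rule G)
    qed
    also have "density (\<Pi>\<^sub>M c\<in>?I. \<nu>\<^sub>f) (\<lambda>z. \<Prod>c\<in>?I. Wc c (z c)) = (\<Pi>\<^sub>M c\<in>?I. density \<nu>\<^sub>f (Wc c))"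
      by (rule PiM_density[OF Q.\<Lambda>.sigma_finite_measure_axioms _ _ Wc_fin, symmetric])
        (auto simp: measurable_cong_sets[OF Q.sets_\<Lambda> refl] Wc)
    \<comment> \<open>The exponent 1 for indices that represent no block satisfies
      \<open>1 \<le> e c\<close>, which \<open>PiM_disintegrate\<close> demands for every
      index.\<close>
    also have "\<dots> = (\<Pi>\<^sub>M c\<in>?I. density \<nu>\<^sub>f (\<lambda>(s, y). (\<Prod>i\<in>block n r c. ennreal (k (X i) y)) *
        ennreal (s ^ (if c \<in> ?I then card (block n r c) else 1))))"
    proof (rule PiM_cong[OF refl], rule density_cong)
      fix c assume c: "c \<in> ?I"
      show "Wc c \<in> borel_measurable \<nu>\<^sub>f" using Wc by (simp add: measurable_cong_sets[OF Q.sets_\<Lambda> refl])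
      have "(\<lambda>(s, y). (\<Prod>i\<in>block n r c. ennreal (k (X i) y)) * ennreal (s ^ (if c \<in> ?I then card (block n r c) else 1)))
          \<in> borel_measurable jump_loc_space"
        using k(2) by measurable
      then show "(\<lambda>(s, y). (\<Prod>i\<in>block n r c. ennreal (k (X i) y)) * ennreal (s ^ (if c \<in> ?I then card (block n r c) else 1)))
          \<in> borel_measurable \<nu>\<^sub>f" by (simp add: measurable_cong_sets[OF Q.sets_\<Lambda> refl])
      show "AE x in \<nu>\<^sub>f. Wc c x = (case x of (s, y) \<Rightarrow> (\<Prod>i\<in>block n r c. ennreal (k (X i) y)) *
          ennreal (s ^ (if c \<in> ?I then card (block n r c) else 1)))"
      proof (rule AE_I2)
        fix x assume "x \<in> space \<nu>\<^sub>f"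
        then have "0 < fst x" using Q.space_\<Lambda> by (auto simp: space_jump_loc_space)
        then show "Wc c x = (case x of (s, y) \<Rightarrow> (\<Prod>i\<in>block n r c. ennreal (k (X i) y)) *
          ennreal (s ^ (if c \<in> ?I then card (block n r c) else 1)))"
          using c k(1) by (simp add: Wc_def w_def case_prod_unfold ennreal_mult prod.distrib ennreal_power)
      qed
    qed
    also have "(\<integral>\<^sup>+z. G z \<partial>\<dots>) = (\<integral>\<^sup>+y. \<integral>\<^sup>+s. G (\<lambda>c\<in>?I. (s (block n r c), y c)) \<partial>latent_jumps (ties n r) y
        \<partial>(\<Pi>\<^sub>M c\<in>?I. density \<eta> (\<lambda>y. (\<Prod>i\<in>block n r c. ennreal (k (X i) y)) *
          kappa g \<rho> (if c \<in> ?I then card (block n r c) else 1) y)))"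
    proof (rule PiM_disintegrate[OF _ _ bij_betw_block_reps[OF r] _ _ _ _ _ G])
      show "sigma_finite_measure (intensity \<rho> \<eta>)"
        by (rule locally_finite_sigma_finite[OF locally_finite_\<nu>])
      show "(\<lambda>y. \<Prod>i\<in>block n r c. ennreal (k (X i) y)) \<in> borel_measurable borel" for c
        using k(2) by measurable
      show "1 \<le> (if c \<in> ?I then card (block n r c) else 1)" for c
        using card_block_range[OF r] by auto
      show "Min (block n r c) = c" if "c \<in> ?I" for c by (rule Min_block_range(1)[OF r that])
      show "(\<Prod>i\<in>block n r c. ennreal (k (X i) y)) < \<infinity>" for c y
        using k(1) by (simp add: prod_ennreal)
    qed simp_all
    also have "(\<Pi>\<^sub>M c\<in>?I. density \<eta> (\<lambda>y. (\<Prod>i\<in>block n r c. ennreal (k (X i) y)) *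
          kappa g \<rho> (if c \<in> ?I then card (block n r c) else 1) y)) = blocks r"
      unfolding blocks_def by (rule PiM_cong) (simp_all add: block_factor_def block_measure_def)
    also have "(\<integral>\<^sup>+y. \<integral>\<^sup>+s. G (\<lambda>c\<in>?I. (s (block n r c), y c)) \<partial>latent_jumps (ties n r) y \<partial>blocks r) =
        (\<integral>\<^sup>+y. \<integral>\<^sup>+s. \<integral>\<^sup>+N. F (conf r y s N) \<partial>Q \<partial>latent_jumps (ties n r) y \<partial>blocks r)"
    proof -
      have "H (\<lambda>c\<in>?I. (s (block n r c), y c)) N = conf r y s N" for s y N
      proof -
        have b: "block n r (r i) = block n r i" if "i \<in> {1..n}" for i
          using reps_D(3)[OF r that] by (rule block_cong)
        have "add_atoms N ?I (\<lambda>_. 1) (\<lambda>c\<in>?I. (s (block n r c), y c)) = add_atoms N ?I (\<lambda>_. 1) (\<lambda>c. (s (block n r c), y c))"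
          by (rule add_atoms_cong) simp
        then show ?thesis
          unfolding H_def conf_def using b by (auto intro!: restrict_ext)
      qed
      then show ?thesis unfolding G_def by simp
    qed
    finally show "(\<integral>\<^sup>+z. \<integral>\<^sup>+N. F' (\<lambda>i\<in>{1..n}. z (r i), add_atoms N ?I (\<lambda>_. 1) z) \<partial>Q \<partial>(\<Pi>\<^sub>M c\<in>?I. \<nu>\<^sub>f)) =
        (\<integral>\<^sup>+y. \<integral>\<^sup>+s. \<integral>\<^sup>+N. F (conf r y s N) \<partial>Q \<partial>latent_jumps (ties n r) y \<partial>blocks r)" .
  qed
  finally show ?thesis .
qed

text \<open>\<open>kappa\<close> is a factor of the density of the block measure, hence nonzero
  almost everywhere under it; there the jump law has full mass.\<close>

lemma AE_blocks_kappa: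
  assumes r: "r \<in> reps n"
  shows "AE y in blocks r. \<forall>C\<in>ties n r. prob_space (jump_law g \<rho> (card C) (y (Min C)))"
proof -
  interpret product_sigma_finite "block_factor r"
    using sigma_finite_block_factor[OF r] by (simp add: product_sigma_finite_def)
  have *: "AE y in blocks r. prob_space (jump_law g \<rho> (card C) (y (Min C)))" if C: "C \<in> ties n r" for C
    unfolding blocks_def
  proof (rule AE_PiM_component_finite[where P="\<lambda>y. prob_space (jump_law g \<rho> (card C) y)"])
    note M = ties_Min_reps[OF r C]
    show "Min C \<in> r ` {1..n}" by (rule M(1))
    have "1 \<le> card C" using card_block_range[OF r M(1)] M(2) by simp
    then have imp: "prob_space (jump_law g \<rho> (card C) y)" if "kappa g \<rho> (card C) y \<noteq> 0" for y
      using that by (rule prob_space_jump_law)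
    have "AE y in block_measure k g X \<rho> \<eta> C. prob_space (jump_law g \<rho> (card C) y)"
      unfolding block_measure_def AE_density[OF measurable_block_density]
      by (intro AE_I2 impI, rule imp) auto
    moreover have "block_factor r (Min C) = block_measure k g X \<rho> \<eta> C"
      using M(1,2) by (simp add: block_factor_def)
    ultimately show "AE y in block_factor r (Min C). prob_space (jump_law g \<rho> (card C) y)"
      by (simp only:)
  qed simp
  then show ?thesis by (simp add: AE_finite_all finite_ties)
qed

text \<open>For fixed values of the other locations, coincidence with one of them confines the
  location of \<open>c\<close> to a single point, a null set for the nonatomic \<open>\<eta>\<close>
  and for every density over it.\<close>

lemma AE_blocks_inj:
  assumes r: "r \<in> reps n"
  shows "AE y in blocks r. inj_on y (r ` {1..n})"
proof -
  let ?I = "r ` {1..n}"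
  interpret product_sigma_finite "block_factor r"
    using sigma_finite_block_factor[OF r] by (simp add: product_sigma_finite_def)
  have *: "AE y in blocks r. y c \<noteq> y c'" if c: "c \<in> ?I" "c' \<in> ?I" "c \<noteq> c'" for c c'
  proof -
    obtain J where J3: "?I = insert c J" and J2: "c \<notin> J"
      using mk_disjoint_insert[OF c(1)] by blast
    have "finite (insert c J)" unfolding J3[symmetric] by simp
    then have J1: "finite J" by simp
    let ?f = "\<lambda>y. indicator {y\<in>space (\<Pi>\<^sub>M c\<in>?I. borel :: 'y measure). y c = y c'} y :: ennreal"
    have m: "{y\<in>space (\<Pi>\<^sub>M c\<in>?I. borel :: 'y measure). y c = y c'} \<in> sets (\<Pi>\<^sub>M c\<in>?I. borel)"
      using c(1,2) by measurable
    then have m': "{y\<in>space (\<Pi>\<^sub>M c\<in>?I. borel :: 'y measure). y c = y c'} \<in> sets (blocks r)"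
      by (simp add: sets_blocks)
    have "(\<integral>\<^sup>+y. ?f y \<partial>blocks r) = (\<integral>\<^sup>+x. \<integral>\<^sup>+y. ?f (x(c := y)) \<partial>block_factor r c \<partial>PiM J (block_factor r))"
      unfolding blocks_def J3
    proof (rule product_nn_integral_insert[OF J1 J2])
      show "(\<lambda>y. indicator {y \<in> space (\<Pi>\<^sub>M c\<in>insert c J. borel). y c = y c'} y) \<in> borel_measurable (PiM (insert c J) (block_factor r))"
        unfolding J3[symmetric] using m' by (intro borel_measurable_indicator) (simp add: blocks_def)
    qed
    also have "\<dots> = (\<integral>\<^sup>+x. 0 \<partial>PiM J (block_factor r))"
    proof (rule nn_integral_cong)
      fix x
      have "(\<integral>\<^sup>+y. ?f (x(c := y)) \<partial>block_factor r c) \<le> (\<integral>\<^sup>+y. indicator {x c'} y \<partial>block_factor r c)"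
        using c(3) by (intro nn_integral_mono) (auto simp: indicator_def)
      also have "\<dots> = emeasure (block_factor r c) {x c'}" by (simp add: sets_block_factor)
      also have "\<dots> = 0"
      proof -
        have "{x c'} \<in> sets \<eta>" by (simp add: eta)
        then have n: "{x c'} \<in> null_sets \<eta>" using nonatomic_singleton[OF nonatomic] by auto
        then show ?thesis
          using null_sets_density_iff[OF measurable_block_density, of "{x c'}"] c(1)
          by (auto simp: block_factor_def block_measure_def null_sets_def emeasure_density[OF measurable_block_density]
              nn_integral_null_set[OF n])
      qed
      finally show "(\<integral>\<^sup>+y. ?f (x(c := y)) \<partial>block_factor r c) = 0" by simp
    qed
    finally have "(\<integral>\<^sup>+y. ?f y \<partial>blocks r) = 0" by simp
    then have "emeasure (blocks r) {y\<in>space (\<Pi>\<^sub>M c\<in>?I. borel :: 'y measure). y c = y c'} = 0"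
      using m' by simp
    then show ?thesis
      using m' by (intro AE_I[of _ _ "{y\<in>space (\<Pi>\<^sub>M c\<in>?I. borel :: 'y measure). y c = y c'}"])
        (auto simp: space_blocks space_PiM)
  qed
  have "AE y in blocks r. \<forall>c\<in>?I. \<forall>c'\<in>?I. c \<noteq> c' \<longrightarrow> y c \<noteq> y c'"
    using * by (intro AE_finite_allI) auto
  then show ?thesis by eventually_elim (auto simp: inj_on_def)
qed

end

section \<open>The joint law of jumps, locations and point process\<close>

lemma add_atoms_reindex:
  assumes "bij_betw \<beta> I J"
  shows "add_atoms N J w z = add_atoms N I (\<lambda>i. w (\<beta> i)) (\<lambda>i. z (\<beta> i))"
proof -
  have "(\<Sum>j\<in>J. w j * indicator A (z j)) = (\<Sum>i\<in>I. w (\<beta> i) * indicator A (z (\<beta> i)))" for A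
    by (rule sum.reindex_bij_betw[OF assms, symmetric])
  then show ?thesis by (simp add: add_atoms_def)
qed

text \<open>By \<open>ties_eq_iff\<close> the event is a finite Boolean combination of the diagonals
  \<open>Y i = Y l\<close>, which are measurable in a Polish space.\<close>

lemma sets_ties_eq: "{Y\<in>space (locs_space n :: (nat \<Rightarrow> 'y::polish_space) measure). ties n Y = ties n r} \<in> sets (locs_space n)"
proof -
  have "{Y\<in>space (locs_space n :: (nat \<Rightarrow> 'y) measure). \<forall>i\<in>{1..n}. \<forall>l\<in>{1..n}. (Y i = Y l) = (r i = r l)} \<in> sets (locs_space n)"
  proof (intro sets.sets_Collect_finite_All)
    fix i l assume il: "i \<in> {1..n}" "l \<in> {1..n}"
    have eq: "{Y\<in>space (locs_space n :: (nat \<Rightarrow> 'y) measure). Y i = Y l} \<in> sets (locs_space n)"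
      using il by measurable
    have "{Y\<in>space (locs_space n :: (nat \<Rightarrow> 'y) measure). Y i \<noteq> Y l} =
        space (locs_space n) - {Y\<in>space (locs_space n). Y i = Y l}" by auto
    also have "\<dots> \<in> sets (locs_space n)" using eq by (rule sets.compl_sets)
    finally have "{Y\<in>space (locs_space n :: (nat \<Rightarrow> 'y) measure). Y i \<noteq> Y l} \<in> sets (locs_space n)" .
    with eq show "{Y\<in>space (locs_space n :: (nat \<Rightarrow> 'y) measure). (Y i = Y l) = (r i = r l)} \<in> sets (locs_space n)"
      by (cases "r i = r l") simp_all
  qed simp_all
  then show ?thesis by (simp only: ties_eq_iff)
qed

lemma ties_reps_inj:
  assumes r: "r \<in> reps n" and y: "inj_on y (r ` {1..n})"
  shows "ties n (\<lambda>i\<in>{1..n}. y (r i)) = ties n r"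
  unfolding ties_eq_iff using inj_on_eq_iff[OF y] by auto

context posterior_model begin

lemma space_data_space: "space data_space = (\<Pi>\<^sub>E i\<in>{1..n}. {0<..}) \<times> (\<Pi>\<^sub>E i\<in>{1..n}. UNIV) \<times> point_measures d"
  by (simp add: space_pair_measure space_PiM)

lemma space_joint[simp]: "space joint = space data_space"
  by (rule sets_eq_imp_space_eq[OF sets_joint])

lemma conf_space:
  assumes r: "r \<in> reps n" and "y \<in> space (blocks r)" "s \<in> space (latent_jumps (ties n r) y')" "N \<in> point_measures d"
  shows "conf r y s N \<in> space data_space"
  using measurable_space[OF measurable_conf_N[OF assms(1-3)], of N] assms(4) by simp

lemma AE_blocks_latent:
  assumes r: "r \<in> reps n"
  shows "AE y in blocks r. prob_space (latent_jumps (ties n r) y)"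
  using AE_blocks_kappa[OF r] unfolding latent_jumps_def
  by eventually_elim (auto intro: prob_space_PiM)

lemma emeasure_blocks_box:
  assumes r: "r \<in> reps n" and A: "\<And>c. c \<in> r ` {1..n} \<Longrightarrow> A c \<in> sets borel"
  shows "emeasure (blocks r) (\<Pi>\<^sub>E c\<in>r ` {1..n}. A c) = (\<Prod>c\<in>r ` {1..n}. emeasure (block_measure k g X \<rho> \<eta> (block n r c)) (A c))"
proof -
  interpret product_sigma_finite "block_factor r"
    using sigma_finite_block_factor[OF r] by (simp add: product_sigma_finite_def)
  have "emeasure (blocks r) (\<Pi>\<^sub>E c\<in>r ` {1..n}. A c) = (\<Prod>c\<in>r ` {1..n}. emeasure (block_factor r c) (A c))"
    unfolding blocks_def by (rule emeasure_PiM) (use A in \<open>auto simp: sets_block_factor\<close>)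
  then show ?thesis by (simp add: block_factor_def)
qed

lemma emeasure_blocks_space:
  assumes r: "r \<in> reps n"
  shows "emeasure (blocks r) (space (blocks r)) = (\<Prod>C\<in>ties n r. block_mass k g X \<rho> \<eta> C)"
  unfolding space_blocks using emeasure_blocks_box[OF r, of "\<lambda>_. UNIV"]
  by (simp add: emeasure_block_measure_space prod_ties_reps[OF r])

abbreviation mass where "mass \<equiv> partition_constant n k g X \<rho> \<eta>"

lemma mass_eq: "mass = (\<Sum>r\<in>reps n. emeasure (blocks r) (space (blocks r)))"
proof -
  have "(\<Sum>r\<in>reps n. emeasure (blocks r) (space (blocks r))) = (\<Sum>r\<in>reps n. \<Prod>C\<in>ties n r. block_mass k g X \<rho> \<eta> C)"
    by (intro sum.cong refl emeasure_blocks_space)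
  also have "\<dots> = mass"
    unfolding partition_constant_def by (rule sum.reindex_bij_betw[OF bij_betw_ties])
  finally show ?thesis ..
qed

text \<open>The total mass computed twice: through partitions it is the tilt constant times
  \<open>C(X)\<close>, directly it is the mean likelihood. The comparison transfers positivity and
  finiteness from the latter to \<open>C(X)\<close>.\<close>

lemma emeasure_unnormalized_space:
  "emeasure unnormalized (space unnormalized) = tilt_mass * mass"
  "emeasure unnormalized (space unnormalized) = (\<integral>\<^sup>+N. likelihood n k g X (mu_of N) \<partial>P)"
proof -
  have one: "emeasure unnormalized (space unnormalized) = (\<integral>\<^sup>+x. 1 \<partial>unnormalized)" by simp
  have "(\<integral>\<^sup>+y. \<integral>\<^sup>+s. \<integral>\<^sup>+N. 1 \<partial>Q \<partial>latent_jumps (ties n r) y \<partial>blocks r) = (\<integral>\<^sup>+y. 1 \<partial>blocks r)" if r: "r \<in> reps n" for r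
  proof (rule nn_integral_cong_AE)
    show "AE y in blocks r. (\<integral>\<^sup>+s. \<integral>\<^sup>+N. 1 \<partial>Q \<partial>latent_jumps (ties n r) y) = 1"
      using AE_blocks_latent[OF r] by eventually_elim (simp add: Q.emeasure_space_1[simplified] prob_space.emeasure_space_1)
  qed
  then show "emeasure unnormalized (space unnormalized) = tilt_mass * mass"
    unfolding one by (subst nn_integral_unnormalized_reps) (simp_all add: mass_eq cong: sum.cong)
  show "emeasure unnormalized (space unnormalized) = (\<integral>\<^sup>+N. likelihood n k g X (mu_of N) \<partial>P)"
    unfolding one by (subst nn_integral_unnormalized) (auto simp: likelihood_eq intro!: nn_integral_cong)
qed

lemma mass: "0 < mass" "mass < \<infinity>"
proof -
  have "0 < tilt_mass * mass" "tilt_mass * mass < \<infinity>"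
    using well_defined emeasure_unnormalized_space by simp_all
  then show "0 < mass" "mass < \<infinity>"
    using tilt_mass(1) by (auto simp: zero_less_iff_neq_zero ennreal_mult_less_top)
qed

lemma prob_space_joint: "prob_space joint"
  unfolding joint_eq using well_defined emeasure_unnormalized_space(2)
  by (intro prob_space_normalized) simp_all

text \<open>The tilt constant occurs in the numerator and in the total mass and cancels, so only
  \<open>C(X)\<close> remains as normalisation.\<close>

lemma nn_integral_joint:
  assumes F: "F \<in> borel_measurable data_space"
  shows "(\<integral>\<^sup>+x. F x \<partial>joint) = inverse mass * (\<Sum>r\<in>reps n.
    \<integral>\<^sup>+y. \<integral>\<^sup>+s. \<integral>\<^sup>+N. F (conf r y s N) \<partial>Q \<partial>latent_jumps (ties n r) y \<partial>blocks r)"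
proof -
  have s: "sets unnormalized = sets data_space" by (simp add: unnormalized_def)
  have "tilt_mass * inverse tilt_mass = 1"
    using tilt_mass by (simp add: divide_ennreal_def[symmetric])
  then have *: "inverse (tilt_mass * mass) * (tilt_mass * a) = inverse mass * a" for a
    using tilt_mass(2) mass(2) by (simp add: ennreal_inverse_mult) (metis mult.assoc mult.commute mult_1)
  have "(\<integral>\<^sup>+x. F x \<partial>joint) = inverse (tilt_mass * mass) * (\<integral>\<^sup>+x. F x \<partial>unnormalized)"
    unfolding joint_eq emeasure_unnormalized_space(1)[symmetric]
    by (rule nn_integral_normalized) (unfold measurable_cong_sets[OF s refl], rule F)
  then show ?thesis unfolding nn_integral_unnormalized_reps[OF F] * .
qed

text \<open>Integrating out the points leaves \<open>tilt\<close> times a product of integrals,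
  which is the likelihood of \<open>mu_of N\<close>.\<close>

lemma distr_joint_N: "distr joint P (\<lambda>(J, Y, N). N) = posterior_N n k g X P"
proof (rule measure_eqI)
  let ?L = "\<lambda>N. likelihood n k g X (mu_of N)"
  show "sets (distr joint P (\<lambda>(J, Y, N). N)) = sets (posterior_N n k g X P)"
    by (simp add: posterior_N_def)
  fix A assume "A \<in> sets (distr joint P (\<lambda>(J, Y, N). N))"
  then have A: "A \<in> sets P" by simp
  then have A': "A \<in> sets PM" by (simp add: sets_P)
  have mw: "(\<lambda>N. \<integral>\<^sup>+z. (\<Prod>i=1..n. w i (z i)) \<partial>(\<Pi>\<^sub>M i\<in>{1..n}. N)) \<in> borel_measurable PM"
  proof (rule measurable_nn_integral_PiM_PM)
    have "(\<lambda>z. \<Prod>i=1..n. w i (z i)) \<in> borel_measurable (\<Pi>\<^sub>M i\<in>{1..n}. jump_loc_space)" by measurable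
    from measurable_compose[OF measurable_snd this]
    show "(\<lambda>(N, z). \<Prod>i=1..n. w i (z i)) \<in> borel_measurable (PM \<Otimes>\<^sub>M (\<Pi>\<^sub>M i\<in>{1..n}. jump_loc_space))"
      by (simp add: case_prod_beta)
  qed simp_all
  have mL: "?L \<in> borel_measurable P"
  proof (rule measurable_cong[THEN iffD2])
    show "(\<lambda>N. tilt N * (\<integral>\<^sup>+z. (\<Prod>i=1..n. w i (z i)) \<partial>(\<Pi>\<^sub>M i\<in>{1..n}. N))) \<in> borel_measurable P"
      unfolding measurable_cong_sets[OF sets_P refl] by (intro borel_measurable_times_ennreal measurable_tilt_PM mw)
  qed (simp add: likelihood_eq)
  have mN: "(\<lambda>(J, Y, N). N) \<in> measurable joint P"
    unfolding measurable_cong_sets[OF sets_joint sets_P] by measurable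
  have mF: "(\<lambda>(J, Y, N). indicator A N :: ennreal) \<in> borel_measurable data_space"
    using A' by measurable
  have d: "emeasure (density P ?L) (space (density P ?L)) = (\<integral>\<^sup>+N. ?L N \<partial>P)"
  proof -
    have "emeasure (density P ?L) (space P) = (\<integral>\<^sup>+N. ?L N * indicator (space P) N \<partial>P)"
      by (rule emeasure_density[OF mL sets.top])
    also have "\<dots> = (\<integral>\<^sup>+N. ?L N \<partial>P)" by (rule nn_integral_cong) simp
    finally show ?thesis by simp
  qed
  have "emeasure (distr joint P (\<lambda>(J, Y, N). N)) A = (\<integral>\<^sup>+N. indicator A N \<partial>distr joint P (\<lambda>(J, Y, N). N))"
    using A by simp
  also have "\<dots> = (\<integral>\<^sup>+x. (\<lambda>(J, Y, N). indicator A N) x \<partial>joint)"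
    using A by (subst nn_integral_distr[OF mN]) (auto intro!: nn_integral_cong simp: case_prod_beta)
  also have "\<dots> = inverse (\<integral>\<^sup>+N. ?L N \<partial>P) * (\<integral>\<^sup>+x. (\<lambda>(J, Y, N). indicator A N) x \<partial>unnormalized)"
    unfolding joint_eq emeasure_unnormalized_space(2)[symmetric]
    using mF by (intro nn_integral_normalized) (simp add: unnormalized_def cong: measurable_cong_sets)
  also have "(\<integral>\<^sup>+x. (\<lambda>(J, Y, N). indicator A N) x \<partial>unnormalized) = (\<integral>\<^sup>+N. ?L N * indicator A N \<partial>P)"
  proof (subst nn_integral_unnormalized[OF mF], rule nn_integral_cong)
    fix N assume N: "N \<in> space P"
    then show "tilt N * (\<integral>\<^sup>+z. (\<Prod>i=1..n. w i (z i)) * (case (\<lambda>i\<in>{1..n}. fst (z i), \<lambda>i\<in>{1..n}. snd (z i), N) of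
        (J, Y, N) \<Rightarrow> indicator A N) \<partial>(\<Pi>\<^sub>M i\<in>{1..n}. N)) = ?L N * indicator A N"
      by (cases "N \<in> A") (simp_all add: likelihood_eq)
  qed
  also have "inverse (\<integral>\<^sup>+N. ?L N \<partial>P) * \<dots> = emeasure (posterior_N n k g X P) A"
    unfolding posterior_N_def emeasure_normalized d by (simp add: emeasure_density[OF mL A])
  finally show "emeasure (distr joint P (\<lambda>(J, Y, N). N)) A = emeasure (posterior_N n k g X P) A" .
qed

text \<open>Almost sure statements under the joint law reduce to almost every family of locations
  under \<open>blocks r\<close>, with arbitrary jumps and Poisson part.\<close>

lemma AE_joint:
  assumes m: "{x\<in>space data_space. R x} \<in> sets data_space"
    and ae: "\<And>r. r \<in> reps n \<Longrightarrow> AE y in blocks r. \<forall>s\<in>space (latent_jumps (ties n r) y). \<forall>N\<in>point_measures d. R (conf r y s N)"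
  shows "AE x in joint. R x"
proof -
  let ?B = "{x\<in>space data_space. \<not> R x}"
  have "?B = space data_space - {x\<in>space data_space. R x}" by auto
  then have B: "?B \<in> sets data_space" using m by auto
  then have "(\<integral>\<^sup>+x. indicator ?B x \<partial>joint) = inverse mass * (\<Sum>r\<in>reps n.
      \<integral>\<^sup>+y. \<integral>\<^sup>+s. \<integral>\<^sup>+N. indicator ?B (conf r y s N) \<partial>Q \<partial>latent_jumps (ties n r) y \<partial>blocks r)"
    by (intro nn_integral_joint borel_measurable_indicator)
  also have "(\<Sum>r\<in>reps n. \<integral>\<^sup>+y. \<integral>\<^sup>+s. \<integral>\<^sup>+N. indicator ?B (conf r y s N) \<partial>Q \<partial>latent_jumps (ties n r) y \<partial>blocks r) = 0"
  proof (rule sum.neutral, rule ballI)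
    fix r assume r: "r \<in> reps n"
    have "(\<integral>\<^sup>+y. \<integral>\<^sup>+s. \<integral>\<^sup>+N. indicator ?B (conf r y s N) \<partial>Q \<partial>latent_jumps (ties n r) y \<partial>blocks r) = (\<integral>\<^sup>+y. 0 \<partial>blocks r)"
    proof (rule nn_integral_cong_AE)
      show "AE y in blocks r. (\<integral>\<^sup>+s. \<integral>\<^sup>+N. indicator ?B (conf r y s N) \<partial>Q \<partial>latent_jumps (ties n r) y) = (0::ennreal)"
        using ae[OF r]
      proof eventually_elim
        case (elim y)
        have "(\<integral>\<^sup>+s. \<integral>\<^sup>+N. indicator ?B (conf r y s N) \<partial>Q \<partial>latent_jumps (ties n r) y) = (\<integral>\<^sup>+s. \<integral>\<^sup>+N. 0 \<partial>Q \<partial>latent_jumps (ties n r) y)"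
          using elim by (intro nn_integral_cong) simp
        then show ?case by simp
      qed
    qed
    then show "(\<integral>\<^sup>+y. \<integral>\<^sup>+s. \<integral>\<^sup>+N. indicator ?B (conf r y s N) \<partial>Q \<partial>latent_jumps (ties n r) y \<partial>blocks r) = 0" by simp
  qed
  finally have "emeasure joint ?B = 0" using B by (simp add: sets_joint)
  with B show ?thesis
    by (intro AE_I[of _ _ ?B]) (simp_all add: sets_joint)
qed

lemma conf_Y: "fst (snd (conf r y s N)) = (\<lambda>i\<in>{1..n}. y (r i))"
  and conf_J: "fst (conf r y s N) = (\<lambda>i\<in>{1..n}. s (block n r i))"
  by (simp_all add: conf_def)

text \<open>Since \<open>y\<close> is injective, the ties of \<open>Y\<close> are those of
  \<open>r\<close>, and \<open>N_star\<close> restores exactly the atoms that \<open>conf\<close>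
  has added. The jumps \<open>s'\<close> have to match \<open>s\<close> on blocks only, which admits
  jumps read off from \<open>J\<close>.\<close>

lemma N_star_conf:
  assumes r: "r \<in> reps n" and y: "inj_on y (r ` {1..n})"
    and s: "\<And>C. C \<in> ties n r \<Longrightarrow> s' C = s C"
  shows "N_star n (\<lambda>i\<in>{1..n}. y (r i)) N s' = snd (snd (conf r y s N))"
proof -
  have "add_atoms N (ties n r) (\<lambda>_. 1) (\<lambda>C. (s' C, (\<lambda>i\<in>{1..n}. y (r i)) (Min C))) =
      add_atoms N (r ` {1..n}) (\<lambda>_. 1) (\<lambda>c. (s' (block n r c), (\<lambda>i\<in>{1..n}. y (r i)) (Min (block n r c))))"
    by (rule add_atoms_reindex[OF bij_betw_block_reps[OF r]])
  also have "\<dots> = add_atoms N (r ` {1..n}) (\<lambda>_. 1) (\<lambda>c. (s (block n r c), y c))"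
  proof (rule add_atoms_cong)
    fix c assume c: "c \<in> r ` {1..n}"
    have "block n r c \<in> ties n r" using bij_betw_block_reps[OF r] c by (auto simp: bij_betw_def)
    then show "(s' (block n r c), (\<lambda>i\<in>{1..n}. y (r i)) (Min (block n r c))) = (s (block n r c), y c)"
      using Min_block_range[OF r c] s by auto
  qed
  finally show ?thesis
    unfolding N_star_def ties_reps_inj[OF r y] conf_def snd_conv .
qed

text \<open>Distinct blocks have almost surely distinct locations, so equal locations stem from one
  block and share its jump.\<close>

lemma AE_joint_ties: "AE (J, Y, N) in joint. \<forall>i\<in>{1..n}. \<forall>l\<in>{1..n}. Y i = Y l \<longrightarrow> J i = J l"
  unfolding case_prod_beta
proof (rule AE_joint)
  show "{x \<in> space data_space. \<forall>i\<in>{1..n}. \<forall>l\<in>{1..n}. fst (snd x) i = fst (snd x) l \<longrightarrow> fst x i = fst x l} \<in> sets data_space"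
  proof (intro sets.sets_Collect_finite_All)
    fix i l assume il[measurable]: "i \<in> {1..n}" "l \<in> {1..n}"
    have [measurable]: "(\<lambda>x. fst x j) \<in> borel_measurable data_space" if "j \<in> {1..n}" for j
      by (rule measurable_jump_ident[OF measurable_compose[OF measurable_fst measurable_component_singleton[OF that]]])
    show "{x \<in> space data_space. fst (snd x) i = fst (snd x) l \<longrightarrow> fst x i = fst x l} \<in> sets data_space"
      using il by measurable
  qed simp_all
  fix r assume r: "r \<in> reps n"
  show "AE y in blocks r. \<forall>s\<in>space (latent_jumps (ties n r) y). \<forall>N\<in>point_measures d.
      \<forall>i\<in>{1..n}. \<forall>l\<in>{1..n}. fst (snd (conf r y s N)) i = fst (snd (conf r y s N)) l \<longrightarrow> fst (conf r y s N) i = fst (conf r y s N) l"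
    using AE_blocks_inj[OF r]
  proof eventually_elim
    case (elim y)
    then show ?case
      unfolding conf_Y conf_J using inj_on_eq_iff[OF elim] by (auto intro: arg_cong[OF block_cong])
  qed
qed

text \<open>Reduces a conditional law under the mixture over partitions to an identity for almost
  every \<open>y\<close>, in which only the jumps and the Poisson part are still integrated.\<close>

lemma has_cond_law_joint:
  assumes V: "V \<in> measurable data_space MV" and W: "W \<in> measurable data_space MW"
    and sK: "\<And>v. v \<in> space MW \<Longrightarrow> sets (K v) = sets MV"
    and mK: "\<And>B. B \<in> sets MV \<Longrightarrow> (\<lambda>v. emeasure (K v) B) \<in> borel_measurable MW"
    and prob: "\<And>r. r \<in> reps n \<Longrightarrow> AE y in blocks r. \<forall>s\<in>space (latent_jumps (ties n r) y). \<forall>N\<in>point_measures d.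
      prob_space (K (W (conf r y s N)))"
    and key: "\<And>r A B. r \<in> reps n \<Longrightarrow> A \<in> sets MW \<Longrightarrow> B \<in> sets MV \<Longrightarrow> AE y in blocks r.
      (\<integral>\<^sup>+s. \<integral>\<^sup>+N. indicator A (W (conf r y s N)) * indicator B (V (conf r y s N)) \<partial>Q \<partial>latent_jumps (ties n r) y) =
      (\<integral>\<^sup>+s. \<integral>\<^sup>+N. emeasure (K (W (conf r y s N))) B * indicator A (W (conf r y s N)) \<partial>Q \<partial>latent_jumps (ties n r) y)"
  shows "has_cond_law joint V MV W MW K"
  unfolding has_cond_law_def
proof (intro conjI ballI)
  show V': "V \<in> measurable joint MV" and W': "W \<in> measurable joint MW"
    using V W by (simp_all add: measurable_cong_sets[OF sets_joint refl])
  show "sets (K v) = sets MV" if "v \<in> space MW" for v using sK[OF that] .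
  show "(\<lambda>v. emeasure (K v) B) \<in> borel_measurable MW" if "B \<in> sets MV" for B using mK[OF that] .
  \<comment> \<open>Rewritten through \<open>emeasure\<close>, the property defines a measurable
    set, as the transfer along \<open>W\<close> requires.\<close>
  have pr: "prob_space (K v) \<longleftrightarrow> emeasure (K v) (space MV) = 1" if "v \<in> space MW" for v
    using sets_eq_imp_space_eq[OF sK[OF that]] by (auto intro: prob_spaceI dest: prob_space.emeasure_space_1)
  have m1: "{v\<in>space MW. emeasure (K v) (space MV) = 1} \<in> sets MW"
    using mK[OF sets.top] by measurable
  have "AE x in joint. emeasure (K (W x)) (space MV) = 1"
  proof (rule AE_joint)
    have "(\<lambda>x. emeasure (K (W x)) (space MV)) \<in> borel_measurable data_space"
      by (rule measurable_compose[OF W mK[OF sets.top]])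
    then show "{x\<in>space data_space. emeasure (K (W x)) (space MV) = 1} \<in> sets data_space" by measurable
    fix r assume r: "r \<in> reps n"
    show "AE y in blocks r. \<forall>s\<in>space (latent_jumps (ties n r) y). \<forall>N\<in>point_measures d.
        emeasure (K (W (conf r y s N))) (space MV) = 1"
      using prob[OF r] AE_space
    proof eventually_elim
      case (elim y)
      then show ?case using pr measurable_space[OF W conf_space[OF r]] by blast
    qed
  qed
  then have "AE v in distr joint MW W. emeasure (K v) (space MV) = 1"
    by (subst AE_distr_iff[OF W' m1])
  then show "AE v in distr joint MW W. prob_space (K v)"
    using AE_space by eventually_elim (simp add: pr)
  fix A B assume A: "A \<in> sets MW" and B: "B \<in> sets MV"
  have e: "{\<omega>\<in>space joint. W \<omega> \<in> A \<and> V \<omega> \<in> B} = (W -` A \<inter> space data_space) \<inter> (V -` B \<inter> space data_space)" by auto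
  have ms: "{\<omega>\<in>space joint. W \<omega> \<in> A \<and> V \<omega> \<in> B} \<in> sets joint"
    unfolding e sets_joint using measurable_sets[OF W A] measurable_sets[OF V B] by auto
  have m2: "(\<lambda>x. indicator A (W x) * indicator B (V x) :: ennreal) \<in> borel_measurable data_space"
    using A B by (intro borel_measurable_times_ennreal measurable_compose[OF W] measurable_compose[OF V]) auto
  have m3: "(\<lambda>x. emeasure (K (W x)) B * indicator A (W x)) \<in> borel_measurable data_space"
    using A by (intro borel_measurable_times_ennreal measurable_compose[OF W] mK B) auto
  have "emeasure joint {\<omega>\<in>space joint. W \<omega> \<in> A \<and> V \<omega> \<in> B} = (\<integral>\<^sup>+x. indicator {\<omega>\<in>space joint. W \<omega> \<in> A \<and> V \<omega> \<in> B} x \<partial>joint)"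
    by (rule nn_integral_indicator[OF ms, symmetric])
  also have "\<dots> = (\<integral>\<^sup>+x. indicator A (W x) * indicator B (V x) \<partial>joint)"
    by (intro nn_integral_cong) (auto simp: indicator_def)
  also have "\<dots> = (\<integral>\<^sup>+x. emeasure (K (W x)) B * indicator A (W x) \<partial>joint)"
    unfolding nn_integral_joint[OF m2] nn_integral_joint[OF m3]
    by (intro arg_cong2[where f=times] refl sum.cong nn_integral_cong_AE key A B)
  also have "\<dots> = (\<integral>\<^sup>+v. emeasure (K v) B * indicator A v \<partial>distr joint MW W)"
  proof (rule nn_integral_distr[OF W', symmetric])
    have "(\<lambda>v. emeasure (K v) B * indicator A v) \<in> borel_measurable MW"
      by (intro borel_measurable_times_ennreal mK B borel_measurable_indicator A)
    then show "(\<lambda>v. emeasure (K v) B * indicator A v) \<in> borel_measurable (distr joint MW W)" by simp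
  qed
  finally show "emeasure joint {\<omega>\<in>space joint. W \<omega> \<in> A \<and> V \<omega> \<in> B} =
      (\<integral>\<^sup>+v. emeasure (K v) B * indicator A v \<partial>distr joint MW W)" .
qed

section \<open>Conditional laws given the locations\<close>

lemma latent_law_eq: "latent_law n g \<rho> Q Y = Q \<Otimes>\<^sub>M latent_jumps (ties n Y) Y"
  by (simp add: latent_law_def latent_jumps_def)

lemma latent_jumps_cong: "(\<And>C. C \<in> p \<Longrightarrow> Y (Min C) = Z (Min C)) \<Longrightarrow> latent_jumps p Y = latent_jumps p Z"
  unfolding latent_jumps_def by (rule PiM_cong) simp_all

lemma sets_latent_law: "sets (latent_law n g \<rho> Q Y) = sets (PM \<Otimes>\<^sub>M (\<Pi>\<^sub>M C\<in>ties n Y. jump_space))"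
  unfolding latent_law_eq by (intro sets_pair_measure_cong Q.sets_Q sets_latent_jumps)

lemma measurable_Q_const: "(\<lambda>_. Q) \<in> measurable M (subprob_algebra PM)"
  using Q.prob_space_axioms
  by (intro measurable_const) (simp add: space_subprob_algebra Q.sets_Q prob_space_imp_subprob_space)

text \<open>The kernels depend on \<open>Y\<close> also through its partition, which even changes
  the index set of the jumps. On each of the finitely many events with fixed ties, a function
  \<open>h r\<close> built for that one partition takes over.\<close>

lemma measurable_piecewise:
  fixes h' :: "'c \<Rightarrow> ennreal"
  assumes h: "\<And>r. r \<in> reps n \<Longrightarrow> h r \<in> borel_measurable M" and \<pi>: "\<pi> \<in> measurable M (locs_space n :: (nat \<Rightarrow> 'y) measure)"
    and eq: "\<And>v r. v \<in> space M \<Longrightarrow> r \<in> reps n \<Longrightarrow> ties n (\<pi> v) = ties n r \<Longrightarrow> h' v = h r v"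
  shows "h' \<in> borel_measurable M"
proof -
  have *: "h' v = (\<Sum>r\<in>reps n. h r v * indicator {Y\<in>space (locs_space n). ties n Y = ties n r} (\<pi> v))"
    if v: "v \<in> space M" for v
  proof -
    have "(\<Sum>r\<in>reps n. h r v * indicator {Y\<in>space (locs_space n). ties n Y = ties n r} (\<pi> v)) =
        (\<Sum>r\<in>{rep n (\<pi> v)}. h r v)"
    proof (rule sum.mono_neutral_cong_right)
      show "{rep n (\<pi> v)} \<subseteq> reps n" by (simp add: rep_reps)
      show "\<forall>r\<in>reps n - {rep n (\<pi> v)}. h r v * indicator {Y\<in>space (locs_space n). ties n Y = ties n r} (\<pi> v) = 0"
      proof
        fix r assume r: "r \<in> reps n - {rep n (\<pi> v)}"
        then have "ties n (rep n (\<pi> v)) \<noteq> ties n r"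
          using bij_betw_ties[of n] rep_reps[of n "\<pi> v"] by (auto simp: bij_betw_def dest: inj_onD)
        then show "h r v * indicator {Y\<in>space (locs_space n). ties n Y = ties n r} (\<pi> v) = 0"
          by (simp add: ties_rep)
      qed
      show "h r v * indicator {Y\<in>space (locs_space n). ties n Y = ties n r} (\<pi> v) = h r v" if "r \<in> {rep n (\<pi> v)}" for r
        using that measurable_space[OF \<pi> v] by (simp add: ties_rep)
    qed (rule finite_reps)
    also have "\<dots> = h' v"
      using eq[OF v rep_reps[of n "\<pi> v"]] by (simp add: ties_rep)
    finally show ?thesis ..
  qed
  have "(\<lambda>v. \<Sum>r\<in>reps n. h r v * indicator {Y\<in>space (locs_space n). ties n Y = ties n r} (\<pi> v)) \<in> borel_measurable M"
    by (intro borel_measurable_sum borel_measurable_times_ennreal h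
        measurable_compose[OF \<pi> borel_measurable_indicator[OF sets_ties_eq]])
  then show ?thesis using * by (simp cong: measurable_cong)
qed

text \<open>The blocks are taken from a fixed \<open>r\<close>, so that measurability in \<open>Y\<close> can be checked separately on
  each of the finitely many events that fix the partition.\<close>

definition jumps_and_N :: "(nat \<Rightarrow> 'b) \<Rightarrow> (nat \<Rightarrow> 'y) \<Rightarrow> (real \<times> 'y) measure \<times> (nat set \<Rightarrow> real) \<Rightarrow>
    (nat \<Rightarrow> real) \<times> (real \<times> 'y) measure" where
  "jumps_and_N r Y x = (\<lambda>i\<in>{1..n}. snd x (block n r i), add_atoms (fst x) (ties n r) (\<lambda>_. 1) (\<lambda>C. (snd x C, Y (Min C))))"

lemma jumps_and_N_eq:
  "(\<lambda>(N, J). (\<lambda>i\<in>{1..n}. J (block n Y i), N_star n Y N J)) = jumps_and_N Y Y"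
  by (auto simp: jumps_and_N_def N_star_def fun_eq_iff)

lemma jumps_and_N_cong: "ties n r = ties n r' \<Longrightarrow> jumps_and_N r Y = jumps_and_N r' Y"
  using block_cong_ties[of n r r'] by (auto simp: jumps_and_N_def fun_eq_iff)

lemma measurable_jumps_and_N:
  "(\<lambda>(Y, x). jumps_and_N r Y x) \<in> measurable (locs_space n \<Otimes>\<^sub>M (PM \<Otimes>\<^sub>M (\<Pi>\<^sub>M C\<in>ties n r. jump_space))) (jumps_space n \<Otimes>\<^sub>M PM)"
proof -
  let ?M = "(locs_space n :: (nat \<Rightarrow> 'y) measure) \<Otimes>\<^sub>M (PM \<Otimes>\<^sub>M (\<Pi>\<^sub>M C\<in>ties n r. jump_space))"
  have b: "block n r i \<in> ties n r" if "i \<in> {1..n}" for i using that unfolding ties_def by (rule imageI)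
  have s: "(\<lambda>x. snd (snd x) C) \<in> measurable ?M jump_space" if "C \<in> ties n r" for C
    by (rule measurable_compose[OF measurable_compose[OF measurable_snd measurable_snd] measurable_component_singleton[OF that]])
  have y: "(\<lambda>x. fst x (Min C)) \<in> measurable ?M borel" if "C \<in> ties n r" for C
    using ties_nonempty[OF that]
    by (intro measurable_compose[OF measurable_fst measurable_component_singleton]) simp
  show ?thesis
    unfolding jumps_and_N_def case_prod_unfold
    by (intro measurable_Pair measurable_restrict measurable_add_atoms s y b finite_ties
        measurable_compose[OF measurable_snd measurable_fst])
qed

lemma measurable_jumps_and_N_Y:
  assumes Y: "Y \<in> space (locs_space n)"
  shows "jumps_and_N Y Y \<in> measurable (latent_law n g \<rho> Q Y) (jumps_space n \<Otimes>\<^sub>M PM)"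
  unfolding measurable_cong_sets[OF sets_latent_law refl]
  using measurable_Pair2[OF measurable_jumps_and_N[of Y] Y] by simp

lemma measurable_kernel_Y:
  assumes "B \<in> sets (jumps_space n \<Otimes>\<^sub>M PM)"
  shows "(\<lambda>Y. emeasure (distr (latent_law n g \<rho> Q Y) (jumps_space n \<Otimes>\<^sub>M PM) (jumps_and_N Y Y)) B) \<in> borel_measurable (locs_space n)"
proof (rule measurable_piecewise[where \<pi>="\<lambda>Y. Y" and
    h="\<lambda>r Y. emeasure (distr (Q \<Otimes>\<^sub>M latent_jumps (ties n r) Y) (jumps_space n \<Otimes>\<^sub>M PM) (jumps_and_N r Y)) B"])
  fix r assume r: "r \<in> reps n"
  have "(\<lambda>Y. latent_jumps (ties n r) Y) \<in> measurable (locs_space n) (subprob_algebra (\<Pi>\<^sub>M C\<in>ties n r. jump_space))"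
    by (intro measurable_latent_jumps finite_ties measurable_component_singleton)
      (use ties_nonempty[of _ n r] in blast)
  then have "(\<lambda>Y. distr (Q \<Otimes>\<^sub>M latent_jumps (ties n r) Y) (jumps_space n \<Otimes>\<^sub>M PM) (jumps_and_N r Y)) \<in>
      measurable (locs_space n) (subprob_algebra (jumps_space n \<Otimes>\<^sub>M PM))"
    by (intro measurable_distr2[OF measurable_jumps_and_N] measurable_pair_measure measurable_Q_const)
  then show "(\<lambda>Y. emeasure (distr (Q \<Otimes>\<^sub>M latent_jumps (ties n r) Y) (jumps_space n \<Otimes>\<^sub>M PM) (jumps_and_N r Y)) B) \<in> borel_measurable (locs_space n)"
    using assms by (rule measurable_emeasure_kernel)
next
  fix Y :: "nat \<Rightarrow> 'y" and r assume ties: "ties n Y = ties n r"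
  show "emeasure (distr (latent_law n g \<rho> Q Y) (jumps_space n \<Otimes>\<^sub>M PM) (jumps_and_N Y Y)) B =
      emeasure (distr (Q \<Otimes>\<^sub>M latent_jumps (ties n r) Y) (jumps_space n \<Otimes>\<^sub>M PM) (jumps_and_N r Y)) B"
    unfolding latent_law_eq jumps_and_N_cong[OF ties] ties ..
qed simp

lemma locs_conf: "(\<lambda>i\<in>{1..n}. y (r i)) \<in> space (locs_space n :: (nat \<Rightarrow> 'y) measure)"
  by (simp add: space_PiM)

text \<open>At a sample point the kernel is the average over jumps and Poisson part with the
  locations held fixed. For fixed \<open>y\<close> the event on the locations is constant, so the
  identity that defines a conditional law follows at once.\<close>

lemma emeasure_kernel_conf:
  assumes r: "r \<in> reps n" and y: "inj_on y (r ` {1..n})" and B: "B \<in> sets (jumps_space n \<Otimes>\<^sub>M PM)"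
  shows "emeasure (distr (latent_law n g \<rho> Q (\<lambda>i\<in>{1..n}. y (r i))) (jumps_space n \<Otimes>\<^sub>M PM)
      (jumps_and_N (\<lambda>i\<in>{1..n}. y (r i)) (\<lambda>i\<in>{1..n}. y (r i)))) B =
    (\<integral>\<^sup>+s. \<integral>\<^sup>+N. indicator B (fst (conf r y s N), snd (snd (conf r y s N))) \<partial>Q \<partial>latent_jumps (ties n r) y)"
proof -
  let ?Y = "\<lambda>i\<in>{1..n}. y (r i)"
  have ties: "ties n ?Y = ties n r" by (rule ties_reps_inj[OF r y])
  have lj: "latent_jumps (ties n ?Y) ?Y = latent_jumps (ties n r) y"
    unfolding ties
  proof (rule latent_jumps_cong)
    fix C assume C: "C \<in> ties n r"
    show "?Y (Min C) = y (Min C)"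
      using ties_Min_reps(3)[OF r C] ties_nonempty[OF C] by simp
  qed
  have Y: "?Y \<in> space (locs_space n :: (nat \<Rightarrow> 'y) measure)" by (rule locs_conf)
  have mT: "jumps_and_N ?Y ?Y \<in> measurable (Q \<Otimes>\<^sub>M latent_jumps (ties n r) y) (jumps_space n \<Otimes>\<^sub>M PM)"
    using measurable_jumps_and_N_Y[OF Y] unfolding latent_law_eq lj .
  interpret jl: subprob_space "jump_law g \<rho> (card C) (y (Min C))" for C
    by (rule subprob_space_jump_law)
  interpret jl: product_sigma_finite "\<lambda>C. jump_law g \<rho> (card C) (y (Min C))" by unfold_locales
  interpret lj: sigma_finite_measure "latent_jumps (ties n r) y"
    unfolding latent_jumps_def by (rule jl.sigma_finite[OF finite_ties])
  interpret pair: pair_sigma_finite Q "latent_jumps (ties n r) y" by unfold_locales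
  have mB: "(\<lambda>x. indicator B (jumps_and_N ?Y ?Y x) :: ennreal) \<in> borel_measurable (Q \<Otimes>\<^sub>M latent_jumps (ties n r) y)"
    by (rule measurable_compose[OF mT borel_measurable_indicator[OF B]])
  have "emeasure (distr (latent_law n g \<rho> Q ?Y) (jumps_space n \<Otimes>\<^sub>M PM) (jumps_and_N ?Y ?Y)) B =
      (\<integral>\<^sup>+x. indicator B x \<partial>distr (Q \<Otimes>\<^sub>M latent_jumps (ties n r) y) (jumps_space n \<Otimes>\<^sub>M PM) (jumps_and_N ?Y ?Y))"
    unfolding latent_law_eq lj using B by simp
  also have "\<dots> = (\<integral>\<^sup>+x. indicator B (jumps_and_N ?Y ?Y x) \<partial>(Q \<Otimes>\<^sub>M latent_jumps (ties n r) y))"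
    by (rule nn_integral_distr[OF mT]) (use B in simp)
  also have "\<dots> = (\<integral>\<^sup>+s. \<integral>\<^sup>+N. indicator B (jumps_and_N ?Y ?Y (N, s)) \<partial>Q \<partial>latent_jumps (ties n r) y)"
    by (rule pair.nn_integral_snd[OF mB, symmetric])
  also have "\<dots> = (\<integral>\<^sup>+s. \<integral>\<^sup>+N. indicator B (fst (conf r y s N), snd (snd (conf r y s N))) \<partial>Q \<partial>latent_jumps (ties n r) y)"
  proof (intro nn_integral_cong)
    fix s N
    have "jumps_and_N ?Y ?Y (N, s) = (\<lambda>i\<in>{1..n}. s (block n ?Y i), N_star n ?Y N s)"
      using fun_cong[OF jumps_and_N_eq[of ?Y], of "(N, s)"] by simp
    also have "\<dots> = (fst (conf r y s N), snd (snd (conf r y s N)))"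
      unfolding N_star_conf[OF r y refl] conf_J
      using block_cong_ties[OF ties] by (auto intro!: restrict_ext)
    finally show "indicator B (jumps_and_N ?Y ?Y (N, s)) = (indicator B (fst (conf r y s N), snd (snd (conf r y s N))) :: ennreal)"
      by simp
  qed
  finally show ?thesis .
qed

lemma nn_integral_const_latent:
  assumes "prob_space (latent_jumps (ties n r) y)"
  shows "(\<integral>\<^sup>+s. \<integral>\<^sup>+N. c \<partial>Q \<partial>latent_jumps (ties n r) y) = c"
  using Q.emeasure_space_1 prob_space.emeasure_space_1[OF assms] by simp

theorem cond_law_JN_Y:
  "has_cond_law joint (\<lambda>(J, Y, N). (J, N)) (jumps_space n \<Otimes>\<^sub>M PM) (\<lambda>(J, Y, N). Y) (locs_space n)
    (\<lambda>Y. distr (latent_law n g \<rho> Q Y) (jumps_space n \<Otimes>\<^sub>M PM)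
      (\<lambda>(N, J). (\<lambda>i\<in>{1..n}. J (block n Y i), N_star n Y N J)))"
  unfolding jumps_and_N_eq
proof (rule has_cond_law_joint)
  show "(\<lambda>(J, Y, N). (J, N)) \<in> measurable data_space (jumps_space n \<Otimes>\<^sub>M PM)" by measurable
  show "(\<lambda>(J, Y, N). Y) \<in> measurable data_space (locs_space n)" by measurable
  show "(\<lambda>Y. emeasure (distr (latent_law n g \<rho> Q Y) (jumps_space n \<Otimes>\<^sub>M PM) (jumps_and_N Y Y)) B) \<in> borel_measurable (locs_space n)"
    if "B \<in> sets (jumps_space n \<Otimes>\<^sub>M PM)" for B
    using that by (rule measurable_kernel_Y)
  have W: "(case conf r y s N of (J, Y, N) \<Rightarrow> Y) = (\<lambda>i\<in>{1..n}. y (r i))" for r y s N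
    by (simp add: conf_def)
  have V: "(case conf r y s N of (J, Y, N) \<Rightarrow> (J, N)) = (fst (conf r y s N), snd (snd (conf r y s N)))" for r y s N
    by (simp add: conf_def)
  fix r assume r: "r \<in> reps n"
  show "AE y in blocks r. \<forall>s\<in>space (latent_jumps (ties n r) y). \<forall>N\<in>point_measures d.
      prob_space (distr (latent_law n g \<rho> Q (case conf r y s N of (J, Y, N) \<Rightarrow> Y)) (jumps_space n \<Otimes>\<^sub>M PM)
        (jumps_and_N (case conf r y s N of (J, Y, N) \<Rightarrow> Y) (case conf r y s N of (J, Y, N) \<Rightarrow> Y)))"
    using AE_blocks_inj[OF r] AE_blocks_latent[OF r]
  proof eventually_elim
    case (elim y)
    let ?Y = "\<lambda>i\<in>{1..n}. y (r i)"
    let ?K = "distr (latent_law n g \<rho> Q ?Y) (jumps_space n \<Otimes>\<^sub>M PM) (jumps_and_N ?Y ?Y)"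
    have "emeasure ?K (space ?K) = 1"
    proof -
      have "emeasure ?K (space ?K) = (\<integral>\<^sup>+s. \<integral>\<^sup>+N. indicator (space (jumps_space n \<Otimes>\<^sub>M PM)) (fst (conf r y s N), snd (snd (conf r y s N))) \<partial>Q \<partial>latent_jumps (ties n r) y)"
        using emeasure_kernel_conf[OF r elim(1) sets.top] by simp
      also have "\<dots> = (\<integral>\<^sup>+s. \<integral>\<^sup>+N. 1 \<partial>Q \<partial>latent_jumps (ties n r) y)"
      proof (intro nn_integral_cong)
        fix s N assume "s \<in> space (latent_jumps (ties n r) y)" "N \<in> space Q"
        \<comment> \<open>Membership of \<open>y\<close> in the space is not at hand here;
          \<open>conf\<close> depends on \<open>y\<close> only at the representatives, so its
          extensional restriction may take its place.\<close>
        moreover have "y' \<in> space (blocks r)" if "y' \<in> extensional (r ` {1..n})" for y'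
          using that by (simp add: space_blocks PiE_def)
        moreover have "conf r y s N = conf r (restrict y (r ` {1..n})) s N"
        proof -
          have "add_atoms N (r ` {1..n}) (\<lambda>_. 1) (\<lambda>c. (s (block n r c), y c)) =
              add_atoms N (r ` {1..n}) (\<lambda>_. 1) (\<lambda>c. (s (block n r c), restrict y (r ` {1..n}) c))"
            by (rule add_atoms_cong) simp
          then show ?thesis unfolding conf_def by (auto intro!: restrict_ext)
        qed
        ultimately have "conf r y s N \<in> space data_space"
          using conf_space[OF r, of "restrict y (r ` {1..n})" s y N] by simp
        then show "indicator (space (jumps_space n \<Otimes>\<^sub>M PM)) (fst (conf r y s N), snd (snd (conf r y s N))) = (1::ennreal)"
          by (auto simp: space_pair_measure)
      qed
      also have "\<dots> = 1" by (rule nn_integral_const_latent[OF elim(2)])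
      finally show ?thesis .
    qed
    then show ?case unfolding W by (auto intro: prob_spaceI)
  qed
  fix A B assume A: "A \<in> sets (locs_space n :: (nat \<Rightarrow> 'y) measure)" and B: "B \<in> sets (jumps_space n \<Otimes>\<^sub>M PM)"
  show "AE y in blocks r.
      (\<integral>\<^sup>+s. \<integral>\<^sup>+N. indicator A (case conf r y s N of (J, Y, N) \<Rightarrow> Y) * indicator B (case conf r y s N of (J, Y, N) \<Rightarrow> (J, N)) \<partial>Q \<partial>latent_jumps (ties n r) y) =
      (\<integral>\<^sup>+s. \<integral>\<^sup>+N. emeasure (distr (latent_law n g \<rho> Q (case conf r y s N of (J, Y, N) \<Rightarrow> Y)) (jumps_space n \<Otimes>\<^sub>M PM)
        (jumps_and_N (case conf r y s N of (J, Y, N) \<Rightarrow> Y) (case conf r y s N of (J, Y, N) \<Rightarrow> Y))) B *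
        indicator A (case conf r y s N of (J, Y, N) \<Rightarrow> Y) \<partial>Q \<partial>latent_jumps (ties n r) y)"
    using AE_blocks_inj[OF r] AE_blocks_latent[OF r]
  proof eventually_elim
    case (elim y)
    let ?Y = "\<lambda>i\<in>{1..n}. y (r i)"
    show ?case
      unfolding W V emeasure_kernel_conf[OF r elim(1) B]
      by (cases "?Y \<in> A") (simp_all add: nn_integral_const_latent[OF elim(2)] del: nn_integral_const)
  qed
qed simp_all

text \<open>Jumps and locations are both given here, so the atoms are fixed and only the Poisson
  part is averaged. The jump of a block is read from \<open>J\<close> at its least element.\<close>

lemma emeasure_N_kernel_conf:
  assumes r: "r \<in> reps n" and y: "inj_on y (r ` {1..n})" "y \<in> space (blocks r)"
    and s: "s \<in> space (latent_jumps (ties n r) y)"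
  defines "N' \<equiv> \<lambda>N. N_star n (\<lambda>i\<in>{1..n}. y (r i)) N (\<lambda>C. (\<lambda>i\<in>{1..n}. s (block n r i)) (Min C))"
  shows "N' = (\<lambda>N. snd (snd (conf r y s N)))" "N' \<in> measurable Q PM"
    "B \<in> sets PM \<Longrightarrow> emeasure (distr Q PM N') B = (\<integral>\<^sup>+N. indicator B (snd (snd (conf r y s N))) \<partial>Q)"
proof -
  show eq: "N' = (\<lambda>N. snd (snd (conf r y s N)))"
  proof
    fix N
    show "N' N = snd (snd (conf r y s N))"
      unfolding N'_def
    proof (rule N_star_conf[OF r y(1)])
      fix C assume C: "C \<in> ties n r"
      then show "(\<lambda>i\<in>{1..n}. s (block n r i)) (Min C) = s C"
        using ties_Min_reps(2)[OF r C] ties_nonempty[OF C] by simp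
    qed
  qed
  have "N' \<in> measurable PM PM"
    unfolding eq using measurable_compose[OF measurable_compose[OF measurable_conf_N[OF r y(2) s] measurable_snd] measurable_snd] by simp
  then show m: "N' \<in> measurable Q PM" by (simp add: measurable_cong_sets[OF Q.sets_Q refl])
  assume B: "B \<in> sets PM"
  have "emeasure (distr Q PM N') B = (\<integral>\<^sup>+N. indicator B N \<partial>distr Q PM N')" using B by simp
  also have "\<dots> = (\<integral>\<^sup>+N. indicator B (N' N) \<partial>Q)" by (rule nn_integral_distr[OF m]) (use B in simp)
  finally show "emeasure (distr Q PM N') B = (\<integral>\<^sup>+N. indicator B (snd (snd (conf r y s N))) \<partial>Q)"
    by (simp add: eq)
qed

text \<open>The law \<open>Q\<close> in the kernel does not involve \<open>J\<close>: this expresses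
  that, given the locations, the Poisson part is independent of the jumps.\<close>

theorem cond_law_N_JY:
  "has_cond_law joint (\<lambda>(J, Y, N). N) PM (\<lambda>(J, Y, N). (J, Y)) (jumps_space n \<Otimes>\<^sub>M locs_space n)
    (\<lambda>(J, Y). distr Q PM (\<lambda>N. N_star n Y N (\<lambda>C. J (Min C))))"
proof (rule has_cond_law_joint)
  show "(\<lambda>(J, Y, N). N) \<in> measurable data_space PM" by measurable
  show "(\<lambda>(J, Y, N). (J, Y)) \<in> measurable data_space (jumps_space n \<Otimes>\<^sub>M locs_space n)" by measurable
  show "sets (case v of (J, Y) \<Rightarrow> distr Q PM (\<lambda>N. N_star n Y N (\<lambda>C. J (Min C)))) = sets PM" for v
    by (cases v) simp
  show "(\<lambda>v. emeasure (case v of (J, Y) \<Rightarrow> distr Q PM (\<lambda>N. N_star n Y N (\<lambda>C. J (Min C)))) B)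
      \<in> borel_measurable (jumps_space n \<Otimes>\<^sub>M locs_space n)" if B: "B \<in> sets PM" for B
  proof (rule measurable_piecewise[where \<pi>=snd and
      h="\<lambda>r v. emeasure (distr Q PM (\<lambda>N. add_atoms N (ties n r) (\<lambda>_. 1) (\<lambda>C. (fst v (Min C), snd v (Min C))))) B"])
    fix r :: "nat \<Rightarrow> nat" assume r: "r \<in> reps n"
    let ?M = "jumps_space n \<Otimes>\<^sub>M (locs_space n :: (nat \<Rightarrow> 'y) measure)"
    have J: "(\<lambda>x. fst (fst x) (Min C)) \<in> measurable (?M \<Otimes>\<^sub>M PM) jump_space"
      and Y: "(\<lambda>x. snd (fst x) (Min C)) \<in> measurable (?M \<Otimes>\<^sub>M PM) borel" if "C \<in> ties n r" for C
    proof -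
      have M: "Min C \<in> {1..n}" using ties_nonempty[OF that] by simp
      show "(\<lambda>x. fst (fst x) (Min C)) \<in> measurable (?M \<Otimes>\<^sub>M PM) jump_space"
        by (rule measurable_compose[OF measurable_compose[OF measurable_fst measurable_fst] measurable_component_singleton[OF M]])
      show "(\<lambda>x. snd (fst x) (Min C)) \<in> measurable (?M \<Otimes>\<^sub>M PM) borel"
        by (rule measurable_compose[OF measurable_compose[OF measurable_fst measurable_snd] measurable_component_singleton[OF M]])
    qed
    have "(\<lambda>(v, N). add_atoms N (ties n r) (\<lambda>_. 1) (\<lambda>C. (fst v (Min C), snd v (Min C)))) \<in> measurable (?M \<Otimes>\<^sub>M PM) PM"
      unfolding case_prod_unfold by (intro measurable_add_atoms measurable_Pair J Y measurable_snd finite_ties)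
    from measurable_distr2[OF this measurable_Q_const]
    show "(\<lambda>v. emeasure (distr Q PM (\<lambda>N. add_atoms N (ties n r) (\<lambda>_. 1) (\<lambda>C. (fst v (Min C), snd v (Min C))))) B) \<in> borel_measurable ?M"
      using B by (rule measurable_emeasure_kernel)
  next
    fix v :: "(nat \<Rightarrow> real) \<times> (nat \<Rightarrow> 'y)" and r :: "nat \<Rightarrow> nat" assume "ties n (snd v) = ties n r"
    then show "emeasure (case v of (J, Y) \<Rightarrow> distr Q PM (\<lambda>N. N_star n Y N (\<lambda>C. J (Min C)))) B =
        emeasure (distr Q PM (\<lambda>N. add_atoms N (ties n r) (\<lambda>_. 1) (\<lambda>C. (fst v (Min C), snd v (Min C))))) B"
      by (cases v) (simp add: N_star_def)
  qed measurable
  have K: "(case (case conf r y s N of (J, Y, N) \<Rightarrow> (J, Y)) of (J, Y) \<Rightarrow> distr Q PM (\<lambda>N. N_star n Y N (\<lambda>C. J (Min C)))) =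
      distr Q PM (\<lambda>N. N_star n (\<lambda>i\<in>{1..n}. y (r i)) N (\<lambda>C. (\<lambda>i\<in>{1..n}. s (block n r i)) (Min C)))" for r y s N
    by (simp add: conf_def)
  fix r assume r: "r \<in> reps n"
  show "AE y in blocks r. \<forall>s\<in>space (latent_jumps (ties n r) y). \<forall>N\<in>point_measures d.
      prob_space (case (case conf r y s N of (J, Y, N) \<Rightarrow> (J, Y)) of (J, Y) \<Rightarrow> distr Q PM (\<lambda>N. N_star n Y N (\<lambda>C. J (Min C))))"
    using AE_blocks_inj[OF r] AE_space
  proof eventually_elim
    case (elim y)
    show ?case
      unfolding K using emeasure_N_kernel_conf(2)[OF r elim] by (auto intro: Q.prob_space_distr)
  qed
  fix A B assume A: "A \<in> sets (jumps_space n \<Otimes>\<^sub>M (locs_space n :: (nat \<Rightarrow> 'y) measure))" and B: "B \<in> sets PM"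
  show "AE y in blocks r.
      (\<integral>\<^sup>+s. \<integral>\<^sup>+N. indicator A (case conf r y s N of (J, Y, N) \<Rightarrow> (J, Y)) * indicator B (case conf r y s N of (J, Y, N) \<Rightarrow> N) \<partial>Q \<partial>latent_jumps (ties n r) y) =
      (\<integral>\<^sup>+s. \<integral>\<^sup>+N. emeasure (case (case conf r y s N of (J, Y, N) \<Rightarrow> (J, Y)) of (J, Y) \<Rightarrow> distr Q PM (\<lambda>N. N_star n Y N (\<lambda>C. J (Min C)))) B *
        indicator A (case conf r y s N of (J, Y, N) \<Rightarrow> (J, Y)) \<partial>Q \<partial>latent_jumps (ties n r) y)"
    using AE_blocks_inj[OF r] AE_space
  proof eventually_elim
    case (elim y)
    show ?case
    proof (rule nn_integral_cong)
      fix s assume s: "s \<in> space (latent_jumps (ties n r) y)"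
      let ?a = "indicator A (\<lambda>i\<in>{1..n}. s (block n r i), \<lambda>i\<in>{1..n}. y (r i)) :: ennreal"
      have W: "indicator A (case conf r y s N of (J, Y, N) \<Rightarrow> (J, Y)) = ?a" for N by (simp add: conf_def)
      have V: "(case conf r y s N of (J, Y, N) \<Rightarrow> N) = snd (snd (conf r y s N))" for N by (simp add: conf_def)
      have "(\<lambda>N. indicator B (snd (snd (conf r y s N))) :: ennreal) \<in> borel_measurable Q"
        using measurable_compose[OF emeasure_N_kernel_conf(2)[OF r elim s] borel_measurable_indicator[OF B]]
        unfolding fun_cong[OF emeasure_N_kernel_conf(1)[OF r elim s]] .
      then have "(\<integral>\<^sup>+N. ?a * indicator B (snd (snd (conf r y s N))) \<partial>Q) = ?a * (\<integral>\<^sup>+N. indicator B (snd (snd (conf r y s N))) \<partial>Q)"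
        by (rule nn_integral_cmult)
      also have "\<dots> = (\<integral>\<^sup>+N. (\<integral>\<^sup>+N. indicator B (snd (snd (conf r y s N))) \<partial>Q) * ?a \<partial>Q)"
        using Q.emeasure_space_1 by (simp add: mult.commute)
      finally show "(\<integral>\<^sup>+N. indicator A (case conf r y s N of (J, Y, N) \<Rightarrow> (J, Y)) * indicator B (case conf r y s N of (J, Y, N) \<Rightarrow> N) \<partial>Q) =
        (\<integral>\<^sup>+N. emeasure (case (case conf r y s N of (J, Y, N) \<Rightarrow> (J, Y)) of (J, Y) \<Rightarrow> distr Q PM (\<lambda>N. N_star n Y N (\<lambda>C. J (Min C)))) B *
          indicator A (case conf r y s N of (J, Y, N) \<Rightarrow> (J, Y)) \<partial>Q)"
        unfolding W V K emeasure_N_kernel_conf(3)[OF r elim s B] .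
    qed
  qed
qed

text \<open>The laws of \<open>N\<close>, of the random measure and of the hazard given
  \<open>Y\<close> are all images of the conditional law of \<open>(J, N)\<close>.\<close>

lemma cond_law_N_map:
  assumes h: "h \<in> measurable PM MV"
  shows "has_cond_law joint (\<lambda>(J, Y, N). h N) MV (\<lambda>(J, Y, N). Y) (locs_space n)
    (\<lambda>Y. distr (latent_law n g \<rho> Q Y) MV (\<lambda>(N, J). h (N_star n Y N J)))"
proof -
  have hs: "(\<lambda>x. h (snd x)) \<in> measurable (jumps_space n \<Otimes>\<^sub>M PM) MV" using h by measurable
  show ?thesis
  proof (rule has_cond_law_cong[OF has_cond_law_map[OF cond_law_JN_Y hs]])
    show "h (snd (case x of (J, Y, N) \<Rightarrow> (J, N))) = (case x of (J, Y, N) \<Rightarrow> h N)" for x :: "(nat \<Rightarrow> real) \<times> (nat \<Rightarrow> 'y) \<times> (real \<times> 'y) measure"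
      by (simp add: case_prod_beta)
    fix Y assume Y: "Y \<in> space (locs_space n :: (nat \<Rightarrow> 'y) measure)"
    have "distr (distr (latent_law n g \<rho> Q Y) (jumps_space n \<Otimes>\<^sub>M PM) (jumps_and_N Y Y)) MV (\<lambda>x. h (snd x)) =
        distr (latent_law n g \<rho> Q Y) MV ((\<lambda>x. h (snd x)) \<circ> jumps_and_N Y Y)"
      by (rule distr_distr[OF hs measurable_jumps_and_N_Y[OF Y]])
    also have "(\<lambda>x. h (snd x)) \<circ> jumps_and_N Y Y = (\<lambda>(N, J). h (N_star n Y N J))"
      unfolding jumps_and_N_eq[symmetric] by (auto simp: fun_eq_iff)
    finally show "distr (distr (latent_law n g \<rho> Q Y) (jumps_space n \<Otimes>\<^sub>M PM)
        (\<lambda>(N, J). (\<lambda>i\<in>{1..n}. J (block n Y i), N_star n Y N J))) MV (\<lambda>x. h (snd x)) =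
        distr (latent_law n g \<rho> Q Y) MV (\<lambda>(N, J). h (N_star n Y N J))"
      unfolding jumps_and_N_eq .
  qed
qed

section \<open>The random measure and the hazard as images of the point process\<close>

lemma measurable_k_ennreal: "(\<lambda>y. ennreal (k x y)) \<in> borel_measurable borel"
  by (rule measurable_compose[OF k(2) measurable_ennreal])

lemma measurable_mark_integrand:
  assumes [measurable]: "h \<in> borel_measurable borel"
  shows "(\<lambda>z. ennreal (fst z) * h (snd z)) \<in> borel_measurable (jump_loc_space :: (real \<times> 'y) measure)"
  by measurable

lemma measurable_mark_integral:
  assumes h: "h \<in> borel_measurable borel"
  shows "(\<lambda>N. \<integral>\<^sup>+z. ennreal (fst z) * h (snd z) \<partial>N) \<in> borel_measurable PM"
proof (rule measurable_nn_integral_PM)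
  show "(\<lambda>(N, z). ennreal (fst z) * h (snd z)) \<in> borel_measurable (PM \<Otimes>\<^sub>M jump_loc_space)"
    unfolding case_prod_unfold by (rule measurable_compose[OF measurable_snd measurable_mark_integrand[OF h]])
qed simp

lemma measurable_mu_of: "mu_of \<in> measurable PM (measures_algebra borel)"
  unfolding measures_algebra_def
proof (rule measurable_evaluation_algebra)
  fix A :: "'y set" assume A: "A \<in> sets borel"
  have "(\<lambda>N. \<integral>\<^sup>+z. ennreal (fst z) * indicator A (snd z) \<partial>N) \<in> borel_measurable PM"
    by (intro measurable_mark_integral borel_measurable_indicator A)
  then show "(\<lambda>N. emeasure (mu_of N) A) \<in> borel_measurable PM"
    by (rule measurable_cong[THEN iffD1, rotated]) (simp add: emeasure_mu_of[OF sets_S A])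
qed simp

lemma hazard_mu_of:
  assumes "sets N = sets (jump_loc_space :: (real \<times> 'y) measure)"
  shows "hazard k (mu_of N) x = (\<integral>\<^sup>+z. ennreal (fst z) * ennreal (k x (snd z)) \<partial>N)"
  unfolding hazard_def by (intro nn_integral_mu_of assms measurable_k_ennreal)

lemma measurable_hazard: "(\<lambda>N. hazard k (mu_of N)) \<in> measurable PM (\<Pi>\<^sub>M x\<in>UNIV. borel)"
proof (rule measurable_PiM_single')
  fix x
  have "(\<lambda>N. \<integral>\<^sup>+z. ennreal (fst z) * ennreal (k x (snd z)) \<partial>N) \<in> borel_measurable PM"
    by (intro measurable_mark_integral measurable_k_ennreal)
  then show "(\<lambda>N. hazard k (mu_of N) x) \<in> borel_measurable PM"
    by (rule measurable_cong[THEN iffD1, rotated]) (simp add: hazard_mu_of[OF sets_S])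
qed auto

lemma space_latent_lawD:
  assumes "(N, J) \<in> space (latent_law n g \<rho> Q Y)"
  shows "N \<in> point_measures d" "\<And>C. C \<in> ties n Y \<Longrightarrow> 0 < J C"
  using assms sets_eq_imp_space_eq[OF sets_latent_law, of Y]
  by (auto simp: space_pair_measure space_PiM PiE_iff)

text \<open>An atom \<open>(s, y)\<close> of the point measure contributes \<open>s * h y\<close> to
  the integral. With an indicator for \<open>h\<close> this gives \<open>mu_star\<close>, with
  \<open>k x\<close> it gives \<open>hazard_star\<close>.\<close>

lemma nn_integral_mu_of_N_star:
  assumes NJ: "(N, J) \<in> space (latent_law n g \<rho> Q Y)" and h: "h \<in> borel_measurable borel"
  shows "(\<integral>\<^sup>+y. h y \<partial>mu_of (N_star n Y N J)) = (\<integral>\<^sup>+y. h y \<partial>mu_of N) + (\<Sum>C\<in>ties n Y. ennreal (J C) * h (Y (Min C)))"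
proof -
  note D = space_latent_lawD[OF NJ]
  note sN = sets_S[OF D(1)]
  have m: "(\<lambda>z. ennreal (fst z) * h (snd z)) \<in> borel_measurable N"
    using measurable_mark_integrand[OF h] by (simp add: measurable_cong_sets[OF sN refl])
  have "(\<integral>\<^sup>+y. h y \<partial>mu_of (N_star n Y N J)) = (\<integral>\<^sup>+z. ennreal (fst z) * h (snd z) \<partial>N_star n Y N J)"
    by (rule nn_integral_mu_of) (simp_all add: N_star_def sN h)
  also have "\<dots> = (\<integral>\<^sup>+z. ennreal (fst z) * h (snd z) \<partial>N) + (\<Sum>C\<in>ties n Y. 1 * (ennreal (fst (J C, Y (Min C))) * h (snd (J C, Y (Min C)))))"
    unfolding N_star_def by (rule nn_integral_add_atoms[OF finite_ties _ m])
      (use D space_S[OF D(1)] in \<open>auto simp: space_jump_loc_space\<close>)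
  also have "(\<integral>\<^sup>+z. ennreal (fst z) * h (snd z) \<partial>N) = (\<integral>\<^sup>+y. h y \<partial>mu_of N)"
    by (rule nn_integral_mu_of[OF sN h, symmetric])
  finally show ?thesis by simp
qed

lemma mu_of_N_star:
  assumes NJ: "(N, J) \<in> space (latent_law n g \<rho> Q Y)"
  shows "mu_of (N_star n Y N J) = mu_star n Y (mu_of N) J"
proof (rule measure_eqI)
  fix A assume "A \<in> sets (mu_of (N_star n Y N J))"
  then have A: "A \<in> sets borel" by simp
  then show "emeasure (mu_of (N_star n Y N J)) A = emeasure (mu_star n Y (mu_of N) J) A"
    using nn_integral_mu_of_N_star[OF NJ, of "indicator A"]
    by (simp add: mu_star_def emeasure_add_atoms)
qed (simp add: mu_star_def)

lemma hazard_N_star: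
  assumes NJ: "(N, J) \<in> space (latent_law n g \<rho> Q Y)"
  shows "hazard k (mu_of (N_star n Y N J)) = hazard_star n k Y (mu_of N) J"
proof
  fix x
  from nn_integral_mu_of_N_star[OF NJ measurable_k_ennreal]
  show "hazard k (mu_of (N_star n Y N J)) x = hazard_star n k Y (mu_of N) J x"
    using space_latent_lawD(2)[OF NJ] k(1)
    by (simp add: hazard_def hazard_star_def ennreal_mult less_imp_le cong: sum.cong)
qed

lemma cond_law_hazard:
  "has_cond_law joint (\<lambda>(J, Y, N). hazard k (mu_of N)) (\<Pi>\<^sub>M x\<in>UNIV. borel) (\<lambda>(J, Y, N). Y) (locs_space n)
    (\<lambda>Y. distr (latent_law n g \<rho> Q Y) (\<Pi>\<^sub>M x\<in>UNIV. borel) (\<lambda>(N, J). hazard_star n k Y (mu_of N) J))"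
proof (rule has_cond_law_cong[OF cond_law_N_map[OF measurable_hazard]])
  fix Y
  show "distr (latent_law n g \<rho> Q Y) (\<Pi>\<^sub>M x\<in>UNIV. borel) (\<lambda>(N, J). hazard k (mu_of (N_star n Y N J))) =
      distr (latent_law n g \<rho> Q Y) (\<Pi>\<^sub>M x\<in>UNIV. borel) (\<lambda>(N, J). hazard_star n k Y (mu_of N) J)"
    by (intro distr_cong refl) (auto simp: hazard_N_star)
qed simp

lemma AE_joint_jump_law: "AE (J, Y, N) in joint. \<forall>C\<in>ties n Y. prob_space (jump_law g \<rho> (card C) (Y (Min C)))"
proof -
  \<comment> \<open>The condition is spread over the finitely many members of \<open>reps\<close>
    and stated through the total mass, so that it describes a measurable set.\<close>
  let ?R = "\<lambda>x. \<forall>r\<in>reps n. ties n (fst (snd x)) = ties n r \<longrightarrow>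
    (\<forall>C\<in>ties n r. emeasure (jump_law g \<rho> (card C) (fst (snd x) (Min C))) {0<..} = 1)"
  have Y: "(\<lambda>x. fst (snd x)) \<in> measurable data_space (locs_space n)" by measurable
  have "AE x in joint. ?R x"
  proof (rule AE_joint)
    show "{x \<in> space data_space. ?R x} \<in> sets data_space"
    proof (intro sets.sets_Collect_finite_All finite_reps sets.sets_Collect_imp finite_ties)
      fix r assume "r \<in> reps n"
      have "(\<lambda>x. fst (snd x)) -` {Y\<in>space (locs_space n). ties n Y = ties n r} \<inter> space data_space \<in> sets data_space"
        by (rule measurable_sets[OF Y sets_ties_eq])
      also have "(\<lambda>x. fst (snd x)) -` {Y\<in>space (locs_space n). ties n Y = ties n r} \<inter> space data_space =
          {x \<in> space data_space. ties n (fst (snd x)) = ties n r}"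
        using measurable_space[OF Y] by auto
      finally show "{x \<in> space data_space. ties n (fst (snd x)) = ties n r} \<in> sets data_space" .
      fix C assume C: "C \<in> ties n r"
      then have "Min C \<in> {1..n}" using ties_nonempty[OF C] by simp
      from measurable_compose[OF Y measurable_component_singleton[OF this]]
      have "(\<lambda>x. emeasure (jump_law g \<rho> (card C) (fst (snd x) (Min C))) (space jump_space)) \<in> borel_measurable data_space"
        by (rule measurable_compose[OF _ measurable_emeasure_kernel[OF measurable_jump_law sets.top]])
      then show "{x \<in> space data_space. emeasure (jump_law g \<rho> (card C) (fst (snd x) (Min C))) {0<..} = 1} \<in> sets data_space"
        by simp measurable
    qed
    fix r assume r: "r \<in> reps n"
    show "AE y in blocks r. \<forall>s\<in>space (latent_jumps (ties n r) y). \<forall>N\<in>point_measures d. ?R (conf r y s N)"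
      using AE_blocks_inj[OF r] AE_blocks_kappa[OF r]
    proof eventually_elim
      case (elim y)
      have "emeasure (jump_law g \<rho> (card C) ((\<lambda>i\<in>{1..n}. y (r i)) (Min C))) {0<..} = 1" if C: "C \<in> ties n r" for C
      proof -
        have "(\<lambda>i\<in>{1..n}. y (r i)) (Min C) = y (Min C)"
          using ties_Min_reps(3)[OF r C] ties_nonempty[OF C] by simp
        moreover have "prob_space (jump_law g \<rho> (card C) (y (Min C)))" using elim(2) C by blast
        ultimately show ?thesis using prob_space.emeasure_space_1 by fastforce
      qed
      then show ?case
        unfolding conf_Y ties_reps_inj[OF r elim(1)] by metis
    qed
  qed
  then show ?thesis
  proof eventually_elim
    case (elim x)
    have "prob_space (jump_law g \<rho> (card C) (fst (snd x) (Min C)))" if C: "C \<in> ties n (fst (snd x))" for C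
    proof (rule prob_spaceI)
      show "emeasure (jump_law g \<rho> (card C) (fst (snd x) (Min C))) (space (jump_law g \<rho> (card C) (fst (snd x) (Min C)))) = 1"
        using elim[rule_format, OF rep_reps[of n "fst (snd x)"]] C by (simp add: ties_rep)
    qed
    then show ?case by (simp add: case_prod_beta)
  qed
qed

text \<open>Total probability: the conditional law of \<open>mu_of N\<close> given \<open>Y\<close>
  is applied with the whole space of locations as event, the law of \<open>N\<close> under the joint
  law being the posterior.\<close>

lemma posterior_mu_mixture:
  assumes A: "A \<in> sets (measures_algebra borel)"
  shows "emeasure (distr (posterior_N n k g X P) (measures_algebra borel) mu_of) A =
    (\<integral>\<^sup>+Y. emeasure (distr (latent_law n g \<rho> Q Y) (measures_algebra borel) (\<lambda>(N, J). mu_of (N_star n Y N J))) A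
       \<partial>distr joint (locs_space n) (\<lambda>(J, Y, N). Y))"
proof -
  have mN: "(\<lambda>(J, Y, N). N) \<in> measurable joint P"
    unfolding measurable_cong_sets[OF sets_joint sets_P] by measurable
  have mP: "mu_of \<in> measurable P (measures_algebra borel)"
    using measurable_mu_of by (simp add: measurable_cong_sets[OF sets_P refl])
  have law: "has_cond_law joint (\<lambda>(J, Y, N). mu_of N) (measures_algebra borel) (\<lambda>(J, Y, N). Y) (locs_space n)
      (\<lambda>Y. distr (latent_law n g \<rho> Q Y) (measures_algebra borel) (\<lambda>(N, J). mu_of (N_star n Y N J)))"
    by (rule cond_law_N_map[OF measurable_mu_of])
  have eq: "distr (posterior_N n k g X P) (measures_algebra borel) mu_of = distr joint (measures_algebra borel) (mu_of \<circ> (\<lambda>(J, Y, N). N))"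
    unfolding distr_joint_N[symmetric] by (rule distr_distr[OF mP mN])
  have "emeasure (distr (posterior_N n k g X P) (measures_algebra borel) mu_of) A =
      emeasure joint {x\<in>space joint. (case x of (J, Y, N) \<Rightarrow> Y) \<in> space (locs_space n) \<and> (case x of (J, Y, N) \<Rightarrow> mu_of N) \<in> A}"
  proof -
    have "emeasure (distr joint (measures_algebra borel) (mu_of \<circ> (\<lambda>(J, Y, N). N))) A =
        emeasure joint ((mu_of \<circ> (\<lambda>(J, Y, N). N)) -` A \<inter> space joint)"
      using A by (intro emeasure_distr measurable_comp[OF mN mP])
    also have "(mu_of \<circ> (\<lambda>(J, Y, N). N)) -` A \<inter> space joint =
        {x\<in>space joint. (case x of (J, Y, N) \<Rightarrow> Y) \<in> space (locs_space n) \<and> (case x of (J, Y, N) \<Rightarrow> mu_of N) \<in> A}"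
    proof (rule set_eqI)
      fix x
      have "(\<lambda>(J, Y, N). Y) \<in> measurable joint (locs_space n)"
        unfolding measurable_cong_sets[OF sets_joint refl] by measurable
      from measurable_space[OF this, of x]
      show "x \<in> (mu_of \<circ> (\<lambda>(J, Y, N). N)) -` A \<inter> space joint \<longleftrightarrow>
          x \<in> {x\<in>space joint. (case x of (J, Y, N) \<Rightarrow> Y) \<in> space (locs_space n) \<and> (case x of (J, Y, N) \<Rightarrow> mu_of N) \<in> A}"
        by (cases x) (simp del: space_joint, blast)
    qed
    finally show ?thesis unfolding eq .
  qed
  also have "\<dots> = (\<integral>\<^sup>+Y. emeasure (distr (latent_law n g \<rho> Q Y) (measures_algebra borel) (\<lambda>(N, J). mu_of (N_star n Y N J))) A *
       indicator (space (locs_space n)) Y \<partial>distr joint (locs_space n) (\<lambda>(J, Y, N). Y))"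
    using law A sets.top unfolding has_cond_law_def by blast
  also have "\<dots> = (\<integral>\<^sup>+Y. emeasure (distr (latent_law n g \<rho> Q Y) (measures_algebra borel) (\<lambda>(N, J). mu_of (N_star n Y N J))) A
       \<partial>distr joint (locs_space n) (\<lambda>(J, Y, N). Y))"
    by (rule nn_integral_cong) simp
  finally show ?thesis .
qed

end

section \<open>The completely random measure and the law of the partition\<close>

text \<open>Independence is a property of the joint law, and the joint law of the \<open>X i\<close>
  under the image measure is that of the \<open>X i (f x)\<close> under \<open>M\<close>.\<close>

lemma (in prob_space) indep_vars_distr:
  assumes f: "f \<in> measurable M N" and X: "\<And>i. i \<in> I \<Longrightarrow> X i \<in> measurable N (M' i)" and I: "I \<noteq> {}"
    and indep: "indep_vars M' (\<lambda>i x. X i (f x)) I"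
  shows "prob_space.indep_vars (distr M N f) M' X I"
proof -
  interpret D: prob_space "distr M N f" by (rule prob_space_distr[OF f])
  have Xf: "random_variable (M' i) (\<lambda>x. X i (f x))" if "i \<in> I" for i
    by (rule measurable_compose[OF f X[OF that]])
  have mX: "(\<lambda>x. \<lambda>i\<in>I. X i x) \<in> measurable N (\<Pi>\<^sub>M i\<in>I. M' i)"
    by (intro measurable_restrict X)
  have "distr (distr M N f) (\<Pi>\<^sub>M i\<in>I. M' i) (\<lambda>x. \<lambda>i\<in>I. X i x) = distr M (\<Pi>\<^sub>M i\<in>I. M' i) (\<lambda>x. \<lambda>i\<in>I. X i (f x))"
    using distr_distr[OF mX f] by (simp add: comp_def)
  also have "\<dots> = (\<Pi>\<^sub>M i\<in>I. distr M (M' i) (\<lambda>x. X i (f x)))"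
    using indep indep_vars_iff_distr_eq_PiM'[OF I Xf] by simp
  also have "\<dots> = (\<Pi>\<^sub>M i\<in>I. distr (distr M N f) (M' i) (X i))"
    using distr_distr[OF X f] by (intro PiM_cong refl) (simp add: comp_def)
  finally have eq: "distr (distr M N f) (\<Pi>\<^sub>M i\<in>I. M' i) (\<lambda>x. \<lambda>i\<in>I. X i x) =
      (\<Pi>\<^sub>M i\<in>I. distr (distr M N f) (M' i) (X i))" .
  have X': "X i \<in> measurable (distr M N f) (M' i)" if "i \<in> I" for i
    using X[OF that] by simp
  show ?thesis
    by (rule D.indep_vars_iff_distr_eq_PiM'[OF I X', THEN iffD2, OF _ eq])
qed

context posterior_model begin

text \<open>The mass of \<open>A\<close> becomes an integral over the strip above \<open>A\<close>;
  disjoint sets have disjoint strips, so independence passes from the point process to the random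
  measure.\<close>

lemma mu_of_section:
  assumes N: "N \<in> point_measures d" and A: "A \<in> sets borel"
  shows "emeasure (mu_of N) A = (\<integral>\<^sup>+z. ennreal (fst z) * indicator ({0<..} \<times> A) z \<partial>N)"
  unfolding emeasure_mu_of[OF sets_S[OF N] A] using space_S[OF N]
  by (intro nn_integral_cong) (auto simp: indicator_def space_jump_loc_space)

text \<open>The properties concern integrals of the jump size against the Poisson part. Finiteness
  comes from \<open>AE_finite_integral\<close>, since \<open>min s 1\<close> is integrable over
  bounded sets; independence comes from \<open>indep_integrals\<close>, and the transform from the
  Laplace functional.\<close>

lemma completely_random:
  assumes rho_eta: "\<And>B. B \<in> sets borel \<Longrightarrow> bounded B \<Longrightarrow>
      (\<integral>\<^sup>+y. (\<integral>\<^sup>+s. ennreal (min s 1) \<partial>\<rho> y) * indicator B y \<partial>\<eta>) < \<infinity>"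
  shows "completely_random_law (distr Q (measures_algebra borel) mu_of) \<nu>\<^sub>f"
  unfolding completely_random_law_def
proof (intro conjI allI ballI impI)
  let ?M = "distr Q (measures_algebra borel) mu_of"
  have mu: "mu_of \<in> measurable Q (measures_algebra borel)"
    using measurable_mu_of by (simp add: measurable_cong_sets[OF Q.sets_Q refl])
  have ev: "(\<lambda>\<mu>. emeasure \<mu> A) \<in> borel_measurable (measures_algebra borel)" if "A \<in> sets borel" for A :: "'y set"
    unfolding measures_algebra_def using that by (rule measurable_emeasure_evaluation_algebra)
  show "prob_space ?M" by (rule Q.prob_space_distr[OF mu])
  show "sets ?M = sets (measures_algebra borel)" by simp
  \<comment> \<open>Balls of integer radius about one centre are countably many and absorb every
    bounded set, which leads to a single exceptional null set.\<close>
  have ball: "AE \<mu> in ?M. emeasure \<mu> (ball y0 (real m)) < \<infinity>" for y0 :: 'y and m :: nat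
  proof -
    let ?B = "ball y0 (real m)"
    let ?h = "\<lambda>z. ennreal (fst z) * indicator ?B (snd z)"
    have h: "?h \<in> borel_measurable (jump_loc_space :: (real \<times> 'y) measure)"
      by (rule measurable_mark_integrand) (rule borel_measurable_indicator, simp)
    have h1: "(\<lambda>z. min (?h z) 1) \<in> borel_measurable (jump_loc_space :: (real \<times> 'y) measure)"
      using h by measurable
    have "(\<integral>\<^sup>+z. min (?h z) 1 \<partial>\<nu>\<^sub>f) = (\<integral>\<^sup>+y. \<integral>\<^sup>+s. ennreal (exp (- (g y * s))) * min (ennreal s * indicator ?B y) 1 \<partial>\<rho> y \<partial>\<eta>)"
      by (subst nn_integral_\<nu>f[OF h1]) simp
    also have "\<dots> \<le> (\<integral>\<^sup>+y. (\<integral>\<^sup>+s. ennreal (min s 1) \<partial>\<rho> y) * indicator ?B y \<partial>\<eta>)"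
    proof (rule nn_integral_mono)
      fix y
      have "(\<integral>\<^sup>+s. ennreal (exp (- (g y * s))) * min (ennreal s * indicator ?B y) 1 \<partial>\<rho> y) \<le>
          (\<integral>\<^sup>+s. ennreal (min s 1) * indicator ?B y \<partial>\<rho> y)"
      proof (rule nn_integral_mono)
        fix s assume "s \<in> space (\<rho> y)"
        then have s: "0 < s" by (simp add: space_rho)
        have "ennreal (exp (- (g y * s))) \<le> 1" using g(2)[of y] s by simp
        then have "ennreal (exp (- (g y * s))) * min (ennreal s * indicator ?B y) 1 \<le> 1 * min (ennreal s * indicator ?B y) 1"
          by (intro mult_right_mono) simp_all
        also have "\<dots> = ennreal (min s 1) * indicator ?B y"
          using s by (cases "y \<in> ?B") (simp_all add: min_def)
        finally show "ennreal (exp (- (g y * s))) * min (ennreal s * indicator ?B y) 1 \<le> ennreal (min s 1) * indicator ?B y" .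
      qed
      also have "\<dots> = (\<integral>\<^sup>+s. ennreal (min s 1) \<partial>\<rho> y) * indicator ?B y"
      proof (rule nn_integral_multc)
        show "(\<lambda>s. ennreal (min s 1)) \<in> borel_measurable (\<rho> y)"
          unfolding measurable_cong_sets[OF rho(1) refl] by measurable
      qed
      finally show "(\<integral>\<^sup>+s. ennreal (exp (- (g y * s))) * min (ennreal s * indicator ?B y) 1 \<partial>\<rho> y) \<le>
          (\<integral>\<^sup>+s. ennreal (min s 1) \<partial>\<rho> y) * indicator ?B y" .
    qed
    also have "\<dots> < \<infinity>" by (rule rho_eta) simp_all
    finally have fin: "(\<integral>\<^sup>+z. min (?h z) 1 \<partial>\<nu>\<^sub>f) < \<infinity>" .
    have "AE N in Q. (\<integral>\<^sup>+z. ?h z \<partial>N) < \<infinity>"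
      by (rule Q.AE_finite_integral[OF h _ fin]) (simp add: indicator_def)
    then have "AE N in Q. emeasure (mu_of N) ?B < \<infinity>"
      using AE_space by eventually_elim (simp add: emeasure_mu_of[OF sets_S])
    moreover have "{\<mu> \<in> space (measures_algebra borel). emeasure \<mu> ?B < \<infinity>} \<in> sets (measures_algebra borel)"
      using ev[of ?B] by measurable
    ultimately show ?thesis by (subst AE_distr_iff[OF mu]) auto
  qed
  have "AE \<mu> in ?M. \<forall>m. emeasure \<mu> (ball (undefined :: 'y) (real m)) < \<infinity>"
    using ball by (simp add: AE_all_countable)
  then show "AE \<mu> in ?M. \<forall>B\<in>sets borel. bounded B \<longrightarrow> emeasure \<mu> B < \<infinity>"
    using AE_space
  proof eventually_elim
    case (elim \<mu>)
    then have sets_\<mu>: "sets \<mu> = sets borel" by (simp add: measures_algebra_def space_evaluation_algebra)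
    show ?case
    proof (intro ballI impI)
      fix B :: "'y set" assume B: "B \<in> sets borel" "bounded B"
      obtain e where "\<forall>y\<in>B. dist undefined y \<le> e"
        using B(2) unfolding bounded_any_center[where a=undefined] by blast
      then have e: "B \<subseteq> cball undefined e" by auto
      obtain m where "e < real m" using reals_Archimedean2 by blast
      then have "B \<subseteq> ball undefined (real m)" using e by (auto simp: subset_iff)
      then have "emeasure \<mu> B \<le> emeasure \<mu> (ball undefined (real m))"
        by (intro emeasure_mono) (simp_all add: sets_\<mu>)
      then show "emeasure \<mu> B < \<infinity>" using elim(1) le_less_trans by blast
    qed
  qed
  show "prob_space.indep_vars ?M (\<lambda>_. borel) (\<lambda>i \<mu>. emeasure \<mu> (A i)) UNIV"
    if A: "range A \<subseteq> sets borel" "disjoint_family A" for A :: "nat \<Rightarrow> 'y set"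
  proof (rule Q.indep_vars_distr[OF mu])
    have Ai: "A i \<in> sets borel" for i using A(1) by auto
    show "(\<lambda>\<mu>. emeasure \<mu> (A i)) \<in> borel_measurable (measures_algebra borel)" for i by (rule ev[OF Ai])
    have s: "{0<..} \<times> A i \<in> sets jump_loc_space" for i
    proof -
      have "space jump_space \<times> A i \<in> sets (jump_space \<Otimes>\<^sub>M borel)" by (rule pair_measureI[OF sets.top Ai])
      then show ?thesis by simp
    qed
    have "Q.indep_vars (\<lambda>_. borel) (\<lambda>i N. \<integral>\<^sup>+z. ennreal (fst z) * indicator ({0<..} \<times> A i) z \<partial>N) UNIV"
    proof (rule Q.indep_integrals[OF _ s])
      show "(\<lambda>z. ennreal (fst z)) \<in> borel_measurable (jump_loc_space :: (real \<times> 'y) measure)"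
        using measurable_mark_integrand[of "\<lambda>_. 1"] by simp
      show "disjoint_family (\<lambda>i. {0::real<..} \<times> A i)"
        using A(2) unfolding disjoint_family_on_def by blast
    qed
    then show "Q.indep_vars (\<lambda>_. borel) (\<lambda>i N. emeasure (mu_of N) (A i)) UNIV"
      by (subst Q.indep_vars_cong_space[where Y="\<lambda>i N. \<integral>\<^sup>+z. ennreal (fst z) * indicator ({0<..} \<times> A i) z \<partial>N"])
        (simp_all add: mu_of_section Ai)
  qed simp
  fix B :: "'y set" and t :: real assume B: "B \<in> sets borel" and t: "0 < t"
  let ?h = "\<lambda>z. ennreal t * (ennreal (fst z) * indicator B (snd z))"
  have h0: "(\<lambda>z. ennreal (fst z) * indicator B (snd z)) \<in> borel_measurable (jump_loc_space :: (real \<times> 'y) measure)"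
    by (rule measurable_mark_integrand) (use B in simp)
  then have h: "?h \<in> borel_measurable (jump_loc_space :: (real \<times> 'y) measure)" by simp
  have "(\<integral>\<^sup>+\<mu>. exp_neg (ennreal t * emeasure \<mu> B) \<partial>?M) = (\<integral>\<^sup>+N. exp_neg (ennreal t * emeasure (mu_of N) B) \<partial>Q)"
  proof (rule nn_integral_distr[OF mu])
    have "(\<lambda>\<mu>. exp_neg (ennreal t * emeasure \<mu> B)) \<in> borel_measurable (measures_algebra borel)"
      by (intro measurable_exp_neg borel_measurable_times_ennreal ev[OF B]) simp
    then show "(\<lambda>\<mu>. exp_neg (ennreal t * emeasure \<mu> B)) \<in> borel_measurable ?M" by simp
  qed
  also have "\<dots> = (\<integral>\<^sup>+N. exp_neg (\<integral>\<^sup>+z. ?h z \<partial>N) \<partial>Q)"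
  proof (rule nn_integral_cong)
    fix N assume "N \<in> space Q"
    then have N: "N \<in> point_measures d" by simp
    have "(\<integral>\<^sup>+z. ?h z \<partial>N) = ennreal t * (\<integral>\<^sup>+z. ennreal (fst z) * indicator B (snd z) \<partial>N)"
      by (rule nn_integral_cmult) (use h0 in \<open>simp add: measurable_cong_sets[OF sets_S[OF N] refl]\<close>)
    then show "exp_neg (ennreal t * emeasure (mu_of N) B) = exp_neg (\<integral>\<^sup>+z. ?h z \<partial>N)"
      by (simp add: emeasure_mu_of[OF sets_S[OF N] B])
  qed
  also have "\<dots> = exp_neg (\<integral>\<^sup>+z. 1 - exp_neg (?h z) \<partial>\<nu>\<^sub>f)"
    by (rule Q.laplace_functional[OF h])
  also have "(\<integral>\<^sup>+z. 1 - exp_neg (?h z) \<partial>\<nu>\<^sub>f) = (\<integral>\<^sup>+(s, y). ennreal (1 - exp (- t * s)) * indicator B y \<partial>\<nu>\<^sub>f)"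
  proof (rule nn_integral_cong)
    fix z assume "z \<in> space \<nu>\<^sub>f"
    then have z: "0 < fst z" using Q.space_\<Lambda> by (auto simp: space_jump_loc_space)
    show "1 - exp_neg (?h z) = (case z of (s, y) \<Rightarrow> ennreal (1 - exp (- t * s)) * indicator B y)"
    proof (cases "snd z \<in> B")
      case True
      have "exp_neg (ennreal t * ennreal (fst z)) = ennreal (exp (- (t * fst z)))"
        using t z by (simp add: ennreal_mult[symmetric] exp_neg_ennreal)
      moreover have "1 - ennreal (exp (- (t * fst z))) = ennreal (1 - exp (- (t * fst z)))"
        by (simp add: ennreal_minus flip: ennreal_1)
      ultimately show ?thesis using True by (simp add: case_prod_unfold)
    qed (simp add: case_prod_unfold)
  qed
  finally show "(\<integral>\<^sup>+\<mu>. exp_neg (ennreal t * emeasure \<mu> B) \<partial>?M) =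
      exp_neg (\<integral>\<^sup>+(s, y). ennreal (1 - exp (- t * s)) * indicator B y \<partial>\<nu>\<^sub>f)" .
qed

section \<open>The law of the partition and of the distinct locations\<close>

lemma measurable_loc: "(\<lambda>x. fst (snd x) i) \<in> borel_measurable data_space"
proof (cases "i \<in> {1..n}")
  case True
  show ?thesis
    by (rule measurable_compose[OF measurable_compose[OF measurable_snd measurable_fst] measurable_component_singleton[OF True]])
next
  case False
  \<comment> \<open>Off \<open>{1..n}\<close> the members of the extensional product space share the
    value \<open>undefined\<close>, so the projection is measurable for every index, such as
    \<open>Min C\<close> for an arbitrary \<open>C\<close>.\<close>
  then have "fst (snd x) i = undefined" if "x \<in> space data_space" for x
    using that unfolding space_data_space PiE_def extensional_def by auto
  then have "(\<lambda>x. fst (snd x) i) \<in> borel_measurable data_space \<longleftrightarrow> (\<lambda>_. undefined :: 'y) \<in> borel_measurable data_space"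
    by (rule measurable_cong)
  then show ?thesis by simp
qed

text \<open>One event for both parts of the description of \<open>Y\<close>: with all sides equal to
  \<open>UNIV\<close> it gives the probability of a partition, with general sides the joint law of
  the distinct locations.\<close>

definition partition_event :: "nat set set \<Rightarrow> (nat set \<Rightarrow> 'y set) \<Rightarrow>
    ((nat \<Rightarrow> real) \<times> (nat \<Rightarrow> 'y) \<times> (real \<times> 'y) measure) set" where
  "partition_event p A = {x\<in>space data_space. ties n (fst (snd x)) = p \<and> (\<forall>C\<in>p. fst (snd x) (Min C) \<in> A C)}"

context
  fixes p assumes p: "partition_on {1..n} p"
begin

lemma finite_p: "finite p"
  by (rule finite_elements[OF _ p]) simp

lemma sets_partition_event:
  assumes A: "\<And>C. C \<in> p \<Longrightarrow> A C \<in> sets borel"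
  shows "partition_event p A \<in> sets data_space"
proof -
  obtain r where r: "r \<in> reps n" "p = ties n r"
    using bij_betw_ties[of n] p by (auto simp: bij_betw_def)
  have Y: "(\<lambda>x. fst (snd x)) \<in> measurable data_space (locs_space n)" by measurable
  have "(\<lambda>x. fst (snd x)) -` {Y\<in>space (locs_space n). ties n Y = ties n r} \<inter> space data_space \<in> sets data_space"
    by (rule measurable_sets[OF Y sets_ties_eq])
  moreover have "{x\<in>space data_space. \<forall>C\<in>p. fst (snd x) (Min C) \<in> A C} \<in> sets data_space"
    by (intro sets.sets_Collect_finite_All finite_p measurable_sets_Collect[OF measurable_loc]) (use A in simp)
  moreover have "partition_event p A = ((\<lambda>x. fst (snd x)) -` {Y\<in>space (locs_space n). ties n Y = ties n r} \<inter> space data_space) \<inter>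
      {x\<in>space data_space. \<forall>C\<in>p. fst (snd x) (Min C) \<in> A C}"
    using measurable_space[OF Y] by (auto simp: partition_event_def r)
  ultimately show ?thesis by simp
qed

text \<open>In the sum over partitions only the summand with ties \<open>p\<close> can meet the
  event, because almost surely the locations of distinct blocks differ. On that summand the event is
  a box of a product measure.\<close>

lemma emeasure_partition_event:
  assumes A: "\<And>C. C \<in> p \<Longrightarrow> A C \<in> sets borel"
  shows "emeasure joint (partition_event p A) = inverse mass * (\<Prod>C\<in>p. emeasure (block_measure k g X \<rho> \<eta> C) (A C))"
proof -
  obtain r where r: "r \<in> reps n" "p = ties n r"
    using bij_betw_ties[of n] p by (auto simp: bij_betw_def)
  let ?E = "partition_event p A"
  note E = sets_partition_event[OF A]
  let ?I = "r ` {1..n}"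
  let ?box = "\<Pi>\<^sub>E c\<in>?I. A (block n r c)"
  have blk: "block n r c \<in> p" if "c \<in> ?I" for c
    using bij_betw_block_reps[OF r(1)] that r(2) by (auto simp: bij_betw_def)
  have box: "?box \<in> sets (blocks r)"
    unfolding sets_blocks using A blk by (intro sets_PiM_I_finite) auto
  have summand: "(\<integral>\<^sup>+y. \<integral>\<^sup>+s. \<integral>\<^sup>+N. indicator ?E (conf r' y s N) \<partial>Q \<partial>latent_jumps (ties n r') y \<partial>blocks r') =
      (if r' = r then emeasure (blocks r) ?box else 0)" if r': "r' \<in> reps n" for r'
  proof -
    have "AE y in blocks r'. (\<integral>\<^sup>+s. \<integral>\<^sup>+N. indicator ?E (conf r' y s N) \<partial>Q \<partial>latent_jumps (ties n r') y) =
        (if r' = r then indicator ?box y else 0)"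
      using AE_blocks_inj[OF r'] AE_blocks_latent[OF r'] AE_space
    proof eventually_elim
      case (elim y)
      have "indicator ?E (conf r' y s N) = (if r' = r then indicator ?box y else (0::ennreal))"
        if sN: "s \<in> space (latent_jumps (ties n r') y)" "N \<in> space Q" for s N
      proof -
        have sp: "conf r' y s N \<in> space data_space"
          using conf_space[OF r' elim(3) sN(1)] sN(2) by simp
        have t: "ties n (fst (snd (conf r' y s N))) = ties n r'"
          unfolding conf_Y by (rule ties_reps_inj[OF r' elim(1)])
        show ?thesis
        proof (cases "r' = r")
          case False
          then have "ties n r' \<noteq> p"
            using bij_betw_ties[of n] r r' by (auto simp: bij_betw_def dest: inj_onD)
          then show ?thesis using False t by (simp add: partition_event_def)
        next
          case True
          have "(\<forall>C\<in>p. fst (snd (conf r y s N)) (Min C) \<in> A C) \<longleftrightarrow> (\<forall>C\<in>p. y (Min C) \<in> A C)"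
          proof (rule ball_cong[OF refl])
            fix C assume C: "C \<in> p"
            then have C': "C \<in> ties n r" using r by simp
            have "fst (snd (conf r y s N)) (Min C) = y (Min C)"
              unfolding conf_Y using ties_Min_reps(3)[OF r(1) C'] ties_nonempty[OF C'] by simp
            then show "fst (snd (conf r y s N)) (Min C) \<in> A C \<longleftrightarrow> y (Min C) \<in> A C" by simp
          qed
          also have "\<dots> \<longleftrightarrow> (\<forall>c\<in>?I. y c \<in> A (block n r c))"
          proof
            assume *: "\<forall>C\<in>p. y (Min C) \<in> A C"
            show "\<forall>c\<in>?I. y c \<in> A (block n r c)"
              using * blk Min_block_range(1)[OF r(1)] by metis
          next
            assume *: "\<forall>c\<in>?I. y c \<in> A (block n r c)"
            show "\<forall>C\<in>p. y (Min C) \<in> A C"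
              using * ties_Min_reps(1,2)[OF r(1)] r(2) by metis
          qed
          also have "\<dots> \<longleftrightarrow> y \<in> ?box"
            using elim(3) True by (auto simp: space_blocks PiE_iff)
          finally have "conf r y s N \<in> ?E \<longleftrightarrow> y \<in> ?box"
            using sp t True r(2) by (simp add: partition_event_def)
          then show ?thesis using True by (simp add: indicator_def)
        qed
      qed
      then have "(\<integral>\<^sup>+s. \<integral>\<^sup>+N. indicator ?E (conf r' y s N) \<partial>Q \<partial>latent_jumps (ties n r') y) =
          (\<integral>\<^sup>+s. \<integral>\<^sup>+N. (if r' = r then indicator ?box y else 0) \<partial>Q \<partial>latent_jumps (ties n r') y)"
        by (intro nn_integral_cong)
      also have "\<dots> = (if r' = r then indicator ?box y else 0)"
        by (rule nn_integral_const_latent[OF elim(2)])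
      finally show ?case .
    qed
    then have "(\<integral>\<^sup>+y. \<integral>\<^sup>+s. \<integral>\<^sup>+N. indicator ?E (conf r' y s N) \<partial>Q \<partial>latent_jumps (ties n r') y \<partial>blocks r') =
        (\<integral>\<^sup>+y. (if r' = r then indicator ?box y else 0) \<partial>blocks r')" by (rule nn_integral_cong_AE)
    then show ?thesis using box by (cases "r' = r") simp_all
  qed
  have "emeasure joint ?E = (\<integral>\<^sup>+x. indicator ?E x \<partial>joint)" using E by (simp add: sets_joint)
  also have "\<dots> = inverse mass * (\<Sum>r'\<in>reps n. if r' = r then emeasure (blocks r) ?box else 0)"
    by (subst nn_integral_joint) (use E summand in \<open>auto intro!: arg_cong2[where f=times] sum.cong\<close>)
  also have "(\<Sum>r'\<in>reps n. if r' = r then emeasure (blocks r) ?box else 0) = emeasure (blocks r) ?box"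
    using r(1) finite_reps by simp
  also have "\<dots> = (\<Prod>c\<in>?I. emeasure (block_measure k g X \<rho> \<eta> (block n r c)) (A (block n r c)))"
    by (rule emeasure_blocks_box[OF r(1)]) (use A blk in auto)
  also have "\<dots> = (\<Prod>C\<in>p. emeasure (block_measure k g X \<rho> \<eta> C) (A C))"
    unfolding r(2) by (rule prod_ties_reps[OF r(1), symmetric])
  finally show ?thesis .
qed

end

end

text \<open>Inversion in \<open>ennreal\<close> fails to be multiplicative for
  \<open>0 * \<infinity>\<close>; positivity of all factors excludes this case.\<close>

lemma ennreal_inverse_prod:
  fixes f :: "'a \<Rightarrow> ennreal"
  assumes "finite I" "\<And>i. i \<in> I \<Longrightarrow> 0 < f i"
  shows "inverse (\<Prod>i\<in>I. f i) = (\<Prod>i\<in>I. inverse (f i))"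
  using assms
proof (induction I)
  case (insert x I)
  have "0 < f x" "0 < (\<Prod>i\<in>I. f i)"
    using insert.prems insert.hyps(1) by (auto simp: zero_less_iff_neq_zero)
  then show ?case using insert by (simp add: ennreal_inverse_mult')
qed simp

lemma ennreal_divide_cancel_left:
  fixes a b c :: ennreal
  assumes c: "0 < c" "c < \<infinity>"
  shows "(c * b) / (c * a) = b / a"
proof -
  have "c * inverse c = 1"
    using c by (simp add: divide_ennreal_def[symmetric])
  then have "b * (c * inverse c) * inverse a = b * inverse a" by simp
  then show ?thesis
    using c by (simp add: divide_ennreal_def ennreal_inverse_mult' ac_simps)
qed

context posterior_model begin

lemma ties_event_eq: "{(J, Y, N) \<in> space joint. ties n Y = p} = partition_event p (\<lambda>_. UNIV)"
  by (auto simp: partition_event_def)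

lemma inverse_mass: "0 < inverse mass" "inverse mass < \<infinity>"
  unfolding ennreal_inverse_positive less_top[symmetric] infinity_ennreal_def ennreal_inverse_eq_top_iff
  using mass by auto

lemma emeasure_joint_ties:
  assumes p: "partition_on {1..n} p"
  shows "emeasure joint {(J, Y, N) \<in> space joint. ties n Y = p} = inverse mass * (\<Prod>C\<in>p. block_mass k g X \<rho> \<eta> C)"
  using emeasure_partition_event[OF p, of "\<lambda>_. UNIV"]
  unfolding ties_event_eq by (simp add: emeasure_block_measure_space)

context
  fixes p assumes p: "partition_on {1..n} p" and pos: "0 < (\<Prod>C\<in>p. block_mass k g X \<rho> \<eta> C)"
begin

abbreviation cond_partition where
  "cond_partition \<equiv> uniform_measure joint {(J, Y, N) \<in> space joint. ties n Y = p}"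

lemma sets_ties_event: "{(J, Y, N) \<in> space joint. ties n Y = p} \<in> sets joint"
  unfolding ties_event_eq sets_joint by (rule sets_partition_event[OF p]) simp

lemma block_mass_pos:
  assumes C: "C \<in> p"
  shows "0 < block_mass k g X \<rho> \<eta> C"
proof -
  have "block_mass k g X \<rho> \<eta> C \<noteq> 0"
  proof
    assume "block_mass k g X \<rho> \<eta> C = 0"
    then have "(\<Prod>C\<in>p. block_mass k g X \<rho> \<eta> C) = 0" using C by (intro prod_zero finite_p[OF p]) blast
    with pos show False by simp
  qed
  then show ?thesis by (rule zero_less_iff_neq_zero[THEN iffD2])
qed

text \<open>The product is one summand of \<open>C(X)\<close>, which is finite.\<close>

lemma prod_block_mass_finite: "(\<Prod>C\<in>p. block_mass k g X \<rho> \<eta> C) < \<infinity>"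
proof -
  have "(\<Prod>C\<in>p. block_mass k g X \<rho> \<eta> C) \<le> mass"
    unfolding partition_constant_def
    by (rule member_le_sum) (use p in \<open>simp_all add: finitely_many_partition_on\<close>)
  then show ?thesis using mass(2) by (rule le_less_trans)
qed

text \<open>An infinite factor would make the product infinite, since the remaining factors are
  positive.\<close>

lemma block_mass_finite: "C \<in> p \<Longrightarrow> block_mass k g X \<rho> \<eta> C < \<infinity>"
proof (rule ccontr)
  assume C: "C \<in> p" "\<not> block_mass k g X \<rho> \<eta> C < \<infinity>"
  then have top: "block_mass k g X \<rho> \<eta> C = \<top>" by (simp add: less_top[symmetric])
  have "(\<Prod>C\<in>p - {C}. block_mass k g X \<rho> \<eta> C) \<noteq> 0"
    unfolding prod_zero_iff[OF finite_Diff[OF finite_p[OF p]]]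
    using block_mass_pos by (auto simp: zero_less_iff_neq_zero)
  then have "(\<Prod>C\<in>p. block_mass k g X \<rho> \<eta> C) = \<top>"
    by (simp add: prod.remove[OF finite_p[OF p] C(1)] top ennreal_top_mult)
  with prod_block_mass_finite show False by simp
qed

lemma emeasure_normalized_block:
  "emeasure (normalized (block_measure k g X \<rho> \<eta> C)) A =
    inverse (block_mass k g X \<rho> \<eta> C) * emeasure (block_measure k g X \<rho> \<eta> C) A"
proof -
  have "space (block_measure k g X \<rho> \<eta> C) = UNIV"
    using sets_eq_imp_space_eq[OF sets_block_measure] by simp
  then show ?thesis by (simp add: normalized_def emeasure_block_measure_space)
qed

lemma prob_space_normalized_block:
  assumes C: "C \<in> p"
  shows "prob_space (normalized (block_measure k g X \<rho> \<eta> C))"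
proof (rule prob_space_normalized)
  have "space (block_measure k g X \<rho> \<eta> C) = UNIV"
    using sets_eq_imp_space_eq[OF sets_block_measure] by simp
  then show "0 < emeasure (block_measure k g X \<rho> \<eta> C) (space (block_measure k g X \<rho> \<eta> C))"
    "emeasure (block_measure k g X \<rho> \<eta> C) (space (block_measure k g X \<rho> \<eta> C)) < \<infinity>"
    using block_mass_pos[OF C] block_mass_finite[OF C] by (simp_all add: emeasure_block_measure_space)
qed

lemma prob_space_cond_partition: "prob_space cond_partition"
proof -
  have pr: "0 < inverse mass * (\<Prod>C\<in>p. block_mass k g X \<rho> \<eta> C)"
    using pos inverse_mass(1) by (rule ennreal_zero_less_mult_iff[THEN iffD2, OF conjI, rotated])
  have "inverse mass * (\<Prod>C\<in>p. block_mass k g X \<rho> \<eta> C) < \<infinity>"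
    using prod_block_mass_finite inverse_mass by (simp add: ennreal_mult_less_top)
  with pr show ?thesis
    unfolding emeasure_joint_ties[OF p, symmetric] by (intro prob_space_uniform_measure) (rule less_imp_neq[symmetric] less_imp_neq, assumption)+
qed

text \<open>The quotient of two values given by \<open>emeasure_partition_event\<close> no longer
  contains \<open>C(X)\<close>, and what remains factors over the blocks.\<close>

lemma emeasure_cond_partition:
  assumes A: "\<And>C. C \<in> p \<Longrightarrow> A C \<in> sets borel"
  shows "emeasure cond_partition {x \<in> space data_space. \<forall>C\<in>p. fst (snd x) (Min C) \<in> A C} =
    (\<Prod>C\<in>p. emeasure (normalized (block_measure k g X \<rho> \<eta> C)) (A C))"
proof -
  let ?E = "{(J, Y, N) \<in> space joint. ties n Y = p}"
  let ?a = "\<Prod>C\<in>p. block_mass k g X \<rho> \<eta> C" and ?b = "\<Prod>C\<in>p. emeasure (block_measure k g X \<rho> \<eta> C) (A C)"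
  have S: "{x \<in> space data_space. \<forall>C\<in>p. fst (snd x) (Min C) \<in> A C} \<in> sets data_space"
    by (intro sets.sets_Collect_finite_All finite_p[OF p] measurable_sets_Collect[OF measurable_loc]) (use A in simp)
  have int: "?E \<inter> {x \<in> space data_space. \<forall>C\<in>p. fst (snd x) (Min C) \<in> A C} = partition_event p A"
    by (auto simp: partition_event_def)
  have "emeasure cond_partition {x \<in> space data_space. \<forall>C\<in>p. fst (snd x) (Min C) \<in> A C} =
      (inverse mass * ?b) / (inverse mass * ?a)"
    using emeasure_uniform_measure[OF sets_ties_event, unfolded sets_joint, OF S]
    by (simp only: int emeasure_partition_event[OF p A] emeasure_joint_ties[OF p])
  also have "\<dots> = ?b / ?a"
    by (rule ennreal_divide_cancel_left) (rule inverse_mass)+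
  also have "\<dots> = (\<Prod>C\<in>p. inverse (block_mass k g X \<rho> \<eta> C)) * ?b"
    by (simp add: divide_ennreal_def ennreal_inverse_prod[OF finite_p[OF p] block_mass_pos] mult.commute)
  also have "\<dots> = (\<Prod>C\<in>p. emeasure (normalized (block_measure k g X \<rho> \<eta> C)) (A C))"
    by (simp add: emeasure_normalized_block prod.distrib)
  finally show ?thesis .
qed

lemma measurable_loc_cond_partition:
  "(\<lambda>(J, Y, N). Y i) \<in> measurable cond_partition borel"
proof -
  have "sets cond_partition = sets data_space" by (simp add: sets_joint)
  then show ?thesis
    unfolding case_prod_beta using measurable_loc by (subst measurable_cong_sets[OF _ refl]) auto
qed

text \<open>The marginal is read off from boxes whose other sides are the whole space, where the
  normalised block measures have mass 1.\<close>

lemma distr_cond_partition: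
  assumes C: "C \<in> p"
  shows "distr cond_partition borel (\<lambda>(J, Y, N). Y (Min C)) = normalized (block_measure k g X \<rho> \<eta> C)"
proof (rule measure_eqI)
  show "sets (distr cond_partition borel (\<lambda>(J, Y, N). Y (Min C))) = sets (normalized (block_measure k g X \<rho> \<eta> C))"
    by (simp add: normalized_def)
  fix B assume "B \<in> sets (distr cond_partition borel (\<lambda>(J, Y, N). Y (Min C)))"
  then have B: "B \<in> sets borel" by simp
  let ?A = "\<lambda>C'. if C' = C then B else UNIV"
  have "emeasure (distr cond_partition borel (\<lambda>(J, Y, N). Y (Min C))) B =
      emeasure cond_partition {x \<in> space data_space. \<forall>C'\<in>p. fst (snd x) (Min C') \<in> ?A C'}"
    unfolding emeasure_distr[OF measurable_loc_cond_partition B] using C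
    by (intro arg_cong[where f="emeasure cond_partition"]) auto
  also have "\<dots> = (\<Prod>C'\<in>p. emeasure (normalized (block_measure k g X \<rho> \<eta> C')) (?A C'))"
    by (rule emeasure_cond_partition) (use B in simp)
  also have "\<dots> = emeasure (normalized (block_measure k g X \<rho> \<eta> C)) B"
  proof -
    have "emeasure (normalized (block_measure k g X \<rho> \<eta> C')) (?A C') = 1" if "C' \<in> p - {C}" for C'
    proof -
      interpret prob_space "normalized (block_measure k g X \<rho> \<eta> C')"
        using prob_space_normalized_block that by simp
      have "space (normalized (block_measure k g X \<rho> \<eta> C')) = UNIV"
        using sets_eq_imp_space_eq[OF sets_block_measure] by (simp add: normalized_def space_scale_measure)
      then show ?thesis using emeasure_space_1 that by simp
    qed
    then show ?thesis by (simp add: prod.remove[OF finite_p[OF p] C])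
  qed
  finally show "emeasure (distr cond_partition borel (\<lambda>(J, Y, N). Y (Min C))) B =
      emeasure (normalized (block_measure k g X \<rho> \<eta> C)) B" .
qed

lemma indep_vars_cond_partition:
  "prob_space.indep_vars cond_partition (\<lambda>_. borel) (\<lambda>C (J, Y, N). Y (Min C)) p"
proof -
  interpret M: prob_space cond_partition by (rule prob_space_cond_partition)
  let ?Y = "\<lambda>C x. case x of (J, Y, N) \<Rightarrow> Y (Min C)"
  show ?thesis
  proof (cases "p = {}")
    \<comment> \<open>Here \<open>n = 0\<close>; the characterisation of independence by a product
      law is stated for nonempty index sets.\<close>
    case True
    then show ?thesis unfolding M.indep_vars_def2 M.indep_sets_def by simp
  next
    case False
    let ?P = "distr cond_partition (\<Pi>\<^sub>M C\<in>p. borel) (\<lambda>x. \<lambda>C\<in>p. ?Y C x)"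
    interpret D: product_sigma_finite "\<lambda>C. distr cond_partition borel (?Y C)"
      by (rule product_sigma_finite.intro)
        (rule prob_space_imp_sigma_finite[OF M.prob_space_distr[OF measurable_loc_cond_partition]])
    have "?P = (\<Pi>\<^sub>M C\<in>p. distr cond_partition borel (?Y C))"
    proof (rule D.PiM_eqI)
      show "finite p" by (rule finite_p[OF p])
      show "sets ?P = sets (\<Pi>\<^sub>M C\<in>p. distr cond_partition borel (?Y C))"
        by (simp cong: sets_PiM_cong)
      fix A assume "\<And>C. C \<in> p \<Longrightarrow> A C \<in> sets (distr cond_partition borel (?Y C))"
      then have A: "A C \<in> sets borel" if "C \<in> p" for C using that by simp
      have box: "Pi\<^sub>E p A \<in> sets (\<Pi>\<^sub>M C\<in>p. borel)"
        using A by (intro sets_PiM_I_finite finite_p[OF p])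
      have "emeasure ?P (Pi\<^sub>E p A) = emeasure cond_partition {x \<in> space data_space. \<forall>C\<in>p. fst (snd x) (Min C) \<in> A C}"
        unfolding emeasure_distr[OF measurable_restrict[OF measurable_loc_cond_partition] box]
        by (intro arg_cong[where f="emeasure cond_partition"]) (auto simp: PiE_iff)
      also have "\<dots> = (\<Prod>C\<in>p. emeasure (distr cond_partition borel (?Y C)) (A C))"
        by (subst emeasure_cond_partition[OF A], assumption) (rule prod.cong[OF refl], simp only: distr_cond_partition)
      finally show "emeasure ?P (Pi\<^sub>E p A) = (\<Prod>C\<in>p. emeasure (distr cond_partition borel (?Y C)) (A C))" .
    qed
    then show ?thesis
      by (rule M.indep_vars_iff_distr_eq_PiM'[OF False measurable_loc_cond_partition, THEN iffD2])
  qed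
qed

end

end

theorem theorem4p1:
  fixes \<eta> :: "'y::polish_space measure"
    and \<rho> :: "'y \<Rightarrow> real measure"
    and d :: "real \<times> 'y \<Rightarrow> real \<times> 'y \<Rightarrow> real"
    and P :: "(real \<times> 'y) measure measure"
    and \<tau> :: "'x::polish_space measure"
    and k :: "'x \<Rightarrow> 'y \<Rightarrow> real"
    and n m :: nat
    and X :: "nat \<Rightarrow> 'x"
    and U :: "nat \<Rightarrow> 'x \<Rightarrow> real"
    and \<nu> \<nu>f :: "(real \<times> 'y) measure"
    and g :: "'y \<Rightarrow> real"
  assumes nu_def: "\<nu> = intensity \<rho> \<eta>"
    and g_def: "g = (\<lambda>y. \<Sum>i=1..m. \<integral>x. U i x * k x y \<partial>\<tau>)"
    and nuf_def: "\<nu>f = density \<nu> (\<lambda>(s, y). ennreal (exp (- (g y * s))))"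
    and eta: "sets \<eta> = sets borel" "sigma_finite_measure \<eta>" "nonatomic \<eta>"
    and rho: "\<And>y. sets (\<rho> y) = sets jump_space"
      "\<And>A. A \<in> sets jump_space \<Longrightarrow> (\<lambda>y. emeasure (\<rho> y) A) \<in> borel_measurable borel"
    and rho_eta: "\<And>B. B \<in> sets borel \<Longrightarrow> bounded B \<Longrightarrow>
      (\<integral>\<^sup>+y. (\<integral>\<^sup>+s. ennreal (min s 1) \<partial>\<rho> y) * indicator B y \<partial>\<eta>) < \<infinity>"
    and metric: "jump_loc_metric d"
    and nu_bounded: "\<And>B. B \<in> sets jump_loc_space \<Longrightarrow> jump_loc_bounded d B \<Longrightarrow> emeasure \<nu> B < \<infinity>"
    and prior: "sets P = sets (point_measures_algebra d)" "poisson_law P \<nu>"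
    and tau: "sets \<tau> = sets borel" "sigma_finite_measure \<tau>"
    and k: "\<And>x y. 0 \<le> k x y" "(\<lambda>(x, y). k x y) \<in> borel_measurable (borel \<Otimes>\<^sub>M borel)"
      "\<And>x. integrable \<eta> (\<lambda>y. k x y)"
      "\<And>B y. B \<in> sets borel \<Longrightarrow> bounded B \<Longrightarrow> (\<integral>\<^sup>+x. ennreal (k x y) * indicator B x \<partial>\<tau>) < \<infinity>"
    and nm: "n \<le> m"
    and U: "\<And>i x. i \<in> {1..m} \<Longrightarrow> 0 \<le> U i x"
      "\<And>i. i \<in> {1..m} \<Longrightarrow> U i \<in> borel_measurable borel"
      "\<And>i y. i \<in> {1..m} \<Longrightarrow> integrable \<tau> (\<lambda>x. U i x * k x y)"
    and g: "g \<in> borel_measurable borel" "bounded {y. g y \<noteq> 0}"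
    and kappa_finite: "\<And>l y. 1 \<le> l \<Longrightarrow> kappa g \<rho> l y < \<infinity>"
    and well_defined: "0 < (\<integral>\<^sup>+N. likelihood n k g X (mu_of N) \<partial>P)"
      "(\<integral>\<^sup>+N. likelihood n k g X (mu_of N) \<partial>P) < \<infinity>"
  shows
    \<comment> \<open>the augmented law is a probability law extending the posterior law of \<open>N\<close> given \<open>X\<close>\<close>
    "prob_space (joint_posterior n k g X P) \<and>
     distr (joint_posterior n k g X P) P (\<lambda>(J, Y, N). N) = posterior_N n k g X P \<and>
    \<comment> \<open>\<open>(J\<^bsub>j,n\<^esub>, Y\<^sub>j\<^sup>*)\<close> are the distinct values of the pairs \<open>(J\<^sub>i, Y\<^sub>i)\<close>\<close>
     (AE (J, Y, N) in joint_posterior n k g X P. \<forall>i\<in>{1..n}. \<forall>l\<in>{1..n}. Y i = Y l \<longrightarrow> J i = J l) \<and>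
     \<nu>f = intensity (\<lambda>y. density (\<rho> y) (\<lambda>s. ennreal (exp (- (g y * s))))) \<eta> \<and>
     (\<exists>Q. sets Q = sets (point_measures_algebra d) \<and> poisson_law Q \<nu>f \<and>
      \<comment> \<open>mixture representation of the posterior law of \<open>\<mu>\<close> given \<open>X\<close>\<close>
      (\<forall>A\<in>sets (measures_algebra borel).
         emeasure (distr (posterior_N n k g X P) (measures_algebra borel) mu_of) A
         = (\<integral>\<^sup>+Y. emeasure (distr (latent_law n g \<rho> Q Y) (measures_algebra borel)
                      (\<lambda>(N, J). mu_of (N_star n Y N J))) A
             \<partial>(distr (joint_posterior n k g X P) (locs_space n) (\<lambda>(J, Y, N). Y)))) \<and>
      \<comment> \<open>(i)\<close>
      has_cond_law (joint_posterior n k g X P)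
        (\<lambda>(J, Y, N). N) (point_measures_algebra d)
        (\<lambda>(J, Y, N). Y) (locs_space n)
        (\<lambda>Y. distr (latent_law n g \<rho> Q Y) (point_measures_algebra d) (\<lambda>(N, J). N_star n Y N J)) \<and>
      has_cond_law (joint_posterior n k g X P)
        (\<lambda>(J, Y, N). N) (point_measures_algebra d)
        (\<lambda>(J, Y, N). (J, Y)) (jumps_space n \<Otimes>\<^sub>M locs_space n)
        (\<lambda>(J, Y). distr Q (point_measures_algebra d) (\<lambda>N. N_star n Y N (\<lambda>C. J (Min C)))) \<and>
      has_cond_law (joint_posterior n k g X P)
        (\<lambda>(J, Y, N). (J, N)) (jumps_space n \<Otimes>\<^sub>M point_measures_algebra d)
        (\<lambda>(J, Y, N). Y) (locs_space n)
        (\<lambda>Y. distr (latent_law n g \<rho> Q Y) (jumps_space n \<Otimes>\<^sub>M point_measures_algebra d)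
               (\<lambda>(N, J). (\<lambda>i\<in>{1..n}. J (block n Y i), N_star n Y N J))) \<and>
      (AE (J, Y, N) in joint_posterior n k g X P.
         \<forall>C\<in>ties n Y. prob_space (jump_law g \<rho> (card C) (Y (Min C)))) \<and>
      \<comment> \<open>(ii)\<close>
      has_cond_law (joint_posterior n k g X P)
        (\<lambda>(J, Y, N). mu_of N) (measures_algebra borel)
        (\<lambda>(J, Y, N). Y) (locs_space n)
        (\<lambda>Y. distr (latent_law n g \<rho> Q Y) (measures_algebra borel)
               (\<lambda>(N, J). mu_of (N_star n Y N J))) \<and>
      (\<forall>Y\<in>space (locs_space n). \<forall>(N, J)\<in>space (latent_law n g \<rho> Q Y).
         mu_of (N_star n Y N J) = mu_star n Y (mu_of N) J) \<and>
      completely_random_law (distr Q (measures_algebra borel) mu_of) \<nu>f \<and>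
      \<comment> \<open>(iii)\<close>
      has_cond_law (joint_posterior n k g X P)
        (\<lambda>(J, Y, N). hazard k (mu_of N)) (\<Pi>\<^sub>M x\<in>UNIV. borel)
        (\<lambda>(J, Y, N). Y) (locs_space n)
        (\<lambda>Y. distr (latent_law n g \<rho> Q Y) (\<Pi>\<^sub>M x\<in>UNIV. borel)
               (\<lambda>(N, J). hazard_star n k Y (mu_of N) J))) \<and>
    \<comment> \<open>(iv)\<close>
     0 < partition_constant n k g X \<rho> \<eta> \<and> partition_constant n k g X \<rho> \<eta> < \<infinity> \<and>
     (\<forall>p. partition_on {1..n} p \<longrightarrow>
        emeasure (joint_posterior n k g X P)
          {(J, Y, N) \<in> space (joint_posterior n k g X P). ties n Y = p}
        = inverse (partition_constant n k g X \<rho> \<eta>) * (\<Prod>C\<in>p. block_mass k g X \<rho> \<eta> C)) \<and>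
     (\<forall>p M. partition_on {1..n} p \<longrightarrow> 0 < (\<Prod>C\<in>p. block_mass k g X \<rho> \<eta> C) \<longrightarrow>
        M = uniform_measure (joint_posterior n k g X P)
              {(J, Y, N) \<in> space (joint_posterior n k g X P). ties n Y = p} \<longrightarrow>
        prob_space M \<and>
        prob_space.indep_vars M (\<lambda>_. borel) (\<lambda>C (J, Y, N). Y (Min C)) p \<and>
        (\<forall>C\<in>p. distr M borel (\<lambda>(J, Y, N). Y (Min C)) = normalized (block_measure k g X \<rho> \<eta> C)))"
proof -
  have g_nonneg: "0 \<le> g y" for y
    unfolding g_def using U(1) k(1) by (auto intro!: sum_nonneg Bochner_Integration.integral_nonneg)
  have k_section: "(\<lambda>y. k x y) \<in> borel_measurable borel" for x
    using measurable_Pair2[OF k(2), of x] by simp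
  interpret posterior_model \<eta> \<rho> g d P k n X
    by unfold_locales
      (fact eta rho g(1) g_nonneg kappa_finite metric nu_bounded[unfolded nu_def] prior(1) prior(2)[unfolded nu_def]
        k(1) k_section well_defined sigma_finite_measure.sigma_finite_countable[OF eta(2)])+
  have nuf: "\<nu>f = \<nu>\<^sub>f" unfolding nuf_def nu_def ..
  show ?thesis
    unfolding nuf point_measures_algebra_eq[of d]
  \<comment> \<open>The tilted prior is the witness for the law of the Poisson part;
    \<open>hypsubst\<close> replaces the variable \<open>M\<close> in the last conjunct by the
    conditioned law that it abbreviates.\<close>
  proof (intro conjI exI[of _ Q] ballI allI impI; hypsubst?)
    fix Y z assume "z \<in> space (latent_law n g \<rho> Q Y)"
    then show "case z of (N, J) \<Rightarrow> mu_of (N_star n Y N J) = mu_star n Y (mu_of N) J"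
      by (cases z) (simp add: mu_of_N_star)
  qed (rule prob_space_joint distr_joint_N AE_joint_ties \<nu>f_eq_intensity Q.sets_Q Q.poisson_law
      posterior_mu_mixture cond_law_N_map[OF measurable_ident_sets[OF refl]] cond_law_N_JY cond_law_JN_Y
      AE_joint_jump_law cond_law_N_map[OF measurable_mu_of] completely_random[OF rho_eta] cond_law_hazard
      mass emeasure_joint_ties prob_space_cond_partition indep_vars_cond_partition distr_cond_partition | assumption)+
qed

end
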